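(* Let $\nu>0$, $\sigma(\lambda)=\sqrt{1-\nu^2\lambda^2}$, and consider the equation for $\lambda$ $$(\lambda-v_1^0)^2-(B_1^0)^2=(H_1^0)^2\,\sigma(\lambda).\qquad(\ast)$$ Assume that the real constants $v_1^0,B_1^0,H_1^0$ satisfy one of the following: (A) $|v_1^0|-1/\nu\le|B_1^0|<|v_1^0|+1/\nu$ and $|H_1^0|>0$; (B) $|B_1^0|<|v_1^0|-1/\nu$ and $|H_1^0|\ge H^*$, where $H^*>0$ is the threshold such that $(\ast)$ has two real roots with $|\lambda|<1/\nu$ if $|H_1^0|\ge H^*$ (coincident if $|H_1^0|=H^*$) and no real root if $|H_1^0|<H^*$. Let $\lambda$ be a real root of $(\ast)$ with $|\lambda|<1/\nu$; put $\sigma=\sigma(\lambda)$, $d=(\lambda-v_1^0)^2-(B_1^0)^2$ and $\mathbf R=(\lambda-v_1^0,\ i(\lambda-v_1^0),\ -B_1^0,\ -iB_1^0,\ d)^T$. Then the solution $U=(\mathbf v,\mathbf B,q)^T$, $V=(\mathbf H,E)^T$, $\varphi$ of the plasma-vacuum interface problem (see context) admits the asymptotic expansion, as $\varepsilon\to0$, $$U=U^0+\varepsilon U^{(1)}(\theta,\eta,\tau)+\varepsilon^2U^{(2)}(\theta,\eta,\tau)+O(\varepsilon^3)\quad(\eta>0),$$ $$V=V^0+\varepsilon V^{(1)}(\theta,\eta,\tau)+\varepsilon^2V^{(2)}(\theta,\eta,\tau)+O(\varepsilon^3)\quad(\eta<0),$$ $$\varphi=\varphi^{(1)}(\theta,\tau)+\varepsilon\varphi^{(2)}(\theta,\tau)+O(\varepsilon^2).$$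 The first order terms are given by $$\hat U^{(1)}(k,\eta,\tau)=\begin{cases}-|k|\,\hat\varphi^{(1)}(k,\tau)\,e^{-k\eta}\,\mathbf R,&k>0,\\-|k|\,\hat\varphi^{(1)}(k,\tau)\,e^{k\eta}\,\overline{\mathbf R},&k<0,\end{cases}\qquad \hat V^{(1)}(k,\eta,\tau)=H_1^0\,\hat\varphi^{(1)}(k,\tau)\,e^{\sigma|k|\eta}\begin{pmatrix}-\sigma|k|\\ ik\\ -i\nu\lambda k\end{pmatrix}.$$ The second order terms are found from $$\hat U^{(2)}=\mathbf S+a\,\mathbf R+b\,\overline{\mathbf R},\qquad \mathbf S=\Big(\tfrac1k\mathbf L_1\cdot\hat p,\ 0,\ \tfrac1k\mathbf L_3\cdot\hat p,\ \tfrac1k\mathbf L_4\cdot\hat p,\ 0\Big)^T,$$ $$a=e^{-k\eta}\Big(a_0(k,\tau)+\int_0^\eta\mathbf L\cdot\hat p(k,\eta',\tau)e^{k\eta'}d\eta'\Big),\qquad b=e^{k\eta}\Big(b_0(k,\tau)+\int_0^\eta\overline{\mathbf L}\cdot\hat p(k,\eta',\tau)e^{-k\eta'}d\eta'\Big),$$ where $$\mathbf L_1\cdot\hat p=i\frac{(\lambda-v_1^0)^2+(B_1^0)^2}{d}|k|e^{-|k|\eta}\hat\varphi^{(1)}_\tau(k)-(\lambda-v_1^0)\,I,\qquad \mathbf L_3\cdot\hat p=-\frac{2iB_1^0(\lambda-v_1^0)}{d}|k|e^{-|k|\eta}\hat\varphi^{(1)}_\tau(k)+B_1^0\,I,$$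 $$\mathbf L_4\cdot\hat p=\frac{B_1^0}{\lambda-v_1^0}\,k\,e^{-|k|\eta}\hat\varphi^{(1)}_\tau(k),\qquad I=\int_{-\infty}^{+\infty}|k-\ell|\,\ell\,(|k-\ell|-|\ell|)\,e^{-(|k-\ell|+|\ell|)\eta}\,\hat\varphi^{(1)}(k-\ell)\hat\varphi^{(1)}(\ell)\,d\ell,$$ and from $$\hat V^{(2)}=\mathbf W+\frac1{2|k|\sigma}\begin{pmatrix}\frac1{i\nu\lambda k}\Big\{\int_{-\infty}^0e^{-\sigma|k||\eta-\zeta|}\partial_\zeta P(k,\zeta,\tau)d\zeta-e^{-\sigma|k\eta|}P(k,0,\tau)\Big\}\\[2pt]-\frac1{\nu\lambda}\int_{-\infty}^0e^{-\sigma|k||\eta-\zeta|}P(k,\zeta,\tau)d\zeta\\[2pt]\int_{-\infty}^0e^{-\sigma|k||\eta-\zeta|}P(k,\zeta,\tau)d\zeta\end{pmatrix}+\begin{pmatrix}\frac1{i\nu\lambda k}\hat p_1'\\[2pt]\frac1{i\nu\lambda k}\hat p_2'\\[2pt]0\end{pmatrix},$$ $$\mathbf W=\begin{cases}\alpha'(k,\tau)e^{\sigma k\eta}\big(\tfrac{\sigma}{i\nu\lambda},-\tfrac1{\nu\lambda},1\big)^T,&k>0,\\[2pt]\beta'(k,\tau)e^{-\sigma k\eta}\big(-\tfrac{\sigma}{i\nu\lambda},-\tfrac1{\nu\lambda},1\big)^T,&k<0,\end{cases}$$ where $$\hat p_1'=-\nu\sigma H_1^0|k|e^{\sigma|k|\eta}\hat\varphi^{(1)}_\tau(k)+i\nu\lambda(\nu^2\lambda^2-1)H_1^0\int_{-\infty}^{+\infty}(k-\ell)\ell^2e^{\sigma|\ell|\eta}\hat\varphi^{(1)}(k-\ell)\hat\varphi^{(1)}(\ell)\,d\ell,$$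 $$\hat p_2'=i\nu H_1^0\,k\,e^{\sigma|k|\eta}\hat\varphi^{(1)}_\tau(k),$$ $$P(k,\zeta,\tau)=2\nu^3\lambda^2H_1^0k^2e^{\sigma|k|\zeta}\hat\varphi^{(1)}_\tau(k)+i\nu\lambda(\nu^2\lambda^2-1)\sigma H_1^0\int_{-\infty}^{+\infty}(k^2-\ell^2)\,\ell|\ell|\,e^{\sigma|\ell|\zeta}\hat\varphi^{(1)}(k-\ell)\hat\varphi^{(1)}(\ell)\,d\ell$$ (the dependence of $\hat\varphi^{(1)}$ on $\tau$ is understood; $\mathbf L$, $\mathbf L_j$, $\hat p$, $a_0,b_0,\alpha',\beta'$ are described in the context). The location of the plasma-vacuum interface is given by $$x_2=\varepsilon\varphi^{(1)}(x_1-\lambda t,\varepsilon t)+O(\varepsilon^2),$$ as $\varepsilon\to0$, with $t=O(\varepsilon^{-1})$ and $\lambda$ the linearized phase velocity of the surface wave. The Fourier transform of the leading order perturbation $\varphi^{(1)}(\theta,\tau)$ satisfies (after an appropriate rescaling in time) the amplitude equation $$\hat\varphi^{(1)}_\tau(k,\tau)+i\,\mathrm{sgn}(k)\int_{-\infty}^{+\infty}\Lambda(k-\ell,\ell)\,\hat\varphi^{(1)}(k-\ell,\tau)\,\hat\varphi^{(1)}(\ell,\tau)\,d\ell=0\quad\forall k\neq0,\qquad \Lambda(k,\ell)=\frac{2|k+\ell|\,|k|\,|\ell|}{|k+\ell|+|k|+|\ell|}.$$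
   Context: **Problem.** Plasma occupies $\{x_2>\zeta(x_1,t)\}$ and vacuum $\{x_2<\zeta(x_1,t)\}$ in $\mathbb R^2$. Unknowns: plasma velocity $\mathbf v=(v_1,v_2)$, plasma magnetic field $\mathbf B=(B_1,B_2)$, total pressure $q$, vacuum magnetic field $\mathbf H=(H_1,H_2)$, scalar vacuum electric field $E$, and $\zeta$. In the plasma (incompressible MHD): $\partial_t\mathbf v+(\mathbf v\cdot\nabla)\mathbf v-(\mathbf B\cdot\nabla)\mathbf B+\nabla q=0$, $\partial_t\mathbf B+(\mathbf v\cdot\nabla)\mathbf B-(\mathbf B\cdot\nabla)\mathbf v=0$, $\mathrm{div}\,\mathbf v=0$ (with $\mathrm{div}\,\mathbf B=0$ imposed on the initial data). In vacuum (Maxwell, $\nu>0$ a fixed small parameter): $\nu\partial_tH_1+\partial_2E=0$, $\nu\partial_tH_2-\partial_1E=0$, $\nu\partial_tE-\partial_1H_2+\partial_2H_1=0$ (with $\mathrm{div}\,\mathbf H=0$ imposed on the initial data). On $x_2=\zeta$, with $N=(-\partial_1\zeta,1)$: $\partial_t\zeta=\mathbf v\cdot N$, $q=\frac12(H_1^2+H_2^2-E^2)$, $\mathbf B\cdot N=0$, $\mathbf H\cdot N=0$, $E-\nu\zeta_tH_1=0$. Surface waves localized near the interface are considered: $U\to U^0=(v_1^0,0,B_1^0,0,q^0)$, $q^0=\frac12(H_1^0)^2$, as $x_2\to+\infty$, and $V\to V^0=(H_1^0,0,0)$ as $x_2\to-\infty$. **Expansion.** $\tau=\varepsilon t$, $\theta=x_1-\lambda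 t$, $\zeta=\varepsilon\varphi(\theta,\tau;\varepsilon)$, $\eta=x_2-\varepsilon\varphi(\theta,\tau;\varepsilon)$; $U,V$ are functions of $(\theta,\eta,\tau;\varepsilon)$. The expansion is the one obtained formally by substituting it in the problem and equating to zero the coefficients of $\varepsilon^1$ and $\varepsilon^2$. Fourier transform in $\theta$: $\hat f(k)=\frac1{2\pi}\int_{-\infty}^{+\infty}f(\theta)e^{-ik\theta}d\theta$. A bar denotes complex conjugation; $\cdot$ is the bilinear (unconjugated) product. **Vectors.** $\mathbf L=-\frac1{2id(\lambda-v_1^0)}\mathbf R$, $\mathbf L_1=\frac1d(-i(\lambda-v_1^0),0,iB_1^0,0,0)^T$, $\mathbf L_3=\frac1d(iB_1^0,0,-i(\lambda-v_1^0),0,0)^T$, $\mathbf L_4=(0,0,0,-\frac{i}{\lambda-v_1^0},0)^T$. (For roots with $|\lambda|<1/\nu$ one has $d\ne0$ and $\lambda\neq v_1^0$.) **Right-hand side in the plasma.** $\hat p$ is the Fourier transform of $p=(p_1,p_2,p_3)^T\in\mathbb R^5$, where, writing $U^{(1)}=(v^{(1)},B^{(1)},q^{(1)})$ with $v^{(1)}=(v^{(1)}_1,v^{(1)}_2)$, $B^{(1)}=(B^{(1)}_1,B^{(1)}_2)$: $p_1=(\partial_\tau+\lambda\varphi^{(1)}_\theta\partial_\eta)v^{(1)}+(v_1^{(1)}\partial_\theta+v_2^{(1)}\partial_\eta-v_1^0\varphi^{(1)}_\theta\partial_\eta)v^{(1)}-(B_1^{(1)}\partial_\theta+B_2^{(1)}\partial_\eta-B_1^0\varphi^{(1)}_\theta\partial_\eta)B^{(1)}-(\varphi^{(1)}_\theta\partial_\eta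 q^{(1)},0)^T$; $p_2=(\partial_\tau+\lambda\varphi^{(1)}_\theta\partial_\eta)B^{(1)}+(v_1^{(1)}\partial_\theta+v_2^{(1)}\partial_\eta-v_1^0\varphi^{(1)}_\theta\partial_\eta)B^{(1)}-(B_1^{(1)}\partial_\theta+B_2^{(1)}\partial_\eta-B_1^0\varphi^{(1)}_\theta\partial_\eta)v^{(1)}$; $p_3=-\varphi^{(1)}_\theta\partial_\eta v_1^{(1)}$. **Functions of integration.** By decay at $\eta\to+\infty$, $a_0(k,\tau)=-\int_0^{+\infty}\mathbf L\cdot\hat p\,e^{k\eta'}d\eta'$ if $k<0$ and $b_0(k,\tau)=-\int_0^{+\infty}\overline{\mathbf L}\cdot\hat p\,e^{-k\eta'}d\eta'$ if $k>0$. The remaining functions ($a_0,\alpha'$ for $k>0$ and $b_0,\beta'$ for $k<0$) are obtained, in terms of $\hat\varphi^{(1)}$ and of an arbitrary second order wave profile $\hat\varphi^{(2)}$, from the Fourier transform of the second order jump conditions at $\eta=0$: $(\lambda-v_1^0)\varphi^{(2)}_\theta+v_2^{(2)}=\varphi^{(1)}_\tau+v_1^{(1)}\varphi^{(1)}_\theta$; $\ B_1^0\varphi^{(2)}_\theta-B_2^{(2)}=-B_1^{(1)}\varphi^{(1)}_\theta$; $\ H_1^0\varphi^{(2)}_\theta-H_2^{(2)}=-H_1^{(1)}\varphi^{(1)}_\theta$; $\ q^{(2)}-H_1^0H_1^{(2)}=\frac12\big((H_1^{(1)})^2+(H_2^{(1)})^2-(E^{(1)})^2\big)$; $\ E^{(2)}+\nu\lambda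 H_1^0\varphi^{(2)}_\theta=-\nu\lambda H_1^{(1)}\varphi^{(1)}_\theta+\nu H_1^0\varphi^{(1)}_\tau$.
   Formalization: The formula for the second order vacuum term V^(2), which divides by λ, is asserted only when λ≠0; λ=0 can be a root (e.g. ν=1, v_1^0=1, B_1^0=0, H_1^0=1), where that formula is undefined. All other conclusions include λ=0. *)

theory Defs
  imports "HOL-Analysis.Analysis" "HOL-Library.Landau_Symbols"
begin

section \<open>Partial derivatives and the nonlinear problem\<close>

text \<open>
  A field has three real arguments. In the physical problem they are \<open>(x\<^sub>1, x\<^sub>2, t)\<close>; in the
  expansion they are \<open>(\<theta>, \<eta>, \<tau>)\<close>. A surface has the two arguments \<open>(x\<^sub>1, t)\<close> or \<open>(\<theta>, \<tau>)\<close>.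
  Plasma fields are vectors \<open>U = (v\<^sub>1, v\<^sub>2, B\<^sub>1, B\<^sub>2, q)\<close> in \<open>real^5\<close> and vacuum fields are vectors
  \<open>V = (H\<^sub>1, H\<^sub>2, E)\<close> in \<open>real^3\<close>; they are functions on the whole space, but only their values
  in the plasma (or vacuum) region and their traces on the interface are ever used.
  Caution: in the library \<open>x $ 5\<close> of a vector in \<open>real^5\<close> is its last component.
\<close>

type_synonym 'a field = "real \<Rightarrow> real \<Rightarrow> real \<Rightarrow> 'a"
type_synonym surface = "real \<Rightarrow> real \<Rightarrow> real"

definition pd1 :: "'a::real_normed_vector field \<Rightarrow> 'a field" where
  "pd1 f x y t = vector_derivative (\<lambda>s. f s y t) (at x)"

definition pd2 :: "'a::real_normed_vector field \<Rightarrow> 'a field" where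
  "pd2 f x y t = vector_derivative (\<lambda>s. f x s t) (at y)"

definition pd3 :: "'a::real_normed_vector field \<Rightarrow> 'a field" where
  "pd3 f x y t = vector_derivative (\<lambda>s. f x y s) (at t)"

definition sd1 :: "surface \<Rightarrow> surface" where
  "sd1 f x t = deriv (\<lambda>s. f s t) x"

definition sd2 :: "surface \<Rightarrow> surface" where
  "sd2 f x t = deriv (\<lambda>s. f x s) t"

lemma vector_5 [simp]:
  "(vector [a, b, c, d, e] :: 'a::zero^5) $ 1 = a"
  "(vector [a, b, c, d, e] :: 'a::zero^5) $ 2 = b"
  "(vector [a, b, c, d, e] :: 'a::zero^5) $ 3 = c"
  "(vector [a, b, c, d, e] :: 'a::zero^5) $ 4 = d"
  "(vector [a, b, c, d, e] :: 'a::zero^5) $ 5 = e"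
  unfolding vector_def by simp_all

text \<open>
  Left-hand sides (minus right-hand sides) of the incompressible MHD equations including
  \<open>div B = 0\<close>, of the Maxwell equations including \<open>div H = 0\<close>, and of the interface conditions.
  The two divergence constraints are imposed on the initial data and are propagated by the
  equations, so they belong to the system at every time.
\<close>

definition plasma_residual :: "(real^5) field \<Rightarrow> real \<Rightarrow> real \<Rightarrow> real \<Rightarrow> real list" where
  "plasma_residual U x y t =
    (let w = U x y t; X = pd1 U x y t; Y = pd2 U x y t; D = pd3 U x y t in
     [D$1 + (w$1 * X$1 + w$2 * Y$1) - (w$3 * X$3 + w$4 * Y$3) + X$5,
      D$2 + (w$1 * X$2 + w$2 * Y$2) - (w$3 * X$4 + w$4 * Y$4) + Y$5,
      D$3 + (w$1 * X$3 + w$2 * Y$3) - (w$3 * X$1 + w$4 * Y$1),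
      D$4 + (w$1 * X$4 + w$2 * Y$4) - (w$3 * X$2 + w$4 * Y$2),
      X$1 + Y$2,
      X$3 + Y$4])"

definition vacuum_residual :: "real \<Rightarrow> (real^3) field \<Rightarrow> real \<Rightarrow> real \<Rightarrow> real \<Rightarrow> real list" where
  "vacuum_residual \<nu> V x y t =
    (let X = pd1 V x y t; Y = pd2 V x y t; D = pd3 V x y t in
     [\<nu> * D$1 + Y$3,
      \<nu> * D$2 - X$3,
      \<nu> * D$3 - X$2 + Y$1,
      X$1 + Y$2])"

definition interface_residual ::
  "real \<Rightarrow> (real^5) field \<Rightarrow> (real^3) field \<Rightarrow> surface \<Rightarrow> real \<Rightarrow> real \<Rightarrow> real list" where
  "interface_residual \<nu> U V \<zeta> x t =
    (let w = U x (\<zeta> x t) t; H = V x (\<zeta> x t) t; \<zeta>x = sd1 \<zeta> x t; \<zeta>t = sd2 \<zeta> x t in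
     [\<zeta>t - (w$2 - \<zeta>x * w$1),
      w$5 - ((H$1)\<^sup>2 + (H$2)\<^sup>2 - (H$3)\<^sup>2) / 2,
      w$4 - \<zeta>x * w$3,
      H$2 - \<zeta>x * H$1,
      H$3 - \<nu> * \<zeta>t * H$1])"

section \<open>The asymptotic expansion\<close>

text \<open>The front \<open>x\<^sub>2 = \<epsilon> \<phi>(x\<^sub>1 - lam t, \<epsilon>t; \<epsilon>)\<close> and a field of \<open>(\<theta>, \<eta>, \<tau>)\<close> read in physical variables.\<close>

definition front :: "real \<Rightarrow> (real \<Rightarrow> surface) \<Rightarrow> real \<Rightarrow> surface" where
  "front lam \<phi> \<epsilon> x t = \<epsilon> * \<phi> \<epsilon> (x - lam * t) (\<epsilon> * t)"

definition physical :: "real \<Rightarrow> (real \<Rightarrow> surface) \<Rightarrow> real \<Rightarrow> 'a field \<Rightarrow> 'a field" where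
  "physical lam \<phi> \<epsilon> F x y t = F (x - lam * t) (y - front lam \<phi> \<epsilon> x t) (\<epsilon> * t)"

text \<open>
  The equations hold up to and including order \<open>\<epsilon>\<^sup>2\<close>, at fixed \<open>(\<theta>, \<eta>, \<tau>)\<close>, that is at
  \<open>t = \<tau>/\<epsilon>\<close>, \<open>x\<^sub>1 = \<theta> + lam t\<close>, \<open>x\<^sub>2 = \<eta> + \<zeta>(x\<^sub>1, t)\<close>. For families expanded in powers of \<open>\<epsilon>\<close> this
  says that the coefficients of \<open>\<epsilon>\<close> and \<open>\<epsilon>\<^sup>2\<close> vanish (the constant states make the
  coefficient of \<open>\<epsilon>\<^sup>0\<close> vanish anyway).
\<close>

definition solves_to_second_order ::
  "real \<Rightarrow> real \<Rightarrow> real \<Rightarrow> (real \<Rightarrow> (real^5) field) \<Rightarrow> (real \<Rightarrow> (real^3) field) \<Rightarrow> (real \<Rightarrow> surface) \<Rightarrow> bool"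
  where
  "solves_to_second_order \<nu> lam T U V \<phi> \<longleftrightarrow>
    (\<forall>\<theta>. \<forall>\<tau>\<in>{0<..<T}.
      (\<forall>\<eta>>0. \<forall>i<6. (\<lambda>\<epsilon>. plasma_residual (physical lam \<phi> \<epsilon> (U \<epsilon>))
          (\<theta> + lam * (\<tau> / \<epsilon>)) (\<eta> + \<epsilon> * \<phi> \<epsilon> \<theta> \<tau>) (\<tau> / \<epsilon>) ! i) \<in> O[at_right 0](\<lambda>\<epsilon>. \<epsilon> ^ 3)) \<and>
      (\<forall>\<eta><0. \<forall>i<4. (\<lambda>\<epsilon>. vacuum_residual \<nu> (physical lam \<phi> \<epsilon> (V \<epsilon>))
          (\<theta> + lam * (\<tau> / \<epsilon>)) (\<eta> + \<epsilon> * \<phi> \<epsilon> \<theta> \<tau>) (\<tau> / \<epsilon>) ! i) \<in> O[at_right 0](\<lambda>\<epsilon>. \<epsilon> ^ 3)) \<and>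
      (\<forall>i<5. (\<lambda>\<epsilon>. interface_residual \<nu> (physical lam \<phi> \<epsilon> (U \<epsilon>)) (physical lam \<phi> \<epsilon> (V \<epsilon>)) (front lam \<phi> \<epsilon>)
          (\<theta> + lam * (\<tau> / \<epsilon>)) (\<tau> / \<epsilon>) ! i) \<in> O[at_right 0](\<lambda>\<epsilon>. \<epsilon> ^ 3)))"

text \<open>
  \<open>F = G + O(\<epsilon>\<^sup>n)\<close> for \<open>\<eta>\<close> in the open set \<open>S\<close>, uniformly for \<open>\<tau>\<close> in compact subintervals of
  \<open>(0, T)\<close>; the relation may be differentiated once and it holds for the traces on the boundary
  of \<open>S\<close> as well.
\<close>

definition agree_to_order ::
  "nat \<Rightarrow> real set \<Rightarrow> real \<Rightarrow> (real \<Rightarrow> 'a::real_normed_vector field) \<Rightarrow> (real \<Rightarrow> 'a field) \<Rightarrow> bool" where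
  "agree_to_order n S T F G \<longleftrightarrow>
    (\<forall>a b. 0 < a \<longrightarrow> b < T \<longrightarrow> (\<exists>C. \<forall>\<^sub>F \<epsilon> in at_right 0. \<forall>\<theta>. \<forall>\<tau>\<in>{a..b}.
      (\<forall>\<eta>\<in>closure S. norm (F \<epsilon> \<theta> \<eta> \<tau> - G \<epsilon> \<theta> \<eta> \<tau>) \<le> C * \<epsilon> ^ n) \<and>
      (\<forall>\<eta>\<in>S.
        (\<lambda>(\<theta>, \<eta>, \<tau>). F \<epsilon> \<theta> \<eta> \<tau>) differentiable (at (\<theta>, \<eta>, \<tau>)) \<and>
        norm (pd1 (F \<epsilon>) \<theta> \<eta> \<tau> - pd1 (G \<epsilon>) \<theta> \<eta> \<tau>) \<le> C * \<epsilon> ^ n \<and>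
        norm (pd2 (F \<epsilon>) \<theta> \<eta> \<tau> - pd2 (G \<epsilon>) \<theta> \<eta> \<tau>) \<le> C * \<epsilon> ^ n \<and>
        norm (pd3 (F \<epsilon>) \<theta> \<eta> \<tau> - pd3 (G \<epsilon>) \<theta> \<eta> \<tau>) \<le> C * \<epsilon> ^ n)))"

text \<open>A surface regarded as a field that does not depend on \<open>\<eta>\<close>.\<close>

definition lift_surface :: "surface \<Rightarrow> real field" where
  "lift_surface \<phi> \<theta> \<eta> \<tau> = \<phi> \<theta> \<tau>"

definition U_base :: "real \<Rightarrow> real \<Rightarrow> real \<Rightarrow> real^5" where
  "U_base v0 B0 H0 = vector [v0, 0, B0, 0, H0\<^sup>2 / 2]"

definition V_base :: "real \<Rightarrow> real^3" where
  "V_base H0 = vector [H0, 0, 0]"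

definition has_expansion ::
  "real \<Rightarrow> real \<Rightarrow> real \<Rightarrow> real \<Rightarrow>
   (real \<Rightarrow> (real^5) field) \<Rightarrow> (real \<Rightarrow> (real^3) field) \<Rightarrow> (real \<Rightarrow> surface) \<Rightarrow>
   (real^5) field \<Rightarrow> (real^3) field \<Rightarrow> surface \<Rightarrow> (real^5) field \<Rightarrow> (real^3) field \<Rightarrow> surface \<Rightarrow> bool" where
  "has_expansion v0 B0 H0 T U V \<phi> U1 V1 \<phi>1 U2 V2 \<phi>2 \<longleftrightarrow>
    agree_to_order 3 {0<..} T U
      (\<lambda>\<epsilon> \<theta> \<eta> \<tau>. U_base v0 B0 H0 + \<epsilon> *\<^sub>R U1 \<theta> \<eta> \<tau> + \<epsilon>\<^sup>2 *\<^sub>R U2 \<theta> \<eta> \<tau>) \<and>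
    agree_to_order 3 {..<0} T V
      (\<lambda>\<epsilon> \<theta> \<eta> \<tau>. V_base H0 + \<epsilon> *\<^sub>R V1 \<theta> \<eta> \<tau> + \<epsilon>\<^sup>2 *\<^sub>R V2 \<theta> \<eta> \<tau>) \<and>
    agree_to_order 2 UNIV T (\<lambda>\<epsilon>. lift_surface (\<phi> \<epsilon>))
      (\<lambda>\<epsilon> \<theta> \<eta> \<tau>. \<phi>1 \<theta> \<tau> + \<epsilon> * \<phi>2 \<theta> \<tau>)"

section \<open>Admissible profiles\<close>

text \<open>
  The regularity and decay that give a meaning to the Fourier transforms in \<open>\<theta>\<close> and to the
  localization near the interface: profiles are continuously differentiable, continuous up to the
  interface, they and their first derivatives have an integrable bounded majorant in \<open>\<theta>\<close>,
  uniformly in \<open>\<eta>\<close> and locally uniformly in \<open>\<tau>\<close>, and they vanish away from the interface.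
\<close>

definition C1_on :: "('a::real_normed_vector \<Rightarrow> 'b::real_normed_vector) \<Rightarrow> 'a set \<Rightarrow> bool" where
  "C1_on f S \<longleftrightarrow> (\<exists>D. (\<forall>p\<in>S. (f has_derivative blinfun_apply (D p)) (at p)) \<and> continuous_on S D)"

definition integrable_majorant :: "(real \<Rightarrow> real) \<Rightarrow> bool" where
  "integrable_majorant g \<longleftrightarrow> integrable lborel g \<and> bounded (range g)"

definition profile :: "real set \<Rightarrow> real \<Rightarrow> 'a::real_normed_vector field \<Rightarrow> bool" where
  "profile S T f \<longleftrightarrow>
    C1_on (\<lambda>(\<theta>, \<eta>, \<tau>). f \<theta> \<eta> \<tau>) (UNIV \<times> S \<times> {0<..<T}) \<and>
    continuous_on (UNIV \<times> closure S \<times> {0<..<T}) (\<lambda>(\<theta>, \<eta>, \<tau>). f \<theta> \<eta> \<tau>) \<and>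
    (\<forall>a b. 0 < a \<longrightarrow> b < T \<longrightarrow> (\<exists>g. integrable_majorant g \<and> (\<forall>\<theta>. \<forall>\<eta>\<in>S. \<forall>\<tau>\<in>{a..b}.
      norm (f \<theta> \<eta> \<tau>) \<le> g \<theta> \<and> norm (pd1 f \<theta> \<eta> \<tau>) \<le> g \<theta> \<and>
      norm (pd2 f \<theta> \<eta> \<tau>) \<le> g \<theta> \<and> norm (pd3 f \<theta> \<eta> \<tau>) \<le> g \<theta>)))"

definition plasma_profile :: "real \<Rightarrow> (real^5) field \<Rightarrow> bool" where
  "plasma_profile T f \<longleftrightarrow> profile {0<..} T f \<and>
    (\<forall>\<theta>. \<forall>\<tau>\<in>{0<..<T}. ((\<lambda>\<eta>. f \<theta> \<eta> \<tau>) \<longlongrightarrow> 0) at_top)"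

definition vacuum_profile :: "real \<Rightarrow> (real^3) field \<Rightarrow> bool" where
  "vacuum_profile T f \<longleftrightarrow> profile {..<0} T f \<and>
    (\<forall>\<theta>. \<forall>\<tau>\<in>{0<..<T}. ((\<lambda>\<eta>. f \<theta> \<eta> \<tau>) \<longlongrightarrow> 0) at_bot)"

definition surface_profile :: "real \<Rightarrow> surface \<Rightarrow> bool" where
  "surface_profile T \<phi> \<longleftrightarrow> profile UNIV T (lift_surface \<phi>)"

definition smooth_surface_profile :: "real \<Rightarrow> surface \<Rightarrow> bool" where
  "smooth_surface_profile T \<phi> \<longleftrightarrow> surface_profile T \<phi> \<and>
    (\<forall>n. \<forall>\<tau>\<in>{0<..<T}. (deriv ^^ n) (\<lambda>s. \<phi> s \<tau>) differentiable_on UNIV) \<and>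
    (\<forall>n a b. 0 < a \<longrightarrow> b < T \<longrightarrow> (\<exists>g. integrable_majorant g \<and>
      (\<forall>\<theta>. \<forall>\<tau>\<in>{a..b}. \<bar>(deriv ^^ n) (\<lambda>s. \<phi> s \<tau>) \<theta>\<bar> \<le> g \<theta>)))"

section \<open>Linearized phase velocity\<close>

definition sigma :: "real \<Rightarrow> real \<Rightarrow> real" where
  "sigma \<nu> lam = sqrt (1 - \<nu>\<^sup>2 * lam\<^sup>2)"

definition dd :: "real \<Rightarrow> real \<Rightarrow> real \<Rightarrow> real" where
  "dd v0 B0 lam = (lam - v0)\<^sup>2 - B0\<^sup>2"

definition phase_equation :: "real \<Rightarrow> real \<Rightarrow> real \<Rightarrow> real \<Rightarrow> real \<Rightarrow> bool" where
  "phase_equation \<nu> v0 B0 H0 lam \<longleftrightarrow> (lam - v0)\<^sup>2 - B0\<^sup>2 = H0\<^sup>2 * sigma \<nu> lam"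

text \<open>
  \<open>Hs\<close> is the threshold \<open>H\<^sup>*\<close>. Real roots are sought where the square root is real,
  \<open>\<bar>lam\<bar> \<le> 1/\<nu>\<close> (the library's \<open>sqrt\<close> is negative on negative arguments).
\<close>

definition critical_field :: "real \<Rightarrow> real \<Rightarrow> real \<Rightarrow> real \<Rightarrow> bool" where
  "critical_field \<nu> v0 B0 Hs \<longleftrightarrow> Hs > 0 \<and>
    (\<forall>H0. (\<bar>H0\<bar> > Hs \<longrightarrow> card {lam. \<bar>lam\<bar> < 1 / \<nu> \<and> phase_equation \<nu> v0 B0 H0 lam} = 2) \<and>
          (\<bar>H0\<bar> = Hs \<longrightarrow> card {lam. \<bar>lam\<bar> < 1 / \<nu> \<and> phase_equation \<nu> v0 B0 H0 lam} = 1) \<and>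
          (\<bar>H0\<bar> < Hs \<longrightarrow> {lam. \<bar>lam\<bar> \<le> 1 / \<nu> \<and> phase_equation \<nu> v0 B0 H0 lam} = {}))"

section \<open>Fourier transform in the phase variable\<close>

definition fourier :: "(real \<Rightarrow> real) \<Rightarrow> real \<Rightarrow> complex" where
  "fourier f k = 1 / (2 * pi) * (LINT \<theta>|lborel. complex_of_real (f \<theta>) * exp (- (\<i> * k * \<theta>)))"

definition surface_hat :: "surface \<Rightarrow> real \<Rightarrow> real \<Rightarrow> complex" where
  "surface_hat \<phi> k \<tau> = fourier (\<lambda>\<theta>. \<phi> \<theta> \<tau>) k"

definition field_hat :: "(real^'n) field \<Rightarrow> real \<Rightarrow> real \<Rightarrow> real \<Rightarrow> complex^'n" where
  "field_hat F k \<eta> \<tau> = (\<chi> j. fourier (\<lambda>\<theta>. F \<theta> \<eta> \<tau> $ j) k)"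

definition cnj_vec :: "complex^'n \<Rightarrow> complex^'n" where
  "cnj_vec x = (\<chi> j. cnj (x $ j))"

text \<open>The bilinear product, without conjugation.\<close>

definition bdot :: "complex^'n \<Rightarrow> complex^'n \<Rightarrow> complex" (infixl "\<odot>" 70) where
  "x \<odot> y = (\<Sum>j\<in>UNIV. x $ j * y $ j)"

section \<open>First order terms\<close>

definition R_vec :: "real \<Rightarrow> real \<Rightarrow> real \<Rightarrow> complex^5" where
  "R_vec v0 B0 lam = vector
    [of_real (lam - v0), \<i> * (lam - v0), of_real (- B0), - (\<i> * B0), of_real (dd v0 B0 lam)]"

definition first_order_terms ::
  "real \<Rightarrow> real \<Rightarrow> real \<Rightarrow> real \<Rightarrow> real \<Rightarrow> real \<Rightarrow>
   (real^5) field \<Rightarrow> (real^3) field \<Rightarrow> surface \<Rightarrow> bool" where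
  "first_order_terms \<nu> v0 B0 H0 lam T U1 V1 \<phi>1 \<longleftrightarrow>
    (\<forall>\<tau>\<in>{0<..<T}. \<forall>k. k \<noteq> 0 \<longrightarrow>
      (\<forall>\<eta>\<ge>0. field_hat U1 k \<eta> \<tau> =
        (if k > 0
         then (- (of_real (\<bar>k\<bar> * exp (- k * \<eta>)) * surface_hat \<phi>1 k \<tau>)) *s R_vec v0 B0 lam
         else (- (of_real (\<bar>k\<bar> * exp (k * \<eta>)) * surface_hat \<phi>1 k \<tau>)) *s cnj_vec (R_vec v0 B0 lam))) \<and>
      (\<forall>\<eta>\<le>0. field_hat V1 k \<eta> \<tau> =
        (of_real (H0 * exp (sigma \<nu> lam * \<bar>k\<bar> * \<eta>)) * surface_hat \<phi>1 k \<tau>) *s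
          vector [of_real (- (sigma \<nu> lam * \<bar>k\<bar>)), \<i> * k, - (\<i> * \<nu> * lam * k)]))"

section \<open>Second order terms in the plasma\<close>

definition L_vec :: "real \<Rightarrow> real \<Rightarrow> real \<Rightarrow> complex^5" where
  "L_vec v0 B0 lam = (- (1 / (2 * \<i> * dd v0 B0 lam * (lam - v0)))) *s R_vec v0 B0 lam"

definition L1_vec :: "real \<Rightarrow> real \<Rightarrow> real \<Rightarrow> complex^5" where
  "L1_vec v0 B0 lam = (1 / dd v0 B0 lam) *s vector [- (\<i> * (lam - v0)), 0, \<i> * B0, 0, 0]"

definition L3_vec :: "real \<Rightarrow> real \<Rightarrow> real \<Rightarrow> complex^5" where
  "L3_vec v0 B0 lam = (1 / dd v0 B0 lam) *s vector [\<i> * B0, 0, - (\<i> * (lam - v0)), 0, 0]"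

definition L4_vec :: "real \<Rightarrow> real \<Rightarrow> complex^5" where
  "L4_vec v0 lam = vector [0, 0, 0, - (\<i> / (lam - v0)), 0]"

text \<open>The quadratic forcing \<open>p\<close>, meaningful for \<open>\<eta> > 0\<close>.\<close>

definition forcing ::
  "real \<Rightarrow> real \<Rightarrow> real \<Rightarrow> (real^5) field \<Rightarrow> surface \<Rightarrow> (real^5) field" where
  "forcing v0 B0 lam U1 \<phi>1 \<theta> \<eta> \<tau> =
    (let w = U1 \<theta> \<eta> \<tau>; X = pd1 U1 \<theta> \<eta> \<tau>; Y = pd2 U1 \<theta> \<eta> \<tau>; D = pd3 U1 \<theta> \<eta> \<tau>; s = sd1 \<phi>1 \<theta> \<tau>;
       slow = (\<lambda>j::5. D$j + lam * s * Y$j);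
       adv = (\<lambda>j::5. w$1 * X$j + w$2 * Y$j - v0 * s * Y$j);
       mag = (\<lambda>j::5. w$3 * X$j + w$4 * Y$j - B0 * s * Y$j)
     in vector
      [slow 1 + adv 1 - mag 3 - s * Y$5,
       slow 2 + adv 2 - mag 4,
       slow 3 + adv 3 - mag 1,
       slow 4 + adv 4 - mag 2,
       - s * Y$1])"

definition I_conv :: "surface \<Rightarrow> real \<Rightarrow> real \<Rightarrow> real \<Rightarrow> complex" where
  "I_conv \<phi>1 k \<eta> \<tau> = (LINT l|lborel.
     of_real (\<bar>k - l\<bar> * l * (\<bar>k - l\<bar> - \<bar>l\<bar>) * exp (- (\<bar>k - l\<bar> + \<bar>l\<bar>) * \<eta>)) *
     surface_hat \<phi>1 (k - l) \<tau> * surface_hat \<phi>1 l \<tau>)"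

text \<open>The explicit values of the products of \<open>L\<^sub>1\<close>, \<open>L\<^sub>3\<close>, \<open>L\<^sub>4\<close> with the transformed forcing.\<close>

definition L1_forcing :: "real \<Rightarrow> real \<Rightarrow> real \<Rightarrow> surface \<Rightarrow> real \<Rightarrow> real \<Rightarrow> real \<Rightarrow> complex" where
  "L1_forcing v0 B0 lam \<phi>1 k \<eta> \<tau> =
    \<i> * (((lam - v0)\<^sup>2 + B0\<^sup>2) / dd v0 B0 lam) * of_real (\<bar>k\<bar> * exp (- \<bar>k\<bar> * \<eta>)) * surface_hat (sd2 \<phi>1) k \<tau>
    - (lam - v0) * I_conv \<phi>1 k \<eta> \<tau>"

definition L3_forcing :: "real \<Rightarrow> real \<Rightarrow> real \<Rightarrow> surface \<Rightarrow> real \<Rightarrow> real \<Rightarrow> real \<Rightarrow> complex" where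
  "L3_forcing v0 B0 lam \<phi>1 k \<eta> \<tau> =
    - (2 * \<i> * B0 * (lam - v0) / dd v0 B0 lam) * of_real (\<bar>k\<bar> * exp (- \<bar>k\<bar> * \<eta>)) * surface_hat (sd2 \<phi>1) k \<tau>
    + B0 * I_conv \<phi>1 k \<eta> \<tau>"

definition L4_forcing :: "real \<Rightarrow> real \<Rightarrow> real \<Rightarrow> surface \<Rightarrow> real \<Rightarrow> real \<Rightarrow> real \<Rightarrow> complex" where
  "L4_forcing v0 B0 lam \<phi>1 k \<eta> \<tau> =
    of_real (B0 / (lam - v0) * k * exp (- \<bar>k\<bar> * \<eta>)) * surface_hat (sd2 \<phi>1) k \<tau>"

text \<open>
  The vector \<open>S\<close> is written with the explicit values of the products, so that it also has a
  value on the interface \<open>\<eta> = 0\<close>, where \<open>forcing\<close> is not defined.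
\<close>

definition S_vec :: "real \<Rightarrow> real \<Rightarrow> real \<Rightarrow> surface \<Rightarrow> real \<Rightarrow> real \<Rightarrow> real \<Rightarrow> complex^5" where
  "S_vec v0 B0 lam \<phi>1 k \<eta> \<tau> = (1 / k) *s vector
    [L1_forcing v0 B0 lam \<phi>1 k \<eta> \<tau>, 0, L3_forcing v0 B0 lam \<phi>1 k \<eta> \<tau>, L4_forcing v0 B0 lam \<phi>1 k \<eta> \<tau>, 0]"

definition second_order_plasma ::
  "real \<Rightarrow> real \<Rightarrow> real \<Rightarrow> real \<Rightarrow> (real^5) field \<Rightarrow> surface \<Rightarrow> (real^5) field \<Rightarrow> bool" where
  "second_order_plasma v0 B0 lam T U1 \<phi>1 U2 \<longleftrightarrow>
    (let p_hat = field_hat (forcing v0 B0 lam U1 \<phi>1); R = R_vec v0 B0 lam; L = L_vec v0 B0 lam in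
      (\<forall>\<tau>\<in>{0<..<T}. \<forall>k. k \<noteq> 0 \<longrightarrow> (\<forall>\<eta>>0.
        L1_vec v0 B0 lam \<odot> p_hat k \<eta> \<tau> = L1_forcing v0 B0 lam \<phi>1 k \<eta> \<tau> \<and>
        L3_vec v0 B0 lam \<odot> p_hat k \<eta> \<tau> = L3_forcing v0 B0 lam \<phi>1 k \<eta> \<tau> \<and>
        L4_vec v0 lam \<odot> p_hat k \<eta> \<tau> = L4_forcing v0 B0 lam \<phi>1 k \<eta> \<tau>)) \<and>
      (\<exists>(a0 :: real \<Rightarrow> real \<Rightarrow> complex) (b0 :: real \<Rightarrow> real \<Rightarrow> complex). \<forall>\<tau>\<in>{0<..<T}. \<forall>k. k \<noteq> 0 \<longrightarrow>
        (k < 0 \<longrightarrow> a0 k \<tau> = - (LBINT s:{0..}. (L \<odot> p_hat k s \<tau>) * of_real (exp (k * s)))) \<and>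
        (k > 0 \<longrightarrow> b0 k \<tau> = - (LBINT s:{0..}. (cnj_vec L \<odot> p_hat k s \<tau>) * of_real (exp (- k * s)))) \<and>
        (\<forall>\<eta>\<ge>0. field_hat U2 k \<eta> \<tau> = S_vec v0 B0 lam \<phi>1 k \<eta> \<tau>
          + (of_real (exp (- k * \<eta>)) * (a0 k \<tau> + (LBINT s:{0..\<eta>}. (L \<odot> p_hat k s \<tau>) * of_real (exp (k * s))))) *s R
          + (of_real (exp (k * \<eta>)) * (b0 k \<tau> + (LBINT s:{0..\<eta>}. (cnj_vec L \<odot> p_hat k s \<tau>) * of_real (exp (- k * s)))))
              *s cnj_vec R)))"

section \<open>Second order terms in the vacuum\<close>

definition p1_vac :: "real \<Rightarrow> real \<Rightarrow> real \<Rightarrow> surface \<Rightarrow> real \<Rightarrow> real \<Rightarrow> real \<Rightarrow> complex" where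
  "p1_vac \<nu> H0 lam \<phi>1 k \<eta> \<tau> =
    - (\<nu> * sigma \<nu> lam * H0 * \<bar>k\<bar> * exp (sigma \<nu> lam * \<bar>k\<bar> * \<eta>) * surface_hat (sd2 \<phi>1) k \<tau>)
    + \<i> * \<nu> * lam * (\<nu>\<^sup>2 * lam\<^sup>2 - 1) * H0 *
      (LINT l|lborel. (k - l) * l\<^sup>2 * exp (sigma \<nu> lam * \<bar>l\<bar> * \<eta>) *
         surface_hat \<phi>1 (k - l) \<tau> * surface_hat \<phi>1 l \<tau>)"

definition p2_vac :: "real \<Rightarrow> real \<Rightarrow> real \<Rightarrow> surface \<Rightarrow> real \<Rightarrow> real \<Rightarrow> real \<Rightarrow> complex" where
  "p2_vac \<nu> H0 lam \<phi>1 k \<eta> \<tau> =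
    \<i> * \<nu> * H0 * k * exp (sigma \<nu> lam * \<bar>k\<bar> * \<eta>) * surface_hat (sd2 \<phi>1) k \<tau>"

definition P_vac :: "real \<Rightarrow> real \<Rightarrow> real \<Rightarrow> surface \<Rightarrow> real \<Rightarrow> real \<Rightarrow> real \<Rightarrow> complex" where
  "P_vac \<nu> H0 lam \<phi>1 k \<zeta> \<tau> =
    2 * \<nu> ^ 3 * lam\<^sup>2 * H0 * k\<^sup>2 * exp (sigma \<nu> lam * \<bar>k\<bar> * \<zeta>) * surface_hat (sd2 \<phi>1) k \<tau>
    + \<i> * \<nu> * lam * (\<nu>\<^sup>2 * lam\<^sup>2 - 1) * sigma \<nu> lam * H0 *
      (LINT l|lborel. (k\<^sup>2 - l\<^sup>2) * l * \<bar>l\<bar> * exp (sigma \<nu> lam * \<bar>l\<bar> * \<zeta>) *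
         surface_hat \<phi>1 (k - l) \<tau> * surface_hat \<phi>1 l \<tau>)"

definition second_order_vacuum ::
  "real \<Rightarrow> real \<Rightarrow> real \<Rightarrow> real \<Rightarrow> surface \<Rightarrow> (real^3) field \<Rightarrow> bool" where
  "second_order_vacuum \<nu> H0 lam T \<phi>1 V2 \<longleftrightarrow>
    (let \<sigma> = sigma \<nu> lam; P = P_vac \<nu> H0 lam \<phi>1 in
      \<exists>(\<alpha> :: real \<Rightarrow> real \<Rightarrow> complex) (\<beta> :: real \<Rightarrow> real \<Rightarrow> complex). \<forall>\<tau>\<in>{0<..<T}. \<forall>k. k \<noteq> 0 \<longrightarrow> (\<forall>\<eta>\<le>0.
        field_hat V2 k \<eta> \<tau> =
          (if k > 0
           then (\<alpha> k \<tau> * exp (\<sigma> * k * \<eta>)) *s vector [\<sigma> / (\<i> * \<nu> * lam), - (1 / (\<nu> * lam)), 1]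
           else (\<beta> k \<tau> * exp (- \<sigma> * k * \<eta>)) *s vector [- (\<sigma> / (\<i> * \<nu> * lam)), - (1 / (\<nu> * lam)), 1])
          + (1 / (2 * \<bar>k\<bar> * \<sigma>)) *s vector
              [1 / (\<i> * \<nu> * lam * k) *
                 ((LBINT \<zeta>:{..0}. exp (- \<sigma> * \<bar>k\<bar> * \<bar>\<eta> - \<zeta>\<bar>) * vector_derivative (\<lambda>z. P k z \<tau>) (at \<zeta>))
                  - exp (- \<sigma> * \<bar>k * \<eta>\<bar>) * P k 0 \<tau>),
               - (1 / (\<nu> * lam)) * (LBINT \<zeta>:{..0}. exp (- \<sigma> * \<bar>k\<bar> * \<bar>\<eta> - \<zeta>\<bar>) * P k \<zeta> \<tau>),
               (LBINT \<zeta>:{..0}. exp (- \<sigma> * \<bar>k\<bar> * \<bar>\<eta> - \<zeta>\<bar>) * P k \<zeta> \<tau>)]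
          + vector
              [1 / (\<i> * \<nu> * lam * k) * p1_vac \<nu> H0 lam \<phi>1 k \<eta> \<tau>,
               1 / (\<i> * \<nu> * lam * k) * p2_vac \<nu> H0 lam \<phi>1 k \<eta> \<tau>,
               0]))"

section \<open>Second order jump conditions and amplitude equation\<close>

text \<open>
  Fourier transform of the second order jump conditions at \<open>\<eta> = 0\<close>. Together with the
  formulas for the second order terms, taken at \<open>\<eta> = 0\<close>, they determine the remaining functions of
  integration from the first and second order wave profiles.
\<close>

definition second_order_jump ::
  "real \<Rightarrow> real \<Rightarrow> real \<Rightarrow> real \<Rightarrow> real \<Rightarrow> real \<Rightarrow>
   (real^5) field \<Rightarrow> (real^3) field \<Rightarrow> surface \<Rightarrow> (real^5) field \<Rightarrow> (real^3) field \<Rightarrow> surface \<Rightarrow> bool" where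
  "second_order_jump \<nu> v0 B0 H0 lam T U1 V1 \<phi>1 U2 V2 \<phi>2 \<longleftrightarrow>
    (\<forall>\<tau>\<in>{0<..<T}. \<forall>k. k \<noteq> 0 \<longrightarrow>
      (let u = (\<lambda>\<theta>. U1 \<theta> 0 \<tau>); h = (\<lambda>\<theta>. V1 \<theta> 0 \<tau>);
           \<phi>\<theta> = (\<lambda>\<theta>. sd1 \<phi>1 \<theta> \<tau>); \<phi>\<tau> = (\<lambda>\<theta>. sd2 \<phi>1 \<theta> \<tau>);
           uh = field_hat U2 k 0 \<tau>; hh = field_hat V2 k 0 \<tau>; f2 = \<i> * k * surface_hat \<phi>2 k \<tau>
       in (lam - v0) * f2 + uh$2 = fourier (\<lambda>\<theta>. \<phi>\<tau> \<theta> + u \<theta> $ 1 * \<phi>\<theta> \<theta>) k \<and>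
          B0 * f2 - uh$4 = fourier (\<lambda>\<theta>. - (u \<theta> $ 3 * \<phi>\<theta> \<theta>)) k \<and>
          H0 * f2 - hh$2 = fourier (\<lambda>\<theta>. - (h \<theta> $ 1 * \<phi>\<theta> \<theta>)) k \<and>
          uh$5 - H0 * hh$1 = fourier (\<lambda>\<theta>. ((h \<theta> $ 1)\<^sup>2 + (h \<theta> $ 2)\<^sup>2 - (h \<theta> $ 3)\<^sup>2) / 2) k \<and>
          hh$3 + \<nu> * lam * H0 * f2 =
            fourier (\<lambda>\<theta>. - (\<nu> * lam * h \<theta> $ 1 * \<phi>\<theta> \<theta>) + \<nu> * H0 * \<phi>\<tau> \<theta>) k))"

definition Lambda :: "real \<Rightarrow> real \<Rightarrow> real" where
  "Lambda k l = 2 * \<bar>k + l\<bar> * \<bar>k\<bar> * \<bar>l\<bar> / (\<bar>k + l\<bar> + \<bar>k\<bar> + \<bar>l\<bar>)"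

definition amplitude_equation :: "surface \<Rightarrow> real set \<Rightarrow> bool" where
  "amplitude_equation \<psi> J \<longleftrightarrow>
    (\<forall>k. k \<noteq> 0 \<longrightarrow> (\<forall>s\<in>J. \<exists>D. ((\<lambda>r. surface_hat \<psi> k r) has_vector_derivative D) (at s) \<and>
      D + \<i> * sgn k *
        (LINT l|lborel. Lambda (k - l) l * surface_hat \<psi> (k - l) s * surface_hat \<psi> l s) = 0))"

end

theory Submission
 imports Defs "HOL-Probability.Sinc_Integral"
begin

text \<open>
  Write \<open>m = lam - v0\<close>, \<open>d = m\<^sup>2 - B0\<^sup>2\<close> and \<open>\<sigma> = sigma \<nu> lam\<close>. Both stability cases give
  \<open>H0 \<noteq> 0\<close>, so the dispersion relation gives \<open>d = H0\<^sup>2 \<sigma> > 0\<close> and hence \<open>m \<noteq> 0\<close>.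

  Comparing coefficients of \<open>\<epsilon>\<close> and \<open>\<epsilon>\<^sup>2\<close> (\<open>solves_to_second_order_iff\<close>), the profiles satisfy two linear
  systems with the same operator; the second one is forced by quadratic expressions in the first order profiles.
  The decay of the profiles makes the Fourier transform in \<open>\<theta>\<close> injective and lets it be differentiated in the
  other variables, so the systems are equivalent to linear differential equations in \<open>\<eta>\<close>, one
  for each wave number \<open>k \<noteq> 0\<close>, coupled by the conditions at \<open>\<eta> = 0\<close>.

  On each half line these equations split into modes \<open>exp (\<plusminus> \<bar>k\<bar> \<eta>)\<close> in the plasma and
  \<open>exp (\<plusminus> \<sigma> \<bar>k\<bar> \<eta>)\<close> in the vacuum. Duhamel's formula represents the amplitude of each mode, and a bounded
  profile cannot contain the growing mode, which fixes the amplitude of this mode on the interface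
  (\<open>bounded_solution_initial_value\<close>). This gives the formulas for the first and the second order terms; conversely,
  the formulas are differentiated to recover the equations.

  Products become convolutions of \<open>w\<close>, the transform of the first order wave profile, with polynomially
  bounded kernels (\<open>conv\<close>), which makes the forcing explicit.
  At second order the two values on the interface fixed by boundedness, one for each side, overdetermine the
  jump conditions. The second order profile drops out because of the dispersion relation, and the remaining condition
  is \<open>- \<i> rate w\<^sub>\<tau> = gain \<integral> Lambda w w\<close> for \<open>k > 0\<close> (\<open>amplitude_relation_pos\<close>): the denominators \<open>k + \<bar>a\<bar> + \<bar>b\<bar>\<close>
  come from integrating the forcing against the decaying exponential, and the kernels of both sides
  symmetrize to \<open>Lambda\<close>. Rescaling time by \<open>- rate / gain\<close> gives the amplitude equation. If \<open>rate = 0\<close>,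
  which happens at a double root, the interaction integral vanishes for all wave numbers and the wave is zero
  (\<open>interaction_zero\<close>). Negative wave numbers follow by conjugation, as the profiles are real.
\<close>

section \<open>First order linear equations on a half line\<close>

text \<open>
 The forcing is only defined for \<open>\<eta> > 0\<close>, hence continuity and boundedness are required on the
 open half line; the value at the end point is arbitrary and does not influence the integrals.
\<close>

definition halfline_source :: "(real \<Rightarrow> complex) \<Rightarrow> bool" where
 "halfline_source r \<longleftrightarrow> continuous_on {0<..} r \<and> (\<exists>M. \<forall>s>0. norm (r s) \<le> M)"

lemma halfline_source_const: "halfline_source (\<lambda>_. c)"
 unfolding halfline_source_def by auto

lemma halfline_source_add:
 assumes "halfline_source f" "halfline_source g"
 shows "halfline_source (\<lambda>s. f s + g s)"
proof -
 from assms obtain M N where "\<forall>s>0. norm (f s) \<le> M" "\<forall>s>0. norm (g s) \<le> N"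
  unfolding halfline_source_def by blast
 then have "\<forall>s>0. norm (f s + g s) \<le> M + N" by (meson add_mono norm_triangle_le)
 then show ?thesis using assms unfolding halfline_source_def by (auto intro: continuous_intros)
qed

lemma halfline_source_cmult:
 assumes "halfline_source f"
 shows "halfline_source (\<lambda>s. c * f s)"
proof -
 from assms obtain M where "\<forall>s>0. norm (f s) \<le> M"
  unfolding halfline_source_def by blast
 then have "\<forall>s>0. norm (c * f s) \<le> norm c * M" by (simp add: mult_left_mono norm_mult)
 then show ?thesis using assms unfolding halfline_source_def by (auto intro: continuous_intros)
qed

lemma halfline_source_diff:
 assumes "halfline_source f" "halfline_source g"
 shows "halfline_source (\<lambda>s. f s - g s)"
 using halfline_source_add[OF assms(1) halfline_source_cmult[OF assms(2), of "-1"]] by simp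

lemmas halfline_source_intros =
 halfline_source_const halfline_source_add halfline_source_diff halfline_source_cmult

lemma halfline_source_cong:
 assumes "halfline_source f" "\<And>s. s > 0 \<Longrightarrow> f s = g s"
 shows "halfline_source g"
proof -
 have "continuous_on {0<..} g"
  using assms by (auto simp: halfline_source_def intro: continuous_on_eq)
 then show ?thesis using assms unfolding halfline_source_def by auto
qed

lemma set_integrable_exp_atLeast:
 assumes "c > (0::real)"
 shows "set_integrable lborel {0..} (\<lambda>s. exp (- (c * s)))"
proof -
 have "integrable lborel (\<lambda>x. indicator {0<..} x *\<^sub>R exp (- (c * x)))"
  using integrable_I0i_exp_mscale[OF assms] by (simp add: set_integrable_def mult.commute)
 then show ?thesis
  unfolding set_integrable_def
  by (rule integrable_cong_AE_imp)
   (auto intro!: AE_I[where N="{0}"] split: split_indicator)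
qed

lemma halfline_source_measurable:
 assumes "halfline_source r"
 shows "(\<lambda>s. indicator {0..} s *\<^sub>R r s) \<in> borel_measurable lborel"
proof -
 have "(\<lambda>s. indicator {0<..} s *\<^sub>R r s) \<in> borel_measurable borel"
  using assms unfolding halfline_source_def
  by (intro borel_measurable_continuous_on_indicator) auto
 then have "(\<lambda>s. indicator {0<..} s *\<^sub>R r s + indicator {0} s *\<^sub>R r 0) \<in> borel_measurable borel"
  by measurable
 also have "(\<lambda>s. indicator {0<..} s *\<^sub>R r s + indicator {0} s *\<^sub>R r 0) = (\<lambda>s. indicator {0..} s *\<^sub>R r s)"
  by (auto split: split_indicator)
 finally show ?thesis by simp
qed

lemma halfline_source_integrable:
 assumes r: "halfline_source r" and S: "S \<subseteq> {0..}" "S \<in> sets lborel" and "set_integrable lborel S e"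
 shows "set_integrable lborel S (\<lambda>s. r s * complex_of_real (e s))"
proof -
 obtain M where M: "\<And>s. s > 0 \<Longrightarrow> norm (r s) \<le> M"
  using r unfolding halfline_source_def by auto
 have M0: "M \<ge> 0" using M[of 1] norm_ge_zero[of "r 1"] by linarith
 have e: "integrable lborel (\<lambda>s. indicator S s *\<^sub>R e s)"
  using assms(4) by (simp add: set_integrable_def)
 have m: "(\<lambda>s. indicator S s *\<^sub>R (r s * complex_of_real (e s))) \<in> borel_measurable lborel"
 proof -
  have "(\<lambda>s. (indicator {0..} s *\<^sub>R r s) * complex_of_real (indicator S s *\<^sub>R e s)) \<in> borel_measurable lborel"
   using halfline_source_measurable[OF r] borel_measurable_integrable[OF e] by measurable
  also have "(\<lambda>s. (indicator {0..} s *\<^sub>R r s) * complex_of_real (indicator S s *\<^sub>R e s)) =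
    (\<lambda>s. indicator S s *\<^sub>R (r s * complex_of_real (e s)))"
  proof
   fix s show "(indicator {0..} s *\<^sub>R r s) * complex_of_real (indicator S s *\<^sub>R e s) =
    indicator S s *\<^sub>R (r s * complex_of_real (e s))"
    using S(1) by (cases "s \<in> S") auto
  qed
  finally show ?thesis .
 qed
 show ?thesis
  unfolding set_integrable_def
 proof (rule Bochner_Integration.integrable_bound[OF _ m])
  show "integrable lborel (\<lambda>s. M * (indicator S s *\<^sub>R e s))"
   using e by simp
  show "AE s in lborel. norm (indicator S s *\<^sub>R (r s * complex_of_real (e s))) \<le> norm (M * (indicator S s *\<^sub>R e s))"
  proof (rule AE_I[where N="{0}"])
   show "{s \<in> space lborel. \<not> norm (indicator S s *\<^sub>R (r s * complex_of_real (e s)))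
    \<le> norm (M * (indicator S s *\<^sub>R e s))} \<subseteq> {0}"
   proof (safe, rule ccontr)
    fix s assume s: "\<not> norm (indicator S s *\<^sub>R (r s * complex_of_real (e s))) \<le> norm (M * (indicator S s *\<^sub>R e s))" "s \<noteq> 0"
    then have "s \<in> S" by (auto split: split_indicator_asm)
    then have "s > 0" using s(2) S(1) by force
    with s(1) M[of s] M0 \<open>s \<in> S\<close> show False
     by (auto simp: norm_mult abs_mult intro: mult_right_mono)
   qed
  qed auto
 qed
qed

lemma set_integrable_exp_Icc: "set_integrable lborel {0..L} (\<lambda>s::real. exp (- (c * s)))"
 by (rule borel_integrable_atLeastAtMost') (intro continuous_intros)

text \<open>Duhamel's formula, with an integrand that is merely bounded at the end point.\<close>

lemma duhamel:
 fixes y r :: "real \<Rightarrow> complex" and c :: real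
 assumes y: "continuous_on {0..} y"
  and D: "\<And>s. s > 0 \<Longrightarrow> (y has_vector_derivative (c * y s + r s)) (at s)"
  and r: "halfline_source r" and "\<eta> \<ge> 0"
 shows "y \<eta> = of_real (exp (c * \<eta>)) * (y 0 + (LBINT s:{0..\<eta>}. r s * of_real (exp (- (c * s)))))"
proof -
 let ?z = "\<lambda>s. y s * complex_of_real (exp (- (c * s)))"
 have "((\<lambda>s. r s * of_real (exp (- (c * s)))) has_integral (?z \<eta> - ?z 0)) {0..\<eta>}"
 proof (rule fundamental_theorem_of_calculus_interior)
  show "continuous_on {0..\<eta>} ?z"
   by (intro continuous_intros continuous_on_subset[OF y]) auto
  fix s assume s: "s \<in> {0<..<\<eta>}"
  have e: "((\<lambda>s. complex_of_real (exp (- (c * s)))) has_vector_derivative of_real (- c * exp (- (c * s)))) (at s)"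
   by (rule has_vector_derivative_of_real)
    (auto intro!: derivative_eq_intros simp: has_real_derivative_iff_has_vector_derivative[symmetric])
  have "(?z has_vector_derivative y s * of_real (- c * exp (- (c * s))) + (c * y s + r s) * complex_of_real (exp (- (c * s)))) (at s)"
   using has_vector_derivative_mult[OF D[of s] e] s by simp
  then show "(?z has_vector_derivative r s * of_real (exp (- (c * s)))) (at s)"
   by (simp add: algebra_simps)
 qed fact
 moreover have "(LBINT s:{0..\<eta>}. r s * of_real (exp (- (c * s)))) = integral {0..\<eta>} (\<lambda>s. r s * of_real (exp (- (c * s))))"
  by (rule set_borel_integral_eq_integral(2), rule halfline_source_integrable[OF r])
   (auto intro: set_integrable_exp_Icc)
 ultimately have "(LBINT s:{0..\<eta>}. r s * of_real (exp (- (c * s)))) = ?z \<eta> - ?z 0"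
  by (simp add: integral_unique)
 then show ?thesis
  by (simp add: exp_minus field_simps)
qed

text \<open>A bounded solution cannot contain the growing exponential; this fixes its initial value.\<close>

lemma bounded_solution_initial_value:
 fixes y r :: "real \<Rightarrow> complex" and c :: real
 assumes y: "continuous_on {0..} y"
  and D: "\<And>s. s > 0 \<Longrightarrow> (y has_vector_derivative (c * y s + r s)) (at s)"
  and r: "halfline_source r" and c: "c > 0" and bdd: "\<And>s. s > 0 \<Longrightarrow> norm (y s) \<le> M"
 shows "y 0 = - (LBINT s:{0..}. r s * of_real (exp (- (c * s))))"
proof -
 let ?I = "\<lambda>\<eta>. LBINT s:{0..\<eta>}. r s * of_real (exp (- (c * s)))"
 have "(?I \<longlongrightarrow> (LBINT s:{0..}. r s * of_real (exp (- (c * s))))) at_top"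
  by (rule tendsto_set_lebesgue_integral_at_top, simp, rule halfline_source_integrable[OF r])
   (auto intro: set_integrable_exp_atLeast c)
 moreover have "(?I \<longlongrightarrow> - y 0) at_top"
 proof (rule Lim_transform_eventually)
  have "((\<lambda>\<eta>. y \<eta> * of_real (exp (- (c * \<eta>)))) \<longlongrightarrow> 0) at_top"
  proof (rule Lim_null_comparison)
   show "\<forall>\<^sub>F x in at_top. norm (y x * complex_of_real (exp (- (c * x)))) \<le> M * exp (- (c * x))"
    using eventually_gt_at_top[of 0]
    by eventually_elim (auto simp: norm_mult intro!: mult_right_mono bdd)
   have "((\<lambda>x. exp (- (c * x))) \<longlongrightarrow> 0) at_top"
    using c by (intro filterlim_compose[OF exp_at_bot])
     (auto simp: filterlim_uminus_at_bot intro: filterlim_tendsto_pos_mult_at_top[OF tendsto_const _ filterlim_ident])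
   then show "((\<lambda>x. M * exp (- (c * x))) \<longlongrightarrow> 0) at_top"
    by (rule tendsto_mult_right_zero)
  qed
  then show "((\<lambda>\<eta>. y \<eta> * of_real (exp (- (c * \<eta>))) - y 0) \<longlongrightarrow> - y 0) at_top"
   using tendsto_diff[OF _ tendsto_const[of "y 0"]] by fastforce
  show "\<forall>\<^sub>F \<eta> in at_top. y \<eta> * of_real (exp (- (c * \<eta>))) - y 0 = ?I \<eta>"
   using eventually_ge_at_top[of 0]
  proof eventually_elim
   case (elim \<eta>)
   show ?case by (subst duhamel[OF y D r elim]) (auto simp: exp_minus field_simps)
  qed
 qed
 ultimately have "(LBINT s:{0..}. r s * of_real (exp (- (c * s)))) = - y 0"
  by (rule tendsto_unique[rotated -2]) simp
 then show ?thesis by simp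
qed

lemma duhamel_has_derivative:
 fixes y r :: "real \<Rightarrow> complex" and c :: real and y0 :: complex
 assumes r: "halfline_source r" and \<eta>: "\<eta> > 0"
 defines "y \<equiv> \<lambda>\<eta>. of_real (exp (c * \<eta>)) * (y0 + (LBINT s:{0..\<eta>}. r s * of_real (exp (- (c * s)))))"
 shows "(y has_vector_derivative (c * y \<eta> + r \<eta>)) (at \<eta>)"
proof -
 let ?g = "\<lambda>s. r s * complex_of_real (exp (- (c * s)))"
 have int: "set_integrable lborel {0..L} ?g" for L
  by (rule halfline_source_integrable[OF r]) (auto intro: set_integrable_exp_Icc)
 have eq: "(LBINT s:{0..L}. ?g s) = integral {0..L} ?g" for L
  by (rule set_borel_integral_eq_integral(2)[OF int])
 have cont: "isCont ?g \<eta>"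
 proof -
  have "continuous_on {0<..} ?g"
   using r unfolding halfline_source_def by (intro continuous_intros) auto
  then show ?thesis using \<eta> by (simp add: continuous_on_eq_continuous_at)
 qed
 have "((\<lambda>u. integral {0..u} ?g) has_vector_derivative ?g \<eta>) (at \<eta> within ({0..\<eta>+1} - {}))"
  using \<eta> cont
  by (intro integral_has_vector_derivative_continuous_at set_borel_integral_eq_integral(1) int)
   (auto intro: continuous_at_imp_continuous_at_within)
 then have "((\<lambda>u. integral {0..u} ?g) has_vector_derivative ?g \<eta>) (at \<eta>)"
  using \<eta> by (simp add: at_within_Icc_at)
 then have "((\<lambda>u. y0 + integral {0..u} ?g) has_vector_derivative ?g \<eta>) (at \<eta>)"
  by (auto intro!: derivative_eq_intros)
 moreover have "((\<lambda>s. complex_of_real (exp (c * s))) has_vector_derivative of_real (c * exp (c * \<eta>))) (at \<eta>)"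
  by (rule has_vector_derivative_of_real)
   (auto intro!: derivative_eq_intros simp: has_real_derivative_iff_has_vector_derivative[symmetric])
 ultimately have "(y has_vector_derivative of_real (exp (c * \<eta>)) * ?g \<eta> +
   of_real (c * exp (c * \<eta>)) * (y0 + integral {0..\<eta>} ?g)) (at \<eta>)"
  unfolding y_def eq by (intro has_vector_derivative_mult)
 also have "of_real (exp (c * \<eta>)) * ?g \<eta> +
   of_real (c * exp (c * \<eta>)) * (y0 + integral {0..\<eta>} ?g) = c * y \<eta> + r \<eta>"
  unfolding y_def eq by (simp add: exp_minus field_simps)
 finally show ?thesis .
qed

lemma duhamel_continuous:
 fixes r :: "real \<Rightarrow> complex" and c :: real
 assumes r: "halfline_source r"
 shows "continuous_on {0..} (\<lambda>y. of_real (exp (c * y)) *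
  (y0 + (LBINT s:{0..y}. r s * of_real (exp (- (c * s))))))"
proof -
 let ?g = "\<lambda>s. r s * complex_of_real (exp (- (c * s)))"
 have int: "set_integrable lborel {0..L} ?g" for L
  by (rule halfline_source_integrable[OF r]) (auto intro: set_integrable_exp_Icc)
 have eq: "(LBINT s:{0..L}. ?g s) = integral {0..L} ?g" for L
  by (rule set_borel_integral_eq_integral(2)[OF int])
 have "continuous_on {0..} (\<lambda>u. integral {0..u} ?g)"
  unfolding continuous_on_eq_continuous_within
 proof
  fix x :: real assume "x \<in> {0..}"
  have "continuous_on {0..x+1} (\<lambda>u. integral {0..u} ?g)"
   by (intro indefinite_integral_continuous_1 set_borel_integral_eq_integral(1) int)
  then have "continuous (at x within {0..x+1}) (\<lambda>u. integral {0..u} ?g)"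
   using \<open>x \<in> {0..}\<close> by (simp add: continuous_on_eq_continuous_within)
  moreover have "at x within {0..x+1} = at x within {0..}"
   using at_within_nhd[of x "{x-1<..<x+1}" "{0..x+1}" "{0..}"] by fastforce
  ultimately show "continuous (at x within {0..}) (\<lambda>u. integral {0..u} ?g)"
   by simp
 qed
 then show ?thesis unfolding eq by (intro continuous_intros) auto
qed

text \<open>
 The Laplace transform of a superposition of exponentials; the weights \<open>1/(\<kappa> + \<alpha>)\<close> that it
 produces are the source of the denominator of the kernel of the amplitude equation.
\<close>

lemma laplace_superposition:
 fixes c :: "real \<Rightarrow> complex" and \<alpha> :: "real \<Rightarrow> real"
 assumes c: "integrable lborel c" and \<alpha>: "continuous_on UNIV \<alpha>" "\<And>l. \<alpha> l \<ge> 0" and \<kappa>: "\<kappa> > 0"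
 shows "(LBINT s:{0..}. (LINT l|lborel. c l * of_real (exp (- (\<alpha> l * s)))) * of_real (exp (- (\<kappa> * s)))) =
  (LINT l|lborel. c l / of_real (\<kappa> + \<alpha> l))"
proof -
 have [measurable]: "c \<in> borel_measurable borel" "\<alpha> \<in> borel_measurable borel"
  using c \<alpha> by (auto intro: borel_measurable_continuous_onI)
 define f where "f = (\<lambda>s l. indicator {0..} s *\<^sub>R (c l * complex_of_real (exp (- (\<alpha> l * s))) * complex_of_real (exp (- (\<kappa> * s)))))"
 have [measurable]: "(\<lambda>(s,l). f s l) \<in> borel_measurable (lborel \<Otimes>\<^sub>M lborel)"
  unfolding f_def by measurable
 have le: "norm (f s l) \<le> norm (c l) * (indicator {0..} s * exp (- (\<kappa> * s)))" for s l
  using \<alpha>(2)[of l] unfolding f_def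
  by (auto split: split_indicator simp: norm_mult intro!: mult_right_mono mult_left_le)
 have i0: "integrable lborel (\<lambda>s. indicator {0..} s * exp (- (\<kappa> * s)))"
  using set_integrable_exp_atLeast[OF \<kappa>] by (simp add: set_integrable_def)
 have i1: "integrable lborel (\<lambda>l. f s l)" for s
  by (rule Bochner_Integration.integrable_bound[of _ "\<lambda>l. norm (c l) * (indicator {0..} s * exp (- (\<kappa> * s)))"])
   (use c le in \<open>auto simp: f_def intro!: integrable_mult_left\<close>)
 have int: "integrable (lborel \<Otimes>\<^sub>M lborel) (\<lambda>(s,l). f s l)"
 proof (rule lborel_pair.Fubini_integrable)
  show "integrable lborel (\<lambda>x. LINT y|lborel. norm (case (x, y) of (s, l) \<Rightarrow> f s l))"
  proof (rule Bochner_Integration.integrable_bound)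
   show "integrable lborel (\<lambda>s. (LINT l|lborel. norm (c l)) * (indicator {0..} s * exp (- (\<kappa> * s))))"
    using i0 by (rule integrable_mult_right)
   show "AE x in lborel. norm (LINT y|lborel. norm (case (x, y) of (s, l) \<Rightarrow> f s l)) \<le>
     norm ((LINT l|lborel. norm (c l)) * (indicator {0..} x * exp (- (\<kappa> * x))))"
   proof (rule AE_I2)
    fix x
    have "(LINT y|lborel. norm (f x y)) \<le> (LINT l|lborel. norm (c l) * (indicator {0..} x * exp (- (\<kappa> * x))))"
     by (rule integral_mono) (use i1 c le in \<open>auto intro!: integrable_mult_left\<close>)
    then show "norm (LINT y|lborel. norm (case (x, y) of (s, l) \<Rightarrow> f s l)) \<le>
     norm ((LINT l|lborel. norm (c l)) * (indicator {0..} x * exp (- (\<kappa> * x))))"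
     by simp
   qed
  qed simp
  show "AE x in lborel. integrable lborel (\<lambda>y. case (x, y) of (s, l) \<Rightarrow> f s l)"
   using i1 by simp
 qed simp
 have inner: "(LINT s|lborel. f s l) = c l / of_real (\<kappa> + \<alpha> l)" for l
 proof -
  have pos: "\<kappa> + \<alpha> l > 0" using \<alpha>(2)[of l] \<kappa> by simp
  have "(1::complex) = - (LBINT s:{0..}. of_real (- (\<kappa> + \<alpha> l)) * of_real (exp (- ((\<kappa> + \<alpha> l) * s))))"
   by (rule bounded_solution_initial_value[where y="\<lambda>_. 1" and M=1])
    (use pos in \<open>auto intro: halfline_source_const derivative_eq_intros\<close>)
  then have "1 = of_real (\<kappa> + \<alpha> l) * (LBINT s:{0..}. complex_of_real (exp (- ((\<kappa> + \<alpha> l) * s))))"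
   unfolding set_integral_mult_right by (simp add: algebra_simps)
  then have *: "(LBINT s:{0..}. complex_of_real (exp (- ((\<kappa> + \<alpha> l) * s)))) = 1 / of_real (\<kappa> + \<alpha> l)"
   using pos by (metis less_irrefl nonzero_mult_div_cancel_left of_real_eq_0_iff)
  have "(LINT s|lborel. f s l) = (LBINT s:{0..}. c l * complex_of_real (exp (- ((\<kappa> + \<alpha> l) * s))))"
   unfolding f_def set_lebesgue_integral_def
   by (intro Bochner_Integration.integral_cong)
    (auto simp: algebra_simps exp_add[symmetric] simp flip: of_real_mult split: split_indicator)
  then show ?thesis using * by simp
 qed
 have "(LBINT s:{0..}. (LINT l|lborel. c l * of_real (exp (- (\<alpha> l * s)))) * of_real (exp (- (\<kappa> * s)))) =
   (LINT s|lborel. LINT l|lborel. f s l)"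
  unfolding set_lebesgue_integral_def f_def
  by (intro Bochner_Integration.integral_cong) (auto split: split_indicator)
 also have "\<dots> = (LINT l|lborel. LINT s|lborel. f s l)"
  by (rule lborel_pair.Fubini_integral[symmetric]) fact
 finally show ?thesis using inner by simp
qed

section \<open>Parameter integrals\<close>

lemma has_vector_derivative_parameter_integral:
 fixes f f' :: "real \<Rightarrow> real \<Rightarrow> complex"
 assumes S: "open S" "p \<in> S"
  and int: "\<And>q. q \<in> S \<Longrightarrow> integrable lborel (f q)"
  and D: "\<And>q x. q \<in> S \<Longrightarrow> ((\<lambda>q. f q x) has_vector_derivative f' q x) (at q)"
  and g: "integrable lborel g" and le: "\<And>q x. q \<in> S \<Longrightarrow> norm (f' q x) \<le> g x"
 shows "((\<lambda>q. LINT x|lborel. f q x) has_vector_derivative (LINT x|lborel. f' p x)) (at p)"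
proof -
 obtain e where e: "e > 0" "ball p e \<subseteq> S" using S openE by blast
 have quotient: "(((\<lambda>q. (1 / (q - p)) *\<^sub>R (F q - F p)) \<longlongrightarrow> D) (at p)) \<longleftrightarrow> (F has_vector_derivative D) (at p)"
  for F :: "real \<Rightarrow> complex" and D
 proof -
  have "((\<lambda>q. norm ((1 / (q - p)) *\<^sub>R (F q - F p) - D)) \<longlongrightarrow> 0) (at p) \<longleftrightarrow>
    ((\<lambda>q. norm (F q - F p - (q - p) *\<^sub>R D) / norm (q - p)) \<longlongrightarrow> 0) (at p)"
  proof (rule Lim_cong_within)
   fix q assume "q \<noteq> p"
   then have "(1 / (q - p)) *\<^sub>R (F q - F p) - D = (1 / (q - p)) *\<^sub>R (F q - F p - (q - p) *\<^sub>R D)"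
    by (simp add: scaleR_diff_right)
   then show "norm ((1 / (q - p)) *\<^sub>R (F q - F p) - D) = norm (F q - F p - (q - p) *\<^sub>R D) / norm (q - p)"
    by (simp add: divide_inverse mult.commute)
  qed auto
  then show ?thesis
   by (simp add: has_vector_derivative_def has_derivative_iff_norm bounded_linear_scaleR_left
     tendsto_norm_zero_iff LIM_zero_iff)
 qed
 have "((\<lambda>q. (1 / (q - p)) *\<^sub>R ((LINT x|lborel. f q x) - (LINT x|lborel. f p x)))
   \<longlongrightarrow> (LINT x|lborel. f' p x)) (at p within ball p e)"
  unfolding tendsto_at_iff_sequentially comp_def
 proof (intro allI impI)
  fix X :: "nat \<Rightarrow> real" assume X: "\<forall>i. X i \<in> ball p e - {p}" "X \<longlonglongrightarrow> p"
  have XS: "X i \<in> S" "X i \<noteq> p" for i using X(1) e by auto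
  have "(\<lambda>i. LINT x|lborel. (1 / (X i - p)) *\<^sub>R (f (X i) x - f p x)) \<longlonglongrightarrow> (LINT x|lborel. f' p x)"
  proof (rule integral_dominated_convergence[where w=g])
   have lim: "(\<lambda>i. (1 / (X i - p)) *\<^sub>R (f (X i) x - f p x)) \<longlonglongrightarrow> f' p x" for x
    using D[OF S(2), of x] X XS unfolding quotient[symmetric] tendsto_at_iff_sequentially comp_def by auto
   then show "AE x in lborel. (\<lambda>i. (1 / (X i - p)) *\<^sub>R (f (X i) x - f p x)) \<longlonglongrightarrow> f' p x"
    by simp
   show meas: "(\<lambda>x. (1 / (X i - p)) *\<^sub>R (f (X i) x - f p x)) \<in> borel_measurable lborel" for i
    using int[OF XS(1)] int[OF S(2)] by measurable
   show "f' p \<in> borel_measurable lborel"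
    by (rule borel_measurable_LIMSEQ_metric[OF meas lim])
   show "AE x in lborel. norm ((1 / (X i - p)) *\<^sub>R (f (X i) x - f p x)) \<le> g x" for i
   proof (rule AE_I2)
    fix x
    have "norm (f (X i) x - f p x) \<le> g x * norm (X i - p)"
    proof (rule differentiable_bound[where S="ball p e" and f'="\<lambda>q t. t *\<^sub>R f' q x"])
     fix q assume q: "q \<in> ball p e"
     then have "q \<in> S" using e by blast
     show "((\<lambda>q. f q x) has_derivative (\<lambda>t. t *\<^sub>R f' q x)) (at q within ball p e)"
      using D[OF \<open>q \<in> S\<close>, unfolded has_vector_derivative_def] by (rule has_derivative_at_withinI)
     have "onorm (\<lambda>t. t *\<^sub>R f' q x) \<le> norm (f' q x)"
      by (rule onorm_le) simp
     then show "onorm (\<lambda>t. t *\<^sub>R f' q x) \<le> g x"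
      using le[OF \<open>q \<in> S\<close>, of x] by simp
    qed (use X(1) \<open>e > 0\<close> in simp_all)
    then show "norm ((1 / (X i - p)) *\<^sub>R (f (X i) x - f p x)) \<le> g x"
     using XS(2)[of i] unfolding norm_scaleR by (simp add: divide_simps mult.commute)
   qed
  qed fact
  then show "(\<lambda>i. (1 / (X i - p)) *\<^sub>R ((LINT x|lborel. f (X i) x) - (LINT x|lborel. f p x)))
    \<longlonglongrightarrow> (LINT x|lborel. f' p x)"
   using int[OF XS(1)] int[OF S(2)] by simp
 qed
 then have "((\<lambda>q. (1 / (q - p)) *\<^sub>R ((LINT x|lborel. f q x) - (LINT x|lborel. f p x)))
   \<longlongrightarrow> (LINT x|lborel. f' p x)) (at p)"
  using e by (simp add: at_within_open[of p "ball p e"])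
 then show ?thesis unfolding quotient[symmetric] .
qed

lemma continuous_on_parameter_integral:
 fixes f :: "real \<Rightarrow> real \<Rightarrow> complex"
 assumes c: "\<And>x. continuous_on S (\<lambda>q. f q x)"
  and m: "\<And>q. q \<in> S \<Longrightarrow> f q \<in> borel_measurable lborel"
  and g: "integrable lborel g" and le: "\<And>q x. q \<in> S \<Longrightarrow> norm (f q x) \<le> g x"
 shows "continuous_on S (\<lambda>q. LINT x|lborel. f q x)"
 unfolding continuous_on_sequentially comp_def
proof (intro allI impI ballI)
 fix X a assume a: "a \<in> S" "(\<forall>n. X n \<in> S) \<and> X \<longlonglongrightarrow> a"
 show "(\<lambda>n. LINT x|lborel. f (X n) x) \<longlonglongrightarrow> (LINT x|lborel. f a x)"
 proof (rule integral_dominated_convergence[where w=g])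
  show "AE x in lborel. (\<lambda>n. f (X n) x) \<longlonglongrightarrow> f a x"
   using c a unfolding continuous_on_sequentially comp_def by auto
 qed (use a m g le in auto)
qed

section \<open>Fourier transforms of continuous, bounded, integrable functions\<close>

definition nice :: "(real \<Rightarrow> real) \<Rightarrow> bool" where
 "nice h \<longleftrightarrow> continuous_on UNIV h \<and> integrable lborel h \<and> bounded (range h)"

lemma nice_dominated:
 assumes "continuous_on UNIV h" "integrable_majorant g" "\<And>x. \<bar>h x\<bar> \<le> g x"
 shows "nice h"
proof -
 have "h \<in> borel_measurable borel" using assms(1) by (rule borel_measurable_continuous_onI)
 then have "integrable lborel h"
  using assms by (intro Bochner_Integration.integrable_bound[of lborel g h])
   (auto simp: integrable_majorant_def intro!: order_trans[OF assms(3)])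
 moreover obtain B where "\<And>x. norm (g x) \<le> B"
  using assms(2) unfolding integrable_majorant_def bounded_iff by auto
 then have "\<And>x. norm (h x) \<le> B" using assms(3)
  by (metis abs_ge_self order_trans real_norm_def)
 then have "bounded (range h)" unfolding bounded_iff by auto
 ultimately show ?thesis using assms(1) by (simp add: nice_def)
qed

lemma nice_majorant: "nice h \<Longrightarrow> integrable_majorant (\<lambda>x. \<bar>h x\<bar>)"
 unfolding nice_def integrable_majorant_def bounded_iff by auto

lemma nice_bound: assumes "nice h" obtains B where "B \<ge> 0" "\<And>x. \<bar>h x\<bar> \<le> B"
 using assms unfolding nice_def bounded_iff by (auto simp: image_iff) (meson abs_ge_zero order_trans)

lemma integrable_majorant_add:
 "integrable_majorant f \<Longrightarrow> integrable_majorant g \<Longrightarrow> integrable_majorant (\<lambda>x. f x + g x)"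
 unfolding integrable_majorant_def by (auto intro: bounded_plus_comp)

lemma integrable_majorant_cmult:
 "integrable_majorant f \<Longrightarrow> integrable_majorant (\<lambda>x. c * f x)"
 unfolding integrable_majorant_def
 by (auto dest: bounded_scaling[of _ c] simp: image_image)

lemma integrable_majorant_mult:
 assumes "integrable_majorant f" "integrable_majorant g"
 shows "integrable_majorant (\<lambda>x. f x * g x)"
proof -
 obtain A B where AB: "\<And>x. norm (f x) \<le> A" "\<And>x. norm (g x) \<le> B"
  using assms unfolding integrable_majorant_def bounded_iff by auto
 have le: "norm (f x * g x) \<le> A * norm (g x)" "norm (f x * g x) \<le> A * B" for x
  using AB[of x] by (auto simp: abs_mult intro: mult_mono mult_right_mono)
 have "integrable lborel (\<lambda>x. A * norm (g x))"
  using assms by (auto simp: integrable_majorant_def)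
 then have "integrable lborel (\<lambda>x. f x * g x)"
  using assms by (elim Bochner_Integration.integrable_bound)
   (use le(1) in \<open>auto simp: integrable_majorant_def intro: order_trans[OF _ abs_ge_self]\<close>)
 moreover have "bounded (range (\<lambda>x. f x * g x))"
  using le(2) unfolding bounded_iff by auto
 ultimately show ?thesis by (simp add: integrable_majorant_def)
qed

text \<open>
 Slices \<open>h p\<close> that depend continuously on a parameter and have a common majorant; this is the form
 in which the profiles enter, with \<open>\<eta>\<close> or \<open>\<tau>\<close> as the parameter.
\<close>

definition nice_family :: "real set \<Rightarrow> (real \<Rightarrow> real \<Rightarrow> real) \<Rightarrow> bool" where
 "nice_family S h \<longleftrightarrow> (\<forall>x. continuous_on S (\<lambda>p. h p x)) \<and> (\<forall>p\<in>S. continuous_on UNIV (h p)) \<and>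
  (\<exists>g. integrable_majorant g \<and> (\<forall>p\<in>S. \<forall>x. \<bar>h p x\<bar> \<le> g x))"

lemma nice_familyD: "nice_family S h \<Longrightarrow> p \<in> S \<Longrightarrow> nice (h p)"
 unfolding nice_family_def using nice_dominated by blast

lemma nice_family_const: "nice h \<Longrightarrow> nice_family S (\<lambda>p. h)"
 unfolding nice_family_def using nice_majorant[of h] by (auto simp: nice_def)

lemma nice_family_subset: "nice_family S h \<Longrightarrow> T \<subseteq> S \<Longrightarrow> nice_family T h"
 unfolding nice_family_def by (blast intro: continuous_on_subset)

lemma nice_family_add:
 assumes "nice_family S f" "nice_family S h"
 shows "nice_family S (\<lambda>p x. f p x + h p x)"
proof -
 obtain g1 g2 where "integrable_majorant g1" "\<forall>p\<in>S. \<forall>x. \<bar>f p x\<bar> \<le> g1 x"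
  "integrable_majorant g2" "\<forall>p\<in>S. \<forall>x. \<bar>h p x\<bar> \<le> g2 x"
  using assms unfolding nice_family_def by blast
 then have "integrable_majorant (\<lambda>x. g1 x + g2 x)" "\<forall>p\<in>S. \<forall>x. \<bar>f p x + h p x\<bar> \<le> g1 x + g2 x"
  by (auto intro!: integrable_majorant_add order_trans[OF abs_triangle_ineq] add_mono)
 then show ?thesis using assms unfolding nice_family_def
  by (intro conjI allI ballI exI[of _ "\<lambda>x. g1 x + g2 x"] continuous_on_add) auto
qed

lemma nice_family_mult:
 assumes "nice_family S f" "nice_family S h"
 shows "nice_family S (\<lambda>p x. f p x * h p x)"
proof -
 obtain g1 g2 where "integrable_majorant g1" "\<forall>p\<in>S. \<forall>x. \<bar>f p x\<bar> \<le> g1 x"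
  "integrable_majorant g2" "\<forall>p\<in>S. \<forall>x. \<bar>h p x\<bar> \<le> g2 x"
  using assms unfolding nice_family_def by blast
 then have "integrable_majorant (\<lambda>x. g1 x * g2 x)" "\<forall>p\<in>S. \<forall>x. \<bar>f p x * h p x\<bar> \<le> g1 x * g2 x"
  by (auto simp: abs_mult intro!: integrable_majorant_mult mult_mono intro: order_trans[OF abs_ge_zero])
 then show ?thesis using assms unfolding nice_family_def
  by (intro conjI allI ballI exI[of _ "\<lambda>x. g1 x * g2 x"] continuous_on_mult) auto
qed

lemma nice_family_cmult:
 assumes "nice_family S f"
 shows "nice_family S (\<lambda>p x. c * f p x)"
proof -
 obtain g where "integrable_majorant g" "\<forall>p\<in>S. \<forall>x. \<bar>f p x\<bar> \<le> g x"
  using assms unfolding nice_family_def by blast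
 then have "integrable_majorant (\<lambda>x. \<bar>c\<bar> * g x)" "\<forall>p\<in>S. \<forall>x. \<bar>c * f p x\<bar> \<le> \<bar>c\<bar> * g x"
  by (auto simp: abs_mult intro: integrable_majorant_cmult mult_left_mono)
 then show ?thesis using assms unfolding nice_family_def
  by (intro conjI allI ballI exI[of _ "\<lambda>x. \<bar>c\<bar> * g x"] continuous_on_mult) (auto intro: continuous_intros)
qed

lemma nice_family_uminus: "nice_family S f \<Longrightarrow> nice_family S (\<lambda>p x. - f p x)"
 using nice_family_cmult[of S f "-1"] by simp

lemma nice_family_diff:
 "nice_family S f \<Longrightarrow> nice_family S h \<Longrightarrow> nice_family S (\<lambda>p x. f p x - h p x)"
 using nice_family_add[of S f "\<lambda>p x. - h p x"] nice_family_uminus by simp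

lemma nice_family_divide: "nice_family S f \<Longrightarrow> nice_family S (\<lambda>p x. f p x / c)"
 using nice_family_cmult[of S f "1/c"] by simp

lemma nice_family_zero: "nice_family S (\<lambda>p x. 0)"
 unfolding nice_family_def by (auto intro!: exI[of _ "\<lambda>_. 0"] simp: integrable_majorant_def)

lemmas nice_family_intros = nice_family_add nice_family_diff nice_family_mult nice_family_cmult
 nice_family_uminus nice_family_divide nice_family_zero

lemma nice_iff_family: "nice h \<longleftrightarrow> nice_family {0} (\<lambda>p. h)"
 using nice_family_const nice_familyD by blast

lemma nice_add: "nice f \<Longrightarrow> nice h \<Longrightarrow> nice (\<lambda>x. f x + h x)"
 and nice_diff: "nice f \<Longrightarrow> nice h \<Longrightarrow> nice (\<lambda>x. f x - h x)"
 and nice_mult: "nice f \<Longrightarrow> nice h \<Longrightarrow> nice (\<lambda>x. f x * h x)"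
 and nice_cmult: "nice f \<Longrightarrow> nice (\<lambda>x. c * f x)"
 and nice_uminus: "nice f \<Longrightarrow> nice (\<lambda>x. - f x)"
 and nice_divide: "nice f \<Longrightarrow> nice (\<lambda>x. f x / c)"
 and nice_zero: "nice (\<lambda>x. 0)"
 unfolding nice_iff_family by (auto intro: nice_family_intros)

lemma nice_power2: "nice f \<Longrightarrow> nice (\<lambda>x. (f x)\<^sup>2)"
 by (simp add: power2_eq_square nice_mult)

lemmas nice_intros = nice_add nice_diff nice_mult nice_cmult nice_uminus nice_divide nice_zero nice_power2

lemma norm_exp_imaginary [simp]: "norm (exp (- (\<i> * complex_of_real k * complex_of_real x))) = 1"
 "norm (exp (\<i> * complex_of_real k * complex_of_real x)) = 1"
 by (simp_all add: norm_exp_eq_Re)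

lemma fourier_integrable:
 fixes f :: "real \<Rightarrow> real" and k :: real
 assumes "integrable lborel f"
 shows "integrable lborel (\<lambda>x. complex_of_real (f x) * exp (- (\<i> * k * x)))"
proof (rule Bochner_Integration.integrable_bound)
 show "integrable lborel f" by fact
 show "(\<lambda>x. complex_of_real (f x) * exp (- (\<i> * k * x))) \<in> borel_measurable lborel"
  using assms by measurable
qed (auto simp: norm_mult)

lemma fourier_add:
 "nice f \<Longrightarrow> nice h \<Longrightarrow> fourier (\<lambda>x. f x + h x) k = fourier f k + fourier h k"
 unfolding fourier_def nice_def using fourier_integrable[of f k] fourier_integrable[of h k]
 by (simp add: algebra_simps)

lemma fourier_cmult: "fourier (\<lambda>x. c * f x) k = of_real c * fourier f k"
 unfolding fourier_def by (simp add: mult.assoc)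

lemma fourier_uminus: "fourier (\<lambda>x. - f x) k = - fourier f k"
 using fourier_cmult[of "-1" f k] by simp

lemma fourier_diff:
 "nice f \<Longrightarrow> nice h \<Longrightarrow> fourier (\<lambda>x. f x - h x) k = fourier f k - fourier h k"
 using fourier_add[of f "\<lambda>x. - h x" k] by (simp add: fourier_uminus nice_uminus)

lemma fourier_divide: "fourier (\<lambda>x. f x / c) k = fourier f k / of_real c"
 using fourier_cmult[of "1/c" f k] by simp

lemma fourier_zero [simp]: "fourier (\<lambda>x. 0) k = 0"
 by (simp add: fourier_def)

lemmas fourier_linear = fourier_add fourier_diff fourier_cmult fourier_uminus fourier_divide

lemma fourier_cnj: "fourier f (- k) = cnj (fourier f k)"
proof -
 have "cnj (LINT x|lborel. complex_of_real (f x) * exp (- (\<i> * k * x))) =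
   (LINT x|lborel. complex_of_real (f x) * exp (- (\<i> * (- k) * x)))"
  by (subst Bochner_Integration.integral_cnj[symmetric], rule Bochner_Integration.integral_cong) (auto simp: exp_cnj)
 then show ?thesis unfolding fourier_def by simp
qed

lemma fourier_bound: "norm (fourier f k) \<le> (LINT x|lborel. \<bar>f x\<bar>) / (2 * pi)"
 unfolding fourier_def using integral_norm_bound[of lborel "\<lambda>x. complex_of_real (f x) * exp (- (\<i> * k * x))"]
 by (simp add: norm_mult norm_divide divide_right_mono)

lemma fourier_continuous: "nice f \<Longrightarrow> continuous_on UNIV (fourier f)"
 unfolding fourier_def
 by (intro continuous_intros continuous_on_parameter_integral[where g="\<lambda>x. \<bar>f x\<bar>"])
  (auto simp: nice_def norm_mult)

lemma nice_family_fourier_bound: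
 assumes "nice_family S h" shows "\<exists>M. \<forall>p\<in>S. \<forall>k. norm (fourier (h p) k) \<le> M"
proof -
 obtain g where g: "integrable_majorant g" "\<forall>p\<in>S. \<forall>x. \<bar>h p x\<bar> \<le> g x"
  using assms unfolding nice_family_def by blast
 have "norm (fourier (h p) k) \<le> (LINT x|lborel. g x) / (2 * pi)" if "p \<in> S" for p k
 proof -
  have "(LINT x|lborel. \<bar>h p x\<bar>) \<le> (LINT x|lborel. g x)"
   using g nice_familyD[OF assms that] that
   by (intro integral_mono) (auto simp: nice_def integrable_majorant_def)
  then show ?thesis
   using fourier_bound[of "h p" k] by (simp add: field_simps)
 qed
 then show ?thesis by blast
qed

lemma nice_family_fourier_continuous:
 assumes "nice_family S h" shows "continuous_on S (\<lambda>p. fourier (h p) k)"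
proof -
 obtain g where g: "integrable_majorant g" "\<forall>p\<in>S. \<forall>x. \<bar>h p x\<bar> \<le> g x"
  using assms unfolding nice_family_def by blast
 have c: "continuous_on S (\<lambda>p. h p x)" for x
  using assms by (simp add: nice_family_def)
 have "continuous_on S (\<lambda>p. LINT x|lborel. complex_of_real (h p x) * exp (- (\<i> * k * x)))"
 proof (rule continuous_on_parameter_integral)
  show "continuous_on S (\<lambda>p. complex_of_real (h p x) * exp (- (\<i> * k * x)))" for x
   by (intro continuous_intros c)
  show "(\<lambda>x. complex_of_real (h p x) * exp (- (\<i> * k * x))) \<in> borel_measurable lborel" if "p \<in> S" for p
   using nice_familyD[OF assms that] unfolding nice_def
   by (intro borel_measurable_integrable[OF fourier_integrable]) blast
  show "integrable lborel g" using g(1) by (simp add: integrable_majorant_def)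
  show "norm (complex_of_real (h p x) * exp (- (\<i> * k * x))) \<le> g x" if "p \<in> S" for p x
   using g(2) that by (simp add: norm_mult)
 qed
 then show ?thesis unfolding fourier_def by (intro continuous_intros)
qed

lemma nice_family_fourier_derivative:
 assumes S: "open S" "p \<in> S" and h: "nice_family S h" "nice_family S h'"
  and D: "\<And>q x. q \<in> S \<Longrightarrow> ((\<lambda>q. h q x) has_real_derivative h' q x) (at q)"
 shows "((\<lambda>q. fourier (h q) k) has_vector_derivative fourier (h' p) k) (at p)"
proof -
 obtain g where g: "integrable_majorant g" "\<forall>p\<in>S. \<forall>x. \<bar>h' p x\<bar> \<le> g x"
  using h(2) unfolding nice_family_def by blast
 have "((\<lambda>q. LINT x|lborel. complex_of_real (h q x) * exp (- (\<i> * k * x))) has_vector_derivative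
   (LINT x|lborel. complex_of_real (h' p x) * exp (- (\<i> * k * x)))) (at p)"
 proof (rule has_vector_derivative_parameter_integral[OF S])
  show "integrable lborel (\<lambda>x. complex_of_real (h q x) * exp (- (\<i> * k * x)))" if "q \<in> S" for q
   using nice_familyD[OF h(1) that] unfolding nice_def by (blast intro: fourier_integrable)
  show "((\<lambda>q. complex_of_real (h q x) * exp (- (\<i> * k * x))) has_vector_derivative
    complex_of_real (h' q x) * exp (- (\<i> * k * x))) (at q)" if "q \<in> S" for q x
   by (intro has_vector_derivative_mult_left has_vector_derivative_of_real D that)
  show "integrable lborel g" using g(1) by (simp add: integrable_majorant_def)
  show "norm (complex_of_real (h' q x) * exp (- (\<i> * k * x))) \<le> g x" if "q \<in> S" for q x
   using g(2) that by (simp add: norm_mult)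
 qed
 then show ?thesis
  unfolding fourier_def by (intro has_vector_derivative_mult_right)
qed

text \<open>
 A continuously differentiable function and its derivative being integrable, the derivative has
 integral \<open>0\<close>: integrate \<open>F (x + 1) - F x\<close> over the line.
\<close>

lemma integral_derivative_zero:
 fixes F F' :: "real \<Rightarrow> complex"
 assumes D: "\<And>x. (F has_vector_derivative F' x) (at x)" and c: "continuous_on UNIV F'"
  and F: "integrable lborel F" and F': "integrable lborel F'"
 shows "(LINT x|lborel. F' x) = 0"
proof -
 define f where "f = (\<lambda>x s. indicator {0..1::real} s *\<^sub>R F' (x + s))"
 have shift: "integrable lborel (\<lambda>x. G (x + s)) \<and> (LINT x|lborel. G (x + s)) = (LINT x|lborel. G x)"
  if "integrable lborel G" for s and G :: "real \<Rightarrow> complex"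
  using lborel_integrable_real_affine[OF that, of 1 s] lborel_integral_real_affine[of 1 G s]
  by (simp add: add.commute)
 have [measurable]: "F' \<in> borel_measurable borel" using c by (rule borel_measurable_continuous_onI)
 have [measurable]: "(\<lambda>(x,s). f x s) \<in> borel_measurable (lborel \<Otimes>\<^sub>M lborel)"
  unfolding f_def by measurable
 have int: "integrable (lborel \<Otimes>\<^sub>M lborel) (\<lambda>(s,x). f x s)"
 proof (rule lborel_pair.Fubini_integrable)
  have "(\<lambda>s. LINT x|lborel. norm (f x s)) = (\<lambda>s. indicator {0..1} s *\<^sub>R (LINT x|lborel. norm (F' x)))"
  proof
   fix s show "(LINT x|lborel. norm (f x s)) = indicator {0..1} s *\<^sub>R (LINT x|lborel. norm (F' x))"
    using lborel_integral_real_affine[of 1 "\<lambda>x. norm (F' x)" s]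
    by (auto simp: f_def add.commute split: split_indicator)
  qed
  then show "integrable lborel (\<lambda>x. LINT y|lborel. norm (case (x, y) of (s, x) \<Rightarrow> f x s))"
   by simp
  show "AE x in lborel. integrable lborel (\<lambda>y. case (x, y) of (s, x) \<Rightarrow> f x s)"
   using shift[OF F'] by (auto simp: f_def)
 qed measurable
 have "(LINT x|lborel. F (x + 1) - F x) = (LINT x|lborel. LINT s|lborel. f x s)"
 proof (rule Bochner_Integration.integral_cong)
  fix x
  have "((\<lambda>s. x + s) has_vector_derivative 1) (at s)" for s
   by (auto intro!: derivative_eq_intros)
  then have Dx: "((\<lambda>s. F (x + s)) has_vector_derivative F' (x + s)) (at s)" for s
   using vector_diff_chain_at[OF _ D, of "\<lambda>s. x + s" 1 s] by (simp add: o_def)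
  have "(LINT s|lborel. f x s) = F (x + 1) - F (x + 0)"
   unfolding f_def
   by (rule integral_FTC_atLeastAtMost)
    (auto intro!: continuous_on_compose2[OF c] continuous_intros has_vector_derivative_at_within Dx)
  then show "F (x + 1) - F x = (LINT s|lborel. f x s)" by simp
 qed simp
 also have "\<dots> = (LINT s|lborel. LINT x|lborel. f x s)"
  by (rule lborel_pair.Fubini_integral[of "\<lambda>s x. f x s"]) (fact int)
 also have "(\<lambda>s. LINT x|lborel. f x s) = (\<lambda>s. indicator {0..1::real} s *\<^sub>R (LINT x|lborel. F' x))"
  using shift[OF F'] by (auto simp: f_def)
 also have "(LINT s|lborel. indicator {0..1::real} s *\<^sub>R (LINT x|lborel. F' x)) =
   (LINT s|lborel. indicator {0..1::real} s) *\<^sub>R (LINT x|lborel. F' x)"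
  by (rule Bochner_Integration.integral_scaleR_left) simp
 also have "\<dots> = (LINT x|lborel. F' x)" by simp
 finally show ?thesis using shift[OF F, of 1] F by simp
qed

lemma fourier_derivative:
 assumes h: "nice h" "nice h'" and D: "\<And>x. (h has_real_derivative h' x) (at x)"
 shows "fourier h' k = \<i> * k * fourier h k"
proof -
 let ?e = "\<lambda>\<theta>. exp (- (\<i> * complex_of_real k * complex_of_real \<theta>))"
 have "((\<lambda>\<theta>. complex_of_real (h \<theta>) * ?e \<theta>) has_vector_derivative
   complex_of_real (h' x) * ?e x - \<i> * k * (complex_of_real (h x) * ?e x)) (at x)" for x
 proof -
  have "(?e has_vector_derivative (- (\<i> * k)) * ?e x) (at x)"
   by (rule has_vector_derivative_real_field) (auto intro!: derivative_eq_intros)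
  from has_vector_derivative_mult[OF has_vector_derivative_of_real[OF D[of x]] this]
  show ?thesis by (simp add: algebra_simps)
 qed
 moreover have "integrable lborel (\<lambda>\<theta>. complex_of_real (h \<theta>) * ?e \<theta>)" "integrable lborel (\<lambda>\<theta>. complex_of_real (h' \<theta>) * ?e \<theta>)"
  using h fourier_integrable by (auto simp: nice_def)
 ultimately have "(LINT \<theta>|lborel. complex_of_real (h' \<theta>) * ?e \<theta> - \<i> * k * (complex_of_real (h \<theta>) * ?e \<theta>)) = 0"
  using h by (intro integral_derivative_zero) (auto simp: nice_def intro!: continuous_intros)
 then show ?thesis
  using \<open>integrable lborel (\<lambda>\<theta>. complex_of_real (h \<theta>) * ?e \<theta>)\<close> \<open>integrable lborel (\<lambda>\<theta>. complex_of_real (h' \<theta>) * ?e \<theta>)\<close>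
  unfolding fourier_def by simp
qed

section \<open>Fourier inversion and products\<close>

lemma integral_line_eq_half_line:
 fixes f :: "real \<Rightarrow> complex"
 assumes f: "integrable lborel f"
 shows "(LINT k|lborel. f k) = (LBINT k:{0..}. f k) + (LBINT k:{0..}. f (- k))"
proof -
 have fm: "integrable lborel (\<lambda>k. f (- k))"
  using lborel_integrable_real_affine[OF f, of "-1" 0] by simp
 have "{0..} \<union> {..<0} = (UNIV :: real set)" by auto
 then have "(LINT k|lborel. f k) = (LBINT k:{0..} \<union> {..<0}. f k)"
  by (simp add: set_lebesgue_integral_def)
 also have "\<dots> = (LBINT k:{0..}. f k) + (LBINT k:{..<0}. f k)"
  using f by (intro set_integral_Un) (auto simp: set_integrable_def intro: integrable_mult_indicator)
 also have "(LBINT k:{..<0}. f k) = (LBINT k:{0<..}. f (- k))"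
  by (subst set_integral_reflect) (simp add: greaterThan_def)
 also have "\<dots> = (LBINT k:{0..}. f (- k))"
 proof (rule set_integral_cong_set)
  have m: "(\<lambda>k. f (- k)) \<in> borel_measurable lborel" using fm by simp
  show "set_borel_measurable lborel {0<..} (\<lambda>k. f (- k))" "set_borel_measurable lborel {0..} (\<lambda>k. f (- k))"
   using m unfolding set_borel_measurable_def by measurable
  show "AE x in lborel. (x \<in> {0..}) = (x \<in> {0::real<..})"
   by (rule AE_I[where N="{0}"]) auto
 qed
 finally show ?thesis .
qed

lemma integrable_exp_abs:
 assumes "c > (0::real)" shows "integrable lborel (\<lambda>k. exp (- (c * \<bar>k\<bar>)))"
proof -
 have i: "integrable lborel (\<lambda>k. indicator {0..} k * exp (- (c * k)))"
  using set_integrable_exp_atLeast[OF assms] by (simp add: set_integrable_def)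
 have "integrable lborel (\<lambda>k. indicator {0..} (-k) * exp (- (c * (-k))))"
  using lborel_integrable_real_affine[OF i, of "-1" 0] by simp
 then have "integrable lborel (\<lambda>k. indicator {0..} k * exp (- (c * k)) + indicator {0..} (-k) * exp (- (c * (-k))))"
  using i by (rule Bochner_Integration.integrable_add[rotated])
 then show ?thesis
  by (rule Bochner_Integration.integrable_bound) (auto split: split_indicator)
qed

lemma poisson_kernel_transform:
 assumes "c > (0::real)"
 shows "(LINT k|lborel. complex_of_real (exp (- (c * \<bar>k\<bar>))) * exp (\<i> * k * y)) = of_real (2 * c / (c\<^sup>2 + y\<^sup>2))"
proof -
 have half: "(LBINT k:{0..}. exp (\<i> * complex_of_real k * complex_of_real z) * complex_of_real (exp (- (c * k)))) = 1 / (c - \<i> * z)" for z :: real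
 proof -
  have nz: "c - \<i> * z \<noteq> 0" using assms by (auto simp: complex_eq_iff)
  have "exp (\<i> * complex_of_real 0 * complex_of_real z) =
   - (LBINT s:{0..}. (\<i> * z - c) * exp (\<i> * complex_of_real s * complex_of_real z) * complex_of_real (exp (- (c * s))))"
  proof (rule bounded_solution_initial_value[where M=1])
   show "continuous_on {0..} (\<lambda>a. exp (\<i> * complex_of_real a * complex_of_real z))"
    by (intro continuous_intros)
   show "((\<lambda>a. exp (\<i> * complex_of_real a * complex_of_real z)) has_vector_derivative
    complex_of_real c * exp (\<i> * complex_of_real s * complex_of_real z) +
    (\<i> * complex_of_real z - complex_of_real c) * exp (\<i> * complex_of_real s * complex_of_real z)) (at s)" for s
    by (rule has_vector_derivative_real_field) (auto intro!: derivative_eq_intros simp: algebra_simps)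
   show "halfline_source (\<lambda>a. (\<i> * complex_of_real z - complex_of_real c) * exp (\<i> * complex_of_real a * complex_of_real z))"
    unfolding halfline_source_def
    by (intro conjI continuous_intros exI[of _ "norm (\<i> * complex_of_real z - complex_of_real c)"]) (auto simp: norm_mult)
  qed (use assms in auto)
  then have "1 = (c - \<i> * z) * (LBINT s:{0..}. exp (\<i> * complex_of_real s * complex_of_real z) * complex_of_real (exp (- (c * s))))"
   unfolding mult.assoc set_integral_mult_right by (simp add: algebra_simps)
  then show ?thesis using nz by (simp add: field_simps)
 qed
 have int: "integrable lborel (\<lambda>k. complex_of_real (exp (- (c * \<bar>k\<bar>))) * exp (\<i> * k * y))"
  by (rule Bochner_Integration.integrable_bound[OF integrable_exp_abs[OF assms]])
   (auto simp: norm_mult intro!: borel_measurable_continuous_onI continuous_intros)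
 have 1: "(LBINT k:{0..}. complex_of_real (exp (- (c * \<bar>k\<bar>))) * exp (\<i> * k * y)) = 1 / (c - \<i> * y)"
  unfolding half[symmetric] by (rule set_lebesgue_integral_cong) auto
 have 2: "(LBINT k:{0..}. complex_of_real (exp (- (c * \<bar>- k\<bar>))) * exp (\<i> * complex_of_real (- k) * y)) = 1 / (c - \<i> * (- y))"
  using half[of "- y"] by (subst set_lebesgue_integral_cong[where g="\<lambda>k. exp (\<i> * complex_of_real k * complex_of_real (- y)) * complex_of_real (exp (- (c * k)))"]) auto
 have nz: "c - \<i> * y \<noteq> 0" "c + \<i> * y \<noteq> 0" using assms by (auto simp: complex_eq_iff)
 have "c\<^sup>2 + y\<^sup>2 > 0" using assms by (simp add: add_pos_nonneg)
 have prod: "(c - \<i> * y) * (c + \<i> * y) = of_real (c\<^sup>2 + y\<^sup>2)"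
  by (simp add: algebra_simps power2_eq_square)
 have "1 / (c - \<i> * y) + 1 / (c - \<i> * (- y)) = 2 * c / ((c - \<i> * y) * (c + \<i> * y))"
  using nz by (simp add: field_simps)
 then show ?thesis
  unfolding integral_line_eq_half_line[OF int] 1 2 unfolding prod by simp
qed

lemma integral_cauchy_density:
 "integrable lborel (\<lambda>u::real. 1 / (1 + u\<^sup>2))" "(LINT u|lborel. 1 / (1 + u\<^sup>2)) = pi"
 using integrable_inverse_1_plus_square LBINT_inverse_1_plus_square
 by (simp_all add: set_integrable_def interval_lebesgue_integral_def set_lebesgue_integral_def inverse_eq_divide)

text \<open>
 Abel summation: damping the inversion integral by \<open>exp (- e \<bar>k\<bar>)\<close> turns it into a convolution of
 \<open>h\<close> with the Poisson kernel, which tends to \<open>h\<close> as \<open>e \<rightarrow> 0\<close>.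
\<close>

theorem fourier_inversion:
 assumes h: "nice h" and int: "integrable lborel (fourier h)"
 shows "complex_of_real (h x) = (LINT k|lborel. fourier h k * exp (\<i> * k * x))"
proof -
 define e where "e = (\<lambda>n. 1 / real (Suc n))"
 have e0: "e n > 0" for n by (simp add: e_def)
 have elim: "e \<longlonglongrightarrow> 0" unfolding e_def by (rule LIMSEQ_Suc[OF lim_1_over_n])
 define A where "A = (\<lambda>n. LINT k|lborel. fourier h k * exp (\<i> * k * x) * complex_of_real (exp (- (e n * \<bar>k\<bar>))))"
 have [measurable]: "h \<in> borel_measurable borel" "fourier h \<in> borel_measurable borel"
  using h fourier_continuous[OF h] by (auto simp: nice_def intro: borel_measurable_continuous_onI)
 have hint: "integrable lborel h" using h by (simp add: nice_def)
 have lim1: "A \<longlonglongrightarrow> (LINT k|lborel. fourier h k * exp (\<i> * k * x))"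
  unfolding A_def
 proof (rule integral_dominated_convergence[where w="\<lambda>k. norm (fourier h k)"])
  show "AE k in lborel. (\<lambda>n. fourier h k * exp (\<i> * k * x) * complex_of_real (exp (- (e n * \<bar>k\<bar>)))) \<longlonglongrightarrow> fourier h k * exp (\<i> * k * x)"
  proof (rule AE_I2)
   fix k :: real
   have "(\<lambda>n. exp (- (e n * \<bar>k\<bar>))) \<longlonglongrightarrow> exp (- (0 * \<bar>k\<bar>))"
    by (intro tendsto_intros elim)
   then have "(\<lambda>n. fourier h k * exp (\<i> * k * x) * complex_of_real (exp (- (e n * \<bar>k\<bar>)))) \<longlonglongrightarrow>
     fourier h k * exp (\<i> * k * x) * complex_of_real (exp (- (0 * \<bar>k\<bar>)))"
    by (intro tendsto_mult tendsto_const tendsto_of_real)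
   then show "(\<lambda>n. fourier h k * exp (\<i> * k * x) * complex_of_real (exp (- (e n * \<bar>k\<bar>)))) \<longlonglongrightarrow> fourier h k * exp (\<i> * k * x)"
    by simp
  qed
  show "integrable lborel (\<lambda>k. norm (fourier h k))" using int by simp
  show "AE k in lborel. norm (fourier h k * exp (\<i> * k * x) * complex_of_real (exp (- (e n * \<bar>k\<bar>)))) \<le> norm (fourier h k)" for n
   using e0[of n] by (auto simp: norm_mult intro!: mult_left_le)
 qed measurable
 have A: "A n = (LINT u|lborel. complex_of_real (h (x - e n * u) * (1 / (pi * (1 + u\<^sup>2)))))" for n
 proof -
  define f where "f = (\<lambda>k \<theta>. complex_of_real (h \<theta>) * (1 / (2 * pi) * (complex_of_real (exp (- (e n * \<bar>k\<bar>))) * exp (\<i> * complex_of_real k * complex_of_real (x - \<theta>)))))"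
  have [measurable]: "(\<lambda>(k,\<theta>). f k \<theta>) \<in> borel_measurable (lborel \<Otimes>\<^sub>M lborel)"
   unfolding f_def by measurable
  have nf: "norm (f k \<theta>) = \<bar>h \<theta>\<bar> * (1 / (2 * pi) * exp (- (e n * \<bar>k\<bar>)))" for k \<theta>
   unfolding f_def norm_mult norm_exp_imaginary by (simp add: norm_divide)
  have i: "integrable lborel (\<lambda>\<theta>. f k \<theta>)" for k
   by (rule Bochner_Integration.integrable_bound[of _ "\<lambda>\<theta>. \<bar>h \<theta>\<bar> * (1 / (2 * pi) * exp (- (e n * \<bar>k\<bar>)))"])
    (use hint nf in \<open>auto simp: f_def\<close>)
  have "integrable lborel (\<lambda>k. LINT \<theta>|lborel. norm (f k \<theta>))"
   unfolding nf using integrable_exp_abs[OF e0[of n]] by simp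
  then have int2: "integrable (lborel \<Otimes>\<^sub>M lborel) (\<lambda>(k,\<theta>). f k \<theta>)"
   using i by (intro lborel_pair.Fubini_integrable) auto
  have "A n = (LINT k|lborel. LINT \<theta>|lborel. f k \<theta>)"
   unfolding A_def fourier_def
  proof (rule Bochner_Integration.integral_cong)
   fix k :: real
   have "complex_of_real (1 / (2 * pi)) * (LINT \<theta>|lborel. complex_of_real (h \<theta>) * exp (- (\<i> * k * \<theta>))) * exp (\<i> * k * x) * complex_of_real (exp (- (e n * \<bar>k\<bar>)))
    = (LINT \<theta>|lborel. complex_of_real (h \<theta>) * exp (- (\<i> * k * \<theta>))) * (complex_of_real (1 / (2 * pi)) * exp (\<i> * k * x) * complex_of_real (exp (- (e n * \<bar>k\<bar>))))"
    by (simp add: ac_simps)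
   also have "\<dots> = (LINT \<theta>|lborel. complex_of_real (h \<theta>) * exp (- (\<i> * k * \<theta>)) * (complex_of_real (1 / (2 * pi)) * exp (\<i> * k * x) * complex_of_real (exp (- (e n * \<bar>k\<bar>)))))"
    using fourier_integrable[OF hint, of k] by (intro Bochner_Integration.integral_mult_left[symmetric]) auto
   also have "\<dots> = (LINT \<theta>|lborel. f k \<theta>)"
   proof (rule Bochner_Integration.integral_cong)
    fix \<theta>
    have "exp (\<i> * complex_of_real k * complex_of_real (x - \<theta>)) = exp (- (\<i> * k * \<theta>)) * exp (\<i> * k * x)"
     by (simp add: exp_add[symmetric] algebra_simps)
    then show "complex_of_real (h \<theta>) * exp (- (\<i> * k * \<theta>)) * (complex_of_real (1 / (2 * pi)) * exp (\<i> * k * x) * complex_of_real (exp (- (e n * \<bar>k\<bar>)))) = f k \<theta>"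
     unfolding f_def by (simp only: ac_simps of_real_mult of_real_numeral of_real_divide of_real_1)
   qed simp
   finally show "complex_of_real (1 / (2 * pi)) * (LINT \<theta>|lborel. complex_of_real (h \<theta>) * exp (- (\<i> * k * \<theta>))) * exp (\<i> * k * x) * complex_of_real (exp (- (e n * \<bar>k\<bar>)))
    = (LINT \<theta>|lborel. f k \<theta>)" .
  qed simp
  also have "\<dots> = (LINT \<theta>|lborel. LINT k|lborel. f k \<theta>)"
   by (rule lborel_pair.Fubini_integral[symmetric, of "\<lambda>k \<theta>. f k \<theta>", OF int2])
  also have "\<dots> = (LINT \<theta>|lborel. complex_of_real (h \<theta> * (1 / (2 * pi) * (2 * e n / ((e n)\<^sup>2 + (x - \<theta>)\<^sup>2)))))"
   unfolding f_def integral_mult_right_zero poisson_kernel_transform[OF e0] by simp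
  also have "\<dots> = \<bar>- e n\<bar> *\<^sub>R (LINT u|lborel. complex_of_real (h (x + (- e n) * u) * (1 / (2 * pi) * (2 * e n / ((e n)\<^sup>2 + (x - (x + (- e n) * u))\<^sup>2)))))"
   using e0[of n] by (intro lborel_integral_real_affine) simp
  also have "\<dots> = (LINT u|lborel. \<bar>- e n\<bar> *\<^sub>R complex_of_real (h (x + (- e n) * u) * (1 / (2 * pi) * (2 * e n / ((e n)\<^sup>2 + (x - (x + (- e n) * u))\<^sup>2)))))"
   by (rule integral_scaleR_right[symmetric])
  also have "\<dots> = (LINT u|lborel. complex_of_real (h (x - e n * u) * (1 / (pi * (1 + u\<^sup>2)))))"
  proof (rule Bochner_Integration.integral_cong)
   fix u :: real
   have "1 + u\<^sup>2 > 0" by (simp add: add_pos_nonneg)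
   have aux: "a * (1 / (2 * pi) * (2 * a / (a\<^sup>2 * v))) = 1 / (pi * v)" if "a > 0" "v > 0" for a v :: real
    using that by (simp add: field_simps power2_eq_square)
   have sq: "(e n)\<^sup>2 + (x - (x + (- e n) * u))\<^sup>2 = (e n)\<^sup>2 * (1 + u\<^sup>2)"
    by (simp add: power2_eq_square algebra_simps)
   have "\<bar>- e n\<bar> = e n" using e0[of n] by simp
   then have "\<bar>- e n\<bar> * (1 / (2 * pi) * (2 * e n / ((e n)\<^sup>2 + (x - (x + (- e n) * u))\<^sup>2))) = 1 / (pi * (1 + u\<^sup>2))"
    unfolding sq by (simp only: aux[OF e0[of n] \<open>1 + u\<^sup>2 > 0\<close>])
   then have "\<bar>- e n\<bar> * (h (x + (- e n) * u) * (1 / (2 * pi) * (2 * e n / ((e n)\<^sup>2 + (x - (x + (- e n) * u))\<^sup>2)))) = h (x - e n * u) * (1 / (pi * (1 + u\<^sup>2)))"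
    unfolding mult.left_commute[of "\<bar>- e n\<bar>"] by (simp only: minus_mult_left[symmetric] diff_conv_add_uminus)
   then show "\<bar>- e n\<bar> *\<^sub>R complex_of_real (h (x + (- e n) * u) * (1 / (2 * pi) * (2 * e n / ((e n)\<^sup>2 + (x - (x + (- e n) * u))\<^sup>2)))) =
     complex_of_real (h (x - e n * u) * (1 / (pi * (1 + u\<^sup>2))))"
    unfolding scaleR_conv_of_real of_real_mult[symmetric] by simp
  qed simp
  finally show ?thesis .
 qed
 obtain B where B: "\<And>\<theta>. \<bar>h \<theta>\<bar> \<le> B" using nice_bound[OF h] by blast
 have "A \<longlonglongrightarrow> (LINT u|lborel. complex_of_real (h x * (1 / (pi * (1 + u\<^sup>2)))))"
  unfolding A
 proof (rule integral_dominated_convergence[where w="\<lambda>u. B / pi * (1 / (1 + u\<^sup>2))"])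
  have "isCont h x" using h by (simp add: nice_def continuous_on_eq_continuous_at)
  moreover have "(\<lambda>n. x - e n * u) \<longlonglongrightarrow> x" for u
   using tendsto_diff[OF tendsto_const tendsto_mult[OF elim tendsto_const[of u]], of x] by simp
  ultimately have "(\<lambda>n. h (x - e n * u)) \<longlonglongrightarrow> h x" for u
   by (rule isCont_tendsto_compose)
  then show "AE u in lborel. (\<lambda>n. complex_of_real (h (x - e n * u) * (1 / (pi * (1 + u\<^sup>2))))) \<longlonglongrightarrow> complex_of_real (h x * (1 / (pi * (1 + u\<^sup>2))))"
   by (intro AE_I2 tendsto_of_real tendsto_mult tendsto_const)
  show "integrable lborel (\<lambda>u. B / pi * (1 / (1 + u\<^sup>2)))"
   using integral_cauchy_density(1) by (rule integrable_mult_right)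
  show "AE u in lborel. norm (complex_of_real (h (x - e n * u) * (1 / (pi * (1 + u\<^sup>2))))) \<le> B / pi * (1 / (1 + u\<^sup>2))" for n
  proof (rule AE_I2)
   fix u :: real
   have "1 + u\<^sup>2 > 0" by (simp add: add_pos_nonneg)
   then show "norm (complex_of_real (h (x - e n * u) * (1 / (pi * (1 + u\<^sup>2))))) \<le> B / pi * (1 / (1 + u\<^sup>2))"
    using B[of "x - e n * u"] unfolding norm_of_real by (simp add: abs_mult abs_of_pos divide_right_mono)
  qed
 qed measurable
 moreover have "(LINT u|lborel. complex_of_real (h x * (1 / (pi * (1 + u\<^sup>2))))) = complex_of_real (h x)"
 proof -
  have "(LINT u|lborel. complex_of_real (h x * (1 / (pi * (1 + u\<^sup>2))))) = complex_of_real (LINT u|lborel. h x / pi * (1 / (1 + u\<^sup>2)))"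
   unfolding integral_complex_of_real by (simp add: field_simps)
  also have "(LINT u|lborel. h x / pi * (1 / (1 + u\<^sup>2))) = h x"
   unfolding integral_mult_right_zero integral_cauchy_density(2) by simp
  finally show ?thesis .
 qed
 ultimately have "A \<longlonglongrightarrow> complex_of_real (h x)" by simp
 then show ?thesis using lim1 LIMSEQ_unique by blast
qed

lemma AE_nonzero: "(\<And>k::real. k \<noteq> 0 \<Longrightarrow> P k) \<Longrightarrow> AE k in lborel. P k"
 by (rule AE_I[where N="{0}"]) auto

lemma fourier_measurable: "nice f \<Longrightarrow> fourier f \<in> borel_measurable lborel"
 using fourier_continuous[of f] by (simp add: borel_measurable_continuous_onI)

text \<open>
  A single wave number is negligible, so the equations at \<open>k \<noteq> 0\<close> already determine a profile.
\<close>

lemma fourier_injective: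
 assumes f: "nice f" and g: "nice g" and eq: "\<And>k. k \<noteq> 0 \<Longrightarrow> fourier f k = fourier g k"
 shows "f x = g x"
proof -
 let ?h = "\<lambda>x. f x - g x"
 have h: "nice ?h" using f g by (rule nice_diff)
 have ae: "AE k in lborel. fourier ?h k = 0"
  using eq f g by (intro AE_nonzero) (simp add: fourier_diff)
 have "integrable lborel (fourier ?h)"
  by (rule integrable_cong_AE_imp[of lborel "\<lambda>_. 0"]) (use ae fourier_measurable[OF h] in \<open>auto elim: eventually_mono\<close>)
 then have "complex_of_real (?h x) = (LINT k|lborel. fourier ?h k * exp (\<i> * k * x))"
  by (rule fourier_inversion[OF h])
 also have "\<dots> = 0"
  using ae by (intro integral_eq_zero_AE) (auto elim: eventually_mono)
 finally show ?thesis by simp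
qed

lemma fourier_product:
 assumes f: "nice f" and g: "nice g" and int: "integrable lborel (fourier g)"
 shows "fourier (\<lambda>x. f x * g x) k = (LINT l|lborel. fourier f (k - l) * fourier g l)"
proof -
 have [measurable]: "f \<in> borel_measurable borel" "fourier g \<in> borel_measurable borel"
  using f fourier_measurable[OF g] by (auto simp: nice_def intro: borel_measurable_continuous_onI)
 have fi: "integrable lborel f" using f by (simp add: nice_def)
 define F where "F = (\<lambda>x l. complex_of_real (f x) * (fourier g l * exp (\<i> * complex_of_real l * complex_of_real x) * exp (- (\<i> * complex_of_real k * complex_of_real x))))"
 have [measurable]: "(\<lambda>(x,l). F x l) \<in> borel_measurable (lborel \<Otimes>\<^sub>M lborel)"
  unfolding F_def by measurable
 have nF: "norm (F x l) = \<bar>f x\<bar> * norm (fourier g l)" for x l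
  unfolding F_def norm_mult norm_exp_imaginary by simp
 have gi: "integrable lborel (\<lambda>l. fourier g l * exp (\<i> * complex_of_real l * complex_of_real x))" for x
  by (rule Bochner_Integration.integrable_bound[OF int]) (auto simp: norm_mult)
 have "integrable lborel (\<lambda>l. F x l)" for x
  unfolding F_def by (intro integrable_mult_right integrable_mult_left gi)
 moreover have "integrable lborel (\<lambda>x. LINT l|lborel. norm (F x l))"
  unfolding nF using fi by simp
 ultimately have int2: "integrable (lborel \<Otimes>\<^sub>M lborel) (\<lambda>(x,l). F x l)"
  by (intro lborel_pair.Fubini_integrable) auto
 have "(LINT x|lborel. complex_of_real (f x * g x) * exp (- (\<i> * k * x))) = (LINT x|lborel. LINT l|lborel. F x l)"
 proof (rule Bochner_Integration.integral_cong)
  fix x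
  have "(LINT l|lborel. F x l) = complex_of_real (f x) * ((LINT l|lborel. fourier g l * exp (\<i> * complex_of_real l * complex_of_real x)) * exp (- (\<i> * complex_of_real k * complex_of_real x)))"
   unfolding F_def by (subst integral_mult_right_zero, subst integral_mult_left_zero) (rule refl)
  then show "complex_of_real (f x * g x) * exp (- (\<i> * k * x)) = (LINT l|lborel. F x l)"
   unfolding fourier_inversion[OF g int, symmetric] by simp
 qed simp
 also have "\<dots> = (LINT l|lborel. LINT x|lborel. F x l)"
  by (rule lborel_pair.Fubini_integral[symmetric, of "\<lambda>x l. F x l", OF int2])
 also have "\<dots> = (LINT l|lborel. 2 * pi * (fourier f (k - l) * fourier g l))"
 proof (rule Bochner_Integration.integral_cong)
  fix l
  have "(LINT x|lborel. F x l) = (LINT x|lborel. fourier g l * (complex_of_real (f x) * exp (- (\<i> * complex_of_real (k - l) * x))))"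
  proof (rule Bochner_Integration.integral_cong)
   fix x
   have "exp (\<i> * complex_of_real l * complex_of_real x) * exp (- (\<i> * complex_of_real k * complex_of_real x)) = exp (- (\<i> * complex_of_real (k - l) * x))"
    by (simp add: exp_add[symmetric] algebra_simps)
   then show "F x l = fourier g l * (complex_of_real (f x) * exp (- (\<i> * complex_of_real (k - l) * x)))"
    unfolding F_def by (metis (no_types, opaque_lifting) mult.assoc mult.commute)
  qed simp
  also have "\<dots> = 2 * pi * (fourier f (k - l) * fourier g l)"
   unfolding integral_mult_right_zero by (simp add: fourier_def)
  finally show "(LINT x|lborel. F x l) = 2 * pi * (fourier f (k - l) * fourier g l)" .
 qed simp
 also have "\<dots> = 2 * pi * (LINT l|lborel. fourier f (k - l) * fourier g l)"
  by simp
 finally show ?thesis unfolding fourier_def[of "\<lambda>x. f x * g x"] by simp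
qed

section \<open>Expansions in powers of the small parameter\<close>

text \<open>
  The residuals of the equations are polynomials in fields with such expansions, so that their
  coefficients are obtained by the sum and product rules below.
\<close>

definition exp3 :: "(real \<Rightarrow> real) \<Rightarrow> real \<Rightarrow> real \<Rightarrow> real \<Rightarrow> bool" where
 "exp3 X x0 x1 x2 \<longleftrightarrow> (\<lambda>e. X e - (x0 + x1 * e + x2 * e\<^sup>2)) \<in> O[at_right 0](\<lambda>e. e ^ 3)"

lemma exp3_const: "exp3 (\<lambda>e. c) c 0 0"
 by (simp add: exp3_def)

lemma exp3_param: "exp3 (\<lambda>e. e) 0 1 0"
 by (simp add: exp3_def)

lemma exp3_add: "exp3 X a b c \<Longrightarrow> exp3 Y a' b' c' \<Longrightarrow> exp3 (\<lambda>e. X e + Y e) (a + a') (b + b') (c + c')"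
 unfolding exp3_def by (drule (1) sum_in_bigo(1)) (simp add: algebra_simps)

lemma exp3_cmult: "exp3 X a b c \<Longrightarrow> exp3 (\<lambda>e. k * X e) (k * a) (k * b) (k * c)"
proof -
 assume "exp3 X a b c"
 then have "(\<lambda>e. k * (X e - (a + b * e + c * e\<^sup>2))) \<in> O[at_right 0](\<lambda>e. 1 * e ^ 3)"
  unfolding exp3_def by (intro landau_o.big.mult) auto
 then show ?thesis unfolding exp3_def by (simp add: algebra_simps)
qed

lemma exp3_uminus: "exp3 X a b c \<Longrightarrow> exp3 (\<lambda>e. - X e) (- a) (- b) (- c)"
 using exp3_cmult[of X a b c "-1"] by simp

lemma exp3_diff: "exp3 X a b c \<Longrightarrow> exp3 Y a' b' c' \<Longrightarrow> exp3 (\<lambda>e. X e - Y e) (a - a') (b - b') (c - c')"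
 using exp3_add[OF _ exp3_uminus, of X a b c Y a' b' c'] by simp

lemma exp3_divide: "exp3 X a b c \<Longrightarrow> exp3 (\<lambda>e. X e / k) (a / k) (b / k) (c / k)"
 using exp3_cmult[of X a b c "1/k"] by simp

lemma bounded_bigo_1:
 fixes f :: "real \<Rightarrow> real"
 assumes "(f \<longlongrightarrow> L) (at_right 0)" shows "f \<in> O[at_right 0](\<lambda>_. 1)"
 using assms by (intro bigoI_tendsto[of f _ L]) auto

lemma exp3_bigo_1: assumes "exp3 X a b c" shows "X \<in> O[at_right 0](\<lambda>_. 1)"
proof -
 have p: "(\<lambda>e::real. e ^ 3) \<in> O[at_right 0](\<lambda>_. 1)"
  by (rule bounded_bigo_1[where L="0^3"]) (intro tendsto_intros)
 have q: "(\<lambda>e::real. a + b * e + c * e\<^sup>2) \<in> O[at_right 0](\<lambda>_. 1)"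
  by (rule bounded_bigo_1[where L="a + b * 0 + c * 0\<^sup>2"]) (intro tendsto_intros)
 have "(\<lambda>e. (X e - (a + b * e + c * e\<^sup>2)) + (a + b * e + c * e\<^sup>2)) \<in> O[at_right 0](\<lambda>_. 1)"
  by (intro sum_in_bigo(1) q landau_o.big.trans[OF _ p]) (use assms in \<open>simp add: exp3_def\<close>)
 then show ?thesis by simp
qed

lemma exp3_mult:
 assumes X: "exp3 X a b c" and Y: "exp3 Y a' b' c'"
 shows "exp3 (\<lambda>e. X e * Y e) (a * a') (a * b' + b * a') (a * c' + b * b' + c * a')"
proof -
 have q: "(\<lambda>e::real. a + b * e + c * e\<^sup>2) \<in> O[at_right 0](\<lambda>_. 1)"
  by (rule bounded_bigo_1[where L="a + b * 0 + c * 0\<^sup>2"]) (intro tendsto_intros)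
 have r: "(\<lambda>e::real. b * c' + c * b' + c * c' * e) \<in> O[at_right 0](\<lambda>_. 1)"
  by (rule bounded_bigo_1[where L="b * c' + c * b' + c * c' * 0"]) (intro tendsto_intros)
 have 1: "(\<lambda>e. (X e - (a + b * e + c * e\<^sup>2)) * Y e) \<in> O[at_right 0](\<lambda>e. e ^ 3 * 1)"
  using X exp3_bigo_1[OF Y] unfolding exp3_def by (rule landau_o.big.mult)
 have 2: "(\<lambda>e. (a + b * e + c * e\<^sup>2) * (Y e - (a' + b' * e + c' * e\<^sup>2))) \<in> O[at_right 0](\<lambda>e. 1 * e ^ 3)"
  using q Y unfolding exp3_def by (rule landau_o.big.mult)
 have 3: "(\<lambda>e. e ^ 3 * (b * c' + c * b' + c * c' * e)) \<in> O[at_right 0](\<lambda>e. e ^ 3 * 1)"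
  by (intro landau_o.big.mult r) simp
 have "(\<lambda>e. (X e - (a + b * e + c * e\<^sup>2)) * Y e + (a + b * e + c * e\<^sup>2) * (Y e - (a' + b' * e + c' * e\<^sup>2)) +
   e ^ 3 * (b * c' + c * b' + c * c' * e)) \<in> O[at_right 0](\<lambda>e. e ^ 3)"
  using sum_in_bigo(1)[OF sum_in_bigo(1)] 1 2 3 by simp
 also have "(\<lambda>e. (X e - (a + b * e + c * e\<^sup>2)) * Y e + (a + b * e + c * e\<^sup>2) * (Y e - (a' + b' * e + c' * e\<^sup>2)) +
   e ^ 3 * (b * c' + c * b' + c * c' * e)) =
   (\<lambda>e. X e * Y e - (a * a' + (a * b' + b * a') * e + (a * c' + b * b' + c * a') * e\<^sup>2))"
  by (rule ext) algebra
 finally show ?thesis by (simp add: exp3_def)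
qed

lemma exp3_power2: "exp3 X a b c \<Longrightarrow> exp3 (\<lambda>e. (X e)\<^sup>2) (a * a) (a * b + b * a) (a * c + b * b + c * a)"
 unfolding power2_eq_square by (rule exp3_mult)

lemmas exp3_intros = exp3_add exp3_diff exp3_uminus exp3_mult exp3_power2 exp3_divide

lemma exp3_bound:
 assumes "\<forall>\<^sub>F e in at_right 0. \<bar>X e - (a + b * e + c * e\<^sup>2)\<bar> \<le> C * e ^ 3"
 shows "exp3 X a b c"
 unfolding exp3_def
proof (rule bigoI)
 show "\<forall>\<^sub>F e in at_right 0. norm (X e - (a + b * e + c * e\<^sup>2)) \<le> C * norm (e ^ 3)"
  using assms eventually_at_right_less[of "0::real"] by eventually_elim simp
qed

lemma exp3_zero_iff:
 assumes "exp3 X 0 a b"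
 shows "X \<in> O[at_right 0](\<lambda>e. e ^ 3) \<longleftrightarrow> a = 0 \<and> b = 0"
proof
 assume "X \<in> O[at_right 0](\<lambda>e. e ^ 3)"
 then have "(\<lambda>e. X e - (X e - (0 + a * e + b * e\<^sup>2))) \<in> O[at_right 0](\<lambda>e. e ^ 3)"
  using assms unfolding exp3_def by (rule sum_in_bigo(2))
 then obtain C where C: "\<forall>\<^sub>F e in at_right 0. norm (a * e + b * e\<^sup>2) \<le> C * norm (e ^ 3)"
  by (elim landau_o.bigE) simp
 have "\<forall>\<^sub>F e in at_right 0. \<bar>a + b * e\<bar> \<le> C * e\<^sup>2"
  using C eventually_at_right_less[of "0::real"]
 proof eventually_elim
  case (elim e)
  have "e * \<bar>a + b * e\<bar> = \<bar>a * e + b * e\<^sup>2\<bar>"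
   using elim abs_mult[of e "a + b * e"] by (simp add: power2_eq_square algebra_simps)
  also have "\<dots> \<le> e * (C * e\<^sup>2)" using elim by (simp add: power3_eq_cube power2_eq_square algebra_simps)
  finally show ?case using elim by simp
 qed
 moreover have "((\<lambda>e::real. \<bar>a + b * e\<bar>) \<longlongrightarrow> \<bar>a + b * 0\<bar>) (at_right 0)"
  "((\<lambda>e::real. C * e\<^sup>2) \<longlongrightarrow> C * 0\<^sup>2) (at_right 0)"
  by (intro tendsto_intros)+
 ultimately have "\<bar>a + b * 0\<bar> \<le> C * 0\<^sup>2"
  by (intro tendsto_le[of "at_right 0"]) auto
 then have a: "a = 0" by simp
 have "\<forall>\<^sub>F e in at_right 0. \<bar>b\<bar> \<le> C * e"
  using C eventually_at_right_less[of "0::real"]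
 proof eventually_elim
  case (elim e)
  have "e\<^sup>2 * \<bar>b\<bar> \<le> e\<^sup>2 * (C * e)" using elim a by (simp add: abs_mult power3_eq_cube power2_eq_square algebra_simps)
  then show ?case using elim by simp
 qed
 moreover have "((\<lambda>e::real. \<bar>b\<bar>) \<longlongrightarrow> \<bar>b\<bar>) (at_right 0)" "((\<lambda>e::real. C * e) \<longlongrightarrow> C * 0) (at_right 0)"
  by (intro tendsto_intros)+
 ultimately have "\<bar>b\<bar> \<le> C * 0"
  by (intro tendsto_le[of "at_right 0"]) auto
 then show "a = 0 \<and> b = 0" using a by simp
next
 assume "a = 0 \<and> b = 0"
 then show "X \<in> O[at_right 0](\<lambda>e. e ^ 3)" using assms by (simp add: exp3_def)
qed

section \<open>Derivatives of profiles and of fields read in physical variables\<close>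

lemma partial_derivatives_of_differentiable:
 fixes F :: "'a::real_normed_vector field"
 assumes "((\<lambda>(x, y, \<tau>). F x y \<tau>) has_derivative F') (at (x, y, \<tau>))"
 shows "((\<lambda>s. F s y \<tau>) has_vector_derivative pd1 F x y \<tau>) (at x)" (is ?thesis1)
  and "((\<lambda>s. F x s \<tau>) has_vector_derivative pd2 F x y \<tau>) (at y)" (is ?thesis2)
  and "((\<lambda>s. F x y s) has_vector_derivative pd3 F x y \<tau>) (at \<tau>)" (is ?thesis3)
  and "F' (a, b, c) = a *\<^sub>R pd1 F x y \<tau> + b *\<^sub>R pd2 F x y \<tau> + c *\<^sub>R pd3 F x y \<tau>" (is ?thesis4)
proof -
 interpret F': bounded_linear F' using assms by (rule has_derivative_bounded_linear)
 have 1: "((\<lambda>s. F s y \<tau>) has_vector_derivative F' (1, 0, 0)) (at x)"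
  unfolding has_vector_derivative_def
  by (rule has_derivative_eq_rhs[OF has_derivative_compose[of "\<lambda>s. (s, y, \<tau>)" "\<lambda>t. (t, 0, 0)", OF _ assms, simplified]])
   (auto intro!: derivative_eq_intros simp: zero_prod_def F'.scaleR[symmetric])
 have 2: "((\<lambda>s. F x s \<tau>) has_vector_derivative F' (0, 1, 0)) (at y)"
  unfolding has_vector_derivative_def
  by (rule has_derivative_eq_rhs[OF has_derivative_compose[of "\<lambda>s. (x, s, \<tau>)" "\<lambda>t. (0, t, 0)", OF _ assms, simplified]])
   (auto intro!: derivative_eq_intros simp: zero_prod_def F'.scaleR[symmetric])
 have 3: "((\<lambda>s. F x y s) has_vector_derivative F' (0, 0, 1)) (at \<tau>)"
  unfolding has_vector_derivative_def
  by (rule has_derivative_eq_rhs[OF has_derivative_compose[of "\<lambda>s. (x, y, s)" "\<lambda>t. (0, 0, t)", OF _ assms, simplified]])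
   (auto intro!: derivative_eq_intros simp: zero_prod_def F'.scaleR[symmetric])
 have e: "pd1 F x y \<tau> = F' (1, 0, 0)" "pd2 F x y \<tau> = F' (0, 1, 0)" "pd3 F x y \<tau> = F' (0, 0, 1)"
  using 1 2 3 by (simp_all add: pd1_def pd2_def pd3_def vector_derivative_at)
 show ?thesis1
  ?thesis2
  ?thesis3
  using 1 2 3 unfolding e by auto
 have "F' (a, b, c) = F' (a *\<^sub>R (1, 0, 0) + b *\<^sub>R (0, 1, 0) + c *\<^sub>R (0, 0, 1))" by simp
 then show ?thesis4
  unfolding F'.add F'.scaleR e .
qed

lemma lift_surface_derivatives:
 assumes "(\<lambda>(x, \<eta>, t). lift_surface \<phi> x \<eta> t) differentiable (at (x, \<eta>, t))"
 shows "((\<lambda>s. \<phi> s t) has_real_derivative pd1 (lift_surface \<phi>) x \<eta> t) (at x)" (is ?thesis1)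
  and "((\<lambda>s. \<phi> x s) has_real_derivative pd3 (lift_surface \<phi>) x \<eta> t) (at t)" (is ?thesis2)
  and "sd1 \<phi> x t = pd1 (lift_surface \<phi>) x \<eta> t" (is ?thesis3)
  and "sd2 \<phi> x t = pd3 (lift_surface \<phi>) x \<eta> t" (is ?thesis4)
proof -
 obtain F' where F': "((\<lambda>(x, \<eta>, t). lift_surface \<phi> x \<eta> t) has_derivative F') (at (x, \<eta>, t))"
  using assms unfolding differentiable_def by blast
 show 1: ?thesis1
  and 2: ?thesis2
  using partial_derivatives_of_differentiable(1,3)[of "lift_surface \<phi>", OF F']
  by (simp_all add: lift_surface_def has_real_derivative_iff_has_vector_derivative)
 show ?thesis3 ?thesis4
  using 1 2 by (auto simp: sd1_def sd2_def intro: DERIV_imp_deriv)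
qed

text \<open>
  The chain rule for the straightened front: a physical time derivative is \<open>- lam\<close> times the phase
  derivative plus \<open>\<epsilon>\<close> times the slow derivative, and the derivatives of the front are
  multiplied by the derivative across the interface.
\<close>

lemma physical_derivatives:
 fixes F :: "'a::real_normed_vector field" and \<phi> :: "real \<Rightarrow> surface" and \<theta> \<eta> \<tau> lam \<epsilon> :: real
 assumes eps: "\<epsilon> \<noteq> 0"
 defines "x \<equiv> \<theta> + lam * (\<tau> / \<epsilon>)" and "t \<equiv> \<tau> / \<epsilon>" and "y \<equiv> \<eta> + \<epsilon> * \<phi> \<epsilon> \<theta> \<tau>"
  and "s \<equiv> pd1 (lift_surface (\<phi> \<epsilon>)) \<theta> \<eta> \<tau>" and "r \<equiv> pd3 (lift_surface (\<phi> \<epsilon>)) \<theta> \<eta> \<tau>"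
 assumes \<phi>: "(\<lambda>(\<theta>, \<eta>, \<tau>). lift_surface (\<phi> \<epsilon>) \<theta> \<eta> \<tau>) differentiable (at (\<theta>, \<eta>, \<tau>))"
 shows "sd1 (front lam \<phi> \<epsilon>) x t = \<epsilon> * s" (is ?thesis1)
  and "sd2 (front lam \<phi> \<epsilon>) x t = \<epsilon> * (\<epsilon> * r) - lam * (\<epsilon> * s)" (is ?thesis2)
  and "physical lam \<phi> \<epsilon> F x y t = F \<theta> \<eta> \<tau>" (is ?thesis3)
  and "front lam \<phi> \<epsilon> x t = \<epsilon> * \<phi> \<epsilon> \<theta> \<tau>" (is ?thesis4)
  and "(\<lambda>(\<theta>, \<eta>, \<tau>). F \<theta> \<eta> \<tau>) differentiable (at (\<theta>, \<eta>, \<tau>)) \<Longrightarrow>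
   pd1 (physical lam \<phi> \<epsilon> F) x y t = pd1 F \<theta> \<eta> \<tau> - (\<epsilon> * s) *\<^sub>R pd2 F \<theta> \<eta> \<tau> \<and>
   pd2 (physical lam \<phi> \<epsilon> F) x y t = pd2 F \<theta> \<eta> \<tau> \<and>
   pd3 (physical lam \<phi> \<epsilon> F) x y t =
    \<epsilon> *\<^sub>R pd3 F \<theta> \<eta> \<tau> + (lam * (\<epsilon> * s) - \<epsilon> * (\<epsilon> * r)) *\<^sub>R pd2 F \<theta> \<eta> \<tau> - lam *\<^sub>R pd1 F \<theta> \<eta> \<tau>"
proof -
 have [simp]: "x - lam * t = \<theta>" "\<epsilon> * t = \<tau>" using eps by (simp_all add: x_def t_def)
 obtain P' where P': "((\<lambda>(\<theta>, \<eta>, \<tau>). lift_surface (\<phi> \<epsilon>) \<theta> \<eta> \<tau>) has_derivative P') (at (\<theta>, \<eta>, \<tau>))"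
  using \<phi> unfolding differentiable_def by blast
 have front: ?thesis4 by (simp add: front_def)
 then have y [simp]: "y - front lam \<phi> \<epsilon> x t = \<eta>" by (simp add: y_def)
 have f1: "((\<lambda>a. front lam \<phi> \<epsilon> a t) has_vector_derivative \<epsilon> * s) (at x)"
  unfolding has_vector_derivative_def
 proof (rule has_derivative_eq_rhs)
  have "((\<lambda>a. (a - lam * t, \<eta>, \<tau>)) has_derivative (\<lambda>h. (h, 0, 0))) (at x)"
   by (auto intro!: derivative_eq_intros simp: zero_prod_def)
  then have "((\<lambda>a. lift_surface (\<phi> \<epsilon>) (a - lam * t) \<eta> \<tau>) has_derivative (\<lambda>h. P' (h, 0, 0))) (at x)"
   using has_derivative_compose[of "\<lambda>a. (a - lam * t, \<eta>, \<tau>)" "\<lambda>h. (h, 0, 0)" x UNIV] P' by fastforce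
  from has_derivative_mult_right[OF this, of \<epsilon>]
  show "((\<lambda>a. front lam \<phi> \<epsilon> a t) has_derivative (\<lambda>h. \<epsilon> * P' (h, 0, 0))) (at x)"
   by (simp add: lift_surface_def front_def)
  show "(\<lambda>h. \<epsilon> * P' (h, 0, 0)) = (\<lambda>h. h *\<^sub>R (\<epsilon> * s))"
   by (auto simp: partial_derivatives_of_differentiable(4)[OF P'] s_def algebra_simps)
 qed
 have f3: "((\<lambda>a. front lam \<phi> \<epsilon> x a) has_vector_derivative \<epsilon> * (\<epsilon> * r) - lam * (\<epsilon> * s)) (at t)"
  unfolding has_vector_derivative_def
 proof (rule has_derivative_eq_rhs)
  have "((\<lambda>a. (x - lam * a, \<eta>, \<epsilon> * a)) has_derivative (\<lambda>h. (- lam * h, 0, \<epsilon> * h))) (at t)"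
   by (auto intro!: derivative_eq_intros simp: zero_prod_def)
  then have "((\<lambda>a. lift_surface (\<phi> \<epsilon>) (x - lam * a) \<eta> (\<epsilon> * a)) has_derivative (\<lambda>h. P' (- lam * h, 0, \<epsilon> * h))) (at t)"
   using has_derivative_compose[of "\<lambda>a. (x - lam * a, \<eta>, \<epsilon> * a)" "\<lambda>h. (- lam * h, 0, \<epsilon> * h)" t UNIV] P' by fastforce
  from has_derivative_mult_right[OF this, of \<epsilon>]
  show "((\<lambda>a. front lam \<phi> \<epsilon> x a) has_derivative (\<lambda>h. \<epsilon> * P' (- lam * h, 0, \<epsilon> * h))) (at t)"
   by (simp add: lift_surface_def front_def)
  show "(\<lambda>h. \<epsilon> * P' (- lam * h, 0, \<epsilon> * h)) = (\<lambda>h. h *\<^sub>R (\<epsilon> * (\<epsilon> * r) - lam * (\<epsilon> * s)))"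
   by (auto simp: partial_derivatives_of_differentiable(4)[OF P'] s_def r_def algebra_simps)
 qed
 show ?thesis1 ?thesis2
  using f1 f3 unfolding sd1_def sd2_def
  by (auto simp: has_real_derivative_iff_has_vector_derivative[symmetric] intro: DERIV_imp_deriv)
 show ?thesis3 by (simp add: physical_def)
 show ?thesis4 by fact
 assume "(\<lambda>(\<theta>, \<eta>, \<tau>). F \<theta> \<eta> \<tau>) differentiable (at (\<theta>, \<eta>, \<tau>))"
 then obtain F' where F': "((\<lambda>(\<theta>, \<eta>, \<tau>). F \<theta> \<eta> \<tau>) has_derivative F') (at (\<theta>, \<eta>, \<tau>))"
  unfolding differentiable_def by blast
 note lin = partial_derivatives_of_differentiable(4)[OF F']
 have "((\<lambda>a. physical lam \<phi> \<epsilon> F a y t) has_vector_derivative pd1 F \<theta> \<eta> \<tau> - (\<epsilon> * s) *\<^sub>R pd2 F \<theta> \<eta> \<tau>) (at x)"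
  unfolding has_vector_derivative_def
 proof (rule has_derivative_eq_rhs)
  have "((\<lambda>a. (a - lam * t, y - front lam \<phi> \<epsilon> a t, \<epsilon> * t)) has_derivative (\<lambda>h. (h, - (h * (\<epsilon> * s)), 0))) (at x)"
   using f1 unfolding has_vector_derivative_def by (auto intro!: derivative_eq_intros simp: zero_prod_def)
  then show "((\<lambda>a. physical lam \<phi> \<epsilon> F a y t) has_derivative (\<lambda>h. F' (h, - (h * (\<epsilon> * s)), 0))) (at x)"
   using has_derivative_compose[of "\<lambda>a. (a - lam * t, y - front lam \<phi> \<epsilon> a t, \<epsilon> * t)" _ x UNIV] F'
   unfolding physical_def by fastforce
 qed (auto simp: lin algebra_simps)
 moreover have "((\<lambda>a. physical lam \<phi> \<epsilon> F x a t) has_vector_derivative pd2 F \<theta> \<eta> \<tau>) (at y)"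
  unfolding has_vector_derivative_def
 proof (rule has_derivative_eq_rhs)
  have "((\<lambda>a. (x - lam * t, a - front lam \<phi> \<epsilon> x t, \<epsilon> * t)) has_derivative (\<lambda>h. (0, h, 0))) (at y)"
   by (auto intro!: derivative_eq_intros simp: zero_prod_def)
  then show "((\<lambda>a. physical lam \<phi> \<epsilon> F x a t) has_derivative (\<lambda>h. F' (0, h, 0))) (at y)"
   using has_derivative_compose[of "\<lambda>a. (x - lam * t, a - front lam \<phi> \<epsilon> x t, \<epsilon> * t)" _ y UNIV] F'
   unfolding physical_def by fastforce
 qed (auto simp: lin)
 moreover have "((\<lambda>a. physical lam \<phi> \<epsilon> F x y a) has_vector_derivative
   \<epsilon> *\<^sub>R pd3 F \<theta> \<eta> \<tau> + (lam * (\<epsilon> * s) - \<epsilon> * (\<epsilon> * r)) *\<^sub>R pd2 F \<theta> \<eta> \<tau> - lam *\<^sub>R pd1 F \<theta> \<eta> \<tau>) (at t)"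
  unfolding has_vector_derivative_def
 proof (rule has_derivative_eq_rhs)
  have "((\<lambda>a. (x - lam * a, y - front lam \<phi> \<epsilon> x a, \<epsilon> * a)) has_derivative
    (\<lambda>h. (- lam * h, - (h * (\<epsilon> * (\<epsilon> * r) - lam * (\<epsilon> * s))), \<epsilon> * h))) (at t)"
   using f3 unfolding has_vector_derivative_def by (auto intro!: derivative_eq_intros simp: zero_prod_def)
  then show "((\<lambda>a. physical lam \<phi> \<epsilon> F x y a) has_derivative
    (\<lambda>h. F' (- lam * h, - (h * (\<epsilon> * (\<epsilon> * r) - lam * (\<epsilon> * s))), \<epsilon> * h))) (at t)"
   using has_derivative_compose[of "\<lambda>a. (x - lam * a, y - front lam \<phi> \<epsilon> x a, \<epsilon> * a)" _ t UNIV] F'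
   unfolding physical_def by fastforce
 qed (auto simp: lin algebra_simps scaleR_diff_left scaleR_diff_right)
 ultimately show "pd1 (physical lam \<phi> \<epsilon> F) x y t = pd1 F \<theta> \<eta> \<tau> - (\<epsilon> * s) *\<^sub>R pd2 F \<theta> \<eta> \<tau> \<and>
   pd2 (physical lam \<phi> \<epsilon> F) x y t = pd2 F \<theta> \<eta> \<tau> \<and>
   pd3 (physical lam \<phi> \<epsilon> F) x y t =
    \<epsilon> *\<^sub>R pd3 F \<theta> \<eta> \<tau> + (lam * (\<epsilon> * s) - \<epsilon> * (\<epsilon> * r)) *\<^sub>R pd2 F \<theta> \<eta> \<tau> - lam *\<^sub>R pd1 F \<theta> \<eta> \<tau>"
  unfolding pd1_def[of "physical lam \<phi> \<epsilon> F"] pd2_def[of "physical lam \<phi> \<epsilon> F"] pd3_def[of "physical lam \<phi> \<epsilon> F"]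
  by (auto intro: vector_derivative_at)
qed

lemma profile_differentiable:
 assumes "profile S T f" "\<eta> \<in> S" "t \<in> {0<..<T}"
 shows "(\<lambda>(x, \<eta>, t). f x \<eta> t) differentiable (at (x, \<eta>, t))"
 using assms unfolding profile_def C1_on_def differentiable_def by fastforce

lemma profile_partial_derivatives:
 assumes "profile S T f" "y \<in> S" "t \<in> {0<..<T}"
 shows "((\<lambda>s. f s y t) has_vector_derivative pd1 f x y t) (at x)"
  and "((\<lambda>s. f x s t) has_vector_derivative pd2 f x y t) (at y)"
  and "((\<lambda>s. f x y s) has_vector_derivative pd3 f x y t) (at t)"
 using profile_differentiable[OF assms, of x] partial_derivatives_of_differentiable
 unfolding differentiable_def by blast+

lemma agree_at_point:
 assumes "agree_to_order n S T F G" "\<tau> \<in> {0<..<T}"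
 obtains C where "\<forall>\<^sub>F e in at_right 0. \<forall>y\<in>closure S. norm (F e x y \<tau> - G e x y \<tau>) \<le> C * e ^ n"
  and "\<forall>\<^sub>F e in at_right 0. \<forall>y\<in>S. (\<lambda>(x, y, \<tau>). F e x y \<tau>) differentiable (at (x, y, \<tau>)) \<and>
    norm (pd1 (F e) x y \<tau> - pd1 (G e) x y \<tau>) \<le> C * e ^ n \<and>
    norm (pd2 (F e) x y \<tau> - pd2 (G e) x y \<tau>) \<le> C * e ^ n \<and>
    norm (pd3 (F e) x y \<tau> - pd3 (G e) x y \<tau>) \<le> C * e ^ n"
proof -
 have "0 < \<tau>" "\<tau> < T" using assms(2) by auto
 with assms(1) obtain C where C: "\<forall>\<^sub>F e in at_right 0. \<forall>x. \<forall>\<tau>'\<in>{\<tau>..\<tau>}.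
   (\<forall>y\<in>closure S. norm (F e x y \<tau>' - G e x y \<tau>') \<le> C * e ^ n) \<and>
   (\<forall>y\<in>S.
    (\<lambda>(x, y, \<tau>). F e x y \<tau>) differentiable (at (x, y, \<tau>')) \<and>
    norm (pd1 (F e) x y \<tau>' - pd1 (G e) x y \<tau>') \<le> C * e ^ n \<and>
    norm (pd2 (F e) x y \<tau>' - pd2 (G e) x y \<tau>') \<le> C * e ^ n \<and>
    norm (pd3 (F e) x y \<tau>' - pd3 (G e) x y \<tau>') \<le> C * e ^ n)"
  unfolding agree_to_order_def by blast
 show thesis
  by (rule that[of C]; rule eventually_mono[OF C]) simp_all
qed

lemma exp3_component:
 fixes X :: "real \<Rightarrow> real^'n"
 assumes "\<forall>\<^sub>F e in at_right 0. norm (X e - (a + e *\<^sub>R b + e\<^sup>2 *\<^sub>R c)) \<le> C * e ^ 3"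
 shows "exp3 (\<lambda>e. X e $ j) (a $ j) (b $ j) (c $ j)"
proof (rule exp3_bound)
 show "\<forall>\<^sub>F e in at_right 0. \<bar>X e $ j - (a $ j + b $ j * e + c $ j * e\<^sup>2)\<bar> \<le> C * e ^ 3"
  using assms
 proof eventually_elim
  case (elim e)
  have "\<bar>(X e - (a + e *\<^sub>R b + e\<^sup>2 *\<^sub>R c)) $ j\<bar> \<le> norm (X e - (a + e *\<^sub>R b + e\<^sup>2 *\<^sub>R c))"
   by (rule component_le_norm_cart)
  then show ?case using elim by (simp add: mult.commute)
 qed
qed

lemma field_expansion:
 fixes F :: "real \<Rightarrow> (real^'n) field"
 assumes agree: "agree_to_order 3 S T F (\<lambda>e x y t. F0 + e *\<^sub>R F1 x y t + e\<^sup>2 *\<^sub>R F2 x y t)"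
  and t: "t \<in> {0<..<T}"
 shows "y \<in> closure S \<Longrightarrow> exp3 (\<lambda>e. F e x y t $ j) (F0 $ j) (F1 x y t $ j) (F2 x y t $ j)"
  and "y \<in> S \<Longrightarrow> \<forall>\<^sub>F e in at_right 0. (\<lambda>(x, y, t). F e x y t) differentiable (at (x, y, t))"
  and "profile S T F1 \<Longrightarrow> profile S T F2 \<Longrightarrow> y \<in> S \<Longrightarrow>
   exp3 (\<lambda>e. pd1 (F e) x y t $ j) 0 (pd1 F1 x y t $ j) (pd1 F2 x y t $ j)"
  and "profile S T F1 \<Longrightarrow> profile S T F2 \<Longrightarrow> y \<in> S \<Longrightarrow>
   exp3 (\<lambda>e. pd2 (F e) x y t $ j) 0 (pd2 F1 x y t $ j) (pd2 F2 x y t $ j)"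
  and "profile S T F1 \<Longrightarrow> profile S T F2 \<Longrightarrow> y \<in> S \<Longrightarrow>
   exp3 (\<lambda>e. pd3 (F e) x y t $ j) 0 (pd3 F1 x y t $ j) (pd3 F2 x y t $ j)"
proof -
 let ?G = "\<lambda>e x y t. F0 + e *\<^sub>R F1 x y t + e\<^sup>2 *\<^sub>R F2 x y t"
 obtain C where C: "\<forall>\<^sub>F e in at_right 0. \<forall>y\<in>closure S. norm (F e x y t - ?G e x y t) \<le> C * e ^ 3"
  "\<forall>\<^sub>F e in at_right 0. \<forall>y\<in>S. (\<lambda>(x, y, t). F e x y t) differentiable (at (x, y, t)) \<and>
    norm (pd1 (F e) x y t - pd1 (?G e) x y t) \<le> C * e ^ 3 \<and>
    norm (pd2 (F e) x y t - pd2 (?G e) x y t) \<le> C * e ^ 3 \<and>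
    norm (pd3 (F e) x y t - pd3 (?G e) x y t) \<le> C * e ^ 3"
  by (rule agree_at_point[OF agree t, of x])
 show "y \<in> closure S \<Longrightarrow> exp3 (\<lambda>e. F e x y t $ j) (F0 $ j) (F1 x y t $ j) (F2 x y t $ j)"
  by (rule exp3_component[where C=C], rule eventually_mono[OF C(1)]) simp
 show "y \<in> S \<Longrightarrow> \<forall>\<^sub>F e in at_right 0. (\<lambda>(x, y, t). F e x y t) differentiable (at (x, y, t))"
  by (rule eventually_mono[OF C(2)]) simp
 assume p: "profile S T F1" "profile S T F2" "y \<in> S"
 note d1 = profile_partial_derivatives[OF p(1,3) t, of x] and d2 = profile_partial_derivatives[OF p(2,3) t, of x]
 have "((\<lambda>s. ?G e s y t) has_vector_derivative e *\<^sub>R pd1 F1 x y t + e\<^sup>2 *\<^sub>R pd1 F2 x y t) (at x)" for e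
  using has_vector_derivative_add[OF has_vector_derivative_add[OF has_vector_derivative_const[of F0]
    bounded_linear.has_vector_derivative[OF bounded_linear_scaleR_right[of e] d1(1)]]
   bounded_linear.has_vector_derivative[OF bounded_linear_scaleR_right[of "e\<^sup>2"] d2(1)]] by simp
 then have g1: "pd1 (?G e) x y t = e *\<^sub>R pd1 F1 x y t + e\<^sup>2 *\<^sub>R pd1 F2 x y t" for e
  unfolding pd1_def[of "?G e"] by (rule vector_derivative_at)
 have "((\<lambda>s. ?G e x s t) has_vector_derivative e *\<^sub>R pd2 F1 x y t + e\<^sup>2 *\<^sub>R pd2 F2 x y t) (at y)" for e
  using has_vector_derivative_add[OF has_vector_derivative_add[OF has_vector_derivative_const[of F0]
    bounded_linear.has_vector_derivative[OF bounded_linear_scaleR_right[of e] d1(2)]]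
   bounded_linear.has_vector_derivative[OF bounded_linear_scaleR_right[of "e\<^sup>2"] d2(2)]] by simp
 then have g2: "pd2 (?G e) x y t = e *\<^sub>R pd2 F1 x y t + e\<^sup>2 *\<^sub>R pd2 F2 x y t" for e
  unfolding pd2_def[of "?G e"] by (rule vector_derivative_at)
 have "((\<lambda>s. ?G e x y s) has_vector_derivative e *\<^sub>R pd3 F1 x y t + e\<^sup>2 *\<^sub>R pd3 F2 x y t) (at t)" for e
  using has_vector_derivative_add[OF has_vector_derivative_add[OF has_vector_derivative_const[of F0]
    bounded_linear.has_vector_derivative[OF bounded_linear_scaleR_right[of e] d1(3)]]
   bounded_linear.has_vector_derivative[OF bounded_linear_scaleR_right[of "e\<^sup>2"] d2(3)]] by simp
 then have g3: "pd3 (?G e) x y t = e *\<^sub>R pd3 F1 x y t + e\<^sup>2 *\<^sub>R pd3 F2 x y t" for e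
  unfolding pd3_def[of "?G e"] by (rule vector_derivative_at)
 have e1: "\<forall>\<^sub>F e in at_right 0. norm (pd1 (F e) x y t -
   (0 + e *\<^sub>R pd1 F1 x y t + e\<^sup>2 *\<^sub>R pd1 F2 x y t)) \<le> C * e ^ 3"
  by (rule eventually_mono[OF C(2)], drule bspec[of _ _ y]) (use p(3) in \<open>simp_all add: g1\<close>)
 have e2: "\<forall>\<^sub>F e in at_right 0. norm (pd2 (F e) x y t -
   (0 + e *\<^sub>R pd2 F1 x y t + e\<^sup>2 *\<^sub>R pd2 F2 x y t)) \<le> C * e ^ 3"
  by (rule eventually_mono[OF C(2)], drule bspec[of _ _ y]) (use p(3) in \<open>simp_all add: g2\<close>)
 have e3: "\<forall>\<^sub>F e in at_right 0. norm (pd3 (F e) x y t -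
   (0 + e *\<^sub>R pd3 F1 x y t + e\<^sup>2 *\<^sub>R pd3 F2 x y t)) \<le> C * e ^ 3"
  by (rule eventually_mono[OF C(2)], drule bspec[of _ _ y]) (use p(3) in \<open>simp_all add: g3\<close>)
 show "exp3 (\<lambda>e. pd1 (F e) x y t $ j) 0 (pd1 F1 x y t $ j) (pd1 F2 x y t $ j)"
  using exp3_component[OF e1, of j] by simp
 show "exp3 (\<lambda>e. pd2 (F e) x y t $ j) 0 (pd2 F1 x y t $ j) (pd2 F2 x y t $ j)"
  using exp3_component[OF e2, of j] by simp
 show "exp3 (\<lambda>e. pd3 (F e) x y t $ j) 0 (pd3 F1 x y t $ j) (pd3 F2 x y t $ j)"
  using exp3_component[OF e3, of j] by simp
qed

lemma exp3_param_mult: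
 assumes "\<forall>\<^sub>F e in at_right 0. \<bar>X e - (a + e * b)\<bar> \<le> C * e\<^sup>2"
 shows "exp3 (\<lambda>e. e * X e) 0 a b"
proof (rule exp3_bound)
 show "\<forall>\<^sub>F e in at_right 0. \<bar>e * X e - (0 + a * e + b * e\<^sup>2)\<bar> \<le> C * e ^ 3"
  using assms eventually_at_right_less[of "0::real"]
 proof eventually_elim
  case (elim e)
  have "\<bar>e * X e - (0 + a * e + b * e\<^sup>2)\<bar> = e * \<bar>X e - (a + e * b)\<bar>"
   using elim abs_mult[of e "X e - (a + e * b)"] by (simp add: power2_eq_square algebra_simps)
  also have "\<dots> \<le> e * (C * e\<^sup>2)" using elim by (intro mult_left_mono) auto
  finally show ?case by (simp add: power2_eq_square power3_eq_cube ac_simps)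
 qed
qed

lemma surface_expansion:
 assumes agree: "agree_to_order 2 UNIV T (\<lambda>e. lift_surface (\<phi> e)) (\<lambda>e x y t. \<phi>1 x t + e * \<phi>2 x t)"
  and \<phi>1: "surface_profile T \<phi>1" and \<phi>2: "surface_profile T \<phi>2" and t: "t \<in> {0<..<T}"
 shows "\<forall>\<^sub>F e in at_right 0. (\<lambda>(x, y, t). lift_surface (\<phi> e) x y t) differentiable (at (x, y, t))" (is ?thesis1)
  and "exp3 (\<lambda>e. e * pd1 (lift_surface (\<phi> e)) x y t) 0 (sd1 \<phi>1 x t) (sd1 \<phi>2 x t)" (is ?thesis2)
  and "exp3 (\<lambda>e. e * (e * pd3 (lift_surface (\<phi> e)) x y t)) 0 0 (sd2 \<phi>1 x t)" (is ?thesis3)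
proof -
 let ?G = "\<lambda>e x y t. \<phi>1 x t + e * \<phi>2 x t"
 obtain C where C: "\<forall>\<^sub>F e in at_right 0. \<forall>y\<in>UNIV. (\<lambda>(x, y, t). lift_surface (\<phi> e) x y t) differentiable (at (x, y, t)) \<and>
    norm (pd1 (lift_surface (\<phi> e)) x y t - pd1 (?G e) x y t) \<le> C * e ^ 2 \<and>
    norm (pd2 (lift_surface (\<phi> e)) x y t - pd2 (?G e) x y t) \<le> C * e ^ 2 \<and>
    norm (pd3 (lift_surface (\<phi> e)) x y t - pd3 (?G e) x y t) \<le> C * e ^ 2"
  by (rule agree_at_point[OF agree t, of x])
 show ?thesis1
  by (rule eventually_mono[OF C]) simp
 note dif1 = profile_differentiable[OF \<phi>1[unfolded surface_profile_def] UNIV_I t, of x y]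
 note dif2 = profile_differentiable[OF \<phi>2[unfolded surface_profile_def] UNIV_I t, of x y]
 note l1 = lift_surface_derivatives[OF dif1] and l2 = lift_surface_derivatives[OF dif2]
 have "((\<lambda>s. ?G e s y t) has_real_derivative sd1 \<phi>1 x t + e * sd1 \<phi>2 x t) (at x)" for e
  using l1(1) l2(1) unfolding l1(3) l2(3) by (auto intro!: derivative_eq_intros)
 then have g1: "pd1 (?G e) x y t = sd1 \<phi>1 x t + e * sd1 \<phi>2 x t" for e
  unfolding pd1_def has_real_derivative_iff_has_vector_derivative by (rule vector_derivative_at)
 have "((\<lambda>s. ?G e x y s) has_real_derivative sd2 \<phi>1 x t + e * sd2 \<phi>2 x t) (at t)" for e
  using l1(2) l2(2) unfolding l1(4) l2(4) by (auto intro!: derivative_eq_intros)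
 then have g3: "pd3 (?G e) x y t = sd2 \<phi>1 x t + e * sd2 \<phi>2 x t" for e
  unfolding pd3_def has_real_derivative_iff_has_vector_derivative by (rule vector_derivative_at)
 show ?thesis2
  by (rule exp3_param_mult[where C=C], rule eventually_mono[OF C], drule bspec[of _ _ y]) (simp_all add: g1)
 have "exp3 (\<lambda>e. e * pd3 (lift_surface (\<phi> e)) x y t) 0 (sd2 \<phi>1 x t) (sd2 \<phi>2 x t)"
  by (rule exp3_param_mult[where C=C], rule eventually_mono[OF C], drule bspec[of _ _ y]) (simp_all add: g3)
 from exp3_mult[OF exp3_param this]
 show ?thesis3
  by simp
qed

section \<open>The equations at first and second order\<close>

text \<open>
 At both orders the same linear operators appear, with \<open>m = lam - v0\<close>; the source is zero at
 first order and quadratic in the first order terms at second order. The source of the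
 constraint \<open>div B = 0\<close> is kept apart because \<open>forcing\<close> has only five components.
\<close>

definition plasma_system :: "real \<Rightarrow> real \<Rightarrow> real \<Rightarrow> (real^5) field \<Rightarrow> (real^5) field \<Rightarrow> real field \<Rightarrow> bool" where
 "plasma_system m b T U p r \<longleftrightarrow> (\<forall>x. \<forall>\<tau>\<in>{0<..<T}. \<forall>y>0.
  (let X = pd1 U x y \<tau>; Y = pd2 U x y \<tau>; f = p x y \<tau> in
   X$5 - m * X$1 - b * X$3 + f$1 = 0 \<and> Y$5 - m * X$2 - b * X$4 + f$2 = 0 \<and>
   - m * X$3 - b * X$1 + f$3 = 0 \<and> - m * X$4 - b * X$2 + f$4 = 0 \<and>
   X$1 + Y$2 + f$5 = 0 \<and> X$3 + Y$4 + r x y \<tau> = 0))"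

definition vacuum_system :: "real \<Rightarrow> real \<Rightarrow> real \<Rightarrow> (real^3) field \<Rightarrow> (real^4) field \<Rightarrow> bool" where
 "vacuum_system \<nu> lam T V p \<longleftrightarrow> (\<forall>x. \<forall>t\<in>{0<..<T}. \<forall>y<0.
  (let X = pd1 V x y t; Y = pd2 V x y t; f = p x y t in
   Y$3 - \<nu> * lam * X$1 + f$1 = 0 \<and> - X$3 - \<nu> * lam * X$2 + f$2 = 0 \<and>
   Y$1 - X$2 - \<nu> * lam * X$3 + f$3 = 0 \<and> X$1 + Y$2 + f$4 = 0))"

definition jump_system ::
 "real \<Rightarrow> real \<Rightarrow> real \<Rightarrow> real \<Rightarrow> real \<Rightarrow> real \<Rightarrow> (real^5) field \<Rightarrow> (real^3) field \<Rightarrow> surface \<Rightarrow> (real \<Rightarrow> real \<Rightarrow> real^5) \<Rightarrow> bool" where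
 "jump_system \<nu> v0 B0 H0 lam T U V \<phi> j \<longleftrightarrow> (\<forall>x. \<forall>t\<in>{0<..<T}.
  (let u = U x 0 t; h = V x 0 t; s = sd1 \<phi> x t; f = j x t in
   (lam - v0) * s + u$2 = f$1 \<and> B0 * s - u$4 = f$2 \<and> H0 * s - h$2 = f$3 \<and>
   u$5 - H0 * h$1 = f$4 \<and> h$3 + \<nu> * lam * H0 * s = f$5))"

definition divergence_forcing :: "(real^5) field \<Rightarrow> surface \<Rightarrow> real field" where
 "divergence_forcing U1 \<phi>1 x y \<tau> = - (sd1 \<phi>1 x \<tau> * pd2 U1 x y \<tau> $ 3)"

definition vacuum_forcing :: "real \<Rightarrow> real \<Rightarrow> (real^3) field \<Rightarrow> surface \<Rightarrow> (real^4) field" where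
 "vacuum_forcing \<nu> lam V1 \<phi>1 x y \<tau> =
  (let Y = pd2 V1 x y \<tau>; D = pd3 V1 x y \<tau>; s = sd1 \<phi>1 x \<tau> in vector
   [\<nu> * (D$1 + lam * s * Y$1), \<nu> * (D$2 + lam * s * Y$2) + s * Y$3,
   \<nu> * (D$3 + lam * s * Y$3) + s * Y$2, - (s * Y$1)])"

definition jump_forcing :: "real \<Rightarrow> real \<Rightarrow> real \<Rightarrow> (real^5) field \<Rightarrow> (real^3) field \<Rightarrow> surface \<Rightarrow> real \<Rightarrow> real \<Rightarrow> real^5" where
 "jump_forcing \<nu> H0 lam U1 V1 \<phi>1 x \<tau> =
  (let u = U1 x 0 \<tau>; h = V1 x 0 \<tau>; s = sd1 \<phi>1 x \<tau>; r = sd2 \<phi>1 x \<tau> in vector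
   [r + u$1 * s, - (u$3 * s), - (h$1 * s), ((h$1)\<^sup>2 + (h$2)\<^sup>2 - (h$3)\<^sup>2) / 2,
   - (\<nu> * lam * h$1 * s) + \<nu> * H0 * r])"

lemma vector_3_4 [simp]:
 "(vector [a, b, c] :: 'a::zero^3) $ 1 = a" "(vector [a, b, c] :: 'a::zero^3) $ 2 = b"
 "(vector [a, b, c] :: 'a::zero^3) $ 3 = c"
 "(vector [a, b, c, d] :: 'a::zero^4) $ 1 = a" "(vector [a, b, c, d] :: 'a::zero^4) $ 2 = b"
 "(vector [a, b, c, d] :: 'a::zero^4) $ 3 = c" "(vector [a, b, c, d] :: 'a::zero^4) $ 4 = d"
 unfolding vector_def by simp_all

lemma all_less_6: "(\<forall>i<6. P i) \<longleftrightarrow> P 0 \<and> P 1 \<and> P 2 \<and> P 3 \<and> P 4 \<and> P (5::nat)"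
 and all_less_5: "(\<forall>i<5. P i) \<longleftrightarrow> P 0 \<and> P 1 \<and> P 2 \<and> P 3 \<and> P (4::nat)"
 and all_less_4: "(\<forall>i<4. P i) \<longleftrightarrow> P 0 \<and> P 1 \<and> P 2 \<and> P (3::nat)"
 by (simp_all add: eval_nat_numeral All_less_Suc conj_ac)

lemma residual_bigo_iff:
 assumes "\<forall>\<^sub>F e in at_right 0. X e = Y e" "exp3 Y c0 a b" "c0 = 0"
 shows "X \<in> O[at_right 0](\<lambda>e. e ^ 3) \<longleftrightarrow> a = 0 \<and> b = 0"
 using exp3_zero_iff[of Y a b] assms landau_o.big.in_cong[OF assms(1)] by simp

text \<open>
  The constant states make the constant coefficient of every residual vanish. The coefficient of \<open>\<epsilon>\<close> is the
  linearized operator; the coefficient of \<open>\<epsilon>\<^sup>2\<close> is the same operator on the second order profiles plus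
  the products of first order quantities, among them those produced by the moving front.
\<close>

lemma solves_to_second_order_iff:
 assumes exp: "has_expansion v0 B0 H0 T U V \<phi> U1 V1 \<phi>1 U2 V2 \<phi>2"
  and U: "plasma_profile T U1" "plasma_profile T U2" and V: "vacuum_profile T V1" "vacuum_profile T V2"
  and S: "surface_profile T \<phi>1" "surface_profile T \<phi>2"
 shows "solves_to_second_order \<nu> lam T U V \<phi> \<longleftrightarrow>
  (plasma_system (lam - v0) B0 T U1 (\<lambda>_ _ _. 0) (\<lambda>_ _ _. 0) \<and> vacuum_system \<nu> lam T V1 (\<lambda>_ _ _. 0) \<and>
  jump_system \<nu> v0 B0 H0 lam T U1 V1 \<phi>1 (\<lambda>_ _. 0)) \<and>
  (plasma_system (lam - v0) B0 T U2 (forcing v0 B0 lam U1 \<phi>1) (divergence_forcing U1 \<phi>1) \<and>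
  vacuum_system \<nu> lam T V2 (vacuum_forcing \<nu> lam V1 \<phi>1) \<and>
  jump_system \<nu> v0 B0 H0 lam T U2 V2 \<phi>2 (jump_forcing \<nu> H0 lam U1 V1 \<phi>1))"
proof -
 have aU: "agree_to_order 3 {0<..} T U (\<lambda>\<epsilon> \<theta> \<eta> \<tau>. U_base v0 B0 H0 + \<epsilon> *\<^sub>R U1 \<theta> \<eta> \<tau> + \<epsilon>\<^sup>2 *\<^sub>R U2 \<theta> \<eta> \<tau>)"
  and aV: "agree_to_order 3 {..<0} T V (\<lambda>\<epsilon> \<theta> \<eta> \<tau>. V_base H0 + \<epsilon> *\<^sub>R V1 \<theta> \<eta> \<tau> + \<epsilon>\<^sup>2 *\<^sub>R V2 \<theta> \<eta> \<tau>)"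
  and a\<phi>: "agree_to_order 2 UNIV T (\<lambda>\<epsilon>. lift_surface (\<phi> \<epsilon>)) (\<lambda>\<epsilon> \<theta> \<eta> \<tau>. \<phi>1 \<theta> \<tau> + \<epsilon> * \<phi>2 \<theta> \<tau>)"
  using exp by (simp_all add: has_expansion_def)
 have pU: "profile {0<..} T U1" "profile {0<..} T U2" and pV: "profile {..<0} T V1" "profile {..<0} T V2"
  using U V by (simp_all add: plasma_profile_def vacuum_profile_def)
 have pos: "\<forall>\<^sub>F \<epsilon>::real in at_right 0. \<epsilon> \<noteq> 0"
  using eventually_at_right_less[of "0::real"] by eventually_elim simp
 define PA where "PA = (\<lambda>\<theta> \<tau> \<eta>.
   (let X = pd1 U1 \<theta> \<eta> \<tau>; Y = pd2 U1 \<theta> \<eta> \<tau>; m = lam - v0; b = B0 in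
   X$5 - m * X$1 - b * X$3 = 0 \<and> Y$5 - m * X$2 - b * X$4 = 0 \<and>
   - m * X$3 - b * X$1 = 0 \<and> - m * X$4 - b * X$2 = 0 \<and>
   X$1 + Y$2 = 0 \<and> X$3 + Y$4 = 0))"
 define PB where "PB = (\<lambda>\<theta> \<tau> \<eta>.
   (let X = pd1 U2 \<theta> \<eta> \<tau>; Y = pd2 U2 \<theta> \<eta> \<tau>; m = lam - v0; b = B0; f = forcing v0 B0 lam U1 \<phi>1 \<theta> \<eta> \<tau> in
   X$5 - m * X$1 - b * X$3 + f$1 = 0 \<and> Y$5 - m * X$2 - b * X$4 + f$2 = 0 \<and>
   - m * X$3 - b * X$1 + f$3 = 0 \<and> - m * X$4 - b * X$2 + f$4 = 0 \<and>
   X$1 + Y$2 + f$5 = 0 \<and> X$3 + Y$4 + divergence_forcing U1 \<phi>1 \<theta> \<eta> \<tau> = 0))"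
 define VA where "VA = (\<lambda>\<theta> \<tau> \<eta>.
   (let X = pd1 V1 \<theta> \<eta> \<tau>; Y = pd2 V1 \<theta> \<eta> \<tau> in
   Y$3 - \<nu> * lam * X$1 = 0 \<and> - X$3 - \<nu> * lam * X$2 = 0 \<and>
   Y$1 - X$2 - \<nu> * lam * X$3 = 0 \<and> X$1 + Y$2 = 0))"
 define VB where "VB = (\<lambda>\<theta> \<tau> \<eta>.
   (let X = pd1 V2 \<theta> \<eta> \<tau>; Y = pd2 V2 \<theta> \<eta> \<tau>; f = vacuum_forcing \<nu> lam V1 \<phi>1 \<theta> \<eta> \<tau> in
   Y$3 - \<nu> * lam * X$1 + f$1 = 0 \<and> - X$3 - \<nu> * lam * X$2 + f$2 = 0 \<and>
   Y$1 - X$2 - \<nu> * lam * X$3 + f$3 = 0 \<and> X$1 + Y$2 + f$4 = 0))"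
 define JA where "JA = (\<lambda>\<theta> \<tau>.
   (let u = U1 \<theta> 0 \<tau>; h = V1 \<theta> 0 \<tau>; s = sd1 \<phi>1 \<theta> \<tau> in
   (lam - v0) * s + u$2 = 0 \<and> B0 * s - u$4 = 0 \<and> H0 * s - h$2 = 0 \<and>
   u$5 - H0 * h$1 = 0 \<and> h$3 + \<nu> * lam * H0 * s = 0))"
 define JB where "JB = (\<lambda>\<theta> \<tau>.
   (let u = U2 \<theta> 0 \<tau>; h = V2 \<theta> 0 \<tau>; s = sd1 \<phi>2 \<theta> \<tau>; f = jump_forcing \<nu> H0 lam U1 V1 \<phi>1 \<theta> \<tau> in
   (lam - v0) * s + u$2 = f$1 \<and> B0 * s - u$4 = f$2 \<and> H0 * s - h$2 = f$3 \<and>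
   u$5 - H0 * h$1 = f$4 \<and> h$3 + \<nu> * lam * H0 * s = f$5))"
 have plasma: "(\<forall>i<6. (\<lambda>\<epsilon>. plasma_residual (physical lam \<phi> \<epsilon> (U \<epsilon>))
     (\<theta> + lam * (\<tau> / \<epsilon>)) (\<eta> + \<epsilon> * \<phi> \<epsilon> \<theta> \<tau>) (\<tau> / \<epsilon>) ! i) \<in> O[at_right 0](\<lambda>\<epsilon>. \<epsilon> ^ 3)) \<longleftrightarrow>
   PA \<theta> \<tau> \<eta> \<and>
   PB \<theta> \<tau> \<eta>"
  if \<tau>: "\<tau> \<in> {0<..<T}" and \<eta>: "\<eta> > 0" for \<theta> \<tau> \<eta>
 proof -
  define u where "u = (\<lambda>j \<epsilon>. U \<epsilon> \<theta> \<eta> \<tau> $ j)"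
  define X where "X = (\<lambda>j \<epsilon>. pd1 (U \<epsilon>) \<theta> \<eta> \<tau> $ j)"
  define Y where "Y = (\<lambda>j \<epsilon>. pd2 (U \<epsilon>) \<theta> \<eta> \<tau> $ j)"
  define D where "D = (\<lambda>j \<epsilon>. pd3 (U \<epsilon>) \<theta> \<eta> \<tau> $ j)"
  define s where "s = (\<lambda>\<epsilon>. \<epsilon> * pd1 (lift_surface (\<phi> \<epsilon>)) \<theta> \<eta> \<tau>)"
  define r where "r = (\<lambda>\<epsilon>. \<epsilon> * (\<epsilon> * pd3 (lift_surface (\<phi> \<epsilon>)) \<theta> \<eta> \<tau>))"
  have u: "exp3 (u j) (U_base v0 B0 H0 $ j) (U1 \<theta> \<eta> \<tau> $ j) (U2 \<theta> \<eta> \<tau> $ j)" for j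
   unfolding u_def by (rule field_expansion(1)[OF aU \<tau>]) (use \<eta> in simp)
  have X: "exp3 (X j) 0 (pd1 U1 \<theta> \<eta> \<tau> $ j) (pd1 U2 \<theta> \<eta> \<tau> $ j)"
   and Y: "exp3 (Y j) 0 (pd2 U1 \<theta> \<eta> \<tau> $ j) (pd2 U2 \<theta> \<eta> \<tau> $ j)"
   and D: "exp3 (D j) 0 (pd3 U1 \<theta> \<eta> \<tau> $ j) (pd3 U2 \<theta> \<eta> \<tau> $ j)" for j
   unfolding X_def Y_def D_def using \<eta> by (auto intro!: field_expansion(3,4,5)[OF aU \<tau> pU])
  have s: "exp3 s 0 (sd1 \<phi>1 \<theta> \<tau>) (sd1 \<phi>2 \<theta> \<tau>)" and r: "exp3 r 0 0 (sd2 \<phi>1 \<theta> \<tau>)"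
   unfolding s_def r_def by (rule surface_expansion[OF a\<phi> S \<tau>])+
  note base = u X Y D s r
  have ev: "\<forall>\<^sub>F \<epsilon> in at_right 0. plasma_residual (physical lam \<phi> \<epsilon> (U \<epsilon>))
     (\<theta> + lam * (\<tau> / \<epsilon>)) (\<eta> + \<epsilon> * \<phi> \<epsilon> \<theta> \<tau>) (\<tau> / \<epsilon>) =
   (let D' = (\<lambda>j. \<epsilon> * D j \<epsilon> + (lam * s \<epsilon> - r \<epsilon>) * Y j \<epsilon> - lam * X j \<epsilon>); X' = (\<lambda>j. X j \<epsilon> - s \<epsilon> * Y j \<epsilon>) in
   [D' 1 + (u 1 \<epsilon> * X' 1 + u 2 \<epsilon> * Y 1 \<epsilon>) - (u 3 \<epsilon> * X' 3 + u 4 \<epsilon> * Y 3 \<epsilon>) + X' 5,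
   D' 2 + (u 1 \<epsilon> * X' 2 + u 2 \<epsilon> * Y 2 \<epsilon>) - (u 3 \<epsilon> * X' 4 + u 4 \<epsilon> * Y 4 \<epsilon>) + Y 5 \<epsilon>,
   D' 3 + (u 1 \<epsilon> * X' 3 + u 2 \<epsilon> * Y 3 \<epsilon>) - (u 3 \<epsilon> * X' 1 + u 4 \<epsilon> * Y 1 \<epsilon>),
   D' 4 + (u 1 \<epsilon> * X' 4 + u 2 \<epsilon> * Y 4 \<epsilon>) - (u 3 \<epsilon> * X' 2 + u 4 \<epsilon> * Y 2 \<epsilon>),
   X' 1 + Y 2 \<epsilon>, X' 3 + Y 4 \<epsilon>])"
   using pos surface_expansion(1)[OF a\<phi> S \<tau>, of \<theta> \<eta>] field_expansion(2)[OF aU \<tau>, of \<eta> \<theta>, simplified, OF \<eta>]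
  proof eventually_elim
   case (elim \<epsilon>)
   show ?case
    unfolding plasma_residual_def Let_def physical_derivatives(3)[where \<phi>=\<phi> and \<theta>=\<theta> and \<eta>=\<eta> and \<tau>=\<tau> and \<epsilon>=\<epsilon> and F="U \<epsilon>" and lam=lam, OF elim(1,2)]
    using physical_derivatives(5)[where \<phi>=\<phi> and \<theta>=\<theta> and \<eta>=\<eta> and \<tau>=\<tau> and \<epsilon>=\<epsilon> and F="U \<epsilon>" and lam=lam, OF elim(1,2,3)]
    by (simp add: u_def X_def Y_def D_def s_def r_def)
  qed
  note iff = residual_bigo_iff[OF eventually_mono[OF ev]]
  show ?thesis
   unfolding all_less_6
  proof (subst iff, (simp add: Let_def; fail), (rule base exp3_const exp3_param exp3_intros)+, (simp add: U_base_def; fail))+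
  qed (auto simp: PA_def PB_def Let_def forcing_def divergence_forcing_def U_base_def algebra_simps)
 qed
 have vacuum: "(\<forall>i<4. (\<lambda>\<epsilon>. vacuum_residual \<nu> (physical lam \<phi> \<epsilon> (V \<epsilon>))
     (\<theta> + lam * (\<tau> / \<epsilon>)) (\<eta> + \<epsilon> * \<phi> \<epsilon> \<theta> \<tau>) (\<tau> / \<epsilon>) ! i) \<in> O[at_right 0](\<lambda>\<epsilon>. \<epsilon> ^ 3)) \<longleftrightarrow>
   VA \<theta> \<tau> \<eta> \<and>
   VB \<theta> \<tau> \<eta>"
  if \<tau>: "\<tau> \<in> {0<..<T}" and \<eta>: "\<eta> < 0" for \<theta> \<tau> \<eta>
 proof -
  define X where "X = (\<lambda>j \<epsilon>. pd1 (V \<epsilon>) \<theta> \<eta> \<tau> $ j)"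
  define Y where "Y = (\<lambda>j \<epsilon>. pd2 (V \<epsilon>) \<theta> \<eta> \<tau> $ j)"
  define D where "D = (\<lambda>j \<epsilon>. pd3 (V \<epsilon>) \<theta> \<eta> \<tau> $ j)"
  define s where "s = (\<lambda>\<epsilon>. \<epsilon> * pd1 (lift_surface (\<phi> \<epsilon>)) \<theta> \<eta> \<tau>)"
  define r where "r = (\<lambda>\<epsilon>. \<epsilon> * (\<epsilon> * pd3 (lift_surface (\<phi> \<epsilon>)) \<theta> \<eta> \<tau>))"
  have X: "exp3 (X j) 0 (pd1 V1 \<theta> \<eta> \<tau> $ j) (pd1 V2 \<theta> \<eta> \<tau> $ j)"
   and Y: "exp3 (Y j) 0 (pd2 V1 \<theta> \<eta> \<tau> $ j) (pd2 V2 \<theta> \<eta> \<tau> $ j)"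
   and D: "exp3 (D j) 0 (pd3 V1 \<theta> \<eta> \<tau> $ j) (pd3 V2 \<theta> \<eta> \<tau> $ j)" for j
   unfolding X_def Y_def D_def using \<eta> by (auto intro!: field_expansion(3,4,5)[OF aV \<tau> pV])
  have s: "exp3 s 0 (sd1 \<phi>1 \<theta> \<tau>) (sd1 \<phi>2 \<theta> \<tau>)" and r: "exp3 r 0 0 (sd2 \<phi>1 \<theta> \<tau>)"
   unfolding s_def r_def by (rule surface_expansion[OF a\<phi> S \<tau>])+
  note base = X Y D s r
  have ev: "\<forall>\<^sub>F \<epsilon> in at_right 0. vacuum_residual \<nu> (physical lam \<phi> \<epsilon> (V \<epsilon>))
     (\<theta> + lam * (\<tau> / \<epsilon>)) (\<eta> + \<epsilon> * \<phi> \<epsilon> \<theta> \<tau>) (\<tau> / \<epsilon>) =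
   (let D' = (\<lambda>j. \<epsilon> * D j \<epsilon> + (lam * s \<epsilon> - r \<epsilon>) * Y j \<epsilon> - lam * X j \<epsilon>); X' = (\<lambda>j. X j \<epsilon> - s \<epsilon> * Y j \<epsilon>) in
   [\<nu> * D' 1 + Y 3 \<epsilon>, \<nu> * D' 2 - X' 3, \<nu> * D' 3 - X' 2 + Y 1 \<epsilon>, X' 1 + Y 2 \<epsilon>])"
   using pos surface_expansion(1)[OF a\<phi> S \<tau>, of \<theta> \<eta>] field_expansion(2)[OF aV \<tau>, of \<eta> \<theta>, simplified, OF \<eta>]
  proof eventually_elim
   case (elim \<epsilon>)
   show ?case
    unfolding vacuum_residual_def Let_def
    using physical_derivatives(5)[where \<phi>=\<phi> and \<theta>=\<theta> and \<eta>=\<eta> and \<tau>=\<tau> and \<epsilon>=\<epsilon> and F="V \<epsilon>" and lam=lam, OF elim(1,2,3)]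
    by (simp add: X_def Y_def D_def s_def r_def)
  qed
  note iff = residual_bigo_iff[OF eventually_mono[OF ev]]
  show ?thesis
   unfolding all_less_4
  proof (subst iff, (simp add: Let_def; fail), (rule base exp3_const exp3_param exp3_intros)+, (simp; fail))+
  qed (auto simp: VA_def VB_def Let_def vacuum_forcing_def algebra_simps)
 qed
 have jump: "(\<forall>i<5. (\<lambda>\<epsilon>. interface_residual \<nu> (physical lam \<phi> \<epsilon> (U \<epsilon>)) (physical lam \<phi> \<epsilon> (V \<epsilon>)) (front lam \<phi> \<epsilon>)
     (\<theta> + lam * (\<tau> / \<epsilon>)) (\<tau> / \<epsilon>) ! i) \<in> O[at_right 0](\<lambda>\<epsilon>. \<epsilon> ^ 3)) \<longleftrightarrow>
   JA \<theta> \<tau> \<and>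
   JB \<theta> \<tau>"
  if \<tau>: "\<tau> \<in> {0<..<T}" for \<theta> \<tau>
 proof -
  define u where "u = (\<lambda>j \<epsilon>. U \<epsilon> \<theta> 0 \<tau> $ j)"
  define h where "h = (\<lambda>j \<epsilon>. V \<epsilon> \<theta> 0 \<tau> $ j)"
  define s where "s = (\<lambda>\<epsilon>. \<epsilon> * pd1 (lift_surface (\<phi> \<epsilon>)) \<theta> 0 \<tau>)"
  define r where "r = (\<lambda>\<epsilon>. \<epsilon> * (\<epsilon> * pd3 (lift_surface (\<phi> \<epsilon>)) \<theta> 0 \<tau>))"
  have u: "exp3 (u j) (U_base v0 B0 H0 $ j) (U1 \<theta> 0 \<tau> $ j) (U2 \<theta> 0 \<tau> $ j)" for j
   unfolding u_def by (rule field_expansion(1)[OF aU \<tau>]) simp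
  have h: "exp3 (h j) (V_base H0 $ j) (V1 \<theta> 0 \<tau> $ j) (V2 \<theta> 0 \<tau> $ j)" for j
   unfolding h_def by (rule field_expansion(1)[OF aV \<tau>]) simp
  have s: "exp3 s 0 (sd1 \<phi>1 \<theta> \<tau>) (sd1 \<phi>2 \<theta> \<tau>)" and r: "exp3 r 0 0 (sd2 \<phi>1 \<theta> \<tau>)"
   unfolding s_def r_def by (rule surface_expansion[OF a\<phi> S \<tau>])+
  note base = u h s r
  have ev: "\<forall>\<^sub>F \<epsilon> in at_right 0. interface_residual \<nu> (physical lam \<phi> \<epsilon> (U \<epsilon>)) (physical lam \<phi> \<epsilon> (V \<epsilon>)) (front lam \<phi> \<epsilon>)
     (\<theta> + lam * (\<tau> / \<epsilon>)) (\<tau> / \<epsilon>) =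
    [(r \<epsilon> - lam * s \<epsilon>) - (u 2 \<epsilon> - s \<epsilon> * u 1 \<epsilon>),
    u 5 \<epsilon> - ((h 1 \<epsilon>)\<^sup>2 + (h 2 \<epsilon>)\<^sup>2 - (h 3 \<epsilon>)\<^sup>2) / 2,
    u 4 \<epsilon> - s \<epsilon> * u 3 \<epsilon>, h 2 \<epsilon> - s \<epsilon> * h 1 \<epsilon>, h 3 \<epsilon> - \<nu> * (r \<epsilon> - lam * s \<epsilon>) * h 1 \<epsilon>]"
   using pos surface_expansion(1)[OF a\<phi> S \<tau>, of \<theta> 0]
  proof eventually_elim
   case (elim \<epsilon>)
   note pd = physical_derivatives[where \<phi>=\<phi> and \<theta>=\<theta> and \<eta>=0 and \<tau>=\<tau> and \<epsilon>=\<epsilon> and lam=lam, OF elim(1,2)]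
   have "front lam \<phi> \<epsilon> (\<theta> + lam * (\<tau> / \<epsilon>)) (\<tau> / \<epsilon>) = 0 + \<epsilon> * \<phi> \<epsilon> \<theta> \<tau>" using pd(4) by simp
   then show ?case
    unfolding interface_residual_def Let_def
    by (simp only: pd(1,2,3)) (simp add: u_def h_def s_def r_def)
  qed
  note iff = residual_bigo_iff[OF eventually_mono[OF ev]]
  show ?thesis
   unfolding all_less_5
  proof (subst iff, (simp; fail), (rule base exp3_const exp3_param exp3_intros)+, (simp add: U_base_def V_base_def power2_eq_square; fail))+
  qed (auto simp: JA_def JB_def Let_def jump_forcing_def U_base_def V_base_def algebra_simps power2_eq_square diff_divide_distrib add_divide_distrib)
 qed
 have PA: "plasma_system (lam - v0) B0 T U1 (\<lambda>_ _ _. 0) (\<lambda>_ _ _. 0) \<longleftrightarrow> (\<forall>\<theta>. \<forall>\<tau>\<in>{0<..<T}. \<forall>\<eta>>0. PA \<theta> \<tau> \<eta>)"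
  and PB: "plasma_system (lam - v0) B0 T U2 (forcing v0 B0 lam U1 \<phi>1) (divergence_forcing U1 \<phi>1) \<longleftrightarrow>
   (\<forall>\<theta>. \<forall>\<tau>\<in>{0<..<T}. \<forall>\<eta>>0. PB \<theta> \<tau> \<eta>)"
  and VA: "vacuum_system \<nu> lam T V1 (\<lambda>_ _ _. 0) \<longleftrightarrow> (\<forall>\<theta>. \<forall>\<tau>\<in>{0<..<T}. \<forall>\<eta><0. VA \<theta> \<tau> \<eta>)"
  and VB: "vacuum_system \<nu> lam T V2 (vacuum_forcing \<nu> lam V1 \<phi>1) \<longleftrightarrow> (\<forall>\<theta>. \<forall>\<tau>\<in>{0<..<T}. \<forall>\<eta><0. VB \<theta> \<tau> \<eta>)"
  and JA: "jump_system \<nu> v0 B0 H0 lam T U1 V1 \<phi>1 (\<lambda>_ _. 0) \<longleftrightarrow> (\<forall>\<theta>. \<forall>\<tau>\<in>{0<..<T}. JA \<theta> \<tau>)"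
  and JB: "jump_system \<nu> v0 B0 H0 lam T U2 V2 \<phi>2 (jump_forcing \<nu> H0 lam U1 V1 \<phi>1) \<longleftrightarrow> (\<forall>\<theta>. \<forall>\<tau>\<in>{0<..<T}. JB \<theta> \<tau>)"
  by (simp_all add: plasma_system_def vacuum_system_def jump_system_def PA_def PB_def VA_def VB_def JA_def JB_def Let_def del: minus_diff_eq)
 have "solves_to_second_order \<nu> lam T U V \<phi> \<longleftrightarrow> (\<forall>\<theta>. \<forall>\<tau>\<in>{0<..<T}.
   (\<forall>\<eta>>0. PA \<theta> \<tau> \<eta> \<and> PB \<theta> \<tau> \<eta>) \<and> (\<forall>\<eta><0. VA \<theta> \<tau> \<eta> \<and> VB \<theta> \<tau> \<eta>) \<and> JA \<theta> \<tau> \<and> JB \<theta> \<tau>)"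
  unfolding solves_to_second_order_def
  by (intro iff_allI ball_cong refl arg_cong2[where f="(\<and>)"] imp_cong plasma vacuum jump)
 then show ?thesis
  unfolding PA PB VA VB JA JB by blast
qed

section \<open>Quadratic convolutions\<close>

text \<open>
  Smooth profiles have transforms that decay faster than any power; against them, kernels of
  polynomial growth give absolutely convergent convolutions.
\<close>

definition rapid :: "(real \<Rightarrow> complex) \<Rightarrow> bool" where
 "rapid w \<longleftrightarrow> continuous_on UNIV w \<and> (\<forall>n. \<exists>C. \<forall>k. (1 + \<bar>k\<bar>) ^ n * norm (w k) \<le> C)"

definition tame :: "(real \<Rightarrow> real \<Rightarrow> complex) \<Rightarrow> bool" where
 "tame K \<longleftrightarrow> continuous_on UNIV (\<lambda>p. K (fst p) (snd p)) \<and>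
  (\<exists>N C. \<forall>a b. norm (K a b) \<le> C * ((1 + \<bar>a\<bar>) ^ N * (1 + \<bar>b\<bar>) ^ N))"

text \<open>
 If \<open>w\<close> is the transform of the wave profile, the transform of a product of two fields with
 transforms \<open>\<alpha> k * w k\<close> and \<open>\<beta> k * w k\<close> is \<open>conv w (\<lambda>a b. \<alpha> a * \<beta> b)\<close>. All quadratic terms
 are handled through their kernels.
\<close>

definition conv :: "(real \<Rightarrow> complex) \<Rightarrow> (real \<Rightarrow> real \<Rightarrow> complex) \<Rightarrow> real \<Rightarrow> complex" where
 "conv w K k = (LINT l|lborel. K (k - l) l * (w (k - l) * w l))"

lemma one_le_weight: "1 \<le> (1 + \<bar>a::real\<bar>) ^ n" by (simp add: one_le_power)

lemma weight_mono: "n \<le> m \<Longrightarrow> (1 + \<bar>a::real\<bar>) ^ n \<le> (1 + \<bar>a\<bar>) ^ m"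
 by (rule power_increasing) auto

lemma tameI:
 assumes "continuous_on UNIV (\<lambda>p. K (fst p) (snd p))"
  and "\<And>a b. norm (K a b) \<le> C * ((1 + \<bar>a\<bar>) ^ N * (1 + \<bar>b\<bar>) ^ N)"
 shows "tame K"
 using assms unfolding tame_def by blast

lemma tame_bounded:
 assumes "continuous_on UNIV (\<lambda>p. K (fst p) (snd p))" "\<And>a b. norm (K a b) \<le> C"
 shows "tame K"
 by (rule tameI[where N=0 and C=C]) (use assms in auto)

lemma tame_const: "tame (\<lambda>a b. c)"
 by (rule tame_bounded) auto

lemma tame_fst: "tame (\<lambda>a b. of_real a)"
proof (rule tameI[where N=1 and C=1])
 show "norm (complex_of_real a) \<le> 1 * ((1 + \<bar>a\<bar>) ^ 1 * (1 + \<bar>b\<bar>) ^ 1)" for a b :: real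
  by (simp add: algebra_simps)
qed (auto intro!: continuous_intros)

lemma tame_snd: "tame (\<lambda>a b. of_real b)"
proof (rule tameI[where N=1 and C=1])
 show "norm (complex_of_real b) \<le> 1 * ((1 + \<bar>a\<bar>) ^ 1 * (1 + \<bar>b\<bar>) ^ 1)" for a b :: real
  by (simp add: algebra_simps)
qed (auto intro!: continuous_intros)

lemma tame_abs_fst: "tame (\<lambda>a b. of_real \<bar>a\<bar>)"
proof (rule tameI[where N=1 and C=1])
 show "norm (complex_of_real \<bar>a\<bar>) \<le> 1 * ((1 + \<bar>a\<bar>) ^ 1 * (1 + \<bar>b\<bar>) ^ 1)" for a b :: real
  by (simp add: algebra_simps)
qed (auto intro!: continuous_intros)

lemma tame_abs_snd: "tame (\<lambda>a b. of_real \<bar>b\<bar>)"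
proof (rule tameI[where N=1 and C=1])
 show "norm (complex_of_real \<bar>b\<bar>) \<le> 1 * ((1 + \<bar>a\<bar>) ^ 1 * (1 + \<bar>b\<bar>) ^ 1)" for a b :: real
  by (simp add: algebra_simps)
qed (auto intro!: continuous_intros)

lemma tame_mult:
 assumes "tame K" "tame K'" shows "tame (\<lambda>a b. K a b * K' a b)"
proof -
 obtain N C N' C' where *: "\<And>a b. norm (K a b) \<le> C * ((1 + \<bar>a\<bar>) ^ N * (1 + \<bar>b\<bar>) ^ N)"
  "\<And>a b. norm (K' a b) \<le> C' * ((1 + \<bar>a\<bar>) ^ N' * (1 + \<bar>b\<bar>) ^ N')"
  using assms unfolding tame_def by blast
 show ?thesis
 proof (rule tameI[where N="N + N'" and C="C * C'"])
  show "continuous_on UNIV (\<lambda>p. K (fst p) (snd p) * K' (fst p) (snd p))"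
   using assms unfolding tame_def by (intro continuous_intros) auto
  fix a b
  have "norm (K a b * K' a b) \<le> (C * ((1 + \<bar>a\<bar>) ^ N * (1 + \<bar>b\<bar>) ^ N)) * (C' * ((1 + \<bar>a\<bar>) ^ N' * (1 + \<bar>b\<bar>) ^ N'))"
   unfolding norm_mult by (intro mult_mono * norm_ge_zero order_trans[OF norm_ge_zero *(1)])
  then show "norm (K a b * K' a b) \<le> C * C' * ((1 + \<bar>a\<bar>) ^ (N + N') * (1 + \<bar>b\<bar>) ^ (N + N'))"
   by (simp add: power_add ac_simps)
 qed
qed

lemma tame_add:
 assumes "tame K" "tame K'" shows "tame (\<lambda>a b. K a b + K' a b)"
proof -
 obtain N C N' C' where *: "\<And>a b. norm (K a b) \<le> C * ((1 + \<bar>a\<bar>) ^ N * (1 + \<bar>b\<bar>) ^ N)"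
  "\<And>a b. norm (K' a b) \<le> C' * ((1 + \<bar>a\<bar>) ^ N' * (1 + \<bar>b\<bar>) ^ N')"
  using assms unfolding tame_def by blast
 have pos: "C \<ge> 0" "C' \<ge> 0"
  using order_trans[OF norm_ge_zero *(1)[of 0 0]] order_trans[OF norm_ge_zero *(2)[of 0 0]] by auto
 show ?thesis
 proof (rule tameI[where N="N + N'" and C="C + C'"])
  show "continuous_on UNIV (\<lambda>p. K (fst p) (snd p) + K' (fst p) (snd p))"
   using assms unfolding tame_def by (intro continuous_intros) auto
  fix a b
  have "norm (K a b) \<le> C * ((1 + \<bar>a\<bar>) ^ (N + N') * (1 + \<bar>b\<bar>) ^ (N + N'))"
   by (rule order_trans[OF *(1)]) (intro mult_left_mono mult_mono weight_mono pos; simp)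
  moreover have "norm (K' a b) \<le> C' * ((1 + \<bar>a\<bar>) ^ (N + N') * (1 + \<bar>b\<bar>) ^ (N + N'))"
   by (rule order_trans[OF *(2)]) (intro mult_left_mono mult_mono weight_mono pos; simp)
  ultimately show "norm (K a b + K' a b) \<le> (C + C') * ((1 + \<bar>a\<bar>) ^ (N + N') * (1 + \<bar>b\<bar>) ^ (N + N'))"
   unfolding distrib_right using norm_triangle_ineq[of "K a b" "K' a b"] by linarith
 qed
qed

lemma tame_uminus: "tame K \<Longrightarrow> tame (\<lambda>a b. - K a b)"
 using tame_mult[OF tame_const[of "-1"]] by simp

lemma tame_diff: "tame K \<Longrightarrow> tame K' \<Longrightarrow> tame (\<lambda>a b. K a b - K' a b)"
 using tame_add[OF _ tame_uminus] by simp

lemma tame_power: "tame K \<Longrightarrow> tame (\<lambda>a b. K a b ^ n)"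
 by (induction n) (auto intro: tame_const tame_mult)

lemma tame_exp:
 assumes "continuous_on UNIV (\<lambda>p. \<alpha> (fst p) (snd p))" "\<And>a b. \<alpha> a b \<ge> 0" "s \<ge> 0"
 shows "tame (\<lambda>a b. of_real (exp (- (\<alpha> a b * s))))"
 by (rule tame_bounded[where C=1]) (use assms in \<open>auto intro!: continuous_intros\<close>)

lemma tame_divide:
 assumes "tame K" "continuous_on UNIV (\<lambda>p. \<alpha> (fst p) (snd p))" "\<And>a b. \<alpha> a b \<ge> 0" "\<kappa> > 0"
 shows "tame (\<lambda>a b. K a b / of_real (\<kappa> + \<alpha> a b))"
proof -
 have pos: "\<kappa> + \<alpha> a b > 0" for a b using assms(3)[of a b] assms(4) by simp
 have "tame (\<lambda>a b. of_real (1 / (\<kappa> + \<alpha> a b)))"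
 proof (rule tame_bounded[where C="1 / \<kappa>"])
  show "continuous_on UNIV (\<lambda>p. complex_of_real (1 / (\<kappa> + \<alpha> (fst p) (snd p))))"
   using assms(2) pos by (intro continuous_intros) (auto simp: less_imp_neq[THEN not_sym])
  show "norm (complex_of_real (1 / (\<kappa> + \<alpha> a b))) \<le> 1 / \<kappa>" for a b
   using pos[of a b] assms(3)[of a b] assms(4) unfolding norm_of_real by (simp add: frac_le)
 qed
 from tame_mult[OF assms(1) this] show ?thesis by (simp add: divide_inverse)
qed

lemmas tame_intros = tame_const tame_fst tame_snd tame_abs_fst tame_abs_snd tame_add tame_diff
 tame_uminus tame_mult tame_power

lemma integrable_inverse_weight: "integrable lborel (\<lambda>k. 1 / (1 + \<bar>k::real\<bar>)\<^sup>2)"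
proof (rule Bochner_Integration.integrable_bound[OF integral_cauchy_density(1)])
 have "1 / (1 + \<bar>k\<bar>)\<^sup>2 \<le> 1 / (1 + k\<^sup>2)" for k :: real
  by (intro divide_left_mono) (auto simp: power2_sum add_pos_nonneg)
 then show "AE k in lborel. norm (1 / (1 + \<bar>k::real\<bar>)\<^sup>2) \<le> norm (1 / (1 + k\<^sup>2))"
  by (simp add: abs_of_pos add_pos_nonneg)
qed measurable

lemma rapid_measurable: "rapid w \<Longrightarrow> w \<in> borel_measurable borel"
 unfolding rapid_def by (auto intro: borel_measurable_continuous_onI)

lemma rapid_integrable:
 assumes w: "rapid w"
 shows "integrable lborel (\<lambda>k. (1 + \<bar>k\<bar>) ^ n * norm (w k))"
proof -
 obtain C where C: "\<And>k. (1 + \<bar>k\<bar>) ^ (n + 2) * norm (w k) \<le> C"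
  using w unfolding rapid_def by blast
 have "integrable lborel (\<lambda>k. C * (1 / (1 + \<bar>k::real\<bar>)\<^sup>2))"
  using integrable_inverse_weight by (rule integrable_mult_right)
 then show ?thesis
 proof (rule Bochner_Integration.integrable_bound)
  show "(\<lambda>k. (1 + \<bar>k\<bar>) ^ n * norm (w k)) \<in> borel_measurable lborel"
   using rapid_measurable[OF w] by measurable
  show "AE k in lborel. norm ((1 + \<bar>k\<bar>) ^ n * norm (w k)) \<le> norm (C * (1 / (1 + \<bar>k\<bar>)\<^sup>2))"
  proof (rule AE_I2)
   fix k :: real
   have "(1 + \<bar>k\<bar>) ^ n * norm (w k) = ((1 + \<bar>k\<bar>) ^ (n + 2) * norm (w k)) * (1 / (1 + \<bar>k\<bar>)\<^sup>2)"
    unfolding power_add by simp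
   also have "\<dots> \<le> C * (1 / (1 + \<bar>k\<bar>)\<^sup>2)"
    using C[of k] by (intro mult_right_mono) auto
   finally show "norm ((1 + \<bar>k\<bar>) ^ n * norm (w k)) \<le> norm (C * (1 / (1 + \<bar>k\<bar>)\<^sup>2))"
    by (metis abs_ge_self abs_of_nonneg mult_nonneg_nonneg norm_ge_zero order_trans real_norm_def zero_le_power add_nonneg_nonneg abs_ge_zero zero_le_one)
  qed
 qed
qed

lemma tame_slice_measurable: "tame K \<Longrightarrow> (\<lambda>l. K (k - l) l) \<in> borel_measurable borel"
 unfolding tame_def
 by (intro borel_measurable_continuous_onI continuous_on_compose2[of UNIV "\<lambda>p. K (fst p) (snd p)" UNIV "\<lambda>l. (k - l, l)", simplified])
  (auto intro!: continuous_intros)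

lemma conv_majorant:
 assumes w: "rapid w" and K: "tame K"
 shows "\<exists>g. integrable lborel g \<and> (\<forall>l. norm (K (k - l) l * (w (k - l) * w l)) \<le> g l)"
proof -
 obtain N C where C: "\<And>a b. norm (K a b) \<le> C * ((1 + \<bar>a\<bar>) ^ N * (1 + \<bar>b\<bar>) ^ N)"
  using K unfolding tame_def by blast
 obtain B where B: "\<And>k. (1 + \<bar>k\<bar>) ^ N * norm (w k) \<le> B"
  using w unfolding rapid_def by blast
 have C0: "C \<ge> 0" using order_trans[OF norm_ge_zero C[of 0 0]] by simp
 have "norm (K (k - l) l * (w (k - l) * w l)) \<le> C * B * ((1 + \<bar>l\<bar>) ^ N * norm (w l))" for l
 proof -
  have "norm (K (k - l) l * (w (k - l) * w l)) \<le>
    C * ((1 + \<bar>k - l\<bar>) ^ N * (1 + \<bar>l\<bar>) ^ N) * (norm (w (k - l)) * norm (w l))"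
   unfolding norm_mult by (intro mult_right_mono C) auto
  also have "\<dots> = C * ((1 + \<bar>k - l\<bar>) ^ N * norm (w (k - l))) * ((1 + \<bar>l\<bar>) ^ N * norm (w l))"
   by (simp add: ac_simps)
  also have "\<dots> \<le> C * B * ((1 + \<bar>l\<bar>) ^ N * norm (w l))"
   using B[of "k - l"] C0 by (intro mult_right_mono mult_left_mono) auto
  finally show ?thesis .
 qed
 moreover have "integrable lborel (\<lambda>l. C * B * ((1 + \<bar>l\<bar>) ^ N * norm (w l)))"
  using rapid_integrable[OF w] by (rule integrable_mult_right)
 ultimately show ?thesis by blast
qed

lemma conv_integrable:
 assumes w: "rapid w" and K: "tame K"
 shows "integrable lborel (\<lambda>l. K (k - l) l * (w (k - l) * w l))"
proof -
 obtain g where g: "integrable lborel g" "\<And>l. norm (K (k - l) l * (w (k - l) * w l)) \<le> g l"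
  using conv_majorant[OF assms] by blast
 show ?thesis
 proof (rule Bochner_Integration.integrable_bound[OF g(1)])
  show "(\<lambda>l. K (k - l) l * (w (k - l) * w l)) \<in> borel_measurable lborel"
   using rapid_measurable[OF w] tame_slice_measurable[OF K] by measurable
 qed (use g(2) in \<open>auto intro: order_trans[OF _ abs_ge_self]\<close>)
qed

lemma conv_add: "rapid w \<Longrightarrow> tame K \<Longrightarrow> tame K' \<Longrightarrow> conv w (\<lambda>a b. K a b + K' a b) k = conv w K k + conv w K' k"
 unfolding conv_def distrib_right by (intro Bochner_Integration.integral_add conv_integrable)

lemma conv_cmult: "conv w (\<lambda>a b. c * K a b) k = c * conv w K k"
 unfolding conv_def mult.assoc by simp

lemma conv_uminus: "conv w (\<lambda>a b. - K a b) k = - conv w K k"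
 using conv_cmult[of w "-1" K k] by simp

lemma conv_diff: "rapid w \<Longrightarrow> tame K \<Longrightarrow> tame K' \<Longrightarrow> conv w (\<lambda>a b. K a b - K' a b) k = conv w K k - conv w K' k"
 using conv_add[of w K "\<lambda>a b. - K' a b" k] by (simp add: tame_uminus conv_uminus)

lemma conv_cong: "(\<And>a b. a + b = k \<Longrightarrow> K a b = K' a b) \<Longrightarrow> conv w K k = conv w K' k"
 unfolding conv_def by (intro Bochner_Integration.integral_cong) auto

lemma conv_swap: "conv w K k = conv w (\<lambda>a b. K b a) k"
 unfolding conv_def
 by (subst lborel_integral_real_affine[where c="-1" and t=k]) (auto simp: mult.commute)

text \<open>Only the symmetric part of a kernel contributes.\<close>

lemma conv_symmetrize:
 assumes w: "rapid w" and K: "tame K" "tame K'" and eq: "\<And>a b. a + b = k \<Longrightarrow> K a b + K b a = K' a b + K' b a"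
 shows "conv w K k = conv w K' k"
proof -
 have swap: "tame (\<lambda>a b. K b a)" if K: "tame K" for K
 proof -
  obtain N C where C: "\<And>a b. norm (K a b) \<le> C * ((1 + \<bar>a\<bar>) ^ N * (1 + \<bar>b\<bar>) ^ N)"
   using K unfolding tame_def by blast
  show ?thesis
  proof (rule tameI[where N=N and C=C])
   have "continuous_on UNIV (\<lambda>p::real\<times>real. K (fst (snd p, fst p)) (snd (snd p, fst p)))"
    by (rule continuous_on_compose2[of UNIV "\<lambda>p. K (fst p) (snd p)"])
     (use K in \<open>auto simp: tame_def intro!: continuous_intros\<close>)
   then show "continuous_on UNIV (\<lambda>p::real\<times>real. K (snd p) (fst p))" by simp
   show "norm (K b a) \<le> C * ((1 + \<bar>a\<bar>) ^ N * (1 + \<bar>b\<bar>) ^ N)" for a b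
    using C[of b a] by (simp add: mult.commute)
  qed
 qed
 have "conv w K k + conv w (\<lambda>a b. K b a) k = conv w K' k + conv w (\<lambda>a b. K' b a) k"
  unfolding conv_add[OF w K(1) swap[OF K(1)], symmetric] conv_add[OF w K(2) swap[OF K(2)], symmetric]
  by (rule conv_cong[OF eq])
 then show ?thesis unfolding conv_swap[of w K k, symmetric] conv_swap[of w K' k, symmetric] by simp
qed

lemma conv_continuous:
 assumes w: "rapid w" and K: "tame K"
  and \<alpha>: "continuous_on UNIV (\<lambda>p. \<alpha> (fst p) (snd p))" "\<And>a b. \<alpha> a b \<ge> 0"
 shows "continuous_on {0..} (\<lambda>s. conv w (\<lambda>a b. K a b * of_real (exp (- (\<alpha> a b * s)))) k)" (is ?thesis1)
  and "\<exists>M. \<forall>s\<ge>0. norm (conv w (\<lambda>a b. K a b * of_real (exp (- (\<alpha> a b * s)))) k) \<le> M" (is ?thesis2)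
proof -
 obtain g where g: "integrable lborel g" "\<And>l. norm (K (k - l) l * (w (k - l) * w l)) \<le> g l"
  using conv_majorant[OF w K] by blast
 have le: "norm (K (k - l) l * of_real (exp (- (\<alpha> (k - l) l * s))) * (w (k - l) * w l)) \<le> g l" if "s \<ge> 0" for s l
 proof -
  have "norm (K (k - l) l * of_real (exp (- (\<alpha> (k - l) l * s))) * (w (k - l) * w l)) =
    norm (K (k - l) l * (w (k - l) * w l)) * exp (- (\<alpha> (k - l) l * s))"
   by (simp add: norm_mult)
  also have "\<dots> \<le> norm (K (k - l) l * (w (k - l) * w l)) * 1"
   using \<alpha>(2)[of "k - l" l] that by (intro mult_left_mono) auto
  finally show ?thesis using g(2)[of l] by simp
 qed
 have int: "integrable lborel (\<lambda>l. K (k - l) l * of_real (exp (- (\<alpha> (k - l) l * s))) * (w (k - l) * w l))" if "s \<ge> 0" for s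
  using conv_integrable[OF w tame_mult[OF K tame_exp[OF \<alpha> that]]] .
 show ?thesis1
  unfolding conv_def
 proof (rule continuous_on_parameter_integral[OF _ _ g(1)])
  show "continuous_on {0..} (\<lambda>s. K (k - l) l * complex_of_real (exp (- (\<alpha> (k - l) l * s))) * (w (k - l) * w l))" for l
   by (intro continuous_intros)
 qed (use int le in auto)
 have "norm (conv w (\<lambda>a b. K a b * of_real (exp (- (\<alpha> a b * s)))) k) \<le> (LINT l|lborel. g l)" if "s \<ge> 0" for s
  unfolding conv_def by (rule Bochner_Integration.integral_norm_bound_integral[OF int g(1)]) (use le that in auto)
 then show ?thesis2 by blast
qed

lemma conv_derivative:
 assumes w: "rapid w" and K: "tame K" and t\<alpha>: "tame (\<lambda>a b. of_real (\<alpha> a b))"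
  and \<alpha>: "continuous_on UNIV (\<lambda>p. \<alpha> (fst p) (snd p))" "\<And>a b. \<alpha> a b \<ge> 0" and s: "s > 0"
 shows "((\<lambda>s. conv w (\<lambda>a b. K a b * of_real (exp (- (\<alpha> a b * s)))) k) has_vector_derivative
  conv w (\<lambda>a b. (- of_real (\<alpha> a b) * K a b) * of_real (exp (- (\<alpha> a b * s)))) k) (at s)"
proof -
 let ?K' = "\<lambda>a b. - of_real (\<alpha> a b) * K a b"
 have K': "tame ?K'" by (intro tame_mult tame_uminus t\<alpha> K)
 obtain g where g: "integrable lborel g" "\<And>l. norm (?K' (k - l) l * (w (k - l) * w l)) \<le> g l"
  using conv_majorant[OF w K'] by blast
 show ?thesis
  unfolding conv_def
 proof (rule has_vector_derivative_parameter_integral[of "{0<..}", OF _ _ _ _ g(1)])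
  show "integrable lborel (\<lambda>l. K (k - l) l * of_real (exp (- (\<alpha> (k - l) l * s))) * (w (k - l) * w l))" if "s \<in> {0<..}" for s
   using conv_integrable[OF w tame_mult[OF K tame_exp[OF \<alpha>, of s]]] that by simp
  fix s :: real and l assume s: "s \<in> {0<..}"
  have "((\<lambda>s. complex_of_real (exp (- (\<alpha> (k - l) l * s)))) has_vector_derivative of_real (- \<alpha> (k - l) l * exp (- (\<alpha> (k - l) l * s)))) (at s)"
   by (rule has_vector_derivative_of_real)
    (auto intro!: derivative_eq_intros simp: has_real_derivative_iff_has_vector_derivative[symmetric])
  from has_vector_derivative_mult_left[OF has_vector_derivative_mult_right[OF this, of "K (k - l) l"], of "w (k - l) * w l"]
  show "((\<lambda>s. K (k - l) l * of_real (exp (- (\<alpha> (k - l) l * s))) * (w (k - l) * w l)) has_vector_derivative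
    ?K' (k - l) l * of_real (exp (- (\<alpha> (k - l) l * s))) * (w (k - l) * w l)) (at s)"
   by (simp add: ac_simps)
  have "norm (?K' (k - l) l * of_real (exp (- (\<alpha> (k - l) l * s))) * (w (k - l) * w l)) =
    norm (?K' (k - l) l * (w (k - l) * w l)) * exp (- (\<alpha> (k - l) l * s))"
   by (simp add: norm_mult)
  also have "\<dots> \<le> norm (?K' (k - l) l * (w (k - l) * w l)) * 1"
   using \<alpha>(2)[of "k - l" l] s by (intro mult_left_mono) auto
  finally show "norm (?K' (k - l) l * of_real (exp (- (\<alpha> (k - l) l * s))) * (w (k - l) * w l)) \<le> g l"
   using g(2)[of l] by simp
 qed (use s in auto)
qed

text \<open>
  Integration against a decaying exponential turns the exponential decay of a kernel into a denominator.
\<close>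

lemma conv_laplace:
 assumes w: "rapid w" and K: "tame K"
  and \<alpha>: "continuous_on UNIV (\<lambda>p. \<alpha> (fst p) (snd p))" "\<And>a b. \<alpha> a b \<ge> 0" and \<kappa>: "\<kappa> > 0"
 shows "(LBINT s:{0..}. conv w (\<lambda>a b. K a b * of_real (exp (- (\<alpha> a b * s)))) k * of_real (exp (- (\<kappa> * s)))) =
  conv w (\<lambda>a b. K a b / of_real (\<kappa> + \<alpha> a b)) k"
proof -
 have c: "continuous_on UNIV (\<lambda>l. \<alpha> (k - l) l)"
  using continuous_on_compose2[OF \<alpha>(1), of UNIV "\<lambda>l. (k - l, l)"]
  by (simp add: continuous_on_Pair continuous_on_diff)
 show ?thesis
  using laplace_superposition[OF conv_integrable[OF w K, of k] c \<alpha>(2) \<kappa>]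
  unfolding conv_def by (simp add: ac_simps)
qed

lemma fourier_product_conv:
 assumes f: "nice f" and g: "nice g" and w: "rapid w" and \<alpha>: "tame (\<lambda>a b. \<alpha> a)" and \<beta>: "tame (\<lambda>a b. \<beta> b)"
  and F: "\<And>k. k \<noteq> 0 \<Longrightarrow> fourier f k = \<alpha> k * w k" and G: "\<And>k. k \<noteq> 0 \<Longrightarrow> fourier g k = \<beta> k * w k"
 shows "fourier (\<lambda>x. f x * g x) k = conv w (\<lambda>a b. \<alpha> a * \<beta> b) k"
proof -
 have meas [measurable]: "fourier f \<in> borel_measurable borel" "fourier g \<in> borel_measurable borel" "w \<in> borel_measurable borel"
  using fourier_measurable[OF f] fourier_measurable[OF g] rapid_measurable[OF w] by auto
 obtain N C where C: "\<And>b. norm (\<beta> b) \<le> C * ((1 + \<bar>0\<bar>) ^ N * (1 + \<bar>b\<bar>) ^ N)"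
  using \<beta> unfolding tame_def by blast
 have int: "integrable lborel (fourier g)"
 proof (rule Bochner_Integration.integrable_bound)
  show "integrable lborel (\<lambda>k. C * ((1 + \<bar>k\<bar>) ^ N * norm (w k)))"
   using rapid_integrable[OF w] by (rule integrable_mult_right)
  show "AE k in lborel. norm (fourier g k) \<le> norm (C * ((1 + \<bar>k\<bar>) ^ N * norm (w k)))"
  proof (rule AE_nonzero)
   fix k :: real assume "k \<noteq> 0"
   have "norm (\<beta> k) * norm (w k) \<le> C * (1 + \<bar>k\<bar>) ^ N * norm (w k)"
    using C[of k] by (intro mult_right_mono) auto
   also have "\<dots> \<le> norm (C * ((1 + \<bar>k\<bar>) ^ N * norm (w k)))"
    by (simp add: mult.assoc)
   finally show "norm (fourier g k) \<le> norm (C * ((1 + \<bar>k\<bar>) ^ N * norm (w k)))"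
    using G[OF \<open>k \<noteq> 0\<close>] by (simp add: norm_mult)
  qed
 qed measurable

 have "fourier (\<lambda>x. f x * g x) k = (LINT l|lborel. fourier f (k - l) * fourier g l)"
  by (rule fourier_product[OF f g int])
 also have "\<dots> = conv w (\<lambda>a b. \<alpha> a * \<beta> b) k"
  unfolding conv_def
 proof (rule integral_cong_AE)
  show "(\<lambda>l. fourier f (k - l) * fourier g l) \<in> borel_measurable lborel" by measurable
  show "(\<lambda>l. \<alpha> (k - l) * \<beta> l * (w (k - l) * w l)) \<in> borel_measurable lborel"
   using conv_integrable[OF w tame_mult[OF \<alpha> \<beta>]] by (rule borel_measurable_integrable)
  show "AE l in lborel. fourier f (k - l) * fourier g l = \<alpha> (k - l) * \<beta> l * (w (k - l) * w l)"
  proof (rule AE_I[where N="{0, k}"])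
   show "{l \<in> space lborel. fourier f (k - l) * fourier g l \<noteq> \<alpha> (k - l) * \<beta> l * (w (k - l) * w l)} \<subseteq> {0, k}"
   proof (rule subsetI, rule ccontr)
    fix l assume l: "l \<in> {l \<in> space lborel. fourier f (k - l) * fourier g l \<noteq> \<alpha> (k - l) * \<beta> l * (w (k - l) * w l)}"
     and "l \<notin> {0, k}"
    then have "k - l \<noteq> 0" "l \<noteq> 0" by auto
    from l F[OF this(1)] G[OF this(2)] show False by (simp add: ac_simps)
   qed
   show "emeasure lborel {0, k} = 0" by (simp add: emeasure_lborel_countable)
  qed simp
 qed
 finally show ?thesis .
qed

section \<open>Fourier transforms of profiles\<close>

lemma profile_pd_continuous:
 assumes f: "profile S T f"
 shows "continuous_on (UNIV \<times> S \<times> {0<..<T}) (\<lambda>(x, y, t). pd1 f x y t)" (is ?thesis1)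
  and "continuous_on (UNIV \<times> S \<times> {0<..<T}) (\<lambda>(x, y, t). pd2 f x y t)" (is ?thesis2)
  and "continuous_on (UNIV \<times> S \<times> {0<..<T}) (\<lambda>(x, y, t). pd3 f x y t)" (is ?thesis3)
proof -
 obtain D where D: "\<And>p. p \<in> UNIV \<times> S \<times> {0<..<T} \<Longrightarrow> ((\<lambda>(x, y, t). f x y t) has_derivative blinfun_apply (D p)) (at p)"
  and c: "continuous_on (UNIV \<times> S \<times> {0<..<T}) D"
  using f unfolding profile_def C1_on_def by blast
 have e: "blinfun_apply (D (x, y, t)) (a, b, c) = a *\<^sub>R pd1 f x y t + b *\<^sub>R pd2 f x y t + c *\<^sub>R pd3 f x y t"
  if "y \<in> S" "t \<in> {0<..<T}" for x y t a b c
  by (rule partial_derivatives_of_differentiable(4)[OF D]) (use that in auto)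
 have "continuous_on (UNIV \<times> S \<times> {0<..<T}) (\<lambda>p. blinfun_apply (D p) v)" for v
  by (intro continuous_intros c)
 note c = this[of "(1, 0, 0)"] this[of "(0, 1, 0)"] this[of "(0, 0, 1)"]
 show ?thesis1
  by (rule continuous_on_eq[OF c(1)]) (auto simp: e)
 show ?thesis2
  by (rule continuous_on_eq[OF c(2)]) (auto simp: e)
 show ?thesis3
  by (rule continuous_on_eq[OF c(3)]) (auto simp: e)
qed

lemma continuous_on_slices:
 assumes c: "continuous_on (UNIV \<times> S \<times> J) (\<lambda>(x, y, t). f x y t)"
 shows "y \<in> S \<Longrightarrow> t \<in> J \<Longrightarrow> continuous_on UNIV (\<lambda>x. f x y t)"
  and "t \<in> J \<Longrightarrow> continuous_on S (\<lambda>y. f x y t)"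
  and "y \<in> S \<Longrightarrow> continuous_on J (\<lambda>t. f x y t)"
proof -
 assume "y \<in> S" "t \<in> J"
 then show "continuous_on UNIV (\<lambda>x. f x y t)"
  by (intro continuous_on_compose2[OF c, of UNIV "\<lambda>x. (x, y, t)", unfolded case_prod_conv])
   (auto intro!: continuous_intros)
next
 assume "t \<in> J"
 then show "continuous_on S (\<lambda>y. f x y t)"
  by (intro continuous_on_compose2[OF c, of S "\<lambda>y. (x, y, t)", unfolded case_prod_conv])
   (auto intro!: continuous_intros)
next
 assume "y \<in> S"
 then show "continuous_on J (\<lambda>t. f x y t)"
  by (intro continuous_on_compose2[OF c, of J "\<lambda>t. (x, y, t)", unfolded case_prod_conv])
   (auto intro!: continuous_intros)
qed

lemma profile_majorant:
 assumes f: "profile S T f" and ab: "0 < a" "b < T"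
 obtains g where "integrable_majorant g"
  and "\<And>x y t. y \<in> closure S \<Longrightarrow> t \<in> {a..b} \<Longrightarrow> norm (f x y t) \<le> g x"
  and "\<And>x y t. y \<in> S \<Longrightarrow> t \<in> {a..b} \<Longrightarrow>
   norm (pd1 f x y t) \<le> g x \<and> norm (pd2 f x y t) \<le> g x \<and> norm (pd3 f x y t) \<le> g x"
proof -
 obtain g where g: "integrable_majorant g" "\<forall>x. \<forall>y\<in>S. \<forall>t\<in>{a..b}.
   norm (f x y t) \<le> g x \<and> norm (pd1 f x y t) \<le> g x \<and>
   norm (pd2 f x y t) \<le> g x \<and> norm (pd3 f x y t) \<le> g x"
  using f ab unfolding profile_def by blast
 have c: "continuous_on (UNIV \<times> closure S \<times> {0<..<T}) (\<lambda>(x, y, t). f x y t)"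
  using f by (simp add: profile_def)
 have "norm (f x y t) \<le> g x" if "y \<in> closure S" "t \<in> {a..b}" for x y t
 proof (rule continuous_le_on_closure[of S "\<lambda>y. norm (f x y t)"])
  show "continuous_on (closure S) (\<lambda>y. norm (f x y t))"
   using that ab by (intro continuous_on_norm continuous_on_slices(2)[OF c]) auto
 qed (use g(2) that in auto)
 then show thesis using that[of g] g by blast
qed

lemma profile_families:
 fixes f :: "real field"
 assumes f: "profile S T f" and \<tau>: "\<tau> \<in> {0<..<T}"
 shows "nice_family (closure S) (\<lambda>y x. f x y \<tau>)" (is ?thesis1)
  and "nice_family S (\<lambda>y x. pd1 f x y \<tau>)" (is ?thesis2)
  and "nice_family S (\<lambda>y x. pd2 f x y \<tau>)" (is ?thesis3)
  and "nice_family S (\<lambda>y x. pd3 f x y \<tau>)" (is ?thesis4)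
proof -
 have c: "continuous_on (UNIV \<times> closure S \<times> {0<..<T}) (\<lambda>(x, y, \<tau>). f x y \<tau>)"
  using f by (simp add: profile_def)
 have ab: "0 < \<tau>" "\<tau> < T" using \<tau> by auto
 obtain g where g: "integrable_majorant g"
  "\<And>x y \<tau>'. y \<in> closure S \<Longrightarrow> \<tau>' \<in> {\<tau>..\<tau>} \<Longrightarrow> norm (f x y \<tau>') \<le> g x"
  "\<And>x y \<tau>'. y \<in> S \<Longrightarrow> \<tau>' \<in> {\<tau>..\<tau>} \<Longrightarrow>
   norm (pd1 f x y \<tau>') \<le> g x \<and> norm (pd2 f x y \<tau>') \<le> g x \<and> norm (pd3 f x y \<tau>') \<le> g x"
  using profile_majorant[OF f ab] by metis
 show ?thesis1
  unfolding nice_family_def using continuous_on_slices(1,2)[OF c] \<tau> g by (intro conjI allI ballI exI[of _ g]) auto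
 show ?thesis2
  unfolding nice_family_def using continuous_on_slices(1,2)[OF profile_pd_continuous(1)[OF f]] \<tau> g
  by (intro conjI allI ballI exI[of _ g]) auto
 show ?thesis3
  unfolding nice_family_def using continuous_on_slices(1,2)[OF profile_pd_continuous(2)[OF f]] \<tau> g
  by (intro conjI allI ballI exI[of _ g]) auto
 show ?thesis4
  unfolding nice_family_def using continuous_on_slices(1,2)[OF profile_pd_continuous(3)[OF f]] \<tau> g
  by (intro conjI allI ballI exI[of _ g]) auto
qed

lemma profile_fourier_pd1:
 fixes f :: "real field"
 assumes f: "profile S T f" and y: "y \<in> S" and t: "t \<in> {0<..<T}"
 shows "fourier (\<lambda>\<theta>. pd1 f \<theta> y t) k = \<i> * k * fourier (\<lambda>\<theta>. f \<theta> y t) k"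
proof (rule fourier_derivative)
 show "nice (\<lambda>\<theta>. f \<theta> y t)" "nice (\<lambda>\<theta>. pd1 f \<theta> y t)"
  using nice_familyD[OF profile_families(1)[OF f t]] nice_familyD[OF profile_families(2)[OF f t]] y closure_subset
  by auto
 show "((\<lambda>\<theta>. f \<theta> y t) has_real_derivative pd1 f x y t) (at x)" for x
  using profile_partial_derivatives(1)[OF f y t] by (simp add: has_real_derivative_iff_has_vector_derivative)
qed

lemma profile_fourier_pd2:
 fixes f :: "real field"
 assumes f: "profile S T f" and S: "open S" and y: "y \<in> S" and t: "t \<in> {0<..<T}"
 shows "((\<lambda>y. fourier (\<lambda>x. f x y t) k) has_vector_derivative fourier (\<lambda>x. pd2 f x y t) k) (at y)"
proof (rule nice_family_fourier_derivative[OF S y])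
 show "nice_family S (\<lambda>y x. f x y t)"
  by (rule nice_family_subset[OF profile_families(1)[OF f t] closure_subset])
 show "nice_family S (\<lambda>y x. pd2 f x y t)" by (rule profile_families(3)[OF f t])
 show "((\<lambda>y. f x y t) has_real_derivative pd2 f x y t) (at y)" if "y \<in> S" for y x
  using profile_partial_derivatives(2)[OF f that t] by (simp add: has_real_derivative_iff_has_vector_derivative)
qed

lemma profile_fourier_pd3:
 fixes f :: "real field"
 assumes f: "profile S T f" and \<eta>: "\<eta> \<in> S" and t: "t \<in> {0<..<T}"
 shows "((\<lambda>t. fourier (\<lambda>x. f x \<eta> t) k) has_vector_derivative fourier (\<lambda>x. pd3 f x \<eta> t) k) (at t)"
proof -
 have "0 < t" "t < T" using t by auto
 then obtain a b where ab: "0 < a" "a < t" "t < b" "b < T" by (meson dense)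
 obtain g where g: "integrable_majorant g"
  "\<And>x \<eta> t. \<eta> \<in> closure S \<Longrightarrow> t \<in> {a..b} \<Longrightarrow> norm (f x \<eta> t) \<le> g x"
  "\<And>x \<eta> t. \<eta> \<in> S \<Longrightarrow> t \<in> {a..b} \<Longrightarrow>
   norm (pd1 f x \<eta> t) \<le> g x \<and> norm (pd2 f x \<eta> t) \<le> g x \<and> norm (pd3 f x \<eta> t) \<le> g x"
  using profile_majorant[OF f ab(1,4)] by metis
 have c: "continuous_on (UNIV \<times> closure S \<times> {0<..<T}) (\<lambda>(x, \<eta>, t). f x \<eta> t)"
  using f by (simp add: profile_def)
 have \<eta>': "\<eta> \<in> closure S" using \<eta> closure_subset by blast
 have sub: "{a<..<b} \<subseteq> {0<..<T}" using ab by auto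
 show ?thesis
 proof (rule nice_family_fourier_derivative[of "{a<..<b}"])
  show "nice_family {a<..<b} (\<lambda>t x. f x \<eta> t)"
   unfolding nice_family_def
  proof (intro conjI allI ballI exI[of _ g])
   show "continuous_on {a<..<b} (\<lambda>t. f x \<eta> t)" for x
    using continuous_on_slices(3)[OF c \<eta>'] sub by (rule continuous_on_subset)
   show "continuous_on UNIV (\<lambda>x. f x \<eta> t)" if "t \<in> {a<..<b}" for t
    using continuous_on_slices(1)[OF c \<eta>'] sub that by blast
   show "\<bar>f x \<eta> t\<bar> \<le> g x" if "t \<in> {a<..<b}" for x t
    using g(2)[OF \<eta>', of t x] that by simp
  qed (rule g)
  show "nice_family {a<..<b} (\<lambda>t x. pd3 f x \<eta> t)"
   unfolding nice_family_def
  proof (intro conjI allI ballI exI[of _ g])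
   show "continuous_on {a<..<b} (\<lambda>t. pd3 f x \<eta> t)" for x
    using continuous_on_slices(3)[OF profile_pd_continuous(3)[OF f] \<eta>] sub by (rule continuous_on_subset)
   show "continuous_on UNIV (\<lambda>x. pd3 f x \<eta> t)" if "t \<in> {a<..<b}" for t
    using continuous_on_slices(1)[OF profile_pd_continuous(3)[OF f] \<eta>] sub that by blast
   show "\<bar>pd3 f x \<eta> t\<bar> \<le> g x" if "t \<in> {a<..<b}" for x t
    using g(3)[OF \<eta>, of t x] that by simp
  qed (rule g)
  show "((\<lambda>t. f x \<eta> t) has_real_derivative pd3 f x \<eta> t) (at t)" if "t \<in> {a<..<b}" for t x
   using profile_partial_derivatives(3)[OF f \<eta>, of t] sub that by (auto simp: has_real_derivative_iff_has_vector_derivative)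
 qed (use ab in auto)
qed

text \<open>The same facts for the components of vector fields.\<close>

lemma pd_component:
 fixes f :: "(real^'n) field"
 assumes f: "profile S T f" and y: "y \<in> S" and t: "t \<in> {0<..<T}"
 shows "pd1 (\<lambda>x y t. f x y t $ j) x y t = pd1 f x y t $ j" (is ?thesis1)
  and "pd2 (\<lambda>x y t. f x y t $ j) x y t = pd2 f x y t $ j" (is ?thesis2)
  and "pd3 (\<lambda>x y t. f x y t $ j) x y t = pd3 f x y t $ j" (is ?thesis3)
proof -
 note d = profile_partial_derivatives[OF f y t, THEN bounded_linear.has_vector_derivative[OF bounded_linear_vec_nth[of j]]]
 show ?thesis1
  using d(1) unfolding pd1_def[of "\<lambda>x y t. f x y t $ j"] by (rule vector_derivative_at)
 show ?thesis2
  using d(2) unfolding pd2_def[of "\<lambda>x y t. f x y t $ j"] by (rule vector_derivative_at)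
 show ?thesis3
  using d(3) unfolding pd3_def[of "\<lambda>x y t. f x y t $ j"] by (rule vector_derivative_at)
qed

lemma profile_component:
 fixes f :: "(real^'n) field"
 assumes f: "profile S T f"
 shows "profile S T (\<lambda>\<theta> y t. f \<theta> y t $ j)"
proof -
 obtain D where D: "\<And>p. p \<in> UNIV \<times> S \<times> {0<..<T} \<Longrightarrow> ((\<lambda>(\<theta>, y, t). f \<theta> y t) has_derivative blinfun_apply (D p)) (at p)"
  and c: "continuous_on (UNIV \<times> S \<times> {0<..<T}) D"
  using f unfolding profile_def C1_on_def by blast
 define N where "N = Blinfun (\<lambda>x::real^'n. x $ j)"
 have N: "blinfun_apply N = (\<lambda>x. x $ j)"
  unfolding N_def by (rule bounded_linear_Blinfun_apply[OF bounded_linear_vec_nth])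
 have "C1_on (\<lambda>(\<theta>, y, t). f \<theta> y t $ j) (UNIV \<times> S \<times> {0<..<T})"
  unfolding C1_on_def
 proof (intro exI[of _ "\<lambda>p. N o\<^sub>L D p"] conjI ballI)
  show "continuous_on (UNIV \<times> S \<times> {0<..<T}) (\<lambda>p. N o\<^sub>L D p)" by (intro continuous_intros c)
  fix p :: "real \<times> real \<times> real" assume "p \<in> UNIV \<times> S \<times> {0<..<T}"
  note der = bounded_linear.has_derivative[OF bounded_linear_vec_nth[of j] D[OF this]]
  have "blinfun_apply (N o\<^sub>L D p) = (\<lambda>x. blinfun_apply (D p) x $ j)"
   by (rule ext) (simp add: N)
  then show "((\<lambda>(\<theta>, y, t). f \<theta> y t $ j) has_derivative blinfun_apply (N o\<^sub>L D p)) (at p)"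
   using der by (simp add: case_prod_unfold)
 qed
 moreover have "continuous_on (UNIV \<times> closure S \<times> {0<..<T}) (\<lambda>(\<theta>, y, t). f \<theta> y t $ j)"
 proof -
  have "continuous_on (UNIV \<times> closure S \<times> {0<..<T}) (\<lambda>(\<theta>, y, t). f \<theta> y t)"
   using f by (simp add: profile_def)
  then show ?thesis unfolding case_prod_unfold by (intro continuous_intros)
 qed
 moreover have "\<exists>g. integrable_majorant g \<and> (\<forall>\<theta>. \<forall>y\<in>S. \<forall>t\<in>{a..b}.
   norm (f \<theta> y t $ j) \<le> g \<theta> \<and> norm (pd1 (\<lambda>\<theta> y t. f \<theta> y t $ j) \<theta> y t) \<le> g \<theta> \<and>
   norm (pd2 (\<lambda>\<theta> y t. f \<theta> y t $ j) \<theta> y t) \<le> g \<theta> \<and> norm (pd3 (\<lambda>\<theta> y t. f \<theta> y t $ j) \<theta> y t) \<le> g \<theta>)"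
  if ab: "0 < a" "b < T" for a b
 proof -
  obtain g where g: "integrable_majorant g" "\<forall>\<theta>. \<forall>y\<in>S. \<forall>t\<in>{a..b}.
   norm (f \<theta> y t) \<le> g \<theta> \<and> norm (pd1 f \<theta> y t) \<le> g \<theta> \<and>
   norm (pd2 f \<theta> y t) \<le> g \<theta> \<and> norm (pd3 f \<theta> y t) \<le> g \<theta>"
   using f ab unfolding profile_def by blast
  show ?thesis
  proof (intro exI[of _ g] conjI g(1) allI ballI)
   fix \<theta> y t assume y: "y \<in> S" and "t \<in> {a..b}"
   then have t: "t \<in> {0<..<T}" using ab by auto
   note le = g(2)[rule_format, OF y \<open>t \<in> {a..b}\<close>, of \<theta>]
   show "norm (f \<theta> y t $ j) \<le> g \<theta>" "norm (pd1 (\<lambda>\<theta> y t. f \<theta> y t $ j) \<theta> y t) \<le> g \<theta>"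
    "norm (pd2 (\<lambda>\<theta> y t. f \<theta> y t $ j) \<theta> y t) \<le> g \<theta>" "norm (pd3 (\<lambda>\<theta> y t. f \<theta> y t $ j) \<theta> y t) \<le> g \<theta>"
    unfolding pd_component[OF f y t] using le by (auto intro: order_trans[OF component_le_norm_cart])
  qed
 qed
 ultimately show ?thesis unfolding profile_def by simp
qed

lemma nice_family_cong:
 assumes "nice_family S f" "\<And>p x. p \<in> S \<Longrightarrow> f p x = g p x"
 shows "nice_family S g"
 using assms unfolding nice_family_def
 by (auto cong: continuous_on_cong simp: fun_eq_iff[symmetric])

lemma field_families:
 fixes f :: "(real^'n) field"
 assumes f: "profile S T f" and t: "t \<in> {0<..<T}"
 shows "nice_family (closure S) (\<lambda>y x. f x y t $ j)"
  and "nice_family S (\<lambda>y x. pd1 f x y t $ j)"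
  and "nice_family S (\<lambda>y x. pd2 f x y t $ j)"
  and "nice_family S (\<lambda>y x. pd3 f x y t $ j)"
 using profile_families[OF profile_component[OF f, of j] t] pd_component[OF f _ t]
 by (auto elim: nice_family_cong)

lemma field_nice:
 fixes f :: "(real^'n) field"
 assumes f: "profile S T f" and t: "t \<in> {0<..<T}"
 shows "y \<in> closure S \<Longrightarrow> nice (\<lambda>x. f x y t $ j)"
  and "y \<in> S \<Longrightarrow> nice (\<lambda>x. pd1 f x y t $ j)"
  and "y \<in> S \<Longrightarrow> nice (\<lambda>x. pd2 f x y t $ j)"
  and "y \<in> S \<Longrightarrow> nice (\<lambda>x. pd3 f x y t $ j)"
 using field_families[OF f t, THEN nice_familyD] by blast+

lemma field_hat_component [simp]: "field_hat f k y t $ j = fourier (\<lambda>x. f x y t $ j) k"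
 by (simp add: field_hat_def)

lemma field_fourier:
 fixes f :: "(real^'n) field"
 assumes f: "profile S T f" and t: "t \<in> {0<..<T}"
 shows "y \<in> S \<Longrightarrow> fourier (\<lambda>x. pd1 f x y t $ j) k = \<i> * k * fourier (\<lambda>x. f x y t $ j) k"
  and "open S \<Longrightarrow> y \<in> S \<Longrightarrow> ((\<lambda>y. fourier (\<lambda>x. f x y t $ j) k) has_vector_derivative fourier (\<lambda>x. pd2 f x y t $ j) k) (at y)"
  and "y \<in> S \<Longrightarrow> ((\<lambda>t. fourier (\<lambda>x. f x y t $ j) k) has_vector_derivative fourier (\<lambda>x. pd3 f x y t $ j) k) (at t)"
 using profile_fourier_pd1[OF profile_component[OF f, of j] _ t, of y k] profile_fourier_pd2[OF profile_component[OF f, of j] _ _ t, of y k]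
  profile_fourier_pd3[OF profile_component[OF f, of j] _ t, of y k] pd_component[OF f _ t, of y j]
 by simp_all

lemma surface_families:
 assumes \<phi>: "surface_profile T \<phi>" and t: "t \<in> {0<..<T}"
 shows "nice (\<lambda>x. \<phi> x t)" (is ?thesis1) "nice (\<lambda>x. sd1 \<phi> x t)" (is ?thesis2) "nice (\<lambda>x. sd2 \<phi> x t)" (is ?thesis3)
proof -
 have p: "profile UNIV T (lift_surface \<phi>)" using \<phi> by (simp add: surface_profile_def)
 note sd = lift_surface_derivatives(3,4)[OF profile_differentiable[OF p UNIV_I t, where \<eta>=0]]
 note fam = profile_families[OF p t]
 show ?thesis1
  using nice_familyD[OF fam(1), of 0] by (simp add: lift_surface_def)
 show ?thesis2 ?thesis3
  using nice_familyD[OF fam(2), of 0] nice_familyD[OF fam(4), of 0] unfolding sd by simp_all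
qed

lemma surface_fourier:
 assumes \<phi>: "surface_profile T \<phi>" and t: "t \<in> {0<..<T}"
 shows "fourier (\<lambda>x. sd1 \<phi> x t) k = \<i> * k * surface_hat \<phi> k t" (is ?thesis1)
  and "((\<lambda>t. surface_hat \<phi> k t) has_vector_derivative surface_hat (sd2 \<phi>) k t) (at t)" (is ?thesis2)
proof -
 have p: "profile UNIV T (lift_surface \<phi>)" using \<phi> by (simp add: surface_profile_def)
 note sd = lift_surface_derivatives(3,4)[OF profile_differentiable[OF p UNIV_I t, where \<eta>=0]]
 show ?thesis1
  using profile_fourier_pd1[OF p UNIV_I t, of 0 k] unfolding sd surface_hat_def lift_surface_def[of \<phi>] .
 show ?thesis2
  using profile_fourier_pd3[OF p UNIV_I t, of 0 k] unfolding sd surface_hat_def by (simp add: lift_surface_def)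
qed

text \<open>Integrating by parts \<open>n\<close> times, the transform of a smooth profile decays faster than any power.\<close>

lemma smooth_surface_rapid:
 assumes \<phi>: "smooth_surface_profile T \<phi>" and t: "t \<in> {0<..<T}"
 shows "rapid (\<lambda>k. surface_hat \<phi> k t)"
proof -
 define f where "f = (\<lambda>n. (deriv ^^ n) (\<lambda>s. \<phi> s t))"
 have dif: "f n differentiable_on UNIV" for n
  using \<phi> t unfolding f_def smooth_surface_profile_def by blast
 have D: "(f n has_real_derivative f (Suc n) x) (at x)" for n x
  using dif[of n] unfolding f_def by (simp add: differentiable_on_def DERIV_deriv_iff_real_differentiable)
 have nice: "nice (f n)" for n
 proof -
  have "0 < t" "t < T" using t by auto
  then obtain g where "integrable_majorant g" "\<And>\<theta>. \<bar>f n \<theta>\<bar> \<le> g \<theta>"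
   using \<phi> unfolding smooth_surface_profile_def f_def by (metis atLeastAtMost_singleton singletonI)
  then show ?thesis using nice_dominated differentiable_imp_continuous_on[OF dif] by blast
 qed
 have pow: "fourier (f n) k = (\<i> * k) ^ n * surface_hat \<phi> k t" for n k
 proof (induction n)
  case 0
  then show ?case by (simp add: f_def surface_hat_def)
 next
  case (Suc n)
  then show ?case using fourier_derivative[OF nice nice D, of n k] by simp
 qed
 have "\<exists>C. \<forall>k. \<bar>k\<bar> ^ n * norm (surface_hat \<phi> k t) \<le> C" for n
  using fourier_bound[of "f n"] unfolding pow by (auto simp: norm_mult norm_power)
 note bound = this
 show ?thesis
  unfolding rapid_def
 proof (intro conjI allI)
  show "continuous_on UNIV (\<lambda>k. surface_hat \<phi> k t)"
   using fourier_continuous[OF nice[of 0]] by (simp add: f_def surface_hat_def)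
  fix n
  obtain C0 Cn where C: "\<And>k. \<bar>k\<bar> ^ 0 * norm (surface_hat \<phi> k t) \<le> C0" "\<And>k. \<bar>k\<bar> ^ n * norm (surface_hat \<phi> k t) \<le> Cn"
   using bound by metis
  have "(1 + \<bar>k\<bar>) ^ n * norm (surface_hat \<phi> k t) \<le> 2 ^ n * (C0 + Cn)" for k
  proof -
   have "(1 + \<bar>k\<bar>) ^ n \<le> (2 * max 1 \<bar>k\<bar>) ^ n" by (intro power_mono) auto
   also have "\<dots> \<le> 2 ^ n * (1 + \<bar>k\<bar> ^ n)" by (auto simp: power_mult_distrib max_def)
   finally have "(1 + \<bar>k\<bar>) ^ n * norm (surface_hat \<phi> k t) \<le> 2 ^ n * (1 + \<bar>k\<bar> ^ n) * norm (surface_hat \<phi> k t)"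
    by (rule mult_right_mono) simp
   also have "\<dots> = 2 ^ n * (\<bar>k\<bar> ^ 0 * norm (surface_hat \<phi> k t) + \<bar>k\<bar> ^ n * norm (surface_hat \<phi> k t))"
    by (simp add: algebra_simps)
   also have "\<dots> \<le> 2 ^ n * (C0 + Cn)" using C[of k] by (intro mult_left_mono add_mono) auto
   finally show ?thesis .
  qed
  then show "\<exists>C. \<forall>k. (1 + \<bar>k\<bar>) ^ n * norm (surface_hat \<phi> k t) \<le> C" by blast
 qed
qed

section \<open>The equations after Fourier transformation\<close>

lemma exhaust_5: fixes x :: 5 shows "x = 1 \<or> x = 2 \<or> x = 3 \<or> x = 4 \<or> x = 5"
proof (induct x)
 case (of_int z)
 then have "z = 0 \<or> z = 1 \<or> z = 2 \<or> z = 3 \<or> z = 4" by fastforce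
 then show ?case by auto
qed

lemma forall_5: "(\<forall>i::5. P i) \<longleftrightarrow> P 1 \<and> P 2 \<and> P 3 \<and> P 4 \<and> P 5"
 by (metis exhaust_5)

lemma UNIV_5: "UNIV = {1, 2, 3, 4, 5::5}"
 using exhaust_5 by auto

lemma sum_5: "sum f (UNIV::5 set) = f 1 + f 2 + f 3 + f 4 + f 5"
 unfolding UNIV_5 by (simp add: ac_simps)

lemma nice_zero_iff:
 assumes "nice h" shows "(\<forall>x. h x = 0) \<longleftrightarrow> (\<forall>k. k \<noteq> 0 \<longrightarrow> fourier h k = 0)"
proof
 assume "\<forall>x. h x = 0"
 then have "h = (\<lambda>x. 0)" by auto
 then show "\<forall>k. k \<noteq> 0 \<longrightarrow> fourier h k = 0" by simp
next
 assume "\<forall>k. k \<noteq> 0 \<longrightarrow> fourier h k = 0"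
 then show "\<forall>x. h x = 0" using fourier_injective[OF assms nice_zero] by auto
qed

definition plasma_hat_system :: "real \<Rightarrow> real \<Rightarrow> real \<Rightarrow> (real^5) field \<Rightarrow> (real^5) field \<Rightarrow> real field \<Rightarrow> bool" where
 "plasma_hat_system m b T U p r \<longleftrightarrow> (\<forall>t\<in>{0<..<T}. \<forall>k. k \<noteq> 0 \<longrightarrow> (\<forall>\<eta>>0.
  (let u = field_hat U k \<eta> t; y = field_hat (pd2 U) k \<eta> t; f = field_hat p k \<eta> t in
   \<i> * k * (u$5 - m * u$1 - b * u$3) + f$1 = 0 \<and> y$5 - \<i> * k * (m * u$2 + b * u$4) + f$2 = 0 \<and>
   - (\<i> * k * (m * u$3 + b * u$1)) + f$3 = 0 \<and> - (\<i> * k * (m * u$4 + b * u$2)) + f$4 = 0 \<and>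
   \<i> * k * u$1 + y$2 + f$5 = 0 \<and> \<i> * k * u$3 + y$4 + fourier (\<lambda>x. r x \<eta> t) k = 0)))"

definition vacuum_hat_system :: "real \<Rightarrow> real \<Rightarrow> real \<Rightarrow> (real^3) field \<Rightarrow> (real^4) field \<Rightarrow> bool" where
 "vacuum_hat_system \<nu> lam T V p \<longleftrightarrow> (\<forall>t\<in>{0<..<T}. \<forall>k. k \<noteq> 0 \<longrightarrow> (\<forall>\<eta><0.
  (let h = field_hat V k \<eta> t; y = field_hat (pd2 V) k \<eta> t; f = field_hat p k \<eta> t in
   y$3 - \<i> * k * (complex_of_real \<nu> * complex_of_real lam) * h$1 + f$1 = 0 \<and> - (\<i> * k * (h$3 + complex_of_real \<nu> * complex_of_real lam * h$2)) + f$2 = 0 \<and>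
   y$1 - \<i> * k * (h$2 + complex_of_real \<nu> * complex_of_real lam * h$3) + f$3 = 0 \<and> \<i> * k * h$1 + y$2 + f$4 = 0)))"

definition jump_hat_system ::
 "real \<Rightarrow> real \<Rightarrow> real \<Rightarrow> real \<Rightarrow> real \<Rightarrow> real \<Rightarrow> (real^5) field \<Rightarrow> (real^3) field \<Rightarrow> surface \<Rightarrow> (real \<Rightarrow> real \<Rightarrow> real^5) \<Rightarrow> bool" where
 "jump_hat_system \<nu> v0 B0 H0 lam T U V \<phi> j \<longleftrightarrow> (\<forall>t\<in>{0<..<T}. \<forall>k. k \<noteq> 0 \<longrightarrow>
  (let u = field_hat U k 0 t; h = field_hat V k 0 t; s = \<i> * k * surface_hat \<phi> k t; f = (\<lambda>i. fourier (\<lambda>x. j x t $ i) k) in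
   complex_of_real (lam - v0) * s + u$2 = f 1 \<and> B0 * s - u$4 = f 2 \<and> H0 * s - h$2 = f 3 \<and>
   u$5 - H0 * h$1 = f 4 \<and> h$3 + complex_of_real \<nu> * complex_of_real lam * complex_of_real H0 * s = f 5))"

text \<open>
  The slices of profile and forcing are continuous and integrable, so the equations may be tested on their transforms.
\<close>

lemma plasma_system_iff_hat:
 assumes U: "profile {0<..} T U"
  and p: "\<And>\<eta> t j. \<eta> > 0 \<Longrightarrow> t \<in> {0<..<T} \<Longrightarrow> nice (\<lambda>x. p x \<eta> t $ j)"
  and r: "\<And>\<eta> t. \<eta> > 0 \<Longrightarrow> t \<in> {0<..<T} \<Longrightarrow> nice (\<lambda>x. r x \<eta> t)"
 shows "plasma_system m b T U p r \<longleftrightarrow> plasma_hat_system m b T U p r"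
proof -
 have "(\<forall>x. (let X = pd1 U x \<eta> t; Y = pd2 U x \<eta> t; f = p x \<eta> t in
   X$5 - m * X$1 - b * X$3 + f$1 = 0 \<and> Y$5 - m * X$2 - b * X$4 + f$2 = 0 \<and>
   - m * X$3 - b * X$1 + f$3 = 0 \<and> - m * X$4 - b * X$2 + f$4 = 0 \<and>
   X$1 + Y$2 + f$5 = 0 \<and> X$3 + Y$4 + r x \<eta> t = 0)) \<longleftrightarrow>
  (\<forall>k. k \<noteq> 0 \<longrightarrow> (let u = field_hat U k \<eta> t; y = field_hat (pd2 U) k \<eta> t; f = field_hat p k \<eta> t in
   \<i> * k * (u$5 - m * u$1 - b * u$3) + f$1 = 0 \<and> y$5 - \<i> * k * (m * u$2 + b * u$4) + f$2 = 0 \<and>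
   - (\<i> * k * (m * u$3 + b * u$1)) + f$3 = 0 \<and> - (\<i> * k * (m * u$4 + b * u$2)) + f$4 = 0 \<and>
   \<i> * k * u$1 + y$2 + f$5 = 0 \<and> \<i> * k * u$3 + y$4 + fourier (\<lambda>x. r x \<eta> t) k = 0))"
  if t: "t \<in> {0<..<T}" and \<eta>: "\<eta> > 0" for t \<eta>
 proof -
  have S: "\<eta> \<in> {0<..}" using \<eta> by simp
  note n = field_nice(2,3)[OF U t S] p[OF \<eta> t] r[OF \<eta> t]
  note F = field_fourier(1)[OF U t S]
  let ?E = "\<lambda>i x. [pd1 U x \<eta> t$5 - m * pd1 U x \<eta> t$1 - b * pd1 U x \<eta> t$3 + p x \<eta> t$1,
   pd2 U x \<eta> t$5 - m * pd1 U x \<eta> t$2 - b * pd1 U x \<eta> t$4 + p x \<eta> t$2,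
   - m * pd1 U x \<eta> t$3 - b * pd1 U x \<eta> t$1 + p x \<eta> t$3,
   - m * pd1 U x \<eta> t$4 - b * pd1 U x \<eta> t$2 + p x \<eta> t$4,
   pd1 U x \<eta> t$1 + pd2 U x \<eta> t$2 + p x \<eta> t$5,
   pd1 U x \<eta> t$3 + pd2 U x \<eta> t$4 + r x \<eta> t] ! i"
  have nE: "\<forall>i<6. nice (?E i)"
   unfolding all_less_6 by (simp, intro conjI nice_intros n)
  have "(\<forall>x. \<forall>i<6. ?E i x = 0) \<longleftrightarrow> (\<forall>k. k \<noteq> 0 \<longrightarrow> (\<forall>i<6. fourier (?E i) k = 0))"
   using nice_zero_iff nE by blast
  then show ?thesis
   unfolding all_less_6 Let_def
   by (simp add: fourier_add fourier_diff fourier_uminus fourier_cmult nice_intros n F algebra_simps)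
 qed
 then show ?thesis
  unfolding plasma_system_def plasma_hat_system_def by blast
qed

lemma vacuum_system_iff_hat:
 assumes V: "profile {..<0} T V"
  and p: "\<And>\<eta> t j. \<eta> < 0 \<Longrightarrow> t \<in> {0<..<T} \<Longrightarrow> nice (\<lambda>x. p x \<eta> t $ j)"
 shows "vacuum_system \<nu> lam T V p \<longleftrightarrow> vacuum_hat_system \<nu> lam T V p"
proof -
 have "(\<forall>x. (let X = pd1 V x \<eta> t; Y = pd2 V x \<eta> t; f = p x \<eta> t in
   Y$3 - \<nu> * lam * X$1 + f$1 = 0 \<and> - X$3 - \<nu> * lam * X$2 + f$2 = 0 \<and>
   Y$1 - X$2 - \<nu> * lam * X$3 + f$3 = 0 \<and> X$1 + Y$2 + f$4 = 0)) \<longleftrightarrow>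
  (\<forall>k. k \<noteq> 0 \<longrightarrow> (let h = field_hat V k \<eta> t; y = field_hat (pd2 V) k \<eta> t; f = field_hat p k \<eta> t in
   y$3 - \<i> * k * (complex_of_real \<nu> * complex_of_real lam) * h$1 + f$1 = 0 \<and> - (\<i> * k * (h$3 + complex_of_real \<nu> * complex_of_real lam * h$2)) + f$2 = 0 \<and>
   y$1 - \<i> * k * (h$2 + complex_of_real \<nu> * complex_of_real lam * h$3) + f$3 = 0 \<and> \<i> * k * h$1 + y$2 + f$4 = 0))"
  if t: "t \<in> {0<..<T}" and \<eta>: "\<eta> < 0" for t \<eta>
 proof -
  have S: "\<eta> \<in> {..<0}" using \<eta> by simp
  note n = field_nice(2,3)[OF V t S] p[OF \<eta> t]
  note F = field_fourier(1)[OF V t S]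
  let ?E = "\<lambda>i x. [pd2 V x \<eta> t$3 - (\<nu> * lam) * pd1 V x \<eta> t$1 + p x \<eta> t$1,
   - pd1 V x \<eta> t$3 - (\<nu> * lam) * pd1 V x \<eta> t$2 + p x \<eta> t$2,
   pd2 V x \<eta> t$1 - pd1 V x \<eta> t$2 - (\<nu> * lam) * pd1 V x \<eta> t$3 + p x \<eta> t$3,
   pd1 V x \<eta> t$1 + pd2 V x \<eta> t$2 + p x \<eta> t$4] ! i"
  have nE: "\<forall>i<4. nice (?E i)"
   unfolding all_less_4 by (simp, intro conjI nice_intros n)
  have "(\<forall>x. \<forall>i<4. ?E i x = 0) \<longleftrightarrow> (\<forall>k. k \<noteq> 0 \<longrightarrow> (\<forall>i<4. fourier (?E i) k = 0))"
   using nice_zero_iff nE by blast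
  then show ?thesis
   unfolding all_less_4 Let_def
   by (simp add: fourier_add fourier_diff fourier_uminus fourier_cmult nice_intros n F algebra_simps)
 qed
 then show ?thesis
  unfolding vacuum_system_def vacuum_hat_system_def by blast
qed

lemma jump_system_iff_hat:
 assumes U: "profile {0<..} T U" and V: "profile {..<0} T V" and \<phi>: "surface_profile T \<phi>"
  and j: "\<And>t i. t \<in> {0<..<T} \<Longrightarrow> nice (\<lambda>x. j x t $ i)"
 shows "jump_system \<nu> v0 B0 H0 lam T U V \<phi> j \<longleftrightarrow> jump_hat_system \<nu> v0 B0 H0 lam T U V \<phi> j"
proof -
 have "(\<forall>x. (let u = U x 0 t; h = V x 0 t; s = sd1 \<phi> x t; f = j x t in
   (lam - v0) * s + u$2 = f$1 \<and> B0 * s - u$4 = f$2 \<and> H0 * s - h$2 = f$3 \<and>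
   u$5 - H0 * h$1 = f$4 \<and> h$3 + \<nu> * lam * H0 * s = f$5)) \<longleftrightarrow>
  (\<forall>k. k \<noteq> 0 \<longrightarrow> (let u = field_hat U k 0 t; h = field_hat V k 0 t; s = \<i> * k * surface_hat \<phi> k t; f = (\<lambda>i. fourier (\<lambda>x. j x t $ i) k) in
   complex_of_real (lam - v0) * s + u$2 = f 1 \<and> B0 * s - u$4 = f 2 \<and> H0 * s - h$2 = f 3 \<and>
   u$5 - H0 * h$1 = f 4 \<and> h$3 + complex_of_real \<nu> * complex_of_real lam * complex_of_real H0 * s = f 5))"
  if t: "t \<in> {0<..<T}" for t
 proof -
  have S: "(0::real) \<in> closure {0<..}" "(0::real) \<in> closure {..<0}" by simp_all
  note n = field_nice(1)[OF U t S(1)] field_nice(1)[OF V t S(2)] surface_families(2)[OF \<phi> t] j[OF t]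
  note F = surface_fourier(1)[OF \<phi> t]
  let ?E = "\<lambda>i x. [(lam - v0) * sd1 \<phi> x t + U x 0 t$2 - j x t$1,
   B0 * sd1 \<phi> x t - U x 0 t$4 - j x t$2, H0 * sd1 \<phi> x t - V x 0 t$2 - j x t$3,
   U x 0 t$5 - H0 * V x 0 t$1 - j x t$4, V x 0 t$3 + (\<nu> * lam * H0) * sd1 \<phi> x t - j x t$5] ! i"
  have nE: "\<forall>i<5. nice (?E i)"
   unfolding all_less_5 by (simp, intro conjI nice_intros n)
  have "(\<forall>x. \<forall>i<5. ?E i x = 0) \<longleftrightarrow> (\<forall>k. k \<noteq> 0 \<longrightarrow> (\<forall>i<5. fourier (?E i) k = 0))"
   using nice_zero_iff nE by blast
  then show ?thesis
   unfolding all_less_5 Let_def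
   by (simp add: fourier_add fourier_diff fourier_uminus fourier_cmult nice_intros n F algebra_simps)
 qed
 then show ?thesis
  unfolding jump_system_def jump_hat_system_def by blast
qed

section \<open>The first order terms\<close>

lemma bounded_exponential_solution:
 fixes y :: "real \<Rightarrow> complex" and c :: real
 assumes y: "continuous_on {0..} y" and D: "\<And>s. s > 0 \<Longrightarrow> (y has_vector_derivative (c * y s)) (at s)"
  and bdd: "\<And>s. s > 0 \<Longrightarrow> norm (y s) \<le> M" and \<eta>: "\<eta> \<ge> 0"
 shows "y \<eta> = of_real (exp (c * \<eta>)) * y 0" (is ?thesis1) and "c > 0 \<Longrightarrow> y \<eta> = 0"
proof -
 have D': "(y has_vector_derivative (c * y s + 0)) (at s)" if "s > 0" for s using D[OF that] by simp
 show 1: ?thesis1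
  using duhamel[OF y D' halfline_source_const \<eta>] by simp
 assume "c > 0"
 then have "y 0 = 0"
  using bounded_solution_initial_value[OF y D' halfline_source_const _ bdd] by simp
 then show "y \<eta> = 0" using 1 by simp
qed

text \<open>
  The equations hold in the open region only, while the formulas are needed on the interface as well.
\<close>

lemma eq_up_to_boundary:
 fixes f g :: "real \<Rightarrow> complex"
 assumes "continuous_on {0..} f" "continuous_on {0..} g" "\<And>s. s > 0 \<Longrightarrow> f s = g s" "y \<ge> 0"
 shows "f y = g y"
proof -
 have "continuous_on (closure {0<..}) (\<lambda>s. norm (f s - g s))"
  using assms(1,2) by (auto intro!: continuous_intros)
 then have "norm (f y - g y) \<le> 0"
  using assms(3,4) by (intro continuous_le_on_closure[of "{0<..}" "\<lambda>s. norm (f s - g s)" y 0]) auto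
 then show ?thesis by simp
qed

lemma exponential_has_derivative:
 fixes c :: complex
 shows "((\<lambda>s. c * complex_of_real (exp (\<kappa> * s))) has_vector_derivative \<kappa> * (c * of_real (exp (\<kappa> * y)))) (at y)"
proof -
 have "((\<lambda>s. complex_of_real (exp (\<kappa> * s))) has_vector_derivative of_real (\<kappa> * exp (\<kappa> * y))) (at y)"
  by (rule has_vector_derivative_of_real)
   (auto intro!: derivative_eq_intros simp: has_real_derivative_iff_has_vector_derivative[symmetric])
 from has_vector_derivative_mult_right[OF this, of c] show ?thesis by (simp add: ac_simps)
qed

lemma derivative_of_exponential:
 fixes f :: "real \<Rightarrow> complex" and \<kappa> :: real and c :: complex
 assumes "(f has_vector_derivative D) (at y)" "open S" "y \<in> S" "\<And>s. s \<in> S \<Longrightarrow> f s = c * of_real (exp (\<kappa> * s))"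
 shows "D = \<kappa> * (c * of_real (exp (\<kappa> * y)))"
proof -
 have "(f has_vector_derivative \<kappa> * (c * of_real (exp (\<kappa> * y)))) (at y)"
  using exponential_has_derivative[of c \<kappa> y] assms(2,3)
  by (rule has_vector_derivative_transform_within_open) (simp add: assms(4))
 then show ?thesis using assms(1) vector_derivative_unique_at by blast
qed

text \<open>The hypotheses on the constants that are common to both cases of the theorem.\<close>

locale surface_wave =
 fixes \<nu> v0 B0 H0 lam :: real
 assumes nu: "\<nu> > 0" and H0: "H0 \<noteq> 0"
  and phase: "phase_equation \<nu> v0 B0 H0 lam" and subluminal: "\<bar>lam\<bar> < 1 / \<nu>"
begin

abbreviation "m \<equiv> lam - v0"
abbreviation "d \<equiv> dd v0 B0 lam"
abbreviation "\<sigma> \<equiv> sigma \<nu> lam"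

lemma sigma_pos: "\<sigma> > 0" and sigma_sq: "\<sigma>\<^sup>2 = 1 - \<nu>\<^sup>2 * lam\<^sup>2" (is ?thesis2)
proof -
 have "\<bar>\<nu> * lam\<bar> < 1" using subluminal nu by (simp add: abs_mult field_simps)
 then have "(\<nu> * lam)\<^sup>2 < 1" by (simp add: abs_square_less_1)
 then have "1 - \<nu>\<^sup>2 * lam\<^sup>2 > 0" by (simp add: power_mult_distrib)
 then show "\<sigma> > 0" ?thesis2 by (simp_all add: sigma_def)
qed

lemma d_eq: "d = m\<^sup>2 - B0\<^sup>2" and d_phase: "d = H0\<^sup>2 * \<sigma>"
 using phase by (simp_all add: dd_def phase_equation_def)

lemma d_pos: "d > 0"
 unfolding d_phase using H0 sigma_pos by simp

lemma m_nonzero: "m \<noteq> 0"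
proof
 assume "m = 0"
 with d_eq d_pos show False by (simp add: not_less[symmetric])
qed

end

text \<open>
 The first order terms written with multipliers, without distinguishing the sign of \<open>k\<close>.
\<close>

definition first_order_multipliers ::
 "real \<Rightarrow> real \<Rightarrow> real \<Rightarrow> real \<Rightarrow> real \<Rightarrow> real \<Rightarrow> (real^5) field \<Rightarrow> (real^3) field \<Rightarrow> surface \<Rightarrow> bool" where
 "first_order_multipliers \<nu> v0 B0 H0 lam T U1 V1 \<phi>1 \<longleftrightarrow>
  (\<forall>t\<in>{0<..<T}. \<forall>k. k \<noteq> 0 \<longrightarrow> (let m = lam - v0; w = surface_hat \<phi>1 k t in
   (\<forall>y\<ge>0. let u = field_hat U1 k y t; e = complex_of_real (exp (- (\<bar>k\<bar> * y))) in
    u$1 = - complex_of_real (m * \<bar>k\<bar>) * w * e \<and> u$2 = - (\<i> * complex_of_real (m * k)) * w * e \<and> u$3 = complex_of_real (B0 * \<bar>k\<bar>) * w * e \<and>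
    u$4 = \<i> * complex_of_real (B0 * k) * w * e \<and> u$5 = - complex_of_real (dd v0 B0 lam * \<bar>k\<bar>) * w * e) \<and>
   (\<forall>y\<le>0. let h = field_hat V1 k y t; e = complex_of_real (exp (sigma \<nu> lam * \<bar>k\<bar> * y)) in
    h$1 = - complex_of_real (H0 * sigma \<nu> lam * \<bar>k\<bar>) * w * e \<and> h$2 = \<i> * complex_of_real (H0 * k) * w * e \<and>
    h$3 = - (\<i> * complex_of_real (H0 * \<nu> * lam * k)) * w * e)))"

lemma first_order_terms_iff:
 "first_order_terms \<nu> v0 B0 H0 lam T U1 V1 \<phi>1 \<longleftrightarrow> first_order_multipliers \<nu> v0 B0 H0 lam T U1 V1 \<phi>1"
proof -
 have eqU: "field_hat U1 k y t =
    (if k > 0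
    then (- (of_real (\<bar>k\<bar> * exp (- k * y)) * surface_hat \<phi>1 k t)) *s R_vec v0 B0 lam
    else (- (of_real (\<bar>k\<bar> * exp (k * y)) * surface_hat \<phi>1 k t)) *s cnj_vec (R_vec v0 B0 lam)) \<longleftrightarrow>
   (let m = lam - v0; w = surface_hat \<phi>1 k t; u = field_hat U1 k y t; e = complex_of_real (exp (- (\<bar>k\<bar> * y))) in
    u$1 = - complex_of_real (m * \<bar>k\<bar>) * w * e \<and> u$2 = - (\<i> * complex_of_real (m * k)) * w * e \<and> u$3 = complex_of_real (B0 * \<bar>k\<bar>) * w * e \<and>
    u$4 = \<i> * complex_of_real (B0 * k) * w * e \<and> u$5 = - complex_of_real (dd v0 B0 lam * \<bar>k\<bar>) * w * e)" if "k \<noteq> 0" for k y t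
  using that unfolding vec_eq_iff forall_5 Let_def R_vec_def cnj_vec_def
  by (cases "k > 0") (simp_all add: ac_simps del: minus_diff_eq)
 have eqV: "field_hat V1 k y t =
    (of_real (H0 * exp (sigma \<nu> lam * \<bar>k\<bar> * y)) * surface_hat \<phi>1 k t) *s
     vector [of_real (- (sigma \<nu> lam * \<bar>k\<bar>)), \<i> * k, - (\<i> * \<nu> * lam * k)] \<longleftrightarrow>
   (let w = surface_hat \<phi>1 k t; h = field_hat V1 k y t; e = complex_of_real (exp (sigma \<nu> lam * \<bar>k\<bar> * y)) in
    h$1 = - complex_of_real (H0 * sigma \<nu> lam * \<bar>k\<bar>) * w * e \<and> h$2 = \<i> * complex_of_real (H0 * k) * w * e \<and>
    h$3 = - (\<i> * complex_of_real (H0 * \<nu> * lam * k)) * w * e)" for k y t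
  unfolding vec_eq_iff forall_3 Let_def by (simp add: ac_simps)
 show ?thesis
  unfolding first_order_terms_def first_order_multipliers_def Let_def
  by (intro ball_cong refl iff_allI imp_cong conj_cong eqU[unfolded Let_def] eqV[unfolded Let_def])
qed

lemma field_eta_halfline:
 fixes U :: "(real^'n) field"
 assumes U: "profile {0<..} T U" and t: "t \<in> {0<..<T}"
 shows "continuous_on {0..} (\<lambda>y. field_hat U k y t $ j)"
  and "\<exists>M. \<forall>y>0. norm (field_hat U k y t $ j) \<le> M"
  and "y > 0 \<Longrightarrow> ((\<lambda>y. field_hat U k y t $ j) has_vector_derivative field_hat (pd2 U) k y t $ j) (at y)"
 using nice_family_fourier_continuous[OF field_families(1)[OF U t], of j k]
  nice_family_fourier_bound[OF field_families(1)[OF U t], of j] field_fourier(2)[OF U t, of y j k]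
 by (auto intro: less_imp_le)

lemma reflect_has_derivative:
 fixes f :: "real \<Rightarrow> complex"
 assumes "(f has_vector_derivative D) (at (- s))"
 shows "((\<lambda>s. f (- s)) has_vector_derivative - D) (at s)"
proof -
 have "((\<lambda>s. - s) has_vector_derivative - 1) (at s)" by (auto intro!: derivative_eq_intros)
 from vector_diff_chain_at[OF this, of f D] assms show ?thesis by (simp add: o_def)
qed

text \<open>The vacuum is reflected, \<open>s = - \<eta>\<close>, to use the same half line as in the plasma.\<close>

lemma field_eta_reflected:
 fixes V :: "(real^'n) field"
 assumes V: "profile {..<0} T V" and t: "t \<in> {0<..<T}"
 shows "continuous_on {0..} (\<lambda>s. field_hat V k (- s) t $ j)" (is ?thesis1)
  and "\<exists>M. \<forall>s>0. norm (field_hat V k (- s) t $ j) \<le> M" (is ?thesis2)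
  and "s > 0 \<Longrightarrow> ((\<lambda>s. field_hat V k (- s) t $ j) has_vector_derivative - field_hat (pd2 V) k (- s) t $ j) (at s)"
proof -
 have "continuous_on {..0} (\<lambda>y. fourier (\<lambda>x. V x y t $ j) k)"
  using nice_family_fourier_continuous[OF field_families(1)[OF V t], of j k] by simp
 then have "continuous_on {0..} (\<lambda>s. (\<lambda>y. fourier (\<lambda>x. V x y t $ j) k) (- s))"
  by (rule continuous_on_compose2) (auto intro!: continuous_intros)
 then show ?thesis1
  by simp
 show ?thesis2
 proof -
  obtain M where "\<forall>p\<in>closure {..<0}. \<forall>k. norm (fourier (\<lambda>x. V x p t $ j) k) \<le> M"
   using nice_family_fourier_bound[OF field_families(1)[OF V t], of j] by blast
  then show ?thesis by (intro exI[of _ M]) simp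
 qed
 assume "s > 0"
 then show "((\<lambda>s. field_hat V k (- s) t $ j) has_vector_derivative - field_hat (pd2 V) k (- s) t $ j) (at s)"
  using reflect_has_derivative[OF field_fourier(2)[OF V t, of "- s" j k]] by simp
qed

lemma plasma_hat_systemD:
 assumes "plasma_hat_system m b T U p r" "t \<in> {0<..<T}" "k \<noteq> 0" "y > 0"
 shows "\<i> * k * (field_hat U k y t $ 5 - m * field_hat U k y t $ 1 - b * field_hat U k y t $ 3) + field_hat p k y t $ 1 = 0"
  and "field_hat (pd2 U) k y t $ 5 - \<i> * k * (m * field_hat U k y t $ 2 + b * field_hat U k y t $ 4) + field_hat p k y t $ 2 = 0"
  and "- (\<i> * k * (m * field_hat U k y t $ 3 + b * field_hat U k y t $ 1)) + field_hat p k y t $ 3 = 0"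
  and "- (\<i> * k * (m * field_hat U k y t $ 4 + b * field_hat U k y t $ 2)) + field_hat p k y t $ 4 = 0"
  and "\<i> * k * field_hat U k y t $ 1 + field_hat (pd2 U) k y t $ 2 + field_hat p k y t $ 5 = 0"
  and "\<i> * k * field_hat U k y t $ 3 + field_hat (pd2 U) k y t $ 4 + fourier (\<lambda>x. r x y t) k = 0"
 using assms unfolding plasma_hat_system_def Let_def by blast+

lemma vacuum_hat_systemD:
 assumes "vacuum_hat_system \<nu> lam T V p" "t \<in> {0<..<T}" "k \<noteq> 0" "y < 0"
 shows "field_hat (pd2 V) k y t $ 3 - \<i> * k * (complex_of_real \<nu> * complex_of_real lam) * field_hat V k y t $ 1 + field_hat p k y t $ 1 = 0"
  and "- (\<i> * k * (field_hat V k y t $ 3 + complex_of_real \<nu> * complex_of_real lam * field_hat V k y t $ 2)) + field_hat p k y t $ 2 = 0"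
  and "field_hat (pd2 V) k y t $ 1 - \<i> * k * (field_hat V k y t $ 2 + complex_of_real \<nu> * complex_of_real lam * field_hat V k y t $ 3) + field_hat p k y t $ 3 = 0"
  and "\<i> * k * field_hat V k y t $ 1 + field_hat (pd2 V) k y t $ 2 + field_hat p k y t $ 4 = 0"
 using assms unfolding vacuum_hat_system_def Let_def by blast+

lemma jump_hat_systemD:
 assumes "jump_hat_system \<nu> v0 B0 H0 lam T U V \<phi> j" "t \<in> {0<..<T}" "k \<noteq> 0"
 shows "complex_of_real (lam - v0) * (\<i> * k * surface_hat \<phi> k t) + field_hat U k 0 t $ 2 = fourier (\<lambda>x. j x t $ 1) k"
  and "B0 * (\<i> * k * surface_hat \<phi> k t) - field_hat U k 0 t $ 4 = fourier (\<lambda>x. j x t $ 2) k"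
  and "H0 * (\<i> * k * surface_hat \<phi> k t) - field_hat V k 0 t $ 2 = fourier (\<lambda>x. j x t $ 3) k"
  and "field_hat U k 0 t $ 5 - H0 * field_hat V k 0 t $ 1 = fourier (\<lambda>x. j x t $ 4) k"
  and "field_hat V k 0 t $ 3 + complex_of_real \<nu> * complex_of_real lam * complex_of_real H0 * (\<i> * k * surface_hat \<phi> k t) = fourier (\<lambda>x. j x t $ 5) k"
 using assms unfolding jump_hat_system_def Let_def by blast+

lemma first_order_multipliersD:
 assumes "first_order_multipliers \<nu> v0 B0 H0 lam T U V \<phi>" "t \<in> {0<..<T}" "k \<noteq> 0"
 shows "y \<ge> 0 \<Longrightarrow> field_hat U k y t $ 1 = - complex_of_real ((lam - v0) * \<bar>k\<bar>) * surface_hat \<phi> k t * of_real (exp (- (\<bar>k\<bar> * y)))"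
  and "y \<ge> 0 \<Longrightarrow> field_hat U k y t $ 2 = - (\<i> * complex_of_real ((lam - v0) * k)) * surface_hat \<phi> k t * of_real (exp (- (\<bar>k\<bar> * y)))"
  and "y \<ge> 0 \<Longrightarrow> field_hat U k y t $ 3 = complex_of_real (B0 * \<bar>k\<bar>) * surface_hat \<phi> k t * of_real (exp (- (\<bar>k\<bar> * y)))"
  and "y \<ge> 0 \<Longrightarrow> field_hat U k y t $ 4 = \<i> * complex_of_real (B0 * k) * surface_hat \<phi> k t * of_real (exp (- (\<bar>k\<bar> * y)))"
  and "y \<ge> 0 \<Longrightarrow> field_hat U k y t $ 5 = - complex_of_real (dd v0 B0 lam * \<bar>k\<bar>) * surface_hat \<phi> k t * of_real (exp (- (\<bar>k\<bar> * y)))"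
  and "y \<le> 0 \<Longrightarrow> field_hat V k y t $ 1 = - complex_of_real (H0 * sigma \<nu> lam * \<bar>k\<bar>) * surface_hat \<phi> k t * of_real (exp (sigma \<nu> lam * \<bar>k\<bar> * y))"
  and "y \<le> 0 \<Longrightarrow> field_hat V k y t $ 2 = \<i> * complex_of_real (H0 * k) * surface_hat \<phi> k t * of_real (exp (sigma \<nu> lam * \<bar>k\<bar> * y))"
  and "y \<le> 0 \<Longrightarrow> field_hat V k y t $ 3 = - (\<i> * complex_of_real (H0 * \<nu> * lam * k)) * surface_hat \<phi> k t * of_real (exp (sigma \<nu> lam * \<bar>k\<bar> * y))"
 using assms unfolding first_order_multipliers_def Let_def by blast+

lemma field_hat_0: "field_hat (\<lambda>_ _ _. 0) k y t $ j = 0"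
 by simp

lemma norm_combination: "norm a \<le> A \<Longrightarrow> norm b \<le> B \<Longrightarrow> norm (a - c * b) \<le> A + norm c * B"
 for a b c :: complex
 using norm_triangle_ineq4[of a "c * b"] mult_left_mono[of "norm b" B "norm c"] by (simp add: norm_mult)

lemma complex_eq_solve: "a - b + 0 = 0 \<Longrightarrow> a = (b::complex)" "- (\<i> * k * c) + 0 = 0 \<Longrightarrow> k \<noteq> 0 \<Longrightarrow> c = 0"
 "\<i> * k * c + 0 = 0 \<Longrightarrow> k \<noteq> 0 \<Longrightarrow> c = 0" "a + b + 0 = 0 \<Longrightarrow> b = - a"
 by (auto simp: add_eq_0_iff)

context surface_wave
begin

lemma sgn_complex: "k \<noteq> 0 \<Longrightarrow> complex_of_real (sgn k) * complex_of_real (sgn k) = 1"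
 "complex_of_real \<bar>k\<bar> = complex_of_real (sgn k) * complex_of_real k"
 "complex_of_real k = complex_of_real (sgn k) * complex_of_real \<bar>k\<bar>"
 by (auto simp: sgn_if abs_if simp flip: of_real_mult)

text \<open>
 The combinations \<open>u$2 \<mp> \<i> * u$1\<close> (and \<open>h$1 \<mp> \<i> * \<sigma> * h$2\<close> in the vacuum) diagonalize the
 system; the one that grows away from the interface vanishes because the profiles are bounded.
\<close>

lemma plasma_hat_solution:
 assumes U: "profile {0<..} T U" and sys: "plasma_hat_system m B0 T U (\<lambda>_ _ _. 0) (\<lambda>_ _ _. 0)"
  and t: "t \<in> {0<..<T}" and k: "k \<noteq> 0" and \<eta>: "\<eta> \<ge> 0"
 defines "u \<equiv> \<lambda>j \<eta>. field_hat U k \<eta> t $ j" and "s \<equiv> complex_of_real (sgn k)"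
 shows "u 2 \<eta> = of_real (exp (- (\<bar>k\<bar> * \<eta>))) * u 2 0" and "u 1 \<eta> = - (\<i> * s) * u 2 \<eta>"
  and "u 3 \<eta> = - of_real (B0 / m) * u 1 \<eta>" and "u 4 \<eta> = - of_real (B0 / m) * u 2 \<eta>" and "u 5 \<eta> = of_real (d / m) * u 1 \<eta>"
proof -
 define y where "y = (\<lambda>j \<eta>. field_hat (pd2 U) k \<eta> t $ j)"
 define M b K where "M = complex_of_real m" and "b = complex_of_real B0" and "K = complex_of_real k"
 have M0: "M \<noteq> 0" and K0: "K \<noteq> 0" and d0: "complex_of_real d \<noteq> 0"
  using m_nonzero k d_pos by (auto simp: M_def K_def)
 have ss: "s * s = 1" "complex_of_real \<bar>k\<bar> = s * K" using sgn_complex[of k] k by (simp_all add: s_def K_def)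
 have dM: "complex_of_real d = M * M - b * b"
  unfolding d_eq M_def b_def by (simp add: power2_eq_square)
 have cont: "continuous_on {0..} (u j)" and D: "\<eta> > 0 \<Longrightarrow> (u j has_vector_derivative y j \<eta>) (at \<eta>)" for j \<eta>
  using field_eta_halfline(1,3)[OF U t] unfolding u_def y_def by auto
 have "\<exists>B. \<forall>j. \<forall>\<eta>>0. norm (u j \<eta>) \<le> B"
 proof -
  obtain B where "\<And>j \<eta>. \<eta> > 0 \<Longrightarrow> norm (u j \<eta>) \<le> B j"
   using field_eta_halfline(2)[OF U t, of k] unfolding u_def by metis
  then have "norm (u j \<eta>) \<le> (\<Sum>j\<in>UNIV. \<bar>B j\<bar>)" if "\<eta> > 0" for j \<eta>
   using that member_le_sum[of j UNIV "\<lambda>j. \<bar>B j\<bar>"] by (fastforce intro: order_trans)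
  then show ?thesis by blast
 qed
 then obtain B where B: "\<And>j \<eta>. \<eta> > 0 \<Longrightarrow> norm (u j \<eta>) \<le> B" by blast
 have eqs: "M * u 3 \<eta> + b * u 1 \<eta> = 0" "M * u 4 \<eta> + b * u 2 \<eta> = 0" "u 5 \<eta> = M * u 1 \<eta> + b * u 3 \<eta>"
  "y 5 \<eta> = \<i> * K * (M * u 2 \<eta> + b * u 4 \<eta>)" "y 2 \<eta> = - (\<i> * K * u 1 \<eta>)" if "\<eta> > 0" for \<eta>
 proof -
  note E = plasma_hat_systemD[OF sys t k that, unfolded field_hat_0 fourier_zero, folded u_def y_def M_def b_def K_def]
  show "M * u 3 \<eta> + b * u 1 \<eta> = 0" "M * u 4 \<eta> + b * u 2 \<eta> = 0"
   "y 5 \<eta> = \<i> * K * (M * u 2 \<eta> + b * u 4 \<eta>)" "y 2 \<eta> = - (\<i> * K * u 1 \<eta>)"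
   using complex_eq_solve(2)[OF E(3) K0] complex_eq_solve(2)[OF E(4) K0] complex_eq_solve(1)[OF E(2)] complex_eq_solve(4)[OF E(5)]
   by (simp_all add: u_def y_def M_def b_def K_def)
  have "u 5 \<eta> - M * u 1 \<eta> - b * u 3 \<eta> = 0"
   using complex_eq_solve(3)[OF E(1) K0] by (simp add: u_def M_def b_def)
  then show "u 5 \<eta> = M * u 1 \<eta> + b * u 3 \<eta>" by (simp add: algebra_simps)
 qed
 have r3: "u 3 \<eta> = - of_real (B0 / m) * u 1 \<eta>" and r4: "u 4 \<eta> = - of_real (B0 / m) * u 2 \<eta>"
  if "\<eta> > 0" for \<eta>
  using eqs(1,2)[OF that] M0 unfolding of_real_divide M_def[symmetric] b_def[symmetric]
  by (simp_all add: field_simps eq_neg_iff_add_eq_0)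
 have r5: "u 5 \<eta> = of_real (d / m) * u 1 \<eta>" if "\<eta> > 0" for \<eta>
  unfolding eqs(3)[OF that] r3[OF that] unfolding of_real_divide dM M_def[symmetric] b_def[symmetric]
  using M0 by (simp add: field_simps)
 have y1: "y 1 \<eta> = \<i> * K * u 2 \<eta>" if "\<eta> > 0" for \<eta>
 proof -
  have "(u 5 has_vector_derivative of_real (d / m) * y 1 \<eta>) (at \<eta>)"
   by (rule has_vector_derivative_transform_within_open[OF has_vector_derivative_mult_right[OF D[OF that]], of "{0<..}"])
    (use that r5 in auto)
  then have "y 5 \<eta> = of_real (d / m) * y 1 \<eta>"
   using D[OF that] vector_derivative_unique_at by blast
  also have "y 5 \<eta> = of_real (d / m) * (\<i> * K * u 2 \<eta>)"
   unfolding eqs(4)[OF that] r4[OF that] unfolding of_real_divide dM M_def[symmetric] b_def[symmetric]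
   using M0 by (simp add: field_simps)
  finally show ?thesis using d_pos m_nonzero by simp
 qed
 define g where "g = (\<lambda>\<eta>. u 2 \<eta> - \<i> * s * u 1 \<eta>)"
 have Dg: "(g has_vector_derivative \<bar>k\<bar> * g \<eta>) (at \<eta>)" if "\<eta> > 0" for \<eta>
 proof -
  have "(g has_vector_derivative y 2 \<eta> - \<i> * s * y 1 \<eta>) (at \<eta>)"
   unfolding g_def by (intro has_vector_derivative_diff has_vector_derivative_mult_right D that)
  also have "y 2 \<eta> - \<i> * s * y 1 \<eta> = \<bar>k\<bar> * g \<eta>"
   unfolding g_def y1[OF that] eqs(5)[OF that] ss(2) using ss(1) by (simp add: algebra_simps)
  finally show ?thesis .
 qed
 have g0: "g \<eta> = 0" if "\<eta> \<ge> 0" for \<eta>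
 proof (rule bounded_exponential_solution(2)[OF _ Dg _ that])
  show "continuous_on {0..} g" unfolding g_def by (intro continuous_intros cont)
  show "norm (g \<eta>) \<le> B + norm (\<i> * s) * B" if "\<eta> > 0" for \<eta>
   unfolding g_def by (intro norm_combination B that)
 qed (use k in auto)
 have u1: "u 1 \<eta> = - (\<i> * s) * u 2 \<eta>" if "\<eta> \<ge> 0" for \<eta>
  using g0[OF that] ss(1) unfolding g_def by (simp add: algebra_simps)
 show "u 1 \<eta> = - (\<i> * s) * u 2 \<eta>" by (rule u1[OF \<eta>])
 have D2: "(u 2 has_vector_derivative (- \<bar>k\<bar>) * u 2 \<eta>) (at \<eta>)" if "\<eta> > 0" for \<eta>
 proof -
  have "y 2 \<eta> = (- \<bar>k\<bar>) * u 2 \<eta>"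
   unfolding eqs(5)[OF that] u1[OF less_imp_le[OF that]] of_real_minus ss(2) using ss(1) by (simp add: algebra_simps)
  then show ?thesis using D[OF that, of 2] by simp
 qed
 show "u 2 \<eta> = of_real (exp (- (\<bar>k\<bar> * \<eta>))) * u 2 0"
  using bounded_exponential_solution(1)[OF cont D2 B \<eta>] by simp
 show "u 3 \<eta> = - of_real (B0 / m) * u 1 \<eta>"
  by (rule eq_up_to_boundary[OF cont _ r3 \<eta>]) (intro continuous_intros cont)
 show "u 4 \<eta> = - of_real (B0 / m) * u 2 \<eta>"
  by (rule eq_up_to_boundary[OF cont _ r4 \<eta>]) (intro continuous_intros cont)
 show "u 5 \<eta> = of_real (d / m) * u 1 \<eta>"
  by (rule eq_up_to_boundary[OF cont _ r5 \<eta>]) (intro continuous_intros cont)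
qed

lemma vacuum_hat_solution:
 assumes V: "profile {..<0} T V" and sys: "vacuum_hat_system \<nu> lam T V (\<lambda>_ _ _. 0)"
  and t: "t \<in> {0<..<T}" and k: "k \<noteq> 0" and \<eta>: "\<eta> \<ge> 0"
 defines "h \<equiv> \<lambda>j \<eta>. field_hat V k (- \<eta>) t $ j" and "s \<equiv> complex_of_real (sgn k)"
 shows "h 2 \<eta> = of_real (exp (- (\<sigma> * \<bar>k\<bar> * \<eta>))) * h 2 0" and "h 1 \<eta> = \<i> * \<sigma> * s * h 2 \<eta>"
  and "h 3 \<eta> = - of_real (\<nu> * lam) * h 2 \<eta>"
proof -
 define y where "y = (\<lambda>j \<eta>. field_hat (pd2 V) k (- \<eta>) t $ j)"
 define K S where "K = complex_of_real k" and "S = complex_of_real \<sigma>"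
 have K0: "K \<noteq> 0" using k by (auto simp: K_def)
 have ss: "s * s = 1" "complex_of_real \<bar>k\<bar> = s * K" using sgn_complex[of k] k by (simp_all add: s_def K_def)
 have SS: "1 - of_real (\<nu> * lam) * of_real (\<nu> * lam) = S * S"
  using arg_cong[OF sigma_sq, of complex_of_real] by (simp add: S_def power2_eq_square ac_simps)
 have cont: "continuous_on {0..} (h j)" and D: "\<eta> > 0 \<Longrightarrow> (h j has_vector_derivative - y j \<eta>) (at \<eta>)" for j \<eta>
  using field_eta_reflected(1,3)[OF V t] unfolding h_def y_def by auto
 obtain B1 where B1: "\<And>\<eta>. \<eta> > 0 \<Longrightarrow> norm (h 1 \<eta>) \<le> B1"
  using field_eta_reflected(2)[OF V t, of k 1] unfolding h_def by blast
 obtain B2 where B2: "\<And>\<eta>. \<eta> > 0 \<Longrightarrow> norm (h 2 \<eta>) \<le> B2"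
  using field_eta_reflected(2)[OF V t, of k 2] unfolding h_def by blast
 have r3: "h 3 \<eta> = - of_real (\<nu> * lam) * h 2 \<eta>" and y1: "y 1 \<eta> = \<i> * K * (h 2 \<eta> + of_real (\<nu> * lam) * h 3 \<eta>)"
  and y2: "y 2 \<eta> = - (\<i> * K * h 1 \<eta>)" if "\<eta> > 0" for \<eta>
 proof -
  have "- \<eta> < 0" using that by simp
  note E = vacuum_hat_systemD[OF sys t k this, unfolded field_hat_0]
  have "h 3 \<eta> + of_real (\<nu> * lam) * h 2 \<eta> = 0"
   using complex_eq_solve(2)[OF E(2)] k by (simp add: h_def)
  then show "h 3 \<eta> = - of_real (\<nu> * lam) * h 2 \<eta>" by (simp add: eq_neg_iff_add_eq_0)
  show "y 1 \<eta> = \<i> * K * (h 2 \<eta> + of_real (\<nu> * lam) * h 3 \<eta>)" "y 2 \<eta> = - (\<i> * K * h 1 \<eta>)"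
   using complex_eq_solve(1)[OF E(3)] complex_eq_solve(4)[OF E(4)] by (simp_all add: h_def y_def K_def)
 qed
 have y1': "y 1 \<eta> = \<i> * K * (S * S) * h 2 \<eta>" if "\<eta> > 0" for \<eta>
  unfolding y1[OF that] r3[OF that] SS[symmetric] by (simp add: algebra_simps)
 define g where "g = (\<lambda>\<eta>. h 1 \<eta> - \<i> * S * s * h 2 \<eta>)"
 have Dg: "(g has_vector_derivative (\<sigma> * \<bar>k\<bar>) * g \<eta>) (at \<eta>)" if "\<eta> > 0" for \<eta>
 proof -
  have "(g has_vector_derivative - y 1 \<eta> - \<i> * S * s * (- y 2 \<eta>)) (at \<eta>)"
   unfolding g_def by (intro has_vector_derivative_diff has_vector_derivative_mult_right D that)
  also have "- y 1 \<eta> - \<i> * S * s * (- y 2 \<eta>) = (\<sigma> * \<bar>k\<bar>) * g \<eta>"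
   unfolding g_def y1'[OF that] y2[OF that] of_real_mult ss(2) S_def[symmetric] using ss(1) by (simp add: algebra_simps)
  finally show ?thesis .
 qed
 have g0: "g \<eta> = 0" if "\<eta> \<ge> 0" for \<eta>
 proof (rule bounded_exponential_solution(2)[OF _ Dg _ that])
  show "continuous_on {0..} g" unfolding g_def by (intro continuous_intros cont)
  show "norm (g \<eta>) \<le> B1 + norm (\<i> * S * s) * B2" if "\<eta> > 0" for \<eta>
   unfolding g_def by (intro norm_combination B1 B2 that)
 qed (use k sigma_pos in auto)
 have h1: "h 1 \<eta> = \<i> * S * s * h 2 \<eta>" if "\<eta> \<ge> 0" for \<eta>
  using g0[OF that] unfolding g_def by simp
 show "h 1 \<eta> = \<i> * \<sigma> * s * h 2 \<eta>" using h1[OF \<eta>] by (simp add: S_def)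
 have D2: "(h 2 has_vector_derivative (- (\<sigma> * \<bar>k\<bar>)) * h 2 \<eta>) (at \<eta>)" if "\<eta> > 0" for \<eta>
 proof -
  have "- y 2 \<eta> = (- (\<sigma> * \<bar>k\<bar>)) * h 2 \<eta>"
   unfolding y2[OF that] h1[OF less_imp_le[OF that]] of_real_minus of_real_mult ss(2) S_def[symmetric]
   using ss(1) by (simp add: algebra_simps)
  then show ?thesis using D[OF that, of 2] by simp
 qed
 show "h 2 \<eta> = of_real (exp (- (\<sigma> * \<bar>k\<bar> * \<eta>))) * h 2 0"
  using bounded_exponential_solution(1)[OF cont D2 B2 \<eta>] by simp
 show "h 3 \<eta> = - of_real (\<nu> * lam) * h 2 \<eta>"
  by (rule eq_up_to_boundary[OF cont _ r3 \<eta>]) (intro continuous_intros cont)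
qed

text \<open>
  Boundedness leaves one mode in each region; its amplitude is fixed by the kinematic condition in the plasma
  and by the tangency of the magnetic field in the vacuum.
\<close>

lemma first_order_forward:
 assumes U: "profile {0<..} T U" and V: "profile {..<0} T V"
  and P: "plasma_hat_system m B0 T U (\<lambda>_ _ _. 0) (\<lambda>_ _ _. 0)"
  and W: "vacuum_hat_system \<nu> lam T V (\<lambda>_ _ _. 0)" and J: "jump_hat_system \<nu> v0 B0 H0 lam T U V \<phi> (\<lambda>_ _. 0)"
 shows "first_order_multipliers \<nu> v0 B0 H0 lam T U V \<phi>"
 unfolding first_order_multipliers_def Let_def
proof (intro ballI allI impI)
 fix t k :: real assume t: "t \<in> {0<..<T}" and k: "k \<noteq> 0"
 define w where "w = surface_hat \<phi> k t"
 define s K where "s = complex_of_real (sgn k)" and "K = complex_of_real k"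
 have ss: "s * s = 1" "complex_of_real \<bar>k\<bar> = s * K" using sgn_complex[of k] k by (simp_all add: s_def K_def)
 have M0: "complex_of_real m \<noteq> 0" using m_nonzero by simp
 have j: "field_hat U k 0 t $ 2 = - (\<i> * K * of_real m * w)" "field_hat V k 0 t $ 2 = \<i> * K * of_real H0 * w"
  using jump_hat_systemD(1,3)[OF J t k] unfolding w_def K_def
  by (simp_all add: eq_neg_iff_add_eq_0 add.commute mult.assoc mult.left_commute del: of_real_diff)
 have pl: "field_hat U k y t $ 1 = - complex_of_real (m * \<bar>k\<bar>) * w * of_real (exp (- (\<bar>k\<bar> * y))) \<and>
   field_hat U k y t $ 2 = - (\<i> * complex_of_real (m * k)) * w * of_real (exp (- (\<bar>k\<bar> * y))) \<and>
   field_hat U k y t $ 3 = complex_of_real (B0 * \<bar>k\<bar>) * w * of_real (exp (- (\<bar>k\<bar> * y))) \<and>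
   field_hat U k y t $ 4 = \<i> * complex_of_real (B0 * k) * w * of_real (exp (- (\<bar>k\<bar> * y))) \<and>
   field_hat U k y t $ 5 = - complex_of_real (d * \<bar>k\<bar>) * w * of_real (exp (- (\<bar>k\<bar> * y)))" if y: "y \<ge> 0" for y
 proof -
  note sol = plasma_hat_solution[OF U P t k y]
  have 2: "field_hat U k y t $ 2 = - (\<i> * complex_of_real (m * k)) * w * of_real (exp (- (\<bar>k\<bar> * y)))"
   unfolding sol(1) j(1) K_def of_real_mult by (simp del: of_real_diff field_hat_component)
  have 1: "field_hat U k y t $ 1 = - complex_of_real (m * \<bar>k\<bar>) * w * of_real (exp (- (\<bar>k\<bar> * y)))"
   unfolding sol(2) 2 of_real_mult ss(2) s_def K_def by (simp add: ac_simps del: of_real_diff field_hat_component)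
  show ?thesis
   using M0 unfolding sol(3,4,5) 1 2 of_real_mult of_real_divide
   by (simp add: field_simps del: of_real_diff field_hat_component)
 qed
 have va: "field_hat V k y t $ 1 = - complex_of_real (H0 * \<sigma> * \<bar>k\<bar>) * w * of_real (exp (\<sigma> * \<bar>k\<bar> * y)) \<and>
   field_hat V k y t $ 2 = \<i> * complex_of_real (H0 * k) * w * of_real (exp (\<sigma> * \<bar>k\<bar> * y)) \<and>
   field_hat V k y t $ 3 = - (\<i> * complex_of_real (H0 * \<nu> * lam * k)) * w * of_real (exp (\<sigma> * \<bar>k\<bar> * y))" if y: "y \<le> 0" for y
 proof -
  have "- y \<ge> 0" using y by simp
  note sol = vacuum_hat_solution[OF V W t k this]
  have 2: "field_hat V k y t $ 2 = \<i> * complex_of_real (H0 * k) * w * of_real (exp (\<sigma> * \<bar>k\<bar> * y))"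
   using sol(1) j(2) unfolding K_def by (simp add: ac_simps del: field_hat_component)
  have 1: "field_hat V k y t $ 1 = - complex_of_real (H0 * \<sigma> * \<bar>k\<bar>) * w * of_real (exp (\<sigma> * \<bar>k\<bar> * y))"
   using sol(2) unfolding minus_minus 2 of_real_mult ss(2) s_def K_def by (simp add: ac_simps del: field_hat_component)
  show ?thesis
   using sol(3) 1 2 unfolding minus_minus 2 by (simp add: ac_simps del: field_hat_component)
 qed
 show "(\<forall>y\<ge>0. field_hat U k y t $ 1 = - complex_of_real (m * \<bar>k\<bar>) * surface_hat \<phi> k t * of_real (exp (- (\<bar>k\<bar> * y))) \<and>
   field_hat U k y t $ 2 = - (\<i> * complex_of_real (m * k)) * surface_hat \<phi> k t * of_real (exp (- (\<bar>k\<bar> * y))) \<and>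
   field_hat U k y t $ 3 = complex_of_real (B0 * \<bar>k\<bar>) * surface_hat \<phi> k t * of_real (exp (- (\<bar>k\<bar> * y))) \<and>
   field_hat U k y t $ 4 = \<i> * complex_of_real (B0 * k) * surface_hat \<phi> k t * of_real (exp (- (\<bar>k\<bar> * y))) \<and>
   field_hat U k y t $ 5 = - complex_of_real (d * \<bar>k\<bar>) * surface_hat \<phi> k t * of_real (exp (- (\<bar>k\<bar> * y)))) \<and>
  (\<forall>y\<le>0. field_hat V k y t $ 1 = - complex_of_real (H0 * \<sigma> * \<bar>k\<bar>) * surface_hat \<phi> k t * of_real (exp (\<sigma> * \<bar>k\<bar> * y)) \<and>
   field_hat V k y t $ 2 = \<i> * complex_of_real (H0 * k) * surface_hat \<phi> k t * of_real (exp (\<sigma> * \<bar>k\<bar> * y)) \<and>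
   field_hat V k y t $ 3 = - (\<i> * complex_of_real (H0 * \<nu> * lam * k)) * surface_hat \<phi> k t * of_real (exp (\<sigma> * \<bar>k\<bar> * y)))"
  using pl va unfolding w_def by blast
qed

lemma first_order_pd2:
 assumes U: "profile {0<..} T U" and V: "profile {..<0} T V" and fo: "first_order_multipliers \<nu> v0 B0 H0 lam T U V \<phi>"
  and t: "t \<in> {0<..<T}" and k: "k \<noteq> 0"
 shows "y > 0 \<Longrightarrow> field_hat (pd2 U) k y t $ j = - of_real \<bar>k\<bar> * field_hat U k y t $ j"
  and "y < 0 \<Longrightarrow> field_hat (pd2 V) k y t $ i = of_real (\<sigma> * \<bar>k\<bar>) * field_hat V k y t $ i"
proof -
 assume y: "y > 0"
 obtain c where c: "\<And>y. y \<ge> 0 \<Longrightarrow> field_hat U k y t $ j = c * of_real (exp (- \<bar>k\<bar> * y))"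
  using fo t k exhaust_5[of j] unfolding first_order_multipliers_def Let_def
  by (metis (no_types, lifting) mult_minus_left)
 show "field_hat (pd2 U) k y t $ j = - of_real \<bar>k\<bar> * field_hat U k y t $ j"
  using derivative_of_exponential[OF field_eta_halfline(3)[OF U t y] open_greaterThan, where c=c and \<kappa>="- \<bar>k\<bar>"] c y
  by (simp del: field_hat_component)
next
 assume y: "y < 0"
 obtain c where c: "\<And>y. y \<le> 0 \<Longrightarrow> field_hat V k y t $ i = c * of_real (exp (\<sigma> * \<bar>k\<bar> * y))"
  using fo t k exhaust_3[of i] unfolding first_order_multipliers_def Let_def by metis
 have "((\<lambda>y. field_hat V k y t $ i) has_vector_derivative field_hat (pd2 V) k y t $ i) (at y)"
  using field_fourier(2)[OF V t, of y i k] y by simp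
 from derivative_of_exponential[OF this open_lessThan, where c=c and \<kappa>="\<sigma> * \<bar>k\<bar>"] c y
 show "field_hat (pd2 V) k y t $ i = of_real (\<sigma> * \<bar>k\<bar>) * field_hat V k y t $ i"
  by (simp del: field_hat_component)
qed

text \<open>
  The dispersion relation is what the continuity of the total pressure requires.
\<close>

lemma first_order_backward:
 assumes U: "profile {0<..} T U" and V: "profile {..<0} T V"
  and fo: "first_order_multipliers \<nu> v0 B0 H0 lam T U V \<phi>"
 shows "plasma_hat_system m B0 T U (\<lambda>_ _ _. 0) (\<lambda>_ _ _. 0)" (is ?thesis1)
  and "vacuum_hat_system \<nu> lam T V (\<lambda>_ _ _. 0)" (is ?thesis2) and "jump_hat_system \<nu> v0 B0 H0 lam T U V \<phi> (\<lambda>_ _. 0)" (is ?thesis3)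
proof -
 have kk: "complex_of_real \<bar>k\<bar> * complex_of_real \<bar>k\<bar> = complex_of_real k * complex_of_real k" for k
  by (simp flip: of_real_mult)
 have dd: "complex_of_real d = of_real m * of_real m - of_real B0 * of_real B0"
  unfolding d_eq by (simp add: power2_eq_square)
 have SS: "of_real \<sigma> * of_real \<sigma> = 1 - complex_of_real \<nu> * of_real lam * (of_real \<nu> * of_real lam)"
  using arg_cong[OF sigma_sq, of complex_of_real] by (simp add: power2_eq_square ac_simps)
 show ?thesis1
  unfolding plasma_hat_system_def Let_def
 proof (intro ballI allI impI)
  fix t k \<eta> :: real assume t: "t \<in> {0<..<T}" and k: "k \<noteq> 0" and \<eta>: "\<eta> > 0"
  define w e M b K A where "w = surface_hat \<phi> k t" and "e = complex_of_real (exp (- (\<bar>k\<bar> * \<eta>)))"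
   and "M = complex_of_real m" and "b = complex_of_real B0" and "K = complex_of_real k" and "A = complex_of_real \<bar>k\<bar>"
  have AA: "A * A = K * K" using kk by (simp add: A_def K_def)
  have AA': "A * (A * x) = K * (K * x)" for x using AA by (simp add: mult.assoc[symmetric])
  have f: "field_hat U k \<eta> t $ 1 = - (M * A) * w * e" "field_hat U k \<eta> t $ 2 = - (\<i> * (M * K)) * w * e"
   "field_hat U k \<eta> t $ 3 = (b * A) * w * e" "field_hat U k \<eta> t $ 4 = \<i> * (b * K) * w * e"
   "field_hat U k \<eta> t $ 5 = - ((M * M - b * b) * A) * w * e"
   using first_order_multipliersD(1-5)[OF fo t k less_imp_le[OF \<eta>]]
   unfolding w_def e_def M_def b_def K_def A_def of_real_mult dd by (simp_all del: of_real_diff field_hat_component)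
  note y = first_order_pd2(1)[OF U V fo t k \<eta>]
  have z: "field_hat (\<lambda>_ _ _. 0::real^5) k \<eta> t $ j = 0" for j by simp
  show "\<i> * k * (field_hat U k \<eta> t $ 5 - m * field_hat U k \<eta> t $ 1 - B0 * field_hat U k \<eta> t $ 3) + field_hat (\<lambda>_ _ _. 0::real^5) k \<eta> t $ 1 = 0 \<and>
   field_hat (pd2 U) k \<eta> t $ 5 - \<i> * k * (m * field_hat U k \<eta> t $ 2 + B0 * field_hat U k \<eta> t $ 4) + field_hat (\<lambda>_ _ _. 0::real^5) k \<eta> t $ 2 = 0 \<and>
   - (\<i> * k * (m * field_hat U k \<eta> t $ 3 + B0 * field_hat U k \<eta> t $ 1)) + field_hat (\<lambda>_ _ _. 0::real^5) k \<eta> t $ 3 = 0 \<and>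
   - (\<i> * k * (m * field_hat U k \<eta> t $ 4 + B0 * field_hat U k \<eta> t $ 2)) + field_hat (\<lambda>_ _ _. 0::real^5) k \<eta> t $ 4 = 0 \<and>
   \<i> * k * field_hat U k \<eta> t $ 1 + field_hat (pd2 U) k \<eta> t $ 2 + field_hat (\<lambda>_ _ _. 0::real^5) k \<eta> t $ 5 = 0 \<and>
   \<i> * k * field_hat U k \<eta> t $ 3 + field_hat (pd2 U) k \<eta> t $ 4 + fourier (\<lambda>\<theta>. 0) k = 0"
   unfolding y f z M_def[symmetric] b_def[symmetric] K_def[symmetric] A_def[symmetric] fourier_zero
   using AA by (simp add: algebra_simps AA')
 qed
 show ?thesis2
  unfolding vacuum_hat_system_def Let_def
 proof (intro ballI allI impI)
  fix t k \<eta> :: real assume t: "t \<in> {0<..<T}" and k: "k \<noteq> 0" and \<eta>: "\<eta> < 0"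
  define w e K A S H N L where "w = surface_hat \<phi> k t" and "e = complex_of_real (exp (\<sigma> * \<bar>k\<bar> * \<eta>))"
   and "K = complex_of_real k" and "A = complex_of_real \<bar>k\<bar>" and "S = complex_of_real \<sigma>"
   and "H = complex_of_real H0" and "N = complex_of_real \<nu>" and "L = complex_of_real lam"
  have AA: "A * A = K * K" using kk by (simp add: A_def K_def)
  have S2: "S * S = 1 - N * L * (N * L)" using SS by (simp add: S_def N_def L_def)
  have f: "field_hat V k \<eta> t $ 1 = - (H * S * A) * w * e" "field_hat V k \<eta> t $ 2 = \<i> * (H * K) * w * e"
   "field_hat V k \<eta> t $ 3 = - (\<i> * (H * N * L * K)) * w * e"
   using first_order_multipliersD(6-8)[OF fo t k less_imp_le[OF \<eta>]]
   unfolding w_def e_def K_def A_def S_def H_def N_def L_def of_real_mult by (simp_all del: of_real_diff field_hat_component)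
  note y = first_order_pd2(2)[OF U V fo t k \<eta>]
  have z: "field_hat (\<lambda>_ _ _. 0::real^4) k \<eta> t $ j = 0" for j by simp
  have e1: "S * A * (- (H * S * A) * w * e) - \<i> * K * (\<i> * (H * K) * w * e + N * L * (- (\<i> * (H * N * L * K)) * w * e)) =
    H * K * K * w * e * ((1 - N * L * (N * L)) - S * S)"
  proof -
   have "S * A * (- (H * S * A) * w * e) = - (A * A) * (S * S * H * w * e)" by (simp only: mult_minus_left mult_minus_right ac_simps)
   then have eq: "S * A * (- (H * S * A) * w * e) = - (K * K) * (S * S * H * w * e)" unfolding AA .
   show ?thesis unfolding eq by (simp add: algebra_simps)
  qed
  show "field_hat (pd2 V) k \<eta> t $ 3 - \<i> * k * (complex_of_real \<nu> * complex_of_real lam) * field_hat V k \<eta> t $ 1 + field_hat (\<lambda>_ _ _. 0::real^4) k \<eta> t $ 1 = 0 \<and>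
   - (\<i> * k * (field_hat V k \<eta> t $ 3 + complex_of_real \<nu> * complex_of_real lam * field_hat V k \<eta> t $ 2)) + field_hat (\<lambda>_ _ _. 0::real^4) k \<eta> t $ 2 = 0 \<and>
   field_hat (pd2 V) k \<eta> t $ 1 - \<i> * k * (field_hat V k \<eta> t $ 2 + complex_of_real \<nu> * complex_of_real lam * field_hat V k \<eta> t $ 3) + field_hat (\<lambda>_ _ _. 0::real^4) k \<eta> t $ 3 = 0 \<and>
   \<i> * k * field_hat V k \<eta> t $ 1 + field_hat (pd2 V) k \<eta> t $ 2 + field_hat (\<lambda>_ _ _. 0::real^4) k \<eta> t $ 4 = 0"
   unfolding y f z of_real_mult K_def[symmetric] A_def[symmetric] S_def[symmetric] N_def[symmetric] L_def[symmetric]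
   using e1 S2 AA by (auto simp: algebra_simps)
 qed
 show ?thesis3
  unfolding jump_hat_system_def Let_def
 proof (intro ballI allI impI)
  fix t k :: real assume t: "t \<in> {0<..<T}" and k: "k \<noteq> 0"
  have dp: "complex_of_real d = complex_of_real H0 * complex_of_real H0 * complex_of_real \<sigma>"
   unfolding d_phase by (simp add: power2_eq_square)
  show "complex_of_real m * (\<i> * k * surface_hat \<phi> k t) + field_hat U k 0 t $ 2 = fourier (\<lambda>\<theta>. (0::real^5) $ 1) k \<and>
   B0 * (\<i> * k * surface_hat \<phi> k t) - field_hat U k 0 t $ 4 = fourier (\<lambda>\<theta>. (0::real^5) $ 2) k \<and>
   H0 * (\<i> * k * surface_hat \<phi> k t) - field_hat V k 0 t $ 2 = fourier (\<lambda>\<theta>. (0::real^5) $ 3) k \<and>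
   field_hat U k 0 t $ 5 - H0 * field_hat V k 0 t $ 1 = fourier (\<lambda>\<theta>. (0::real^5) $ 4) k \<and>
   field_hat V k 0 t $ 3 + complex_of_real \<nu> * complex_of_real lam * complex_of_real H0 * (\<i> * k * surface_hat \<phi> k t) = fourier (\<lambda>\<theta>. (0::real^5) $ 5) k"
   using first_order_multipliersD[OF fo t k, of 0] dp
   by (simp add: ac_simps del: of_real_diff field_hat_component)
 qed
qed

end

section \<open>The quadratic forcing in the plasma\<close>

lemma pd_proportional:
 fixes U :: "(real^'n) field"
 assumes U: "profile S T U" and S: "open S"
  and eq: "\<And>x y t. y \<in> S \<Longrightarrow> t \<in> {0<..<T} \<Longrightarrow> U x y t $ j = c * U x y t $ i"
  and y: "y \<in> S" and t: "t \<in> {0<..<T}"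
 shows "pd1 U x y t $ j = c * pd1 U x y t $ i" (is ?thesis1)
  and "pd2 U x y t $ j = c * pd2 U x y t $ i" (is ?thesis2)
  and "pd3 U x y t $ j = c * pd3 U x y t $ i" (is ?thesis3)
proof -
 have d: "((\<lambda>s. U s y t $ l) has_vector_derivative pd1 U x y t $ l) (at x)"
  "((\<lambda>s. U x s t $ l) has_vector_derivative pd2 U x y t $ l) (at y)"
  "((\<lambda>s. U x y s $ l) has_vector_derivative pd3 U x y t $ l) (at t)" for l
  using profile_partial_derivatives[OF U y t, THEN bounded_linear.has_vector_derivative[OF bounded_linear_vec_nth[of l]]] by auto
 have "((\<lambda>s. U s y t $ j) has_vector_derivative c * pd1 U x y t $ i) (at x)"
  by (rule has_vector_derivative_transform_within_open[OF has_vector_derivative_mult_right[OF d(1)], of UNIV])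
   (use eq y t in auto)
 then show ?thesis1 using d(1) vector_derivative_unique_at by blast
 have "((\<lambda>s. U x s t $ j) has_vector_derivative c * pd2 U x y t $ i) (at y)"
  by (rule has_vector_derivative_transform_within_open[OF has_vector_derivative_mult_right[OF d(2)], of S])
   (use eq S y t in auto)
 then show ?thesis2 using d(2) vector_derivative_unique_at by blast
 have "((\<lambda>s. U x y s $ j) has_vector_derivative c * pd3 U x y t $ i) (at t)"
  by (rule has_vector_derivative_transform_within_open[OF has_vector_derivative_mult_right[OF d(3)], of "{0<..<T}"])
   (use eq y t in auto)
 then show ?thesis3 using d(3) vector_derivative_unique_at by blast
qed

text \<open>
  A name that keeps \<open>lam - v0\<close> together when it is embedded into the complex numbers.
\<close>

definition (in surface_wave) "mu = m"

locale first_order_solution = surface_wave +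
 fixes T :: real and U1 :: "(real^5) field" and V1 :: "(real^3) field" and \<phi>1 :: surface
 assumes U1: "profile {0<..} T U1" and V1: "profile {..<0} T V1" and \<phi>1: "smooth_surface_profile T \<phi>1"
  and fo: "first_order_multipliers \<nu> v0 B0 H0 lam T U1 V1 \<phi>1"
begin

abbreviation w :: "real \<Rightarrow> real \<Rightarrow> complex" where "w t k \<equiv> surface_hat \<phi>1 k t"
abbreviation wt :: "real \<Rightarrow> real \<Rightarrow> complex" where "wt t k \<equiv> surface_hat (sd2 \<phi>1) k t"

lemma \<phi>1_profile: "surface_profile T \<phi>1"
 using \<phi>1 by (simp add: smooth_surface_profile_def)

lemma w_rapid: "t \<in> {0<..<T} \<Longrightarrow> rapid (w t)"
 using smooth_surface_rapid[OF \<phi>1] by simp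

text \<open>
 All components of \<open>U1\<close> are multiples of the conjugate harmonic functions \<open>F\<close> and \<open>G\<close> with
 transforms \<open>\<bar>k\<bar> exp (- \<bar>k\<bar> \<eta>) w\<close> and \<open>\<i> k exp (- \<bar>k\<bar> \<eta>) w\<close>.
\<close>

definition "F x \<eta> t = - U1 x \<eta> t $ 1 / m"
definition "Fx x y t = - pd1 U1 x y t $ 1 / m"
definition "Fy x y t = - pd2 U1 x y t $ 1 / m"
definition "Ft x y t = - pd3 U1 x y t $ 1 / m"
definition "G x y t = - U1 x y t $ 2 / m"
definition "Gx x y t = - pd1 U1 x y t $ 2 / m"
definition "Gy x y t = - pd2 U1 x y t $ 2 / m"
definition "Gt x y t = - pd3 U1 x y t $ 2 / m"

lemmas FG_defs = F_def Fx_def Fy_def Ft_def G_def Gx_def Gy_def Gt_def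

text \<open>
  In the null vectors of the plasma the components 3, 4, 5 are multiples of the components 1, 2, 1 by real
  constants, the same for \<open>k > 0\<close> and \<open>k < 0\<close>; injectivity of the transform carries this over to the fields.
\<close>

lemma U1_proportional:
 assumes t: "t \<in> {0<..<T}" and y: "y \<ge> 0"
 shows "U1 x y t $ 3 = - (B0 / m) * U1 x y t $ 1" (is ?thesis1) "U1 x y t $ 4 = - (B0 / m) * U1 x y t $ 2" (is ?thesis2)
  "U1 x y t $ 5 = d / m * U1 x y t $ 1" (is ?thesis3)
proof -
 have S: "y \<in> closure {0<..}" using y by simp
 have M: "complex_of_real m \<noteq> 0" using m_nonzero by simp
 note n = field_nice(1)[OF U1 t S]
 show ?thesis1
 proof (rule fourier_injective[OF n nice_cmult[OF n]])
  show "fourier (\<lambda>x. U1 x y t $ 3) k = fourier (\<lambda>x. - (B0 / m) * U1 x y t $ 1) k" if "k \<noteq> 0" for k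
   using first_order_multipliersD(1,3)[OF fo t that y] M
   unfolding fourier_cmult field_hat_component of_real_mult mu_def[symmetric] by (simp add: field_simps)
 qed
 show ?thesis2
 proof (rule fourier_injective[OF n nice_cmult[OF n]])
  show "fourier (\<lambda>x. U1 x y t $ 4) k = fourier (\<lambda>x. - (B0 / m) * U1 x y t $ 2) k" if "k \<noteq> 0" for k
   using first_order_multipliersD(2,4)[OF fo t that y] M
   unfolding fourier_cmult field_hat_component of_real_mult mu_def[symmetric] by (simp add: field_simps)
 qed
 show ?thesis3
 proof (rule fourier_injective[OF n nice_cmult[OF n]])
  show "fourier (\<lambda>x. U1 x y t $ 5) k = fourier (\<lambda>x. d / m * U1 x y t $ 1) k" if "k \<noteq> 0" for k
   using first_order_multipliersD(1,5)[OF fo t that y] M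
   unfolding fourier_cmult field_hat_component of_real_mult mu_def[symmetric] by (simp add: field_simps)
 qed
qed

lemma U1_components:
 assumes t: "t \<in> {0<..<T}" and y: "y > 0"
 shows "U1 x y t $ 1 = - m * F x y t" (is ?thesis1) "U1 x y t $ 2 = - m * G x y t" (is ?thesis2)
  "U1 x y t $ 3 = B0 * F x y t" (is ?thesis3) "U1 x y t $ 4 = B0 * G x y t" (is ?thesis4) "U1 x y t $ 5 = - d * F x y t" (is ?thesis5)
  "pd1 U1 x y t $ 1 = - m * Fx x y t" (is ?thesis6) "pd1 U1 x y t $ 2 = - m * Gx x y t" (is ?thesis7)
  "pd1 U1 x y t $ 3 = B0 * Fx x y t" (is ?thesis8) "pd1 U1 x y t $ 4 = B0 * Gx x y t" (is ?thesis9) "pd1 U1 x y t $ 5 = - d * Fx x y t" (is ?thesis10)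
  "pd2 U1 x y t $ 1 = - m * Fy x y t" (is ?thesis11) "pd2 U1 x y t $ 2 = - m * Gy x y t" (is ?thesis12)
  "pd2 U1 x y t $ 3 = B0 * Fy x y t" (is ?thesis13) "pd2 U1 x y t $ 4 = B0 * Gy x y t" (is ?thesis14) "pd2 U1 x y t $ 5 = - d * Fy x y t" (is ?thesis15)
  "pd3 U1 x y t $ 1 = - m * Ft x y t" (is ?thesis16) "pd3 U1 x y t $ 2 = - m * Gt x y t" (is ?thesis17)
  "pd3 U1 x y t $ 3 = B0 * Ft x y t" (is ?thesis18) "pd3 U1 x y t $ 4 = B0 * Gt x y t" (is ?thesis19) "pd3 U1 x y t $ 5 = - d * Ft x y t" (is ?thesis20)
proof -
 have S: "y \<in> {0<..}" and S': "y \<ge> 0" using y by auto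
 have p: "\<And>x y t. y \<in> {0<..} \<Longrightarrow> t \<in> {0<..<T} \<Longrightarrow> U1 x y t $ 3 = - (B0 / m) * U1 x y t $ 1"
  "\<And>x y t. y \<in> {0<..} \<Longrightarrow> t \<in> {0<..<T} \<Longrightarrow> U1 x y t $ 4 = - (B0 / m) * U1 x y t $ 2"
  "\<And>x y t. y \<in> {0<..} \<Longrightarrow> t \<in> {0<..<T} \<Longrightarrow> U1 x y t $ 5 = d / m * U1 x y t $ 1"
  using U1_proportional by (meson greaterThan_iff less_imp_le)+
 note q = pd_proportional[where j=3 and i=1 and c="- (B0 / m)", OF U1 open_greaterThan p(1) S t, of x]
  pd_proportional[where j=4 and i=2 and c="- (B0 / m)", OF U1 open_greaterThan p(2) S t, of x]
  pd_proportional[where j=5 and i=1 and c="d / m", OF U1 open_greaterThan p(3) S t, of x]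
 have mu: "mu \<noteq> 0" using m_nonzero by (simp add: mu_def)
 show ?thesis1 ?thesis2
  ?thesis3 ?thesis4 ?thesis5
  ?thesis6 ?thesis7
  ?thesis8 ?thesis9 ?thesis10
  ?thesis11 ?thesis12
  ?thesis13 ?thesis14 ?thesis15
  ?thesis16 ?thesis17
  ?thesis18 ?thesis19 ?thesis20
  using mu U1_proportional[OF t S', of x] q unfolding FG_defs mu_def[symmetric] by simp_all
qed

text \<open>
  Advection and magnetic tension contribute the same products with the factors \<open>m\<^sup>2\<close> and \<open>- B0\<^sup>2\<close>, which add up
  to \<open>d\<close>.
\<close>

lemma forcing_components:
 assumes t: "t \<in> {0<..<T}" and y: "y > 0"
 shows "forcing v0 B0 lam U1 \<phi>1 x y t $ 1 = - m * Ft x y t + d * (F x y t * Fx x y t + Fy x y t * G x y t)"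
  and "forcing v0 B0 lam U1 \<phi>1 x y t $ 2 = - m * Gt x y t +
   d * (F x y t * Gx x y t + G x y t * Gy x y t - sd1 \<phi>1 x t * Gy x y t)"
  and "forcing v0 B0 lam U1 \<phi>1 x y t $ 3 = B0 * Ft x y t"
  and "forcing v0 B0 lam U1 \<phi>1 x y t $ 4 = B0 * Gt x y t"
  and "forcing v0 B0 lam U1 \<phi>1 x y t $ 5 = m * (sd1 \<phi>1 x t * Fy x y t)"
  and "divergence_forcing U1 \<phi>1 x y t = - B0 * (sd1 \<phi>1 x t * Fy x y t)"
 unfolding forcing_def divergence_forcing_def Let_def vector_5 U1_components[OF t y] d_eq
 by (simp_all add: algebra_simps power2_eq_square)

definition E :: "real \<Rightarrow> real \<Rightarrow> complex" where "E k \<eta> = of_real (exp (- (\<bar>k\<bar> * \<eta>)))"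

lemma FG_nice:
 assumes t: "t \<in> {0<..<T}" and y: "y > 0"
 shows "nice (\<lambda>x. F x y t)" "nice (\<lambda>x. Fx x y t)" "nice (\<lambda>x. Fy x y t)" "nice (\<lambda>x. Ft x y t)"
  "nice (\<lambda>x. G x y t)" "nice (\<lambda>x. Gx x y t)" "nice (\<lambda>x. Gy x y t)" "nice (\<lambda>x. Gt x y t)"
  "nice (\<lambda>x. sd1 \<phi>1 x t)"
 using field_nice(1)[OF U1 t, of y] field_nice(2,3,4)[OF U1 t, of y] y surface_families(2)[OF \<phi>1_profile t]
 unfolding FG_defs by (auto intro!: nice_divide nice_uminus)

lemma FG_fourier:
 assumes t: "t \<in> {0<..<T}" and \<eta>: "\<eta> > 0" and k: "k \<noteq> 0"
 shows "fourier (\<lambda>\<theta>. F \<theta> \<eta> t) k = (of_real \<bar>k\<bar> * E k \<eta>) * w t k" (is ?thesis1)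
  and "fourier (\<lambda>\<theta>. Fx \<theta> \<eta> t) k = (\<i> * of_real k * of_real \<bar>k\<bar> * E k \<eta>) * w t k" (is ?thesis2)
  and "fourier (\<lambda>\<theta>. Fy \<theta> \<eta> t) k = (- (of_real k * of_real k) * E k \<eta>) * w t k" (is ?thesis3)
  and "fourier (\<lambda>\<theta>. Ft \<theta> \<eta> t) k = of_real \<bar>k\<bar> * E k \<eta> * wt t k" (is ?thesis4)
  and "fourier (\<lambda>\<theta>. G \<theta> \<eta> t) k = (\<i> * of_real k * E k \<eta>) * w t k" (is ?thesis5)
  and "fourier (\<lambda>\<theta>. Gx \<theta> \<eta> t) k = (- (of_real k * of_real k) * E k \<eta>) * w t k" (is ?thesis6)
  and "fourier (\<lambda>\<theta>. Gy \<theta> \<eta> t) k = (- (\<i> * of_real k * of_real \<bar>k\<bar>) * E k \<eta>) * w t k" (is ?thesis7)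
  and "fourier (\<lambda>\<theta>. Gt \<theta> \<eta> t) k = \<i> * of_real k * E k \<eta> * wt t k" (is ?thesis8)
  and "fourier (\<lambda>\<theta>. sd1 \<phi>1 \<theta> t) k = (\<i> * of_real k) * w t k" (is ?thesis9)
proof -
 have S: "\<eta> \<in> {0<..}" and S': "\<eta> \<ge> 0" using \<eta> by auto
 have M0: "complex_of_real m \<noteq> 0" using m_nonzero by simp
 have kk: "complex_of_real \<bar>k\<bar> * complex_of_real \<bar>k\<bar> = complex_of_real k * complex_of_real k"
  by (simp flip: of_real_mult)
 have kk': "complex_of_real \<bar>k\<bar> * (complex_of_real \<bar>k\<bar> * x) = complex_of_real k * (complex_of_real k * x)" for x
  using kk by (simp add: mult.assoc[symmetric])
 note c = first_order_multipliersD(1,2)[OF fo t k S', unfolded field_hat_component of_real_mult, folded E_def]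
 have y: "fourier (\<lambda>\<theta>. pd2 U1 \<theta> \<eta> t $ j) k = - of_real \<bar>k\<bar> * fourier (\<lambda>\<theta>. U1 \<theta> \<eta> t $ j) k" for j
  using first_order_pd2(1)[OF U1 V1 fo t k \<eta>] by simp
 note x = field_fourier(1)[OF U1 t S]
 have t1: "fourier (\<lambda>\<theta>. pd3 U1 \<theta> \<eta> t $ 1) k = - complex_of_real m * of_real \<bar>k\<bar> * E k \<eta> * wt t k"
 proof -
  have "((\<lambda>t. (- complex_of_real m * of_real \<bar>k\<bar> * E k \<eta>) * w t k) has_vector_derivative (- complex_of_real m * of_real \<bar>k\<bar> * E k \<eta>) * wt t k) (at t)"
   by (rule has_vector_derivative_mult_right[OF surface_fourier(2)[OF \<phi>1_profile t]])
  then have "((\<lambda>t. fourier (\<lambda>\<theta>. U1 \<theta> \<eta> t $ 1) k) has_vector_derivative (- complex_of_real m * of_real \<bar>k\<bar> * E k \<eta>) * wt t k) (at t)"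
   by (rule has_vector_derivative_transform_within_open[of _ _ _ "{0<..<T}"])
    (use t first_order_multipliersD(1)[OF fo _ k S', unfolded field_hat_component of_real_mult, folded E_def] in \<open>auto simp: ac_simps simp del: of_real_diff\<close>)
  then show ?thesis using field_fourier(3)[OF U1 t S, of 1 k] vector_derivative_unique_at by blast
 qed
 have t2: "fourier (\<lambda>\<theta>. pd3 U1 \<theta> \<eta> t $ 2) k = - complex_of_real m * (\<i> * of_real k) * E k \<eta> * wt t k"
 proof -
  have "((\<lambda>t. (- complex_of_real m * (\<i> * of_real k) * E k \<eta>) * w t k) has_vector_derivative (- complex_of_real m * (\<i> * of_real k) * E k \<eta>) * wt t k) (at t)"
   by (rule has_vector_derivative_mult_right[OF surface_fourier(2)[OF \<phi>1_profile t]])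
  then have "((\<lambda>t. fourier (\<lambda>\<theta>. U1 \<theta> \<eta> t $ 2) k) has_vector_derivative (- complex_of_real m * (\<i> * of_real k) * E k \<eta>) * wt t k) (at t)"
   by (rule has_vector_derivative_transform_within_open[of _ _ _ "{0<..<T}"])
    (use t first_order_multipliersD(2)[OF fo _ k S', unfolded field_hat_component of_real_mult, folded E_def] in \<open>auto simp: ac_simps simp del: of_real_diff\<close>)
  then show ?thesis using field_fourier(3)[OF U1 t S, of 2 k] vector_derivative_unique_at by blast
 qed
 show ?thesis1
  ?thesis2
  ?thesis3
  ?thesis4
  ?thesis5
  ?thesis6
  ?thesis7
  ?thesis8
  unfolding FG_defs fourier_divide fourier_uminus x y t1 t2 c
  unfolding mu_def[symmetric] using M0[folded mu_def] by (simp_all add: field_simps kk')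
 show ?thesis9
  by (rule surface_fourier(1)[OF \<phi>1_profile t])
qed

text \<open>
  Decay in \<open>\<eta>\<close> of a product in which both factors, or only the second factor, depend on \<open>\<eta>\<close>.
\<close>

definition EE :: "real \<Rightarrow> real \<Rightarrow> real \<Rightarrow> complex" where "EE y a b = of_real (exp (- ((\<bar>a\<bar> + \<bar>b\<bar>) * y)))"
definition E2 :: "real \<Rightarrow> real \<Rightarrow> real \<Rightarrow> complex" where "E2 y a b = of_real (exp (- (\<bar>b\<bar> * y)))"

text \<open>
  The kernels of \<open>F Fx + Fy G\<close> (up to the factor \<open>- \<i>\<close>), of \<open>F Gx + G Gy\<close>, and of \<open>Gy\<close> and \<open>Fy\<close>
  multiplied by the slope of the front.
\<close>

definition KI :: "real \<Rightarrow> real \<Rightarrow> complex" where "KI a b = of_real a * of_real a * of_real b - of_real \<bar>a\<bar> * of_real b * of_real \<bar>b\<bar>"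
definition KY :: "real \<Rightarrow> real \<Rightarrow> complex" where "KY a b = of_real a * of_real b * of_real \<bar>b\<bar> - of_real \<bar>a\<bar> * of_real b * of_real b"
definition KG :: "real \<Rightarrow> real \<Rightarrow> complex" where "KG a b = of_real a * of_real b * of_real \<bar>b\<bar>"
definition KF :: "real \<Rightarrow> real \<Rightarrow> complex" where "KF a b = - (\<i> * of_real a * of_real b * of_real b)"

lemma kernels_tame: "tame KI" "tame KY" "tame KG" "tame KF"
 unfolding KI_def[abs_def] KY_def[abs_def] KG_def[abs_def] KF_def[abs_def] by (intro tame_intros)+

lemma E_split: "E a y * E b y = EE y a b" "E b y = E2 y a b"
 by (simp_all add: E_def EE_def E2_def exp_add[symmetric] distrib_right flip: of_real_mult)

lemma tame_E: "y \<ge> 0 \<Longrightarrow> tame (\<lambda>a b. E a y)" "y \<ge> 0 \<Longrightarrow> tame (\<lambda>a b. E b y)"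
 "y \<ge> 0 \<Longrightarrow> tame (EE y)" "y \<ge> 0 \<Longrightarrow> tame (E2 y)"
 unfolding E_def EE_def[abs_def] E2_def[abs_def] by (auto intro!: tame_exp continuous_intros)

lemma forcing_fourier:
 assumes \<tau>: "\<tau> \<in> {0<..<T}" and y: "y > 0" and k: "k \<noteq> 0"
 defines "p \<equiv> field_hat (forcing v0 B0 lam U1 \<phi>1) k y \<tau>"
 shows "p $ 1 = - m * (of_real \<bar>k\<bar> * E k y * wt \<tau> k) + d * (- \<i> * conv (w \<tau>) (\<lambda>a b. KI a b * EE y a b) k)" (is ?thesis1)
  and "p $ 2 = - m * (\<i> * of_real k * E k y * wt \<tau> k) +
   d * (conv (w \<tau>) (\<lambda>a b. KY a b * EE y a b) k - conv (w \<tau>) (\<lambda>a b. KG a b * E2 y a b) k)" (is ?thesis2)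
  and "p $ 3 = B0 * (of_real \<bar>k\<bar> * E k y * wt \<tau> k)" (is ?thesis3)
  and "p $ 4 = B0 * (\<i> * of_real k * E k y * wt \<tau> k)" (is ?thesis4)
  and "p $ 5 = m * conv (w \<tau>) (\<lambda>a b. KF a b * E2 y a b) k" (is ?thesis5)
  and "fourier (\<lambda>x. divergence_forcing U1 \<phi>1 x y \<tau>) k = - B0 * conv (w \<tau>) (\<lambda>a b. KF a b * E2 y a b) k" (is ?thesis6)
proof -
 note n = FG_nice[OF \<tau> y] and f = FG_fourier[OF \<tau> y] and w = w_rapid[OF \<tau>]
 have e: "y \<ge> 0" using y by simp
 have t: "tame (\<lambda>a b. of_real \<bar>b\<bar> * E b y)" "tame (\<lambda>a b. of_real \<bar>a\<bar> * E a y)"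
  "tame (\<lambda>a b. \<i> * of_real b * of_real \<bar>b\<bar> * E b y)" "tame (\<lambda>a b. - (of_real a * of_real a) * E a y)"
  "tame (\<lambda>a b. - (of_real b * of_real b) * E b y)" "tame (\<lambda>a b. \<i> * of_real b * E b y)" "tame (\<lambda>a b. \<i> * of_real a * E a y)"
  "tame (\<lambda>a b. - (\<i> * of_real b * of_real \<bar>b\<bar>) * E b y)" "tame (\<lambda>a b. \<i> * of_real a)"
  by (intro tame_intros tame_E e)+
 have 1: "fourier (\<lambda>x. F x y \<tau> * Fx x y \<tau>) k = conv (w \<tau>) (\<lambda>a b. (of_real \<bar>a\<bar> * E a y) * (\<i> * of_real b * of_real \<bar>b\<bar> * E b y)) k"
  by (rule fourier_product_conv[OF n(1,2) w t(2,3) f(1,2)])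
 have 2: "fourier (\<lambda>x. Fy x y \<tau> * G x y \<tau>) k = conv (w \<tau>) (\<lambda>a b. (- (of_real a * of_real a) * E a y) * (\<i> * of_real b * E b y)) k"
  by (rule fourier_product_conv[OF n(3,5) w t(4,6) f(3,5)])
 have 3: "fourier (\<lambda>x. F x y \<tau> * Gx x y \<tau>) k = conv (w \<tau>) (\<lambda>a b. (of_real \<bar>a\<bar> * E a y) * (- (of_real b * of_real b) * E b y)) k"
  by (rule fourier_product_conv[OF n(1,6) w t(2,5) f(1,6)])
 have 4: "fourier (\<lambda>x. G x y \<tau> * Gy x y \<tau>) k = conv (w \<tau>) (\<lambda>a b. (\<i> * of_real a * E a y) * (- (\<i> * of_real b * of_real \<bar>b\<bar>) * E b y)) k"
  by (rule fourier_product_conv[OF n(5,7) w t(7,8) f(5,7)])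
 have 5: "fourier (\<lambda>x. sd1 \<phi>1 x \<tau> * Gy x y \<tau>) k = conv (w \<tau>) (\<lambda>a b. (\<i> * of_real a) * (- (\<i> * of_real b * of_real \<bar>b\<bar>) * E b y)) k"
  by (rule fourier_product_conv[OF n(9,7) w t(9,8) f(9,7)])
 have 6: "fourier (\<lambda>x. sd1 \<phi>1 x \<tau> * Fy x y \<tau>) k = conv (w \<tau>) (\<lambda>a b. (\<i> * of_real a) * (- (of_real b * of_real b) * E b y)) k"
  by (rule fourier_product_conv[OF n(9,3) w t(9,5) f(9,3)])
 have X: "fourier (\<lambda>x. F x y \<tau> * Fx x y \<tau>) k + fourier (\<lambda>x. Fy x y \<tau> * G x y \<tau>) k = - \<i> * conv (w \<tau>) (\<lambda>a b. KI a b * EE y a b) k"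
  unfolding 1 2 conv_cmult[symmetric] conv_add[OF w tame_mult[OF t(2,3)] tame_mult[OF t(4,6)], symmetric]
  by (rule conv_cong) (simp add: KI_def E_split(1)[symmetric] algebra_simps)
 have Y: "fourier (\<lambda>x. F x y \<tau> * Gx x y \<tau>) k + fourier (\<lambda>x. G x y \<tau> * Gy x y \<tau>) k = conv (w \<tau>) (\<lambda>a b. KY a b * EE y a b) k"
  unfolding 3 4 conv_add[OF w tame_mult[OF t(2,5)] tame_mult[OF t(7,8)], symmetric]
  by (rule conv_cong) (simp add: KY_def E_split(1)[symmetric] algebra_simps)
 have Z: "fourier (\<lambda>x. sd1 \<phi>1 x \<tau> * Gy x y \<tau>) k = conv (w \<tau>) (\<lambda>a b. KG a b * E2 y a b) k"
  unfolding 5 by (rule conv_cong) (simp add: KG_def E_split(2)[symmetric] algebra_simps)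
 have Z': "fourier (\<lambda>x. sd1 \<phi>1 x \<tau> * Fy x y \<tau>) k = conv (w \<tau>) (\<lambda>a b. KF a b * E2 y a b) k"
  unfolding 6 by (rule conv_cong) (simp add: KF_def E_split(2)[symmetric] algebra_simps)
 note fc = forcing_components[OF \<tau> y]
 show ?thesis1
  unfolding p_def field_hat_component fc X[symmetric] mu_def[symmetric] using f(4)[OF k]
  by (simp add: fourier_linear nice_intros n algebra_simps)
 show ?thesis2
  unfolding p_def field_hat_component fc Y[symmetric] Z[symmetric] mu_def[symmetric] using f(8)[OF k]
  by (simp add: fourier_linear nice_intros n algebra_simps)
 show ?thesis3 ?thesis4
  ?thesis5
  unfolding p_def field_hat_component fc fourier_cmult f(4)[OF k] f(8)[OF k] Z' by (rule refl)+
 show ?thesis6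
  unfolding fc fourier_cmult Z' by simp
qed

lemma forcing_nice:
 assumes t: "t \<in> {0<..<T}" and y: "y > 0"
 shows "nice (\<lambda>x. forcing v0 B0 lam U1 \<phi>1 x y t $ j)" "nice (\<lambda>x. divergence_forcing U1 \<phi>1 x y t)"
 using exhaust_5[of j] by (auto simp: forcing_components[OF t y] intro!: nice_intros FG_nice[OF t y])

lemma I_conv_eq: "I_conv \<phi>1 k y t = conv (w t) (\<lambda>a b. KI a b * EE y a b) k"
proof -
 have "complex_of_real (\<bar>a\<bar> * b * (\<bar>a\<bar> - \<bar>b\<bar>) * exp (- (\<bar>a\<bar> + \<bar>b\<bar>) * y)) = KI a b * EE y a b" for a b
 proof -
  have "KI a b = complex_of_real (\<bar>a\<bar> * b * (\<bar>a\<bar> - \<bar>b\<bar>))"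
  proof -
   have "a * a * b - \<bar>a\<bar> * b * \<bar>b\<bar> = \<bar>a\<bar> * b * (\<bar>a\<bar> - \<bar>b\<bar>)"
    by (cases "a \<ge> 0"; cases "b \<ge> 0"; simp add: algebra_simps)
   then show ?thesis
    unfolding KI_def of_real_mult[symmetric] of_real_diff[symmetric] of_real_eq_iff .
  qed
  then show ?thesis by (simp only: EE_def of_real_mult mult_minus_left)
 qed
 then show ?thesis unfolding I_conv_def conv_def by (simp only: mult.assoc)
qed

end

section \<open>The second order terms in the plasma\<close>

text \<open>
 Algebra of the \<open>5 \<times> 5\<close> system at a fixed wave number: the first, third and fourth equation
 determine \<open>u1\<close>, \<open>u3\<close>, \<open>u4\<close>, and the coefficients \<open>a\<close>, \<open>c\<close> of the two null vectors
 \<open>R\<close> and its conjugate satisfy scalar equations.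
\<close>

lemma plasma_diagonalization:
 fixes M b D K u1 u2 u3 u4 u5 y2 y5 p1 p2 p3 p4 p5 :: complex
 assumes nz: "M \<noteq> 0" "D \<noteq> 0" "K \<noteq> 0" and D: "D = M * M - b * b"
  and e1: "\<i> * K * (u5 - M * u1 - b * u3) + p1 = 0" and e2: "y5 - \<i> * K * (M * u2 + b * u4) + p2 = 0"
  and e3: "- (\<i> * K * (M * u3 + b * u1)) + p3 = 0" and e4: "- (\<i> * K * (M * u4 + b * u2)) + p4 = 0"
  and e5: "\<i> * K * u1 + y2 + p5 = 0"
 defines "a \<equiv> (u5 / D + u2 / (\<i> * M)) / 2" and "c \<equiv> (u5 / D - u2 / (\<i> * M)) / 2"
 shows "u1 = (- \<i> * M * p1 + \<i> * b * p3) / (D * K) + M * (a + c)" (is ?thesis1) and "u2 = \<i> * M * (a - c)" (is ?thesis2)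
  and "u3 = (\<i> * b * p1 - \<i> * M * p3) / (D * K) - b * (a + c)" (is ?thesis3) and "u4 = - (\<i> / M) * p4 / K - \<i> * b * (a - c)" (is ?thesis4)
  and "u5 = D * (a + c)"
  and "(y5 / D + y2 / (\<i> * M)) / 2 = - K * a + \<i> / (2 * D * M) * (M * p1 + \<i> * M * p2 - b * p3 - \<i> * b * p4 + D * p5)" (is ?thesis6)
  and "(y5 / D - y2 / (\<i> * M)) / 2 = K * c - \<i> / (2 * D * M) * (M * p1 - \<i> * M * p2 - b * p3 + \<i> * b * p4 + D * p5)" (is ?thesis7)
proof -
 have p: "p1 = - (\<i> * K * (u5 - M * u1 - b * u3))" "p2 = \<i> * K * (M * u2 + b * u4) - y5" "p3 = \<i> * K * (M * u3 + b * u1)"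
  "p4 = \<i> * K * (M * u4 + b * u2)" "p5 = - (\<i> * K * u1 + y2)"
  using e1 e2 e3 e4 e5 by (simp_all add: eq_neg_iff_add_eq_0 add.commute algebra_simps) (simp_all add: add_eq_0_iff algebra_simps)?
 have s: "a + c = u5 / D" "a - c = u2 / (\<i> * M)"
  unfolding a_def c_def by (simp_all add: field_simps)
 show ?thesis2 "u5 = D * (a + c)" unfolding s using nz by simp_all
 have n1: "- \<i> * M * p1 + \<i> * b * p3 = K * (D * u1 - M * u5)" and n3: "\<i> * b * p1 - \<i> * M * p3 = K * (D * u3 + b * u5)"
  unfolding p D by (simp_all add: algebra_simps)
 show ?thesis1 ?thesis3
  unfolding n1 n3 s using nz by (simp_all add: field_simps)
 show ?thesis4
  unfolding p s using nz by (simp add: field_simps)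
 have q1: "M * p1 - b * p3 + D * p5 = - (\<i> * K * M * u5) - D * y2"
  unfolding p D by (simp add: algebra_simps)
 have q2: "\<i> * M * p2 - \<i> * b * p4 = - (K * D * u2) - \<i> * M * y5"
  unfolding p D by (simp add: algebra_simps)
 have "M * p1 + \<i> * M * p2 - b * p3 - \<i> * b * p4 + D * p5 = (M * p1 - b * p3 + D * p5) + (\<i> * M * p2 - \<i> * b * p4)"
  "M * p1 - \<i> * M * p2 - b * p3 + \<i> * b * p4 + D * p5 = (M * p1 - b * p3 + D * p5) - (\<i> * M * p2 - \<i> * b * p4)"
  by (simp_all add: algebra_simps)
 note q = this[unfolded q1 q2]
 show ?thesis6
  unfolding q a_def using nz by (simp add: field_simps)
 show ?thesis7
  unfolding q c_def using nz by (simp add: field_simps)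
qed

lemma plasma_diagonalization_converse:
 fixes M b D K a c f q p1 p2 p4 :: complex
 assumes nz: "M \<noteq> 0" "D \<noteq> 0" "K \<noteq> 0" and D: "D = M * M - b * b"
 defines "p3 \<equiv> b * f" and "p5 \<equiv> M * q"
 defines "a' \<equiv> - K * a + \<i> / (2 * D * M) * (M * p1 + \<i> * M * p2 - b * p3 - \<i> * b * p4 + D * p5)"
  and "c' \<equiv> K * c - \<i> / (2 * D * M) * (M * p1 - \<i> * M * p2 - b * p3 + \<i> * b * p4 + D * p5)"
  and "u1 \<equiv> (- \<i> * M * p1 + \<i> * b * p3) / (D * K) + M * (a + c)" and "u2 \<equiv> \<i> * M * (a - c)"
  and "u3 \<equiv> (\<i> * b * p1 - \<i> * M * p3) / (D * K) - b * (a + c)" and "u4 \<equiv> - (\<i> / M) * p4 / K - \<i> * b * (a - c)"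
  and "u5 \<equiv> D * (a + c)"
 shows "\<i> * K * (u5 - M * u1 - b * u3) + p1 = 0" (is ?thesis1) and "D * (a' + c') - \<i> * K * (M * u2 + b * u4) + p2 = 0" (is ?thesis2)
  and "- (\<i> * K * (M * u3 + b * u1)) + p3 = 0" (is ?thesis3) and "- (\<i> * K * (M * u4 + b * u2)) + p4 = 0" (is ?thesis4)
  and "\<i> * K * u1 + \<i> * M * (a' - c') + p5 = 0" (is ?thesis5)
  and "\<i> * K * u3 + (- (b / M) * f - \<i> * b * (a' - c')) - b * q = 0" (is ?thesis6)
proof -
 have A: "D * (a' + c') = - K * D * (a - c) + (b * p4 / M - p2)"
  unfolding a'_def c'_def using nz by (simp add: field_simps)
 have B: "\<i> * M * (a' - c') = - \<i> * K * M * (a + c) - (M * p1 - b * p3) / D - p5"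
  unfolding a'_def c'_def using nz by (simp add: field_simps)
 have C: "\<i> * b * (a' - c') = - \<i> * K * b * (a + c) - b * (M * p1 - b * p3) / (D * M) - b * p5 / M"
 proof -
  have eq: "\<i> * b * (a' - c') = b / M * (\<i> * M * (a' - c'))" using nz by simp
  show ?thesis unfolding eq B using nz by (simp add: field_simps)
 qed
 have U1: "M * u1 + b * u3 = u5 - \<i> * p1 / K"
 proof -
  have "M * u1 + b * u3 = ((M * M - b * b) / D) * (- \<i> * p1 / K) + (M * M - b * b) * (a + c)"
   unfolding u1_def u3_def using nz by (simp add: field_simps)
  then show ?thesis unfolding D[symmetric] u5_def using nz by simp
 qed
 show ?thesis1
 proof -
  have "u5 - M * u1 - b * u3 = \<i> * p1 / K" using U1 by (simp add: algebra_simps)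
  then show ?thesis using nz by simp
 qed
 have U3: "M * u3 + b * u1 = ((M * M - b * b) / D) * (- \<i> * p3 / K)"
  unfolding u1_def u3_def using nz by (simp add: field_simps)
 show ?thesis3
  unfolding U3 D[symmetric] using nz by simp
 have U4: "M * u4 + b * u2 = - \<i> * p4 / K"
  unfolding u4_def u2_def using nz by (simp add: field_simps)
 show ?thesis4
  unfolding U4 using nz by simp
 have U2: "M * u2 + b * u4 = (M * M - b * b) * (\<i> * (a - c)) - \<i> * b * p4 / (M * K)"
  unfolding u4_def u2_def using nz by (simp add: field_simps)
 show ?thesis2
  unfolding A U2 D[symmetric] using nz by (simp add: field_simps)
 show ?thesis5
  unfolding B u1_def using nz by (simp add: field_simps)
 have "\<i> * K * u3 + (- (b / M) * f - \<i> * b * (a' - c')) - b * q =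
   (M * p3 - b * p1) / D - b / M * f + b * (M * p1 - b * p3) / (D * M) + (b * p5 / M - b * q)"
  unfolding C u3_def using nz by (simp add: field_simps)
 also have "\<dots> = ((M * M - b * b) / D) * (p3 / M) - b / M * f + (b * p5 / M - b * q)"
  using nz by (simp add: field_simps)
 also have "\<dots> = 0" unfolding D[symmetric] p3_def p5_def using nz by simp
 finally show ?thesis6 .
qed


context first_order_solution
begin

abbreviation "Mc \<equiv> complex_of_real mu"
abbreviation "bc \<equiv> complex_of_real B0"
abbreviation "Dc \<equiv> complex_of_real d"
abbreviation "p_hat \<equiv> field_hat (forcing v0 B0 lam U1 \<phi>1)"

lemma Mc_nonzero: "Mc \<noteq> 0" and Dc_nonzero: "Dc \<noteq> 0" and Dc_eq: "Dc = Mc * Mc - bc * bc"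
proof -
 show "Mc \<noteq> 0" using m_nonzero by (simp only: mu_def of_real_eq_0_iff not_False_eq_True)
 show "Dc \<noteq> 0" using d_pos by simp
 have "d = mu * mu - B0 * B0" by (simp add: d_eq mu_def power2_eq_square)
 then show "Dc = Mc * Mc - bc * bc" by (simp only: of_real_mult of_real_diff)
qed

lemma bdot_vectors:
 "L_vec v0 B0 lam \<odot> x = \<i> / (2 * Dc * Mc) * (Mc * x$1 + \<i> * Mc * x$2 - bc * x$3 - \<i> * bc * x$4 + Dc * x$5)"
 "cnj_vec (L_vec v0 B0 lam) \<odot> x = - (\<i> / (2 * Dc * Mc) * (Mc * x$1 - \<i> * Mc * x$2 - bc * x$3 + \<i> * bc * x$4 + Dc * x$5))"
 "L1_vec v0 B0 lam \<odot> x = (- \<i> * Mc * x$1 + \<i> * bc * x$3) / Dc"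
 "L3_vec v0 B0 lam \<odot> x = (\<i> * bc * x$1 - \<i> * Mc * x$3) / Dc"
 "L4_vec v0 lam \<odot> x = - (\<i> / Mc) * x$4"
 unfolding bdot_def sum_5 L_vec_def cnj_vec_def R_vec_def L1_vec_def L3_vec_def L4_vec_def of_real_diff[symmetric] mu_def[symmetric]
 using Mc_nonzero Dc_nonzero by (simp_all add: field_simps)

lemma L_forcing_eq:
 assumes t: "t \<in> {0<..<T}" and k: "k \<noteq> 0" and y: "y > 0"
 shows "L1_vec v0 B0 lam \<odot> p_hat k y t = L1_forcing v0 B0 lam \<phi>1 k y t" (is ?thesis1)
  and "L3_vec v0 B0 lam \<odot> p_hat k y t = L3_forcing v0 B0 lam \<phi>1 k y t" (is ?thesis2)
  and "L4_vec v0 lam \<odot> p_hat k y t = L4_forcing v0 B0 lam \<phi>1 k y t" (is ?thesis3)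
proof -
 have e: "- \<bar>k\<bar> * y = - (\<bar>k\<bar> * y)" by simp
 have q: "complex_of_real ((lam - v0)\<^sup>2) = Mc * Mc" "complex_of_real (B0\<^sup>2) = bc * bc"
  unfolding mu_def by (simp_all add: power2_eq_square)
 note f = forcing_fourier[OF t y k]
 show ?thesis1
  unfolding bdot_vectors f L1_forcing_def I_conv_eq e of_real_mult E_def[symmetric] of_real_diff[symmetric] mu_def[symmetric]
  using Dc_nonzero by (simp add: field_simps power2_eq_square)
 show ?thesis2
  unfolding bdot_vectors f L3_forcing_def I_conv_eq e of_real_mult E_def[symmetric] of_real_diff[symmetric] mu_def[symmetric]
  using Dc_nonzero by (simp add: field_simps power2_eq_square)
 show ?thesis3
  unfolding bdot_vectors f L4_forcing_def e of_real_mult E_def[symmetric] of_real_diff[symmetric] mu_def[symmetric]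
  using Mc_nonzero by (simp add: field_simps)
qed

lemma conv_exp_continuous:
 assumes t: "t \<in> {0<..<T}" and K: "tame K"
 shows "continuous_on {0..} (\<lambda>y. conv (w t) (\<lambda>a b. K a b * EE y a b) k)" (is ?thesis1)
  and "continuous_on {0..} (\<lambda>y. conv (w t) (\<lambda>a b. K a b * E2 y a b) k)" (is ?thesis2)
  and "halfline_source (\<lambda>y. conv (w t) (\<lambda>a b. K a b * EE y a b) k)" (is ?thesis3)
  and "halfline_source (\<lambda>y. conv (w t) (\<lambda>a b. K a b * E2 y a b) k)" (is ?thesis4)
proof -
 have c: "continuous_on UNIV (\<lambda>p::real\<times>real. \<bar>fst p\<bar> + \<bar>snd p\<bar>)" "continuous_on UNIV (\<lambda>p::real\<times>real. \<bar>snd p\<bar>)"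
  by (intro continuous_intros)+
 note A = conv_continuous[OF w_rapid[OF t] K, of "\<lambda>a b. \<bar>a\<bar> + \<bar>b\<bar>" k, OF c(1)]
 note B = conv_continuous[OF w_rapid[OF t] K, of "\<lambda>a b. \<bar>b\<bar>" k, OF c(2)]
 show cA: ?thesis1
  and cB: ?thesis2
  unfolding EE_def E2_def by (rule A(1) B(1), simp)+
 have "\<exists>M. \<forall>s\<ge>0. norm (conv (w t) (\<lambda>a b. K a b * EE s a b) k) \<le> M" "\<exists>M. \<forall>s\<ge>0. norm (conv (w t) (\<lambda>a b. K a b * E2 s a b) k) \<le> M"
  unfolding EE_def E2_def by (rule A(2) B(2), simp)+
 then show ?thesis3
  ?thesis4
  unfolding halfline_source_def using continuous_on_subset[OF cA, of "{0<..}"] continuous_on_subset[OF cB, of "{0<..}"]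
  by (auto intro: less_imp_le)
qed

lemma E_source: "halfline_source (\<lambda>y. E k y)" and E_continuous: "continuous_on {0..} (\<lambda>y. E k y)"
 unfolding halfline_source_def E_def by (auto intro!: continuous_intros exI[of _ 1])

lemma forcing_source:
 assumes t: "t \<in> {0<..<T}" and k: "k \<noteq> 0"
 shows "halfline_source (\<lambda>y. p_hat k y t $ j)"
proof -
 note I = halfline_source_intros conv_exp_continuous(3,4)[OF t] kernels_tame E_source
 have wt: "halfline_source (\<lambda>y. c * E k y * wt t k)" for c
  using halfline_source_cmult[OF E_source, of "c * wt t k" k] by (simp add: ac_simps)
 have "halfline_source (\<lambda>y. - m * (of_real \<bar>k\<bar> * E k y * wt t k) + d * (- \<i> * conv (w t) (\<lambda>a b. KI a b * EE y a b) k))"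
  "halfline_source (\<lambda>y. - m * (\<i> * of_real k * E k y * wt t k) +
   d * (conv (w t) (\<lambda>a b. KY a b * EE y a b) k - conv (w t) (\<lambda>a b. KG a b * E2 y a b) k))"
  "halfline_source (\<lambda>y. B0 * (of_real \<bar>k\<bar> * E k y * wt t k))" "halfline_source (\<lambda>y. B0 * (\<i> * of_real k * E k y * wt t k))"
  "halfline_source (\<lambda>y. m * conv (w t) (\<lambda>a b. KF a b * E2 y a b) k)"
  by (intro I wt)+
 note s = this[THEN halfline_source_cong]
 note f = forcing_fourier[OF t _ k]
 have "halfline_source (\<lambda>y. p_hat k y t $ 1)" by (rule s(1)) (rule f(1)[symmetric])
 moreover have "halfline_source (\<lambda>y. p_hat k y t $ 2)" by (rule s(2)) (rule f(2)[symmetric])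
 moreover have "halfline_source (\<lambda>y. p_hat k y t $ 3)" by (rule s(3)) (rule f(3)[symmetric])
 moreover have "halfline_source (\<lambda>y. p_hat k y t $ 4)" by (rule s(4)) (rule f(4)[symmetric])
 moreover have "halfline_source (\<lambda>y. p_hat k y t $ 5)" by (rule s(5)) (rule f(5)[symmetric])
 ultimately show ?thesis using exhaust_5[of j] by blast
qed

lemma bdot_source:
 assumes t: "t \<in> {0<..<T}" and k: "k \<noteq> 0"
 shows "halfline_source (\<lambda>y. x \<odot> p_hat k y t)"
 unfolding bdot_def sum_5 by (intro halfline_source_intros forcing_source t k)

lemma L_forcing_continuous:
 assumes t: "t \<in> {0<..<T}"
 shows "continuous_on {0..} (\<lambda>y. L1_forcing v0 B0 lam \<phi>1 k y t)" "continuous_on {0..} (\<lambda>y. L3_forcing v0 B0 lam \<phi>1 k y t)"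
  "continuous_on {0..} (\<lambda>y. L4_forcing v0 B0 lam \<phi>1 k y t)"
 unfolding L1_forcing_def L3_forcing_def L4_forcing_def I_conv_eq
 by (intro continuous_intros conv_exp_continuous(1) t kernels_tame)+

lemma second_order_vector_iff:
 assumes k: "k \<noteq> 0"
 shows "X = S_vec v0 B0 lam \<phi>1 k y t + A *s R_vec v0 B0 lam + C *s cnj_vec (R_vec v0 B0 lam) \<longleftrightarrow>
  X$1 = L1_forcing v0 B0 lam \<phi>1 k y t / k + Mc * (A + C) \<and> X$2 = \<i> * Mc * (A - C) \<and>
  X$3 = L3_forcing v0 B0 lam \<phi>1 k y t / k - bc * (A + C) \<and> X$4 = L4_forcing v0 B0 lam \<phi>1 k y t / k - \<i> * bc * (A - C) \<and>
  X$5 = Dc * (A + C)"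
 unfolding vec_eq_iff forall_5 S_vec_def R_vec_def cnj_vec_def of_real_diff[symmetric] mu_def[symmetric]
 by (simp add: algebra_simps)

text \<open>
  The coefficients \<open>a\<close> and \<open>c\<close> of the two null vectors satisfy scalar equations with rates \<open>- k\<close> and \<open>k\<close>, forced by
  the products with \<open>L\<close> and its conjugate. The algebraic equations for the components 1, 3 and 4 give \<open>S\<close>.
\<close>

lemma second_order_plasma_forward:
 assumes U2: "profile {0<..} T U2"
  and sys: "plasma_hat_system m B0 T U2 (forcing v0 B0 lam U1 \<phi>1) (divergence_forcing U1 \<phi>1)"
 shows "second_order_plasma v0 B0 lam T U1 \<phi>1 U2"
proof -
 define u where "u = (\<lambda>\<tau> k j \<eta>. field_hat U2 k \<eta> \<tau> $ j)"
 define y where "y = (\<lambda>\<tau> k j \<eta>. field_hat (pd2 U2) k \<eta> \<tau> $ j)"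
 define a where "a = (\<lambda>\<tau> k \<eta>. (u \<tau> k 5 \<eta> / Dc + u \<tau> k 2 \<eta> / (\<i> * Mc)) / 2)"
 define c where "c = (\<lambda>\<tau> k \<eta>. (u \<tau> k 5 \<eta> / Dc - u \<tau> k 2 \<eta> / (\<i> * Mc)) / 2)"
 let ?L = "L_vec v0 B0 lam"
 let ?A = "\<lambda>\<tau> k \<eta>. of_real (exp (- k * \<eta>)) * (a \<tau> k 0 + (LBINT s:{0..\<eta>}. (?L \<odot> p_hat k s \<tau>) * of_real (exp (k * s))))"
 let ?C = "\<lambda>\<tau> k \<eta>. of_real (exp (k * \<eta>)) * (c \<tau> k 0 + (LBINT s:{0..\<eta>}. (cnj_vec ?L \<odot> p_hat k s \<tau>) * of_real (exp (- k * s))))"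
 have main: "(k < 0 \<longrightarrow> a \<tau> k 0 = - (LBINT s:{0..}. (?L \<odot> p_hat k s \<tau>) * of_real (exp (k * s)))) \<and>
   (k > 0 \<longrightarrow> c \<tau> k 0 = - (LBINT s:{0..}. (cnj_vec ?L \<odot> p_hat k s \<tau>) * of_real (exp (- k * s)))) \<and>
   (\<forall>\<eta>\<ge>0. field_hat U2 k \<eta> \<tau> = S_vec v0 B0 lam \<phi>1 k \<eta> \<tau> + ?A \<tau> k \<eta> *s R_vec v0 B0 lam + ?C \<tau> k \<eta> *s cnj_vec (R_vec v0 B0 lam))"
  if \<tau>: "\<tau> \<in> {0<..<T}" and k: "k \<noteq> 0" for \<tau> k
 proof -
  have K0: "complex_of_real k \<noteq> 0" using k by simp
  have cont: "continuous_on {0..} (u \<tau> k j)" and D: "\<eta> > 0 \<Longrightarrow> (u \<tau> k j has_vector_derivative y \<tau> k j \<eta>) (at \<eta>)" for j \<eta>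
   using field_eta_halfline(1,3)[OF U2 \<tau>] unfolding u_def y_def by auto
  obtain B5 where B5: "\<And>\<eta>. \<eta> > 0 \<Longrightarrow> norm (u \<tau> k 5 \<eta>) \<le> B5"
   using field_eta_halfline(2)[OF U2 \<tau>, of k 5] unfolding u_def by blast
  obtain B2 where B2: "\<And>\<eta>. \<eta> > 0 \<Longrightarrow> norm (u \<tau> k 2 \<eta>) \<le> B2"
   using field_eta_halfline(2)[OF U2 \<tau>, of k 2] unfolding u_def by blast
  have ca: "continuous_on {0..} (a \<tau> k)" and cc: "continuous_on {0..} (c \<tau> k)"
   unfolding a_def c_def using Dc_nonzero Mc_nonzero by (auto intro!: continuous_intros cont)
  note eqs = plasma_hat_systemD[OF sys \<tau> k, unfolded mu_def[symmetric]]
  note dg = plasma_diagonalization[OF Mc_nonzero Dc_nonzero K0 Dc_eq eqs(1-5)]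
  have dga: "(a \<tau> k has_vector_derivative complex_of_real (- k) * a \<tau> k \<eta> + ?L \<odot> p_hat k \<eta> \<tau>) (at \<eta>)"
   and dgc: "(c \<tau> k has_vector_derivative complex_of_real k * c \<tau> k \<eta> + cnj_vec ?L \<odot> p_hat k \<eta> \<tau>) (at \<eta>)" if "\<eta> > 0" for \<eta>
  proof -
   have "(a \<tau> k has_vector_derivative (y \<tau> k 5 \<eta> / Dc + y \<tau> k 2 \<eta> / (\<i> * Mc)) / 2) (at \<eta>)"
    unfolding a_def by (intro has_vector_derivative_divide has_vector_derivative_add D that)
   also have "(y \<tau> k 5 \<eta> / Dc + y \<tau> k 2 \<eta> / (\<i> * Mc)) / 2 = complex_of_real (- k) * a \<tau> k \<eta> + ?L \<odot> p_hat k \<eta> \<tau>"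
    using dg(6)[OF that that that that that] unfolding bdot_vectors a_def u_def y_def of_real_minus by simp
   finally show "(a \<tau> k has_vector_derivative complex_of_real (- k) * a \<tau> k \<eta> + ?L \<odot> p_hat k \<eta> \<tau>) (at \<eta>)" .
   have "(c \<tau> k has_vector_derivative (y \<tau> k 5 \<eta> / Dc - y \<tau> k 2 \<eta> / (\<i> * Mc)) / 2) (at \<eta>)"
    unfolding c_def by (intro has_vector_derivative_divide has_vector_derivative_diff D that)
   also have "(y \<tau> k 5 \<eta> / Dc - y \<tau> k 2 \<eta> / (\<i> * Mc)) / 2 = complex_of_real k * c \<tau> k \<eta> + cnj_vec ?L \<odot> p_hat k \<eta> \<tau>"
    using dg(7)[OF that that that that that] unfolding bdot_vectors c_def u_def y_def by simp
   finally show "(c \<tau> k has_vector_derivative complex_of_real k * c \<tau> k \<eta> + cnj_vec ?L \<odot> p_hat k \<eta> \<tau>) (at \<eta>)" .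
  qed
  have A: "a \<tau> k \<eta> = ?A \<tau> k \<eta>" and C: "c \<tau> k \<eta> = ?C \<tau> k \<eta>" if "\<eta> \<ge> 0" for \<eta>
   using duhamel[OF ca dga bdot_source[OF \<tau> k] that] duhamel[OF cc dgc bdot_source[OF \<tau> k] that] by simp_all
  have bound: "norm (u \<tau> k 5 \<eta> / Dc) \<le> B5 / norm Dc" "norm (u \<tau> k 2 \<eta> / (\<i> * Mc)) \<le> B2 / norm (\<i> * Mc)" if "\<eta> > 0" for \<eta>
   unfolding norm_divide by (intro divide_right_mono B5 B2 that norm_ge_zero)+
  have ba: "norm (a \<tau> k \<eta>) \<le> (B5 / norm Dc + B2 / norm (\<i> * Mc)) / 2"
   and bc: "norm (c \<tau> k \<eta>) \<le> (B5 / norm Dc + B2 / norm (\<i> * Mc)) / 2" if "\<eta> > 0" for \<eta>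
   unfolding a_def c_def norm_divide[of _ 2] norm_numeral
   by (rule divide_right_mono[OF order_trans[OF norm_triangle_ineq add_mono[OF bound[OF that]]]]
     divide_right_mono[OF order_trans[OF norm_triangle_ineq4 add_mono[OF bound[OF that]]]], simp)+
  have i1: "a \<tau> k 0 = - (LBINT s:{0..}. (?L \<odot> p_hat k s \<tau>) * of_real (exp (k * s)))" if "k < 0"
   using bounded_solution_initial_value[OF ca dga bdot_source[OF \<tau> k] _ ba] that by simp
  have i2: "c \<tau> k 0 = - (LBINT s:{0..}. (cnj_vec ?L \<odot> p_hat k s \<tau>) * of_real (exp (- k * s)))" if "k > 0"
   using bounded_solution_initial_value[OF cc dgc bdot_source[OF \<tau> k] _ bc] that by simp
  have comp: "field_hat U2 k \<eta> \<tau> = S_vec v0 B0 lam \<phi>1 k \<eta> \<tau> + a \<tau> k \<eta> *s R_vec v0 B0 lam + c \<tau> k \<eta> *s cnj_vec (R_vec v0 B0 lam)"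
   if \<eta>: "\<eta> \<ge> 0" for \<eta>
   unfolding second_order_vector_iff[OF k]
  proof (intro conjI)
   note fe = L_forcing_eq[OF \<tau> k, unfolded bdot_vectors]
   note cl = L_forcing_continuous[OF \<tau>]
   have kk: "k \<noteq> 0 \<Longrightarrow> z / Dc / complex_of_real k = z / (Dc * complex_of_real k)" for z by simp
   have "u \<tau> k 1 \<eta> = L1_forcing v0 B0 lam \<phi>1 k \<eta> \<tau> / k + Mc * (a \<tau> k \<eta> + c \<tau> k \<eta>)"
   proof (rule eq_up_to_boundary[OF cont _ _ \<eta>])
    show "continuous_on {0..} (\<lambda>\<eta>. L1_forcing v0 B0 lam \<phi>1 k \<eta> \<tau> / k + Mc * (a \<tau> k \<eta> + c \<tau> k \<eta>))"
     using K0 by (intro continuous_intros cl ca cc) auto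
    show "u \<tau> k 1 s = L1_forcing v0 B0 lam \<phi>1 k s \<tau> / k + Mc * (a \<tau> k s + c \<tau> k s)" if "s > 0" for s
     using dg(1)[OF that that that that that] unfolding fe(1)[OF that, symmetric] u_def a_def c_def divide_divide_eq_left .
   qed
   then show "field_hat U2 k \<eta> \<tau> $ 1 = L1_forcing v0 B0 lam \<phi>1 k \<eta> \<tau> / k + Mc * (a \<tau> k \<eta> + c \<tau> k \<eta>)" by (simp add: u_def)
   have "u \<tau> k 3 \<eta> = L3_forcing v0 B0 lam \<phi>1 k \<eta> \<tau> / k - bc * (a \<tau> k \<eta> + c \<tau> k \<eta>)"
   proof (rule eq_up_to_boundary[OF cont _ _ \<eta>])
    show "continuous_on {0..} (\<lambda>\<eta>. L3_forcing v0 B0 lam \<phi>1 k \<eta> \<tau> / k - bc * (a \<tau> k \<eta> + c \<tau> k \<eta>))"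
     using K0 by (intro continuous_intros cl ca cc) auto
    show "u \<tau> k 3 s = L3_forcing v0 B0 lam \<phi>1 k s \<tau> / k - bc * (a \<tau> k s + c \<tau> k s)" if "s > 0" for s
     using dg(3)[OF that that that that that] unfolding fe(2)[OF that, symmetric] u_def a_def c_def divide_divide_eq_left .
   qed
   then show "field_hat U2 k \<eta> \<tau> $ 3 = L3_forcing v0 B0 lam \<phi>1 k \<eta> \<tau> / k - bc * (a \<tau> k \<eta> + c \<tau> k \<eta>)" by (simp add: u_def)
   have "u \<tau> k 4 \<eta> = L4_forcing v0 B0 lam \<phi>1 k \<eta> \<tau> / k - \<i> * bc * (a \<tau> k \<eta> - c \<tau> k \<eta>)"
   proof (rule eq_up_to_boundary[OF cont _ _ \<eta>])
    show "continuous_on {0..} (\<lambda>\<eta>. L4_forcing v0 B0 lam \<phi>1 k \<eta> \<tau> / k - \<i> * bc * (a \<tau> k \<eta> - c \<tau> k \<eta>))"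
     using K0 by (intro continuous_intros cl ca cc) auto
    show "u \<tau> k 4 s = L4_forcing v0 B0 lam \<phi>1 k s \<tau> / k - \<i> * bc * (a \<tau> k s - c \<tau> k s)" if "s > 0" for s
     using dg(4)[OF that that that that that] unfolding fe(3)[OF that, symmetric] u_def a_def c_def .
   qed
   then show "field_hat U2 k \<eta> \<tau> $ 4 = L4_forcing v0 B0 lam \<phi>1 k \<eta> \<tau> / k - \<i> * bc * (a \<tau> k \<eta> - c \<tau> k \<eta>)" by (simp add: u_def)
   have "a \<tau> k \<eta> + c \<tau> k \<eta> = u \<tau> k 5 \<eta> / Dc" "a \<tau> k \<eta> - c \<tau> k \<eta> = u \<tau> k 2 \<eta> / (\<i> * Mc)"
    unfolding a_def c_def by (simp_all add: field_simps)
   then show "field_hat U2 k \<eta> \<tau> $ 2 = \<i> * Mc * (a \<tau> k \<eta> - c \<tau> k \<eta>)" "field_hat U2 k \<eta> \<tau> $ 5 = Dc * (a \<tau> k \<eta> + c \<tau> k \<eta>)"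
    using Dc_nonzero Mc_nonzero by (simp_all add: u_def)
  qed
  have "\<forall>\<eta>\<ge>0. field_hat U2 k \<eta> \<tau> = S_vec v0 B0 lam \<phi>1 k \<eta> \<tau> + ?A \<tau> k \<eta> *s R_vec v0 B0 lam + ?C \<tau> k \<eta> *s cnj_vec (R_vec v0 B0 lam)"
  proof (intro allI impI)
   fix \<eta> :: real assume \<eta>: "\<eta> \<ge> 0"
   show "field_hat U2 k \<eta> \<tau> = S_vec v0 B0 lam \<phi>1 k \<eta> \<tau> + ?A \<tau> k \<eta> *s R_vec v0 B0 lam + ?C \<tau> k \<eta> *s cnj_vec (R_vec v0 B0 lam)"
    by (rule comp[OF \<eta>, unfolded A[OF \<eta>] C[OF \<eta>]])
  qed
  then show ?thesis using i1 i2 by blast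
 qed
 show ?thesis
  unfolding second_order_plasma_def Let_def
 proof (intro conjI ballI allI impI)
  fix \<tau> k \<eta> :: real assume "\<tau> \<in> {0<..<T}" "k \<noteq> 0" "\<eta> > 0"
  then show "L1_vec v0 B0 lam \<odot> p_hat k \<eta> \<tau> = L1_forcing v0 B0 lam \<phi>1 k \<eta> \<tau>"
   "L3_vec v0 B0 lam \<odot> p_hat k \<eta> \<tau> = L3_forcing v0 B0 lam \<phi>1 k \<eta> \<tau>"
   "L4_vec v0 lam \<odot> p_hat k \<eta> \<tau> = L4_forcing v0 B0 lam \<phi>1 k \<eta> \<tau>"
   by (rule L_forcing_eq)+
 next
  show "\<exists>a0 b0. \<forall>\<tau>\<in>{0<..<T}. \<forall>k. k \<noteq> 0 \<longrightarrow>
   (k < 0 \<longrightarrow> a0 k \<tau> = - (LBINT s:{0..}. (?L \<odot> p_hat k s \<tau>) * of_real (exp (k * s)))) \<and>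
   (k > 0 \<longrightarrow> b0 k \<tau> = - (LBINT s:{0..}. (cnj_vec ?L \<odot> p_hat k s \<tau>) * of_real (exp (- k * s)))) \<and>
   (\<forall>\<eta>\<ge>0. field_hat U2 k \<eta> \<tau> = S_vec v0 B0 lam \<phi>1 k \<eta> \<tau>
     + (of_real (exp (- k * \<eta>)) * (a0 k \<tau> + (LBINT s:{0..\<eta>}. (?L \<odot> p_hat k s \<tau>) * of_real (exp (k * s))))) *s R_vec v0 B0 lam
     + (of_real (exp (k * \<eta>)) * (b0 k \<tau> + (LBINT s:{0..\<eta>}. (cnj_vec ?L \<odot> p_hat k s \<tau>) * of_real (exp (- k * s)))))
       *s cnj_vec (R_vec v0 B0 lam))"
   by (rule exI[of _ "\<lambda>k \<tau>. a \<tau> k 0"], rule exI[of _ "\<lambda>k \<tau>. c \<tau> k 0"]) (use main in blast)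
 qed
qed

text \<open>
  Components 2, 4 and 5 are differentiated. The divergence of \<open>B\<close> closes because its forcing is \<open>- B0 / m\<close> times
  the one of the divergence of \<open>v\<close>.
\<close>

lemma second_order_plasma_backward:
 assumes U2: "profile {0<..} T U2" and so: "second_order_plasma v0 B0 lam T U1 \<phi>1 U2"
 shows "plasma_hat_system m B0 T U2 (forcing v0 B0 lam U1 \<phi>1) (divergence_forcing U1 \<phi>1)"
 unfolding plasma_hat_system_def
proof (intro ballI allI impI)
 fix \<tau> k \<eta> :: real assume \<tau>: "\<tau> \<in> {0<..<T}" and k: "k \<noteq> 0" and \<eta>: "\<eta> > 0"
 let ?L = "L_vec v0 B0 lam"
 have K0: "complex_of_real k \<noteq> 0" using k by simp
 obtain a0 b0 where f: "\<forall>\<eta>\<ge>0. field_hat U2 k \<eta> \<tau> = S_vec v0 B0 lam \<phi>1 k \<eta> \<tau>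
     + (of_real (exp (- k * \<eta>)) * (a0 k \<tau> + (LBINT s:{0..\<eta>}. (?L \<odot> p_hat k s \<tau>) * of_real (exp (k * s))))) *s R_vec v0 B0 lam
     + (of_real (exp (k * \<eta>)) * (b0 k \<tau> + (LBINT s:{0..\<eta>}. (cnj_vec ?L \<odot> p_hat k s \<tau>) * of_real (exp (- k * s)))))
       *s cnj_vec (R_vec v0 B0 lam)"
  using so \<tau> k unfolding second_order_plasma_def Let_def by blast
 define A where "A = (\<lambda>\<eta>. of_real (exp (- k * \<eta>)) * (a0 k \<tau> + (LBINT s:{0..\<eta>}. (?L \<odot> p_hat k s \<tau>) * of_real (exp (k * s)))))"
 define C where "C = (\<lambda>\<eta>. of_real (exp (k * \<eta>)) * (b0 k \<tau> + (LBINT s:{0..\<eta>}. (cnj_vec ?L \<odot> p_hat k s \<tau>) * of_real (exp (- k * s)))))"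
 have comp: "field_hat U2 k s \<tau> $ 1 = L1_forcing v0 B0 lam \<phi>1 k s \<tau> / k + Mc * (A s + C s)"
  "field_hat U2 k s \<tau> $ 2 = \<i> * Mc * (A s - C s)"
  "field_hat U2 k s \<tau> $ 3 = L3_forcing v0 B0 lam \<phi>1 k s \<tau> / k - bc * (A s + C s)"
  "field_hat U2 k s \<tau> $ 4 = L4_forcing v0 B0 lam \<phi>1 k s \<tau> / k - \<i> * bc * (A s - C s)"
  "field_hat U2 k s \<tau> $ 5 = Dc * (A s + C s)" if "s > 0" for s
  using f[rule_format, OF less_imp_le[OF that], folded A_def C_def, unfolded second_order_vector_iff[OF k]] unfolding A_def C_def by blast+
 define A' where "A' = complex_of_real (- k) * A \<eta> + ?L \<odot> p_hat k \<eta> \<tau>"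
 define C' where "C' = complex_of_real k * C \<eta> + cnj_vec ?L \<odot> p_hat k \<eta> \<tau>"
 have DA: "(A has_vector_derivative A') (at \<eta>)"
  using duhamel_has_derivative[OF bdot_source[OF \<tau> k, of ?L] \<eta>, of "- k" "a0 k \<tau>"] unfolding A_def A'_def by simp
 have DC: "(C has_vector_derivative C') (at \<eta>)"
  using duhamel_has_derivative[OF bdot_source[OF \<tau> k, of "cnj_vec ?L"] \<eta>, of k "b0 k \<tau>"] unfolding C_def C'_def by simp
 have D: "((\<lambda>\<eta>. field_hat U2 k \<eta> \<tau> $ j) has_vector_derivative field_hat (pd2 U2) k \<eta> \<tau> $ j) (at \<eta>)" for j
  by (rule field_eta_halfline(3)[OF U2 \<tau> \<eta>])
 have unique: "field_hat (pd2 U2) k \<eta> \<tau> $ j = X" if "(g has_vector_derivative X) (at \<eta>)" "\<And>s. s > 0 \<Longrightarrow> field_hat U2 k s \<tau> $ j = g s" for g X j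
 proof -
  have "((\<lambda>\<eta>. field_hat U2 k \<eta> \<tau> $ j) has_vector_derivative X) (at \<eta>)"
   by (rule has_vector_derivative_transform_within_open[OF that(1), of "{0<..}"]) (use \<eta> that(2) in auto)
  then show ?thesis using D vector_derivative_unique_at by blast
 qed
 have y5: "field_hat (pd2 U2) k \<eta> \<tau> $ 5 = Dc * (A' + C')"
  by (rule unique[OF _ comp(5)]) (intro has_vector_derivative_mult_right has_vector_derivative_add DA DC)
 have y2: "field_hat (pd2 U2) k \<eta> \<tau> $ 2 = \<i> * Mc * (A' - C')"
  by (rule unique[OF _ comp(2)]) (intro has_vector_derivative_mult_right has_vector_derivative_diff DA DC)
 define f where "f = of_real \<bar>k\<bar> * E k \<eta> * wt \<tau> k"
 define q where "q = conv (w \<tau>) (\<lambda>a b. KF a b * E2 \<eta> a b) k"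
 have L4: "L4_forcing v0 B0 lam \<phi>1 k s \<tau> / k = (bc / Mc * wt \<tau> k) * of_real (exp (- \<bar>k\<bar> * s))" for s
  unfolding L4_forcing_def mu_def[symmetric] using K0 by (simp add: field_simps)
 have y4: "field_hat (pd2 U2) k \<eta> \<tau> $ 4 = - (bc / Mc) * f - \<i> * bc * (A' - C')"
 proof (rule unique[OF _ comp(4)])
  have "((\<lambda>s. L4_forcing v0 B0 lam \<phi>1 k s \<tau> / k) has_vector_derivative - (bc / Mc) * f) (at \<eta>)"
   unfolding L4 using exponential_has_derivative[of "bc / Mc * wt \<tau> k" "- \<bar>k\<bar>" \<eta>]
   by (simp add: f_def E_def ac_simps)
  then show "((\<lambda>s. L4_forcing v0 B0 lam \<phi>1 k s \<tau> / k - \<i> * bc * (A s - C s)) has_vector_derivative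
    - (bc / Mc) * f - \<i> * bc * (A' - C')) (at \<eta>)"
   by (intro has_vector_derivative_diff has_vector_derivative_mult_right DA DC)
 qed
 note ff = forcing_fourier[OF \<tau> \<eta> k, unfolded mu_def[symmetric], folded f_def q_def]
 define p1 p2 p4 where "p1 = p_hat k \<eta> \<tau> $ 1" and "p2 = p_hat k \<eta> \<tau> $ 2" and "p4 = p_hat k \<eta> \<tau> $ 4"
 note fe = L_forcing_eq[OF \<tau> k \<eta>, unfolded bdot_vectors ff(3,5), folded p1_def p2_def p4_def]
 note cv0 = plasma_diagonalization_converse[OF Mc_nonzero Dc_nonzero K0 Dc_eq, where a="A \<eta>" and c="C \<eta>"]
 note cv = cv0(1)[where ?p1.0=p1 and f=f]
  cv0(2)[where ?p1.0=p1 and ?p2.0=p2 and f=f and ?p4.0=p4 and q=q]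
  cv0(3)[where ?p1.0=p1 and f=f] cv0(4)[where ?p4.0=p4]
  cv0(5)[where ?p1.0=p1 and ?p2.0=p2 and f=f and ?p4.0=p4 and q=q]
  cv0(6)[where ?p1.0=p1 and ?p2.0=p2 and f=f and ?p4.0=p4 and q=q]
 have A'_eq: "A' = - complex_of_real k * A \<eta> + \<i> / (2 * Dc * Mc) * (Mc * p1 + \<i> * Mc * p2 - bc * (bc * f) - \<i> * bc * p4 + Dc * (Mc * q))"
  and C'_eq: "C' = complex_of_real k * C \<eta> - \<i> / (2 * Dc * Mc) * (Mc * p1 - \<i> * Mc * p2 - bc * (bc * f) + \<i> * bc * p4 + Dc * (Mc * q))"
  unfolding A'_def C'_def bdot_vectors ff(3,5) p1_def p2_def p4_def by simp_all
 note c = comp[OF \<eta>, folded fe, unfolded divide_divide_eq_left]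
 show "let u = field_hat U2 k \<eta> \<tau>; y = field_hat (pd2 U2) k \<eta> \<tau>; f = p_hat k \<eta> \<tau> in
   \<i> * k * (u$5 - m * u$1 - B0 * u$3) + f$1 = 0 \<and> y$5 - \<i> * k * (m * u$2 + B0 * u$4) + f$2 = 0 \<and>
   - (\<i> * k * (m * u$3 + B0 * u$1)) + f$3 = 0 \<and> - (\<i> * k * (m * u$4 + B0 * u$2)) + f$4 = 0 \<and>
   \<i> * k * u$1 + y$2 + f$5 = 0 \<and> \<i> * k * u$3 + y$4 + fourier (\<lambda>x. divergence_forcing U1 \<phi>1 x \<eta> \<tau>) k = 0"
  unfolding Let_def mu_def[symmetric] ff(3,5,6) y2 y4 y5 c p1_def[symmetric] p2_def[symmetric] p4_def[symmetric]
  using cv[folded A'_eq C'_eq] by simp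
qed

end

section \<open>The exponential kernel of a half line\<close>

text \<open>
 The kernel \<open>exp (- \<kappa> \<bar>s - z\<bar>)\<close> on the half line splits at \<open>z = s\<close> into two parts, which solve
 first order equations with the rates \<open>- \<kappa>\<close> and \<open>\<kappa>\<close>; \<open>future\<close> is the only bounded solution
 (up to the sign) of the second one.
\<close>

definition past :: "real \<Rightarrow> (real \<Rightarrow> complex) \<Rightarrow> real \<Rightarrow> complex" where
 "past \<kappa> r s = of_real (exp (- \<kappa> * s)) * (0 + (LBINT z:{0..s}. r z * of_real (exp (- (- \<kappa> * z)))))"

definition future :: "real \<Rightarrow> (real \<Rightarrow> complex) \<Rightarrow> real \<Rightarrow> complex" where
 "future \<kappa> r s = - (of_real (exp (\<kappa> * s)) * (- (LBINT z:{0..}. r z * of_real (exp (- (\<kappa> * z))))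
   + (LBINT z:{0..s}. r z * of_real (exp (- (\<kappa> * z))))))"

lemma past_derivative:
 "halfline_source r \<Longrightarrow> s > 0 \<Longrightarrow> (past \<kappa> r has_vector_derivative (- complex_of_real \<kappa> * past \<kappa> r s + r s)) (at s)"
 using duhamel_has_derivative[of r s "- \<kappa>" 0] unfolding past_def[abs_def] by simp

lemma future_derivative:
 "halfline_source r \<Longrightarrow> s > 0 \<Longrightarrow> (future \<kappa> r has_vector_derivative (complex_of_real \<kappa> * future \<kappa> r s - r s)) (at s)"
 using has_vector_derivative_minus[OF duhamel_has_derivative[of r s \<kappa> "- (LBINT z:{0..}. r z * of_real (exp (- (\<kappa> * z))))"]]
 unfolding future_def[abs_def] by simp

lemma past_continuous: "halfline_source r \<Longrightarrow> continuous_on {0..} (past \<kappa> r)"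
 unfolding past_def[abs_def] by (rule duhamel_continuous)

lemma decaying_solution:
 assumes "continuous_on {0..} y" "\<And>s. s > 0 \<Longrightarrow> (y has_vector_derivative (- complex_of_real \<kappa> * y s + r s)) (at s)"
  "halfline_source r" "s \<ge> 0"
 shows "y s = of_real (exp (- \<kappa> * s)) * y 0 + past \<kappa> r s"
 using duhamel[of y "- \<kappa>" r s] assms unfolding past_def by (simp add: distrib_left)

lemma past_0: "halfline_source r \<Longrightarrow> past \<kappa> r 0 = 0"
 using decaying_solution[where y="past \<kappa> r" and \<kappa>=\<kappa> and r=r and s=0] past_continuous[of r \<kappa>] past_derivative[of r _ \<kappa>]
 by simp

lemma growing_solution:
 assumes y: "continuous_on {0..} y" and D: "\<And>s. s > 0 \<Longrightarrow> (y has_vector_derivative (complex_of_real \<kappa> * y s + r s)) (at s)"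
  and r: "halfline_source r" and \<kappa>: "\<kappa> > 0" and bdd: "\<And>s. s > 0 \<Longrightarrow> norm (y s) \<le> M" and s: "s \<ge> 0"
 shows "y s = - future \<kappa> r s"
 using duhamel[OF y D r s] bounded_solution_initial_value[OF y D r \<kappa> bdd] unfolding future_def by simp

lemma two_sided_kernel:
 assumes r: "halfline_source r" and \<kappa>: "\<kappa> > 0" and s: "s \<ge> 0"
 shows "(LBINT z:{0..}. of_real (exp (- \<kappa> * \<bar>s - z\<bar>)) * r z) = past \<kappa> r s + future \<kappa> r s"
proof -
 have S: "{0..} = {0..s} \<union> {s<..}" using s by auto
 have e: "set_integrable lborel {s<..} (\<lambda>z. exp (- (\<kappa> * z)))"
  by (rule set_integrable_subset[OF set_integrable_exp_atLeast[OF \<kappa>]]) (use s in auto)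
 have i1: "set_integrable lborel {0..s} (\<lambda>z. r z * complex_of_real (exp (- (- \<kappa> * z))))"
  by (rule halfline_source_integrable[OF r _ _ set_integrable_exp_Icc]) auto
 have i2: "set_integrable lborel {0..s} (\<lambda>z. r z * complex_of_real (exp (- (\<kappa> * z))))"
  by (rule halfline_source_integrable[OF r _ _ set_integrable_exp_Icc]) auto
 have i3: "set_integrable lborel {s<..} (\<lambda>z. r z * complex_of_real (exp (- (\<kappa> * z))))"
  by (rule halfline_source_integrable[OF r _ _ e]) (use s in auto)
 have split: "(LBINT z:{0..}. r z * complex_of_real (exp (- (\<kappa> * z)))) =
   (LBINT z:{0..s}. r z * complex_of_real (exp (- (\<kappa> * z)))) + (LBINT z:{s<..}. r z * complex_of_real (exp (- (\<kappa> * z))))"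
  unfolding S by (rule set_integral_Un[OF _ i2 i3]) auto
 have l: "of_real (exp (- \<kappa> * \<bar>s - z\<bar>)) * r z = of_real (exp (- \<kappa> * s)) * (r z * complex_of_real (exp (- (- \<kappa> * z))))"
  if "z \<in> {0..s}" for z
 proof -
  have "exp (- \<kappa> * \<bar>s - z\<bar>) = exp (- \<kappa> * s) * exp (- (- \<kappa> * z))"
   unfolding exp_add[symmetric] using that by (simp add: algebra_simps)
  then show ?thesis by (simp only: of_real_mult ac_simps)
 qed
 have g: "of_real (exp (- \<kappa> * \<bar>s - z\<bar>)) * r z = of_real (exp (\<kappa> * s)) * (r z * complex_of_real (exp (- (\<kappa> * z))))"
  if "z \<in> {s<..}" for z
 proof -
  have "exp (- \<kappa> * \<bar>s - z\<bar>) = exp (\<kappa> * s) * exp (- (\<kappa> * z))"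
   unfolding exp_add[symmetric] using that by (simp add: algebra_simps)
  then show ?thesis by (simp only: of_real_mult ac_simps)
 qed
 have "(LBINT z:{0..}. of_real (exp (- \<kappa> * \<bar>s - z\<bar>)) * r z) =
   (LBINT z:{0..s}. of_real (exp (- \<kappa> * \<bar>s - z\<bar>)) * r z) + (LBINT z:{s<..}. of_real (exp (- \<kappa> * \<bar>s - z\<bar>)) * r z)"
  unfolding S
 proof (rule set_integral_Un)
  show "set_integrable lborel {0..s} (\<lambda>z. of_real (exp (- \<kappa> * \<bar>s - z\<bar>)) * r z)"
   by (rule set_integrable_cong[OF refl refl l, THEN iffD2]) (assumption, rule set_integrable_mult_right, rule i1)
  show "set_integrable lborel {s<..} (\<lambda>z. of_real (exp (- \<kappa> * \<bar>s - z\<bar>)) * r z)"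
   by (rule set_integrable_cong[OF refl refl g, THEN iffD2]) (assumption, rule set_integrable_mult_right, rule i3)
 qed auto
 also have "(LBINT z:{0..s}. of_real (exp (- \<kappa> * \<bar>s - z\<bar>)) * r z) = past \<kappa> r s"
  unfolding past_def add_0_left set_integral_mult_right[symmetric]
  by (rule set_lebesgue_integral_cong) (simp, intro allI impI, rule l)
 also have "(LBINT z:{s<..}. of_real (exp (- \<kappa> * \<bar>s - z\<bar>)) * r z) =
   of_real (exp (\<kappa> * s)) * (LBINT z:{s<..}. r z * complex_of_real (exp (- (\<kappa> * z))))"
  unfolding set_integral_mult_right[symmetric]
  by (rule set_lebesgue_integral_cong) (simp, intro allI impI, rule g)
 also have "\<dots> = future \<kappa> r s" unfolding future_def split by (simp add: algebra_simps)
 finally show ?thesis .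
qed

lemma past_by_parts:
 assumes Q: "continuous_on {0..} Q" and D: "\<And>s. s > 0 \<Longrightarrow> (Q has_vector_derivative q s) (at s)"
  and sQ: "halfline_source Q" and sq: "halfline_source q" and s: "s \<ge> 0"
 shows "past \<kappa> q s = Q s - of_real (exp (- \<kappa> * s)) * Q 0 - \<kappa> * past \<kappa> Q s"
proof -
 define X where "X = (\<lambda>s. Q s - \<kappa> * past \<kappa> Q s)"
 have "X s = of_real (exp (- \<kappa> * s)) * X 0 + past \<kappa> q s"
 proof (rule decaying_solution[OF _ _ sq s])
  show "continuous_on {0..} X" unfolding X_def by (intro continuous_intros Q past_continuous sQ)
  show "(X has_vector_derivative - complex_of_real \<kappa> * X s + q s) (at s)" if "s > 0" for s
  proof -
   have "(X has_vector_derivative q s - \<kappa> * (- complex_of_real \<kappa> * past \<kappa> Q s + Q s)) (at s)"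
    unfolding X_def by (intro has_vector_derivative_diff has_vector_derivative_mult_right D past_derivative sQ that)
   then show ?thesis by (simp add: X_def algebra_simps)
  qed
 qed
 moreover have "X 0 = Q 0" by (simp add: X_def past_0[OF sQ])
 ultimately have "X s = of_real (exp (- \<kappa> * s)) * Q 0 + past \<kappa> q s" by simp
 then show ?thesis by (simp add: X_def algebra_simps)
qed

lemma future_by_parts:
 assumes Q: "continuous_on {0..} Q" and D: "\<And>s. s > 0 \<Longrightarrow> (Q has_vector_derivative q s) (at s)"
  and sQ: "halfline_source Q" and sq: "halfline_source q" and \<kappa>: "\<kappa> > 0" and s: "s \<ge> 0"
 shows "future \<kappa> q s = - Q s + \<kappa> * future \<kappa> Q s"
proof -
 obtain M where M: "\<And>s. s > 0 \<Longrightarrow> norm (Q s) \<le> M" using sQ unfolding halfline_source_def by blast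
 have "Q s = - future \<kappa> (\<lambda>s. q s - \<kappa> * Q s) s"
 proof (rule growing_solution[OF Q _ _ \<kappa> M s])
  show "(Q has_vector_derivative complex_of_real \<kappa> * Q s + (q s - \<kappa> * Q s)) (at s)" if "s > 0" for s
   using D[OF that] by simp
 qed (intro halfline_source_intros sQ sq)
 also have "future \<kappa> (\<lambda>s. q s - \<kappa> * Q s) s = future \<kappa> q s - \<kappa> * future \<kappa> Q s"
 proof -
  have lin: "(LBINT z:S. (q z - \<kappa> * Q z) * complex_of_real (exp (- (\<kappa> * z)))) =
    (LBINT z:S. q z * of_real (exp (- (\<kappa> * z)))) - \<kappa> * (LBINT z:S. Q z * of_real (exp (- (\<kappa> * z))))"
   if S: "S \<subseteq> {0..}" "S \<in> sets lborel" "set_integrable lborel S (\<lambda>z. exp (- (\<kappa> * z)))" for S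
   unfolding left_diff_distrib mult.assoc set_integral_mult_right[symmetric]
   by (intro set_integral_diff set_integrable_mult_right halfline_source_integrable sQ sq S)
  have 1: "{0..} \<subseteq> {0::real..}" "{0::real..} \<in> sets lborel" and 2: "{0..s} \<subseteq> {0..}" "{0..s} \<in> sets lborel" by auto
  show ?thesis unfolding future_def lin[OF 1 set_integrable_exp_atLeast[OF \<kappa>]] lin[OF 2 set_integrable_exp_Icc]
   by (simp add: algebra_simps)
 qed
 finally show ?thesis by (simp add: algebra_simps)
qed

text \<open>
  The combinations \<open>g + \<kappa> h\<close> and \<open>g - \<kappa> h\<close> decouple the system.
\<close>

lemma two_sided_solution:
 fixes h g Q :: "real \<Rightarrow> complex"
 assumes \<kappa>: "\<kappa> > 0" and h: "continuous_on {0..} h" and g: "continuous_on {0..} g"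
  and bh: "\<And>s. s > 0 \<Longrightarrow> norm (h s) \<le> M" and bg: "\<And>s. s > 0 \<Longrightarrow> norm (g s) \<le> M'" and Q: "halfline_source Q"
  and Dh: "\<And>s. s > 0 \<Longrightarrow> (h has_vector_derivative - g s) (at s)"
  and Dg: "\<And>s. s > 0 \<Longrightarrow> (g has_vector_derivative (Q s - complex_of_real \<kappa> * complex_of_real \<kappa> * h s)) (at s)"
 shows "\<exists>\<alpha>. \<forall>s\<ge>0. h s = \<alpha> * of_real (exp (- \<kappa> * s)) + (past \<kappa> Q s + future \<kappa> Q s) / of_real (2 * \<kappa>) \<and>
  g s = \<kappa> * \<alpha> * of_real (exp (- \<kappa> * s)) + (past \<kappa> Q s - future \<kappa> Q s) / 2"
proof (intro exI allI impI)
 fix s :: real assume s: "s \<ge> 0"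
 define x y where "x = (\<lambda>s. g s + \<kappa> * h s)" and "y = (\<lambda>s. g s - \<kappa> * h s)"
 have x: "x s = of_real (exp (- \<kappa> * s)) * x 0 + past \<kappa> Q s"
 proof (rule decaying_solution[OF _ _ Q s])
  show "continuous_on {0..} x" unfolding x_def by (intro continuous_intros h g)
  show "(x has_vector_derivative - complex_of_real \<kappa> * x s + Q s) (at s)" if "s > 0" for s
  proof -
   have "(x has_vector_derivative Q s - complex_of_real \<kappa> * complex_of_real \<kappa> * h s + \<kappa> * (- g s)) (at s)"
    unfolding x_def by (intro has_vector_derivative_add has_vector_derivative_mult_right Dh Dg that)
   then show ?thesis by (simp add: x_def algebra_simps)
  qed
 qed
 have y: "y s = - future \<kappa> Q s"
 proof (rule growing_solution[OF _ _ Q \<kappa> _ s])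
  show "continuous_on {0..} y" unfolding y_def by (intro continuous_intros h g)
  show "(y has_vector_derivative complex_of_real \<kappa> * y s + Q s) (at s)" if "s > 0" for s
  proof -
   have "(y has_vector_derivative Q s - complex_of_real \<kappa> * complex_of_real \<kappa> * h s - \<kappa> * (- g s)) (at s)"
    unfolding y_def by (intro has_vector_derivative_diff has_vector_derivative_mult_right Dh Dg that)
   then show ?thesis by (simp add: y_def algebra_simps)
  qed
  show "norm (y s) \<le> M' + norm (complex_of_real \<kappa>) * M" if "s > 0" for s
   unfolding y_def by (intro norm_combination bh bg that)
 qed
 have hx: "h s = (x s - y s) / of_real (2 * \<kappa>)" "g s = (x s + y s) / 2"
  using \<kappa> by (simp_all add: x_def y_def)
 show "h s = (x 0 / of_real (2 * \<kappa>)) * of_real (exp (- \<kappa> * s)) + (past \<kappa> Q s + future \<kappa> Q s) / of_real (2 * \<kappa>) \<and>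
  g s = \<kappa> * (x 0 / of_real (2 * \<kappa>)) * of_real (exp (- \<kappa> * s)) + (past \<kappa> Q s - future \<kappa> Q s) / 2"
  unfolding hx x y using \<kappa> by (simp add: field_simps)
qed

section \<open>The quadratic forcing in the vacuum\<close>

context first_order_solution
begin

definition EV :: "real \<Rightarrow> real \<Rightarrow> complex" where "EV b s = of_real (exp (- (\<sigma> * \<bar>b\<bar> * s)))"

definition KQ :: "real \<Rightarrow> real \<Rightarrow> complex" where "KQ a b = of_real a * of_real b * of_real b"
definition KP :: "real \<Rightarrow> real \<Rightarrow> complex" where
 "KP a b = (of_real a * of_real a + 2 * of_real a * of_real b) * (of_real b * of_real \<bar>b\<bar>)"
definition KR :: "real \<Rightarrow> real \<Rightarrow> complex" where "KR a b = KQ a b * of_real \<bar>b\<bar>"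

abbreviation "Nc \<equiv> complex_of_real \<nu>"
abbreviation "Lc \<equiv> complex_of_real lam"
abbreviation "Hc \<equiv> complex_of_real H0"
abbreviation "Sc \<equiv> complex_of_real \<sigma>"

text \<open>The forcing in the reflected variable \<open>s = - \<eta>\<close>.\<close>

definition "convV K t k s = conv (w t) (\<lambda>a b. K a b * EV b s) k"
definition "P1 t k s = - (Nc * Sc * Hc * of_real \<bar>k\<bar> * EV k s * wt t k) - \<i> * Nc * Lc * (Sc * Sc) * Hc * convV KQ t k s"
definition "P2 t k s = \<i> * Nc * Hc * of_real k * EV k s * wt t k"
definition "P3 t k s = - (\<i> * Nc * Nc * Lc * Hc * of_real k * EV k s * wt t k) - Sc * Sc * Sc * Hc * convV KG t k s"
definition "P4 t k s = \<i> * Hc * (Sc * Sc) * convV KQ t k s"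
definition "PQ t k s = 2 * Nc * Nc * Nc * Lc * Lc * Hc * of_real k * of_real k * EV k s * wt t k
  - \<i> * Nc * Lc * (Sc * Sc) * Sc * Hc * convV KP t k s"

lemma vacuum_kernels_tame: "tame KQ" "tame KP" "tame KR"
 unfolding KQ_def[abs_def] KP_def[abs_def] KR_def[abs_def] by (intro tame_intros)+

lemma sigma_rate: "continuous_on UNIV (\<lambda>p::real\<times>real. \<sigma> * \<bar>snd p\<bar>)" "\<sigma> * \<bar>b\<bar> \<ge> 0" "tame (\<lambda>a b. of_real (\<sigma> * \<bar>b\<bar>))"
 using sigma_pos by (auto intro!: continuous_intros tame_intros)

lemma tame_EV: "s \<ge> 0 \<Longrightarrow> tame (\<lambda>a b. EV b s)"
 unfolding EV_def by (rule tame_exp) (use sigma_rate(1,2) in auto)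

lemma sigma_square_complex: "Nc * Lc * (Nc * Lc) = 1 - Sc * Sc"
 using arg_cong[OF sigma_sq, of complex_of_real] by (simp add: power2_eq_square ac_simps)

lemma convV_continuous:
 assumes t: "t \<in> {0<..<T}" and K: "tame K"
 shows "continuous_on {0..} (convV K t k)" and "\<exists>M. \<forall>s\<ge>0. norm (convV K t k s) \<le> M"
 unfolding convV_def[abs_def] EV_def
 by (rule conv_continuous[OF w_rapid[OF t] K, of "\<lambda>a b. \<sigma> * \<bar>b\<bar>", OF sigma_rate(1,2)])+

lemma convV_derivative:
 assumes t: "t \<in> {0<..<T}" and K: "tame K" and s: "s > 0"
 shows "(convV K t k has_vector_derivative - Sc * convV (\<lambda>a b. K a b * of_real \<bar>b\<bar>) t k s) (at s)"
proof -
 have "(convV K t k has_vector_derivative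
   conv (w t) (\<lambda>a b. - complex_of_real (\<sigma> * \<bar>b\<bar>) * K a b * complex_of_real (exp (- (\<sigma> * \<bar>b\<bar> * s)))) k) (at s)"
  unfolding convV_def[abs_def] EV_def
  by (rule conv_derivative[OF w_rapid[OF t] K, of "\<lambda>a b. \<sigma> * \<bar>b\<bar>", OF sigma_rate(3,1,2) s])
 also have "conv (w t) (\<lambda>a b. - complex_of_real (\<sigma> * \<bar>b\<bar>) * K a b * complex_of_real (exp (- (\<sigma> * \<bar>b\<bar> * s)))) k =
   - Sc * convV (\<lambda>a b. K a b * of_real \<bar>b\<bar>) t k s"
  unfolding convV_def conv_cmult[symmetric] by (rule conv_cong) (simp only: EV_def of_real_mult mult_minus_left mult_minus_right ac_simps)
 finally show ?thesis .
qed

lemma convV_source: "t \<in> {0<..<T} \<Longrightarrow> tame K \<Longrightarrow> halfline_source (convV K t k)"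
 unfolding halfline_source_def using convV_continuous[of t K k] continuous_on_subset[of "{0..}" "convV K t k" "{0<..}"]
 by (auto intro: less_imp_le)

lemma EV_facts: "continuous_on S (EV k)" "s \<ge> 0 \<Longrightarrow> norm (EV k s) \<le> 1"
 "(EV k has_vector_derivative - Sc * of_real \<bar>k\<bar> * EV k s) (at s)" (is ?thesis3) "halfline_source (EV k)"
proof -
 show c: "continuous_on S (EV k)" for S unfolding EV_def[abs_def] by (intro continuous_intros)
 show n: "norm (EV k s) \<le> 1" if "s \<ge> 0" for s unfolding EV_def using sigma_pos that by simp
 show ?thesis3
  using exponential_has_derivative[of 1 "- (\<sigma> * \<bar>k\<bar>)" s] unfolding EV_def[abs_def] by simp
 show "halfline_source (EV k)" unfolding halfline_source_def using c n by (meson less_imp_le)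
qed

lemma P_vac_eq:
 "p1_vac \<nu> H0 lam \<phi>1 k (- s) t = P1 t k s" (is ?thesis1) "p2_vac \<nu> H0 lam \<phi>1 k (- s) t = P2 t k s" (is ?thesis2)
 "P_vac \<nu> H0 lam \<phi>1 k (- s) t = PQ t k s" (is ?thesis3)
proof -
 have e: "\<sigma> * \<bar>b\<bar> * - s = - (\<sigma> * \<bar>b\<bar> * s)" for b by simp
 have S: "Nc\<^sup>2 * Lc\<^sup>2 - 1 = - (Sc * Sc)" using sigma_square_complex by (simp add: power2_eq_square algebra_simps)
 have 1: "(CLBINT l. complex_of_real ((k - l) * l\<^sup>2 * exp (- (\<sigma> * \<bar>l\<bar> * s))) * w t (k - l) * w t l) = convV KQ t k s"
  unfolding convV_def conv_def KQ_def EV_def by (simp only: of_real_mult power2_eq_square mult.assoc)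
 have 2: "(CLBINT l. complex_of_real ((k\<^sup>2 - l\<^sup>2) * l * \<bar>l\<bar> * exp (- (\<sigma> * \<bar>l\<bar> * s))) * w t (k - l) * w t l) = convV KP t k s"
 proof -
  have "complex_of_real ((k\<^sup>2 - l\<^sup>2) * l * \<bar>l\<bar> * exp (- (\<sigma> * \<bar>l\<bar> * s))) = KP (k - l) l * EV l s" for l
  proof -
   have "(k\<^sup>2 - l\<^sup>2) = ((k - l) * (k - l) + 2 * (k - l) * l)" by (simp add: power2_eq_square algebra_simps)
   then show ?thesis by (simp only: KP_def EV_def of_real_mult of_real_add of_real_numeral mult.assoc)
  qed
  then show ?thesis unfolding convV_def conv_def by (simp only: mult.assoc)
 qed
 show ?thesis1 ?thesis2
  ?thesis3
  unfolding p1_vac_def p2_vac_def P_vac_def P1_def P2_def PQ_def e S 1 2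
  unfolding of_real_mult EV_def[symmetric] power2_eq_square power3_eq_cube of_real_numeral
  by (simp_all only: ac_simps mult_minus_left mult_minus_right diff_conv_add_uminus)
qed

lemma P_regular:
 assumes t: "t \<in> {0<..<T}"
 shows "continuous_on {0..} (P1 t k)" (is ?thesis1) "continuous_on {0..} (P2 t k)" (is ?thesis2) "continuous_on {0..} (PQ t k)" (is ?thesis3)
  "halfline_source (P1 t k)" (is ?thesis4) "halfline_source (PQ t k)" (is ?thesis5)
proof -
 have E: "halfline_source (\<lambda>s. c * EV k s * wt t k)" for c
  using halfline_source_cmult[OF EV_facts(4), of "c * wt t k" k] by (simp add: ac_simps)
 show ?thesis1 ?thesis2 ?thesis3
  unfolding P1_def[abs_def] P2_def[abs_def] PQ_def[abs_def]
  by (intro continuous_intros convV_continuous EV_facts t vacuum_kernels_tame)+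
 have "halfline_source (\<lambda>s. (- (Nc * Sc * Hc * of_real \<bar>k\<bar>)) * EV k s * wt t k - \<i> * Nc * Lc * (Sc * Sc) * Hc * convV KQ t k s)"
  by (intro halfline_source_intros E convV_source t vacuum_kernels_tame)
 then show ?thesis4 by (rule halfline_source_cong) (simp add: P1_def)
 show ?thesis5
  unfolding PQ_def[abs_def] by (intro halfline_source_intros E convV_source t vacuum_kernels_tame)
qed

lemma P_derivatives:
 assumes t: "t \<in> {0<..<T}" and s: "s > 0"
 shows "(P1 t k has_vector_derivative - (PQ t k s - \<i> * Nc * Lc * of_real k * P3 t k s + \<i> * of_real k * P2 t k s)) (at s)" (is ?thesis1)
  and "(P2 t k has_vector_derivative - Sc * of_real \<bar>k\<bar> * P2 t k s) (at s)" (is ?thesis2)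
  and "\<exists>q. halfline_source q \<and> (\<forall>s>0. (PQ t k has_vector_derivative q s) (at s))" (is ?thesis3)
proof -
 have kk: "complex_of_real \<bar>k\<bar> * complex_of_real \<bar>k\<bar> = complex_of_real k * complex_of_real k"
  by (simp flip: of_real_mult)
 have cRG: "convV KP t k s = convV KR t k s + of_real k * convV KG t k s"
  unfolding convV_def conv_cmult[symmetric]
  by (subst conv_add[OF w_rapid[OF t], symmetric])
   (auto intro!: tame_intros tame_EV kernels_tame vacuum_kernels_tame conv_cong simp: less_imp_le[OF s] KP_def KR_def KQ_def KG_def algebra_simps)
 have "(P1 t k has_vector_derivative - (Nc * Sc * Hc * of_real \<bar>k\<bar> * (- Sc * of_real \<bar>k\<bar> * EV k s) * wt t k)
   - \<i> * Nc * Lc * (Sc * Sc) * Hc * (- Sc * convV KR t k s)) (at s)"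
  unfolding P1_def[abs_def] KR_def[abs_def]
  by (intro has_vector_derivative_diff has_vector_derivative_minus has_vector_derivative_mult_right has_vector_derivative_mult_left
    EV_facts convV_derivative t s vacuum_kernels_tame)
 also have "- (Nc * Sc * Hc * of_real \<bar>k\<bar> * (- Sc * of_real \<bar>k\<bar> * EV k s) * wt t k)
   - \<i> * Nc * Lc * (Sc * Sc) * Hc * (- Sc * convV KR t k s) =
  - (PQ t k s - \<i> * Nc * Lc * of_real k * P3 t k s + \<i> * of_real k * P2 t k s)"
 proof -
  have "Nc * Sc * Hc * of_real \<bar>k\<bar> * (- Sc * of_real \<bar>k\<bar> * EV k s) * wt t k =
   - (Nc * Hc * EV k s * wt t k) * (complex_of_real \<bar>k\<bar> * complex_of_real \<bar>k\<bar>) * (Sc * Sc)"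
   by (simp only: ac_simps mult_minus_left mult_minus_right)
  then have a: "Nc * Sc * Hc * of_real \<bar>k\<bar> * (- Sc * of_real \<bar>k\<bar> * EV k s) * wt t k =
   - (Nc * Hc * EV k s * wt t k) * (complex_of_real k * complex_of_real k) * (1 - Nc * Lc * (Nc * Lc))"
   unfolding kk sigma_square_complex by simp
  show ?thesis unfolding a PQ_def P3_def P2_def cRG by (simp add: algebra_simps)
 qed
 finally show ?thesis1 .
 have "(P2 t k has_vector_derivative \<i> * Nc * Hc * of_real k * (- Sc * of_real \<bar>k\<bar> * EV k s) * wt t k) (at s)"
  unfolding P2_def[abs_def]
  by (intro has_vector_derivative_mult_right has_vector_derivative_mult_left EV_facts)
 then show ?thesis2
  by (simp add: P2_def algebra_simps)
 let ?q = "\<lambda>s. (2 * Nc * Nc * Nc * Lc * Lc * Hc * of_real k * of_real k * (- Sc * of_real \<bar>k\<bar>)) * wt t k * EV k s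
  - \<i> * Nc * Lc * (Sc * Sc) * Sc * Hc * (- Sc * convV (\<lambda>a b. KP a b * of_real \<bar>b\<bar>) t k s)"
 show ?thesis3
 proof (intro exI[of _ ?q] conjI allI impI)
  show "halfline_source ?q"
   by (intro halfline_source_intros EV_facts convV_source t tame_intros vacuum_kernels_tame)
  fix s :: real assume s: "s > 0"
  have "(PQ t k has_vector_derivative 2 * Nc * Nc * Nc * Lc * Lc * Hc * of_real k * of_real k * (- Sc * of_real \<bar>k\<bar> * EV k s) * wt t k
   - \<i> * Nc * Lc * (Sc * Sc) * Sc * Hc * (- Sc * convV (\<lambda>a b. KP a b * of_real \<bar>b\<bar>) t k s)) (at s)"
   unfolding PQ_def[abs_def]
   by (intro has_vector_derivative_diff has_vector_derivative_mult_right has_vector_derivative_mult_left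
     EV_facts convV_derivative t s vacuum_kernels_tame)
  then show "(PQ t k has_vector_derivative ?q s) (at s)" by (simp add: algebra_simps)
 qed
qed

text \<open>
  This identity of the forcing lets the constraint on the divergence of \<open>H\<close> follow from the other equations.
\<close>

lemma P_compatible:
 assumes t: "t \<in> {0<..<T}"
 shows "\<i> * of_real k * P1 t k s + Sc * of_real \<bar>k\<bar> * P2 t k s + \<i> * Nc * Lc * of_real k * P4 t k s = 0"
 unfolding P1_def P2_def P4_def by (simp add: algebra_simps)

text \<open>
  The first order fields depend on \<open>\<tau>\<close> only through the wave profile, so their slow derivatives involve \<open>wt\<close>.
\<close>

lemma V1_fourier:
 assumes \<tau>: "\<tau> \<in> {0<..<T}" and s: "s > 0" and k: "k \<noteq> 0"
 shows "field_hat (pd2 V1) k (- s) \<tau> $ 1 = - (Hc * Sc * Sc * (of_real k * of_real k) * EV k s) * w \<tau> k" (is ?thesis1)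
  and "field_hat (pd2 V1) k (- s) \<tau> $ 2 = (\<i> * Hc * Sc * (of_real k * of_real \<bar>k\<bar>) * EV k s) * w \<tau> k" (is ?thesis2)
  and "field_hat (pd2 V1) k (- s) \<tau> $ 3 = - (\<i> * Hc * Sc * Nc * Lc * (of_real k * of_real \<bar>k\<bar>) * EV k s) * w \<tau> k" (is ?thesis3)
  and "field_hat (pd3 V1) k (- s) \<tau> $ 1 = - (Hc * Sc * of_real \<bar>k\<bar> * EV k s) * wt \<tau> k" (is ?thesis4)
  and "field_hat (pd3 V1) k (- s) \<tau> $ 2 = (\<i> * Hc * of_real k * EV k s) * wt \<tau> k" (is ?thesis5)
  and "field_hat (pd3 V1) k (- s) \<tau> $ 3 = - (\<i> * Hc * Nc * Lc * of_real k * EV k s) * wt \<tau> k" (is ?thesis6)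
proof -
 have S: "- s \<in> {..<0}" and S': "- s \<le> 0" "- s < 0" using s by auto
 have kk: "complex_of_real \<bar>k\<bar> * complex_of_real \<bar>k\<bar> = complex_of_real k * complex_of_real k"
  by (simp flip: of_real_mult)
 have e: "\<sigma> * \<bar>k\<bar> * - s = - (\<sigma> * \<bar>k\<bar> * s)" by simp
 have c: "field_hat V1 k (- s) \<tau> $ 1 = - (Hc * Sc * of_real \<bar>k\<bar> * EV k s) * w \<tau> k"
  "field_hat V1 k (- s) \<tau> $ 2 = (\<i> * Hc * of_real k * EV k s) * w \<tau> k"
  "field_hat V1 k (- s) \<tau> $ 3 = - (\<i> * Hc * Nc * Lc * of_real k * EV k s) * w \<tau> k" if "\<tau> \<in> {0<..<T}" for \<tau>
  unfolding first_order_multipliersD(6-8)[OF fo that k S'(1)] e EV_def[symmetric] of_real_mult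
  by (simp_all only: ac_simps mult_minus_left mult_minus_right)
 note y = first_order_pd2(2)[OF U1 V1 fo \<tau> k S'(2)]
 have "field_hat (pd2 V1) k (- s) \<tau> $ 1 = - (Hc * Sc * Sc * (of_real \<bar>k\<bar> * of_real \<bar>k\<bar>) * EV k s) * w \<tau> k"
  unfolding y c[OF \<tau>] of_real_mult by (simp only: ac_simps mult_minus_left mult_minus_right)
 then show ?thesis1
  unfolding kk .
 show ?thesis2
  ?thesis3
  unfolding y c[OF \<tau>] of_real_mult by (simp_all only: ac_simps mult_minus_left mult_minus_right)
 have t: "field_hat (pd3 V1) k (- s) \<tau> $ j = C * wt \<tau> k" if "\<And>\<tau>. \<tau> \<in> {0<..<T} \<Longrightarrow> field_hat V1 k (- s) \<tau> $ j = C * w \<tau> k" for j C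
 proof -
  have "((\<lambda>\<tau>. C * w \<tau> k) has_vector_derivative C * wt \<tau> k) (at \<tau>)"
   by (rule has_vector_derivative_mult_right[OF surface_fourier(2)[OF \<phi>1_profile \<tau>]])
  then have "((\<lambda>\<tau>. fourier (\<lambda>x. V1 x (- s) \<tau> $ j) k) has_vector_derivative C * wt \<tau> k) (at \<tau>)"
   by (rule has_vector_derivative_transform_within_open[of _ _ _ "{0<..<T}"])
    (use \<tau> that in \<open>auto simp del: of_real_diff\<close>)
  then show ?thesis using field_fourier(3)[OF V1 \<tau> S, of j k] vector_derivative_unique_at
   unfolding field_hat_component by blast
 qed
 show ?thesis4
  ?thesis5
  ?thesis6
  by (rule t[OF c(1)] t[OF c(2)] t[OF c(3)], assumption)+
qed

lemma V1_nice:
 assumes t: "t \<in> {0<..<T}" and s: "s > 0"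
 shows "nice (\<lambda>x. pd2 V1 x (- s) t $ j)" "nice (\<lambda>x. pd3 V1 x (- s) t $ j)" "nice (\<lambda>x. sd1 \<phi>1 x t)"
 using field_nice(3,4)[OF V1 t, of "- s"] s surface_families(2)[OF \<phi>1_profile t] by auto

lemma vacuum_forcing_components:
 "vacuum_forcing \<nu> lam V1 \<phi>1 x y t $ 1 = \<nu> * pd3 V1 x y t $ 1 + \<nu> * lam * (sd1 \<phi>1 x t * pd2 V1 x y t $ 1)"
 "vacuum_forcing \<nu> lam V1 \<phi>1 x y t $ 2 =
  \<nu> * pd3 V1 x y t $ 2 + \<nu> * lam * (sd1 \<phi>1 x t * pd2 V1 x y t $ 2) + sd1 \<phi>1 x t * pd2 V1 x y t $ 3"
 "vacuum_forcing \<nu> lam V1 \<phi>1 x y t $ 3 =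
  \<nu> * pd3 V1 x y t $ 3 + \<nu> * lam * (sd1 \<phi>1 x t * pd2 V1 x y t $ 3) + sd1 \<phi>1 x t * pd2 V1 x y t $ 2"
 "vacuum_forcing \<nu> lam V1 \<phi>1 x y t $ 4 = - (sd1 \<phi>1 x t * pd2 V1 x y t $ 1)"
 unfolding vacuum_forcing_def Let_def vector_3_4 by (simp_all add: algebra_simps)

lemma vacuum_forcing_nice:
 assumes t: "t \<in> {0<..<T}" and y: "y < 0"
 shows "nice (\<lambda>x. vacuum_forcing \<nu> lam V1 \<phi>1 x y t $ j)"
proof -
 have "- y > 0" using y by simp
 note n = V1_nice[OF t this, unfolded minus_minus]
 show ?thesis
  using exhaust_4[of j] by (auto simp: vacuum_forcing_components intro!: nice_intros n)
qed

text \<open>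
  The products with the slope cancel in the second component, since \<open>E = - \<nu> lam H\<^sub>2\<close> at first order.
\<close>

lemma vacuum_forcing_fourier:
 assumes \<tau>: "\<tau> \<in> {0<..<T}" and s: "s > 0" and k: "k \<noteq> 0"
 defines "p \<equiv> field_hat (vacuum_forcing \<nu> lam V1 \<phi>1) k (- s) \<tau>"
 shows "p $ 1 = P1 \<tau> k s" and "p $ 2 = P2 \<tau> k s" and "p $ 3 = P3 \<tau> k s" and "p $ 4 = P4 \<tau> k s"
proof -
 have e: "s \<ge> 0" using s by simp
 note n = V1_nice[OF \<tau> s] and w = w_rapid[OF \<tau>]
 have sx: "fourier (\<lambda>x. sd1 \<phi>1 x \<tau>) l = (\<i> * of_real l) * w \<tau> l" for l
  by (rule surface_fourier(1)[OF \<phi>1_profile \<tau>])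
 have t: "tame (\<lambda>a b. \<i> * of_real a)" "tame (\<lambda>a b. - (Hc * Sc * Sc * (of_real b * of_real b) * EV b s))"
  "tame (\<lambda>a b. \<i> * Hc * Sc * (of_real b * of_real \<bar>b\<bar>) * EV b s)"
  "tame (\<lambda>a b. - (\<i> * Hc * Sc * Nc * Lc * (of_real b * of_real \<bar>b\<bar>) * EV b s))"
  by (intro tame_intros tame_EV e)+
 note V = V1_fourier[OF \<tau> s, unfolded field_hat_component]
 have 1: "fourier (\<lambda>x. sd1 \<phi>1 x \<tau> * pd2 V1 x (- s) \<tau> $ 1) k = - (\<i> * Hc * (Sc * Sc)) * convV KQ \<tau> k s"
  unfolding convV_def conv_cmult[symmetric]
  by (rule trans[OF fourier_product_conv[OF n(3,1) w t(1,2) sx V(1)] conv_cong]) (simp_all add: KQ_def algebra_simps)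
 have 2: "fourier (\<lambda>x. sd1 \<phi>1 x \<tau> * pd2 V1 x (- s) \<tau> $ 2) k = - (Hc * Sc) * convV KG \<tau> k s"
  unfolding convV_def conv_cmult[symmetric]
  by (rule trans[OF fourier_product_conv[OF n(3,1) w t(1,3) sx V(2)] conv_cong]) (simp_all add: KG_def algebra_simps)
 have 3: "fourier (\<lambda>x. sd1 \<phi>1 x \<tau> * pd2 V1 x (- s) \<tau> $ 3) k = Hc * Sc * Nc * Lc * convV KG \<tau> k s"
  unfolding convV_def conv_cmult[symmetric]
  by (rule trans[OF fourier_product_conv[OF n(3,1) w t(1,4) sx V(3)] conv_cong]) (simp_all add: KG_def algebra_simps)
 note lin = fourier_linear nice_intros n V[OF k] 1 2 3
 show "p $ 1 = P1 \<tau> k s" "p $ 2 = P2 \<tau> k s" "p $ 4 = P4 \<tau> k s"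
  unfolding p_def field_hat_component vacuum_forcing_components P1_def P2_def P4_def
  by (simp_all add: lin algebra_simps)
 have "p $ 3 = - (\<i> * Nc * Nc * Lc * Hc * of_real k * EV k s * wt \<tau> k) - Hc * Sc * (1 - Nc * Lc * (Nc * Lc)) * convV KG \<tau> k s"
  unfolding p_def field_hat_component vacuum_forcing_components by (simp add: lin algebra_simps)
 then show "p $ 3 = P3 \<tau> k s" unfolding sigma_square_complex P3_def by (simp add: algebra_simps)
qed

end

section \<open>The second order terms in the vacuum\<close>

lemma all_nonpos_iff: "(\<forall>y\<le>(0::real). F y) \<longleftrightarrow> (\<forall>s\<ge>0. F (- s))"
 by (metis neg_0_le_iff_le neg_le_0_iff_le minus_minus)

context first_order_solution
begin

abbreviation "NL \<equiv> Nc * Lc"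

lemma kappa_pos: "k \<noteq> 0 \<Longrightarrow> \<sigma> * \<bar>k\<bar> > 0"
 using sigma_pos by simp

text \<open>The formulas of the second order terms, solved for the three components.\<close>

definition vacuum_solution :: "(real^3) field \<Rightarrow> real \<Rightarrow> real \<Rightarrow> complex \<Rightarrow> bool" where
 "vacuum_solution V2 t k c \<longleftrightarrow> (\<forall>s\<ge>0. let h = field_hat V2 k (- s) t;
   p = past (\<sigma> * \<bar>k\<bar>) (PQ t k) s; f = future (\<sigma> * \<bar>k\<bar>) (PQ t k) s in
  h$3 = c * EV k s + (p + f) / of_real (2 * (\<sigma> * \<bar>k\<bar>)) \<and>
  h$1 = (of_real (\<sigma> * \<bar>k\<bar>) * c * EV k s + (p - f) / 2 + P1 t k s) / (\<i> * NL * k) \<and>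
  h$2 = - (h$3 / NL) + P2 t k s / (\<i> * NL * k))"

lemma vacuum_vector_iff:
 fixes X :: "complex^3"
 assumes k: "k \<noteq> 0" and lam: "lam \<noteq> 0"
 shows "X = (if 0 < k
    then \<alpha> * complex_of_real (exp (\<sigma> * k * - s)) *s vector [Sc / (\<i> * Nc * Lc), - (1 / (Nc * Lc)), 1]
    else \<beta> * complex_of_real (exp (- \<sigma> * k * - s)) *s vector [- (Sc / (\<i> * Nc * Lc)), - (1 / (Nc * Lc)), 1]) +
   complex_of_real (1 / (2 * \<bar>k\<bar> * \<sigma>)) *s
    vector [1 / (\<i> * Nc * Lc * complex_of_real k) * J1, - (1 / (Nc * Lc)) * J2, J2] +
   vector [1 / (\<i> * Nc * Lc * complex_of_real k) * p1, 1 / (\<i> * Nc * Lc * complex_of_real k) * p2, 0] \<longleftrightarrow>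
  (let c = (if k > 0 then \<alpha> else \<beta>) in
   X$3 = c * EV k s + J2 / of_real (2 * (\<sigma> * \<bar>k\<bar>)) \<and>
   X$1 = (of_real (\<sigma> * \<bar>k\<bar>) * c * EV k s + J1 / of_real (2 * (\<sigma> * \<bar>k\<bar>)) + p1) / (\<i> * NL * k) \<and>
   X$2 = - (X$3 / NL) + p2 / (\<i> * NL * k))" (is "X = ?R \<longleftrightarrow> _")
proof -
 let ?c = "if k > 0 then \<alpha> else \<beta>"
 have nz: "complex_of_real k \<noteq> 0" "Nc \<noteq> 0" "Lc \<noteq> 0" "Sc \<noteq> 0" "complex_of_real \<bar>k\<bar> \<noteq> 0"
  using k lam nu sigma_pos by auto
 have e: "k > 0 \<Longrightarrow> complex_of_real (exp (\<sigma> * k * - s)) = EV k s" "\<not> k > 0 \<Longrightarrow> complex_of_real (exp (- \<sigma> * k * - s)) = EV k s"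
  unfolding EV_def by simp_all
 have a: "k > 0 \<Longrightarrow> complex_of_real \<bar>k\<bar> = complex_of_real k" "\<not> k > 0 \<Longrightarrow> complex_of_real \<bar>k\<bar> = - complex_of_real k"
  by simp_all
 have R3: "?R $ 3 = ?c * EV k s + J2 / of_real (2 * (\<sigma> * \<bar>k\<bar>))"
  using e nz by (simp add: field_simps)
 have R1: "?R $ 1 = (of_real (\<sigma> * \<bar>k\<bar>) * ?c * EV k s + J1 / of_real (2 * (\<sigma> * \<bar>k\<bar>)) + p1) / (\<i> * NL * k)"
 proof (cases "k > 0")
  case True
  then show ?thesis using e(1) nz by (simp add: field_simps)
 next
  case False
  then show ?thesis using e(2) nz by (simp add: field_simps)
 qed
 have R2: "?R $ 2 = - (?R $ 3 / NL) + p2 / (\<i> * NL * k)"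
  unfolding R3 using e nz by (simp add: field_simps)
 show ?thesis unfolding vec_eq_iff forall_3 R1 R2 Let_def R3[symmetric] by auto
qed

text \<open>
  The integral with the derivative of \<open>P\<close> is integrated by parts on both sides of the point \<open>\<eta>\<close>; the boundary
  terms at \<open>\<eta>\<close> cancel and the one on the interface cancels the extra term.
\<close>

lemma kernel_integral:
 assumes t: "t \<in> {0<..<T}" and k: "k \<noteq> 0" and s: "s \<ge> 0"
 defines "\<kappa> \<equiv> \<sigma> * \<bar>k\<bar>"
 shows "(CLBINT \<zeta>:{..0}. complex_of_real (exp (- \<sigma> * \<bar>k\<bar> * \<bar>- s - \<zeta>\<bar>)) * P_vac \<nu> H0 lam \<phi>1 k \<zeta> t) =
   past \<kappa> (PQ t k) s + future \<kappa> (PQ t k) s" (is ?A)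
  and "(CLBINT \<zeta>:{..0}. complex_of_real (exp (- \<sigma> * \<bar>k\<bar> * \<bar>- s - \<zeta>\<bar>)) * vector_derivative (\<lambda>z. P_vac \<nu> H0 lam \<phi>1 k z t) (at \<zeta>)) -
    complex_of_real (exp (- \<sigma> * \<bar>k * - s\<bar>)) * P_vac \<nu> H0 lam \<phi>1 k 0 t =
   \<kappa> * (past \<kappa> (PQ t k) s - future \<kappa> (PQ t k) s)" (is ?B)
proof -
 have \<kappa>: "\<kappa> > 0" unfolding \<kappa>_def by (rule kappa_pos[OF k])
 have S: "{z::real. - z \<in> {..0}} = {0..}" by auto
 have e: "exp (- \<sigma> * \<bar>k\<bar> * \<bar>- s - - z\<bar>) = exp (- \<kappa> * \<bar>s - z\<bar>)" for z
  unfolding \<kappa>_def by (simp add: abs_minus_commute)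
 have e': "exp (- \<sigma> * \<bar>k * - s\<bar>) = exp (- \<kappa> * s)"
  unfolding \<kappa>_def using s by (simp add: abs_mult)
 note P = P_regular[OF t]
 have "(CLBINT \<zeta>:{..0}. complex_of_real (exp (- \<sigma> * \<bar>k\<bar> * \<bar>- s - \<zeta>\<bar>)) * P_vac \<nu> H0 lam \<phi>1 k \<zeta> t) =
   (CLBINT z:{0..}. complex_of_real (exp (- \<kappa> * \<bar>s - z\<bar>)) * PQ t k z)"
  unfolding set_integral_reflect[of "{..0}"] S e P_vac_eq by (rule refl)
 then show ?A using two_sided_kernel[OF P(5) \<kappa> s] by simp
 obtain q where q: "halfline_source q" "\<And>s. s > 0 \<Longrightarrow> (PQ t k has_vector_derivative q s) (at s)"
  using P_derivatives(3)[OF t zero_less_one] by blast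
 have vd: "vector_derivative (\<lambda>z. P_vac \<nu> H0 lam \<phi>1 k z t) (at (- z)) = - q z" if "z > 0" for z
 proof (rule vector_derivative_at)
  have eq: "(\<lambda>z. P_vac \<nu> H0 lam \<phi>1 k z t) = (\<lambda>z. PQ t k (- z))"
   using P_vac_eq(3)[of k "- z" t for z] by (simp add: fun_eq_iff)
  show "((\<lambda>z. P_vac \<nu> H0 lam \<phi>1 k z t) has_vector_derivative - q z) (at (- z))"
   unfolding eq by (rule reflect_has_derivative) (use q(2)[OF that] in simp)
 qed
 have drop: "(CLBINT z:{0..}. f z) = (CLBINT z:{0<..}. f z)" for f :: "real \<Rightarrow> complex"
  by (rule set_integral_discrete_difference[where X="{0}"]) auto
 have "(CLBINT \<zeta>:{..0}. complex_of_real (exp (- \<sigma> * \<bar>k\<bar> * \<bar>- s - \<zeta>\<bar>)) * vector_derivative (\<lambda>z. P_vac \<nu> H0 lam \<phi>1 k z t) (at \<zeta>)) =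
   (CLBINT z:{0<..}. complex_of_real (exp (- \<kappa> * \<bar>s - z\<bar>)) * vector_derivative (\<lambda>z. P_vac \<nu> H0 lam \<phi>1 k z t) (at (- z)))"
  unfolding set_integral_reflect[of "{..0}"] S e drop by (rule refl)
 also have "\<dots> = (CLBINT z:{0<..}. (- 1) * (complex_of_real (exp (- \<kappa> * \<bar>s - z\<bar>)) * q z))"
  by (rule set_lebesgue_integral_cong) (auto simp: vd)
 also have "\<dots> = (- 1) * (CLBINT z:{0..}. complex_of_real (exp (- \<kappa> * \<bar>s - z\<bar>)) * q z)"
  unfolding drop by (rule set_integral_mult_right)
 also have "\<dots> = - (past \<kappa> q s + future \<kappa> q s)"
  unfolding two_sided_kernel[OF q(1) \<kappa> s] by simp
 also have "\<dots> = complex_of_real (exp (- \<kappa> * s)) * PQ t k 0 + \<kappa> * (past \<kappa> (PQ t k) s - future \<kappa> (PQ t k) s)"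
 proof -
  have p: "past \<kappa> q s = PQ t k s - of_real (exp (- \<kappa> * s)) * PQ t k 0 - \<kappa> * past \<kappa> (PQ t k) s"
   by (rule past_by_parts[OF P(3) q(2) P(5) q(1) s])
  have f: "future \<kappa> q s = - PQ t k s + \<kappa> * future \<kappa> (PQ t k) s"
   by (rule future_by_parts[OF P(3) q(2) P(5) q(1) \<kappa> s])
  show ?thesis unfolding p f by (simp add: algebra_simps)
 qed
 finally show ?B
  unfolding e' using P_vac_eq(3)[of k 0 t] by simp
qed

lemma second_order_vacuum_iff:
 assumes lam: "lam \<noteq> 0"
 shows "second_order_vacuum \<nu> H0 lam T \<phi>1 V2 \<longleftrightarrow> (\<forall>\<tau>\<in>{0<..<T}. \<forall>k. k \<noteq> 0 \<longrightarrow> (\<exists>c. vacuum_solution V2 \<tau> k c))"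
proof -
 let ?P = "P_vac \<nu> H0 lam \<phi>1"
 let ?J1 = "\<lambda>\<tau> k y. (CLBINT \<zeta>:{..0}. complex_of_real (exp (- \<sigma> * \<bar>k\<bar> * \<bar>y - \<zeta>\<bar>)) * vector_derivative (\<lambda>z. ?P k z \<tau>) (at \<zeta>)) -
    complex_of_real (exp (- \<sigma> * \<bar>k * y\<bar>)) * ?P k 0 \<tau>"
 let ?J2 = "\<lambda>\<tau> k y. CLBINT \<zeta>:{..0}. complex_of_real (exp (- \<sigma> * \<bar>k\<bar> * \<bar>y - \<zeta>\<bar>)) * ?P k \<zeta> \<tau>"
 let ?R = "\<lambda>\<tau> k y \<alpha> \<beta>. (if 0 < k
    then \<alpha> * complex_of_real (exp (\<sigma> * k * y)) *s vector [Sc / (\<i> * Nc * Lc), - (1 / (Nc * Lc)), 1]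
    else \<beta> * complex_of_real (exp (- \<sigma> * k * y)) *s vector [- (Sc / (\<i> * Nc * Lc)), - (1 / (Nc * Lc)), 1]) +
   complex_of_real (1 / (2 * \<bar>k\<bar> * \<sigma>)) *s
    vector [1 / (\<i> * Nc * Lc * complex_of_real k) * ?J1 \<tau> k y, - (1 / (Nc * Lc)) * ?J2 \<tau> k y, ?J2 \<tau> k y] +
   vector [1 / (\<i> * Nc * Lc * complex_of_real k) * p1_vac \<nu> H0 lam \<phi>1 k y \<tau>, 1 / (\<i> * Nc * Lc * complex_of_real k) * p2_vac \<nu> H0 lam \<phi>1 k y \<tau>, 0] :: complex^3"
 have pt: "(\<forall>y\<le>0. field_hat V2 k y \<tau> = ?R \<tau> k y \<alpha> \<beta>) \<longleftrightarrow> vacuum_solution V2 \<tau> k (if k > 0 then \<alpha> else \<beta>)"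
  if \<tau>: "\<tau> \<in> {0<..<T}" and k: "k \<noteq> 0" for \<tau> k \<alpha> \<beta>
 proof -
  have nz: "complex_of_real (\<sigma> * \<bar>k\<bar>) \<noteq> 0" using kappa_pos[OF k] by (metis less_irrefl of_real_eq_0_iff)
  have c: "complex_of_real (\<sigma> * \<bar>k\<bar>) * z / of_real (2 * (\<sigma> * \<bar>k\<bar>)) = z / 2" for z
   using nz unfolding of_real_mult of_real_numeral by (simp add: field_simps)
  have "(\<forall>y\<le>0. field_hat V2 k y \<tau> = ?R \<tau> k y \<alpha> \<beta>) \<longleftrightarrow> (\<forall>s\<ge>0. field_hat V2 k (- s) \<tau> = ?R \<tau> k (- s) \<alpha> \<beta>)"
   by (rule all_nonpos_iff)
  also have "\<dots> \<longleftrightarrow> vacuum_solution V2 \<tau> k (if k > 0 then \<alpha> else \<beta>)"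
   unfolding vacuum_solution_def vacuum_vector_iff[OF k lam]
   by (intro arg_cong[where f=All] ext imp_cong refl) (simp only: Let_def kernel_integral[OF \<tau> k] P_vac_eq c)
  finally show ?thesis .
 qed
 show ?thesis
 proof
  assume "second_order_vacuum \<nu> H0 lam T \<phi>1 V2"
  then obtain \<alpha> \<beta> where "\<forall>\<tau>\<in>{0<..<T}. \<forall>k. k \<noteq> 0 \<longrightarrow> (\<forall>y\<le>0. field_hat V2 k y \<tau> = ?R \<tau> k y (\<alpha> k \<tau>) (\<beta> k \<tau>))"
   unfolding second_order_vacuum_def Let_def by blast
  then show "\<forall>\<tau>\<in>{0<..<T}. \<forall>k. k \<noteq> 0 \<longrightarrow> (\<exists>c. vacuum_solution V2 \<tau> k c)" using pt by blast
 next
  assume c: "\<forall>\<tau>\<in>{0<..<T}. \<forall>k. k \<noteq> 0 \<longrightarrow> (\<exists>c. vacuum_solution V2 \<tau> k c)"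
  define c where "c = (\<lambda>k \<tau>. SOME c. vacuum_solution V2 \<tau> k c)"
  have "vacuum_solution V2 \<tau> k (c k \<tau>)" if "\<tau> \<in> {0<..<T}" "k \<noteq> 0" for \<tau> k
   unfolding c_def using c that by (blast intro: someI_ex)
  then have "\<forall>\<tau>\<in>{0<..<T}. \<forall>k. k \<noteq> 0 \<longrightarrow> (\<forall>y\<le>0. field_hat V2 k y \<tau> = ?R \<tau> k y (c k \<tau>) (c k \<tau>))"
   using pt[of _ _ "c k \<tau>" "c k \<tau>" for k \<tau>] by simp
  then show "second_order_vacuum \<nu> H0 lam T \<phi>1 V2"
   unfolding second_order_vacuum_def Let_def by (intro exI[of _ c])
 qed
qed

text \<open>
  Elimination of \<open>H\<close> gives \<open>E'' = \<sigma>\<^sup>2 k\<^sup>2 E - P\<close>, here written as a system for \<open>E\<close> and its derivative \<open>g\<close>.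
\<close>

lemma second_order_vacuum_forward:
 assumes V2: "profile {..<0} T V2" and sys: "vacuum_hat_system \<nu> lam T V2 (vacuum_forcing \<nu> lam V1 \<phi>1)" and lam: "lam \<noteq> 0"
 shows "second_order_vacuum \<nu> H0 lam T \<phi>1 V2"
 unfolding second_order_vacuum_iff[OF lam]
proof (intro ballI allI impI)
 fix t k :: real assume t: "t \<in> {0<..<T}" and k: "k \<noteq> 0"
 define h where "h = (\<lambda>j s. field_hat V2 k (- s) t $ j)"
 define y where "y = (\<lambda>j s. field_hat (pd2 V2) k (- s) t $ j)"
 define \<kappa> where "\<kappa> = \<sigma> * \<bar>k\<bar>"
 define K where "K = complex_of_real k"
 have \<kappa>: "\<kappa> > 0" unfolding \<kappa>_def by (rule kappa_pos[OF k])
 have nz: "K \<noteq> 0" "NL \<noteq> 0" using k lam nu by (simp_all add: K_def)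
 have \<kappa>\<kappa>: "complex_of_real \<kappa> * complex_of_real \<kappa> = Sc * Sc * K * K"
  unfolding \<kappa>_def K_def by (simp add: mult_ac flip: of_real_mult) (simp add: mult.left_commute[of "\<bar>k\<bar>"] mult.assoc[symmetric])?
 have cont: "continuous_on {0..} (h j)" and D: "s > 0 \<Longrightarrow> (h j has_vector_derivative - y j s) (at s)" for j s
  using field_eta_reflected(1,3)[OF V2 t] unfolding h_def y_def by auto
 obtain M1 where M1: "\<And>s. s > 0 \<Longrightarrow> norm (h 1 s) \<le> M1"
  using field_eta_reflected(2)[OF V2 t, of k 1] unfolding h_def by blast
 obtain M3 where M3: "\<And>s. s > 0 \<Longrightarrow> norm (h 3 s) \<le> M3"
  using field_eta_reflected(2)[OF V2 t, of k 3] unfolding h_def by blast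
 obtain MP where MP: "\<And>s. s > 0 \<Longrightarrow> norm (P1 t k s) \<le> MP"
  using P_regular(4)[OF t, of k] unfolding halfline_source_def by blast
 have e: "y 3 s - \<i> * K * NL * h 1 s + P1 t k s = 0" "- (\<i> * K * (h 3 s + NL * h 2 s)) + P2 t k s = 0"
  "y 1 s - \<i> * K * (h 2 s + NL * h 3 s) + P3 t k s = 0" if "s > 0" for s
  using vacuum_hat_systemD[OF sys t k, of "- s"] that
  unfolding vacuum_forcing_fourier[OF t that k] h_def y_def K_def by (simp_all del: field_hat_component)
 define g where "g = (\<lambda>s. \<i> * K * NL * h 1 s - P1 t k s)"
 have "\<exists>\<alpha>::complex. \<forall>s\<ge>0. h 3 s = \<alpha> * of_real (exp (- \<kappa> * s)) + (past \<kappa> (PQ t k) s + future \<kappa> (PQ t k) s) / of_real (2 * \<kappa>) \<and>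
  g s = complex_of_real \<kappa> * \<alpha> * of_real (exp (- \<kappa> * s)) + (past \<kappa> (PQ t k) s - future \<kappa> (PQ t k) s) / 2"
 proof (rule two_sided_solution[OF \<kappa> cont _ M3 _ P_regular(5)[OF t]])
  show "continuous_on {0..} g" unfolding g_def by (intro continuous_intros cont P_regular t)
  show "norm (g s) \<le> norm (\<i> * K * NL) * M1 + MP" if "s > 0" for s
  proof -
   have "norm (g s) \<le> norm (\<i> * K * NL * h 1 s) + norm (P1 t k s)" unfolding g_def by (rule norm_triangle_ineq4)
   also have "\<dots> \<le> norm (\<i> * K * NL) * M1 + MP"
    unfolding norm_mult[of "\<i> * K * NL"] by (intro add_mono mult_left_mono M1 MP that norm_ge_zero)
   finally show ?thesis .
  qed
  show "(h 3 has_vector_derivative - g s) (at s)" if "s > 0" for s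
  proof -
   have "y 3 s = g s" using e(1)[OF that] by (simp add: g_def algebra_simps eq_diff_eq)
   then show ?thesis using D[OF that, of 3] by simp
  qed
  show "(g has_vector_derivative PQ t k s - complex_of_real \<kappa> * complex_of_real \<kappa> * h 3 s) (at s)" if "s > 0" for s
  proof -
   have 1: "(g has_vector_derivative \<i> * K * NL * (- y 1 s) - - (PQ t k s - \<i> * Nc * Lc * of_real k * P3 t k s + \<i> * of_real k * P2 t k s)) (at s)"
    unfolding g_def by (intro has_vector_derivative_diff has_vector_derivative_mult_right D P_derivatives t that)
   have y1: "y 1 s = \<i> * K * (h 2 s + NL * h 3 s) - P3 t k s" and p2: "P2 t k s = \<i> * K * (h 3 s + NL * h 2 s)"
    using e(2,3)[OF that] by (simp_all add: algebra_simps eq_neg_iff_add_eq_0 add_eq_0_iff)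
   have "\<i> * K * NL * (- y 1 s) - - (PQ t k s - \<i> * Nc * Lc * of_real k * P3 t k s + \<i> * of_real k * P2 t k s) =
     PQ t k s - (1 - NL * NL) * K * K * h 3 s"
    unfolding y1 p2 K_def[symmetric] by (simp add: algebra_simps)
   also have "\<dots> = PQ t k s - complex_of_real \<kappa> * complex_of_real \<kappa> * h 3 s"
    unfolding sigma_square_complex \<kappa>\<kappa> by simp
   finally have eq: "\<i> * K * NL * (- y 1 s) - - (PQ t k s - \<i> * Nc * Lc * of_real k * P3 t k s + \<i> * of_real k * P2 t k s) =
     PQ t k s - complex_of_real \<kappa> * complex_of_real \<kappa> * h 3 s" .
   show ?thesis using 1 unfolding eq .
  qed
 qed
 then obtain c where c: "\<And>s. s \<ge> 0 \<Longrightarrow> h 3 s = c * of_real (exp (- \<kappa> * s)) + (past \<kappa> (PQ t k) s + future \<kappa> (PQ t k) s) / of_real (2 * \<kappa>)"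
  "\<And>s. s \<ge> 0 \<Longrightarrow> g s = complex_of_real \<kappa> * c * of_real (exp (- \<kappa> * s)) + (past \<kappa> (PQ t k) s - future \<kappa> (PQ t k) s) / 2" by blast
 have E: "complex_of_real (exp (- \<kappa> * s)) = EV k s" for s by (simp add: EV_def \<kappa>_def)
 have h2: "h 2 s = - (h 3 s / NL) + P2 t k s / (\<i> * NL * k)" if "s \<ge> 0" for s
 proof (rule eq_up_to_boundary[OF cont _ _ that])
  show "continuous_on {0..} (\<lambda>s. - (h 3 s / NL) + P2 t k s / (\<i> * NL * k))"
   using nz by (intro continuous_intros cont P_regular t) (auto simp: K_def)
  show "h 2 s = - (h 3 s / NL) + P2 t k s / (\<i> * NL * k)" if "s > 0" for s
  proof -
   have p2: "P2 t k s = \<i> * K * (h 3 s + NL * h 2 s)" using e(2)[OF that] by (simp add: algebra_simps)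
   show ?thesis unfolding p2 K_def[symmetric] using nz by (simp add: field_simps)
  qed
 qed
 have h1: "h 1 s = (of_real \<kappa> * c * EV k s + (past \<kappa> (PQ t k) s - future \<kappa> (PQ t k) s) / 2 + P1 t k s) / (\<i> * NL * k)" if "s \<ge> 0" for s
  using c(2)[OF that, unfolded E, symmetric] nz unfolding g_def K_def by simp
 show "\<exists>c. vacuum_solution V2 t k c"
  unfolding vacuum_solution_def Let_def
  using c(1)[unfolded E] h1 h2 unfolding h_def \<kappa>_def by blast
qed

lemma second_order_vacuum_backward:
 assumes V2: "profile {..<0} T V2" and so: "second_order_vacuum \<nu> H0 lam T \<phi>1 V2" and lam: "lam \<noteq> 0"
 shows "vacuum_hat_system \<nu> lam T V2 (vacuum_forcing \<nu> lam V1 \<phi>1)"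
 unfolding vacuum_hat_system_def
proof (intro ballI allI impI)
 fix t k \<eta> :: real assume t: "t \<in> {0<..<T}" and k: "k \<noteq> 0" and \<eta>: "\<eta> < 0"
 define s where "s = - \<eta>"
 have s: "s > 0" and \<eta>s: "\<eta> = - s" using \<eta> by (simp_all add: s_def)
 define h where "h = (\<lambda>j s. field_hat V2 k (- s) t $ j)"
 define y where "y = (\<lambda>j s. field_hat (pd2 V2) k (- s) t $ j)"
 define \<kappa> where "\<kappa> = \<sigma> * \<bar>k\<bar>"
 define K where "K = complex_of_real k"
 have \<kappa>: "\<kappa> > 0" unfolding \<kappa>_def by (rule kappa_pos[OF k])
 have nz: "K \<noteq> 0" "NL \<noteq> 0" "complex_of_real \<kappa> \<noteq> 0" using k lam nu \<kappa> by (simp_all add: K_def)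
 have \<kappa>\<kappa>: "complex_of_real \<kappa> * complex_of_real \<kappa> = Sc * Sc * K * K"
  unfolding \<kappa>_def K_def by (simp add: mult_ac flip: of_real_mult) (simp add: mult.left_commute[of "\<bar>k\<bar>"] mult.assoc[symmetric])?
 obtain c where "vacuum_solution V2 t k c" using so t k unfolding second_order_vacuum_iff[OF lam] by blast
 then have h: "h 3 s = c * EV k s + (past \<kappa> (PQ t k) s + future \<kappa> (PQ t k) s) / of_real (2 * \<kappa>)"
  "h 1 s = (of_real \<kappa> * c * EV k s + (past \<kappa> (PQ t k) s - future \<kappa> (PQ t k) s) / 2 + P1 t k s) / (\<i> * NL * k)"
  "h 2 s = - (h 3 s / NL) + P2 t k s / (\<i> * NL * k)" if "s > 0" for s
  using that unfolding vacuum_solution_def Let_def h_def \<kappa>_def by (simp_all del: field_hat_component)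
 have D: "(h j has_vector_derivative - y j s) (at s)" for j
  using field_eta_reflected(3)[OF V2 t s] unfolding h_def y_def by auto
 have unique: "- y j s = X" if "(f has_vector_derivative X) (at s)" "\<And>s. s > 0 \<Longrightarrow> h j s = f s" for f X j
 proof -
  have "(h j has_vector_derivative X) (at s)"
   by (rule has_vector_derivative_transform_within_open[OF that(1), of "{0<..}"]) (use s that(2) in auto)
  then show ?thesis using D vector_derivative_unique_at by blast
 qed
 define p f q e where "p = past \<kappa> (PQ t k) s" and "f = future \<kappa> (PQ t k) s" and "q = PQ t k s" and "e = EV k s"
 have De: "(EV k has_vector_derivative - of_real \<kappa> * e) (at s)"
  using EV_facts(3)[of k s] unfolding \<kappa>_def e_def by simp
 have Dp: "(past \<kappa> (PQ t k) has_vector_derivative - of_real \<kappa> * p + q) (at s)"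
  and Df: "(future \<kappa> (PQ t k) has_vector_derivative of_real \<kappa> * f - q) (at s)"
  using past_derivative[OF P_regular(5)[OF t] s] future_derivative[OF P_regular(5)[OF t] s] unfolding p_def f_def q_def by auto
 have DP: "(P1 t k has_vector_derivative - (q - \<i> * Nc * Lc * of_real k * P3 t k s + \<i> * of_real k * P2 t k s)) (at s)"
  unfolding q_def by (rule P_derivatives(1)[OF t s])
 have y3: "- y 3 s = - (of_real \<kappa> * c * e + (p - f) / 2)"
 proof -
  have "- y 3 s = c * (- of_real \<kappa> * e) + ((- of_real \<kappa> * p + q) + (of_real \<kappa> * f - q)) / of_real (2 * \<kappa>)"
   by (rule unique[OF _ h(1)])
    (intro has_vector_derivative_add has_vector_derivative_mult_right has_vector_derivative_divide De Dp Df)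
  also have "\<dots> = - (of_real \<kappa> * c * e + (p - f) / 2)" using nz by (simp add: field_simps)
  finally show ?thesis .
 qed
 have y2: "- y 2 s = - (- y 3 s / NL) + (- Sc * of_real \<bar>k\<bar> * P2 t k s) / (\<i> * NL * k)"
  by (rule unique[OF _ h(3)])
   (intro has_vector_derivative_add has_vector_derivative_minus has_vector_derivative_divide D P_derivatives t s)
 have y1: "- y 1 s = (of_real \<kappa> * c * (- of_real \<kappa> * e) + ((- of_real \<kappa> * p + q) - (of_real \<kappa> * f - q)) / 2
   + - (q - \<i> * Nc * Lc * of_real k * P3 t k s + \<i> * of_real k * P2 t k s)) / (\<i> * NL * k)"
  by (rule unique[OF _ h(2)])
   (intro has_vector_derivative_add has_vector_derivative_diff has_vector_derivative_mult_right has_vector_derivative_divide De Dp Df DP)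
 note hs = h[OF s, folded p_def f_def e_def]
 define A where "A = \<i> * NL * K"
 have A: "A \<noteq> 0" using nz by (simp add: A_def)
 have div: "A * z = - Z" if "- z = Z / A" for z Z
 proof -
  have "A * z = - (A * (- z))" by simp
  also have "\<dots> = - Z" unfolding that using A by simp
  finally show ?thesis .
 qed
 have 1: "y 3 s = A * h 1 s - P1 t k s"
  unfolding hs(2) K_def[symmetric] A_def[symmetric] using y3[unfolded neg_equal_iff_equal] A by simp
 have h2: "NL * h 2 s = - h 3 s + P2 t k s / (\<i> * K)"
  unfolding hs(3) K_def[symmetric] using nz by (simp add: field_simps)
 have 2: "\<i> * K * (h 3 s + NL * h 2 s) = P2 t k s" unfolding h2 using nz by simp
 have 3: "A * y 1 s = of_real \<kappa> * of_real \<kappa> * h 3 s + \<i> * K * P2 t k s - A * P3 t k s"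
 proof -
  have "A * y 1 s = of_real \<kappa> * c * (of_real \<kappa> * e) + of_real \<kappa> * (p + f) / 2 + \<i> * K * P2 t k s - A * P3 t k s"
   unfolding div[OF y1[folded K_def, folded A_def]] by (simp add: A_def field_simps)
  also have "of_real \<kappa> * c * (of_real \<kappa> * e) + of_real \<kappa> * (p + f) / 2 = of_real \<kappa> * of_real \<kappa> * h 3 s"
   unfolding hs(1) using nz by (simp add: field_simps)
  finally show ?thesis .
 qed
 have e3: "y 1 s - \<i> * K * (h 2 s + NL * h 3 s) + P3 t k s = 0"
 proof -
  have "A * (\<i> * K * (h 2 s + NL * h 3 s)) = - (K * K) * (NL * h 2 s + (NL * NL) * h 3 s)"
   by (simp add: A_def algebra_simps)
  also have "\<dots> = of_real \<kappa> * of_real \<kappa> * h 3 s + \<i> * K * P2 t k s"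
   unfolding h2 sigma_square_complex \<kappa>\<kappa> using nz by (simp add: field_simps)
  finally have "A * (y 1 s - \<i> * K * (h 2 s + NL * h 3 s) + P3 t k s) = 0"
   using 3 by (simp add: algebra_simps)
  then show ?thesis using A by simp
 qed
 have 4: "\<i> * K * h 1 s + y 2 s + P4 t k s = 0"
 proof -
  have "A * y 2 s = - (\<i> * K * y 3 s) + Sc * of_real \<bar>k\<bar> * P2 t k s"
   using arg_cong[OF y2, of "\<lambda>z. - A * z"] nz unfolding K_def[symmetric] by (simp add: A_def field_simps)
  then have "A * (\<i> * K * h 1 s + y 2 s + P4 t k s) = \<i> * K * P1 t k s + Sc * of_real \<bar>k\<bar> * P2 t k s + A * P4 t k s"
   unfolding 1 by (simp add: algebra_simps)
  also have "\<dots> = 0" using P_compatible[OF t, of k s] unfolding A_def K_def by (simp add: algebra_simps)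
  finally show ?thesis using A by simp
 qed
 show "let h = field_hat V2 k \<eta> t; y = field_hat (pd2 V2) k \<eta> t; f = field_hat (vacuum_forcing \<nu> lam V1 \<phi>1) k \<eta> t in
   y$3 - \<i> * k * (complex_of_real \<nu> * complex_of_real lam) * h$1 + f$1 = 0 \<and> - (\<i> * k * (h$3 + complex_of_real \<nu> * complex_of_real lam * h$2)) + f$2 = 0 \<and>
   y$1 - \<i> * k * (h$2 + complex_of_real \<nu> * complex_of_real lam * h$3) + f$3 = 0 \<and> \<i> * k * h$1 + y$2 + f$4 = 0"
  using 1 2 e3 4 unfolding Let_def \<eta>s vacuum_forcing_fourier[OF t s k] h_def y_def A_def K_def
  by (simp add: algebra_simps del: field_hat_component)
qed

end

section \<open>Laplace transforms of the forcing\<close>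

definition laplace :: "real \<Rightarrow> (real \<Rightarrow> complex) \<Rightarrow> complex" where
 "laplace \<kappa> f = (LBINT s:{0..}. f s * of_real (exp (- (\<kappa> * s))))"

lemma set_integral_drop_0: "(CLBINT z:{0..}. f z) = (CLBINT z:{0<..}. f z)" for f :: "real \<Rightarrow> complex"
 by (rule set_integral_discrete_difference[where X="{0}"]) auto

lemma laplace_cong: "(\<And>s. s > 0 \<Longrightarrow> f s = g s) \<Longrightarrow> laplace \<kappa> f = laplace \<kappa> g"
 unfolding laplace_def set_integral_drop_0 by (rule set_lebesgue_integral_cong) auto

lemma laplace_integrable:
 "halfline_source f \<Longrightarrow> \<kappa> > 0 \<Longrightarrow> set_integrable lborel {0..} (\<lambda>s. f s * complex_of_real (exp (- (\<kappa> * s))))"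
 by (rule halfline_source_integrable[OF _ _ _ set_integrable_exp_atLeast]) auto

lemma laplace_add: "\<kappa> > 0 \<Longrightarrow> halfline_source f \<Longrightarrow> halfline_source g \<Longrightarrow> laplace \<kappa> (\<lambda>s. f s + g s) = laplace \<kappa> f + laplace \<kappa> g"
 unfolding laplace_def distrib_right by (intro set_integral_add laplace_integrable)

lemma laplace_diff: "\<kappa> > 0 \<Longrightarrow> halfline_source f \<Longrightarrow> halfline_source g \<Longrightarrow> laplace \<kappa> (\<lambda>s. f s - g s) = laplace \<kappa> f - laplace \<kappa> g"
 unfolding laplace_def left_diff_distrib by (intro set_integral_diff laplace_integrable)

lemma laplace_cmult: "laplace \<kappa> (\<lambda>s. c * f s) = c * laplace \<kappa> f"
 unfolding laplace_def mult.assoc by (rule set_integral_mult_right)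

lemma laplace_exp:
 assumes "\<kappa> > 0" "c > 0"
 shows "laplace \<kappa> (\<lambda>s. of_real (exp (- (c * s)))) = 1 / of_real (\<kappa> + c)"
proof -
 have nz: "complex_of_real \<kappa> + of_real c \<noteq> 0" using assms by (metis add_pos_pos less_irrefl of_real_add of_real_eq_0_iff)
 define y where "y = (\<lambda>s. (- 1 / of_real (\<kappa> + c)) * complex_of_real (exp ((- c) * s)))"
 have "y 0 = - (LBINT s:{0..}. complex_of_real (exp (- (c * s))) * of_real (exp (- (\<kappa> * s))))"
 proof (rule bounded_solution_initial_value[OF _ _ _ assms(1)])
  show "continuous_on {0..} y" unfolding y_def by (intro continuous_intros)
  show "(y has_vector_derivative complex_of_real \<kappa> * y s + complex_of_real (exp (- (c * s)))) (at s)" for s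
  proof -
   have "(y has_vector_derivative (- c) * y s) (at s)" unfolding y_def by (rule exponential_has_derivative)
   also have "(- c) * y s = complex_of_real \<kappa> * y s + complex_of_real (exp (- (c * s)))"
    unfolding y_def using nz by (simp add: field_simps)
   finally show ?thesis .
  qed
  show "halfline_source (\<lambda>s. complex_of_real (exp (- (c * s))))"
   unfolding halfline_source_def using assms by (auto intro!: continuous_intros exI[of _ 1])
  show "norm (y s) \<le> norm (- 1 / complex_of_real (\<kappa> + c))" if "s > 0" for s
   unfolding y_def norm_mult using that assms by (intro mult_left_le) auto
 qed
 then show ?thesis unfolding laplace_def y_def by simp
qed

section \<open>The interaction kernel\<close>

text \<open>
 After symmetrization the kernels that arise in the plasma and in the vacuum both become the
 kernel \<open>Lambda\<close> of the amplitude equation, although they look quite different.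
\<close>

lemma plasma_kernel_symmetrized:
 fixes a b k :: real
 assumes k: "k > 0" and ab: "a + b = k"
 defines "N \<equiv> \<lambda>a b. (a * a * b - \<bar>a\<bar> * b * \<bar>b\<bar> + (a * b * \<bar>b\<bar> - \<bar>a\<bar> * b * b)) / (k + (\<bar>a\<bar> + \<bar>b\<bar>)) + (a * b * b - a * b * \<bar>b\<bar>) / (k + \<bar>b\<bar>) - a * \<bar>b\<bar>"
  and "L \<equiv> \<lambda>a b. - (2 * k * \<bar>a\<bar> * \<bar>b\<bar> / (k + (\<bar>a\<bar> + \<bar>b\<bar>)))"
 shows "N a b + N b a = L a b + L b a"
proof -
 have pos: "N a b + N b a = L a b + L b a" if "a \<ge> 0" "b \<ge> 0" "a + b = k" for a b
 proof -
  have e: "\<bar>a\<bar> = a" "\<bar>b\<bar> = b" "\<bar>b\<bar> + \<bar>a\<bar> = k" "k + (a + b) = 2 * k" "k + (b + a) = 2 * k" using that by auto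
  have "N a b + N b a = - (2 * (a * b))" unfolding N_def e(1,2) using e k by (simp add: field_simps)
  moreover have "L a b + L b a = - (2 * (a * b))" unfolding L_def e(1,2) using e k by (simp add: field_simps)
  ultimately show ?thesis by simp
 qed
 have mixed: "N a b + N b a = L a b + L b a" if "b < 0" "a + b = k" for a b
 proof -
  define c where "c = - b"
  have a: "a > 0" "k = a - c" "\<bar>a\<bar> = a" "\<bar>b\<bar> = c" "b = - c" using that k by (auto simp: c_def)
  have e: "k + (a + c) = 2 * a" "k + (c + a) = 2 * a" "k + c = a" using a by auto
  have "N a b + N b a = - (2 * c * k)" unfolding N_def a(3,4) e unfolding a(5) a(2) using a(1) by (simp add: field_simps)
  moreover have "L a b + L b a = - (2 * c * k)" unfolding L_def a(3,4) e unfolding a(2) using a(1) by (simp add: field_simps)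
  ultimately show ?thesis by simp
 qed
 consider "a \<ge> 0" "b \<ge> 0" | "b < 0" | "a < 0" by linarith
 then show ?thesis
 proof cases
  case 1 then show ?thesis using pos ab by simp
 next
  case 2 then show ?thesis using mixed ab by simp
 next
  case 3
  then have "N b a + N a b = L b a + L a b" using mixed[of a b] ab by simp
  then show ?thesis by simp
 qed
qed

lemma vacuum_kernel_symmetrized:
 fixes a b k :: real
 assumes k: "k > 0" and ab: "a + b = k"
 defines "N \<equiv> \<lambda>a b. (a * b * \<bar>b\<bar> - a * b * b) / (k + \<bar>b\<bar>) + a * \<bar>b\<bar> + (\<bar>a\<bar> * \<bar>b\<bar> - a * b) / 2"
  and "L \<equiv> \<lambda>a b. 2 * k * \<bar>a\<bar> * \<bar>b\<bar> / (k + (\<bar>a\<bar> + \<bar>b\<bar>))"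
 shows "N a b + N b a = L a b + L b a"
proof -
 have pos: "N a b + N b a = L a b + L b a" if "a \<ge> 0" "b \<ge> 0" "a + b = k" for a b
 proof -
  have e: "\<bar>a\<bar> = a" "\<bar>b\<bar> = b" "k + (a + b) = 2 * k" "k + (b + a) = 2 * k" using that by auto
  have "N a b + N b a = 2 * (a * b)" unfolding N_def e(1,2) using k by (simp add: field_simps)
  moreover have "L a b + L b a = 2 * (a * b)" unfolding L_def e(1,2) using e k by (simp add: field_simps)
  ultimately show ?thesis by simp
 qed
 have mixed: "N a b + N b a = L a b + L b a" if "b < 0" "a + b = k" for a b
 proof -
  define c where "c = - b"
  have a: "a > 0" "k = a - c" "\<bar>a\<bar> = a" "\<bar>b\<bar> = c" "b = - c" using that k by (auto simp: c_def)
  have e: "k + (a + c) = 2 * a" "k + (c + a) = 2 * a" "k + c = a" using a by auto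
  have "N a b + N b a = 2 * c * k" unfolding N_def a(3,4) e unfolding a(5) a(2) using a(1) by (simp add: field_simps)
  moreover have "L a b + L b a = 2 * c * k" unfolding L_def a(3,4) e unfolding a(2) using a(1) by (simp add: field_simps)
  ultimately show ?thesis by simp
 qed
 consider "a \<ge> 0" "b \<ge> 0" | "b < 0" | "a < 0" by linarith
 then show ?thesis
 proof cases
  case 1 then show ?thesis using pos ab by simp
 next
  case 2 then show ?thesis using mixed ab by simp
 next
  case 3
  then have "N b a + N a b = L b a + L a b" using mixed[of a b] ab by simp
  then show ?thesis by simp
 qed
qed

section \<open>The solvability condition\<close>

context first_order_solution
begin

definition interaction :: "real \<Rightarrow> real \<Rightarrow> complex" where
 "interaction t k = conv (w t) (\<lambda>a b. of_real (Lambda a b)) k"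

definition KL :: "real \<Rightarrow> real \<Rightarrow> real \<Rightarrow> complex" where
 "KL k a b = 2 * of_real k * of_real \<bar>a\<bar> * of_real \<bar>b\<bar> / of_real (k + (\<bar>a\<bar> + \<bar>b\<bar>))"

definition KX :: "real \<Rightarrow> real \<Rightarrow> complex" where "KX a b = of_real a * of_real \<bar>b\<bar>"
definition KZ :: "real \<Rightarrow> real \<Rightarrow> complex" where "KZ a b = of_real \<bar>a\<bar> * of_real \<bar>b\<bar> - of_real a * of_real b"

lemma rates:
 "continuous_on UNIV (\<lambda>p::real\<times>real. \<bar>fst p\<bar> + \<bar>snd p\<bar>)" "\<bar>a\<bar> + \<bar>b\<bar> \<ge> (0::real)"
 "continuous_on UNIV (\<lambda>p::real\<times>real. \<bar>snd p\<bar>)" "\<bar>b\<bar> \<ge> (0::real)"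
 by (auto intro!: continuous_intros)

lemma KX_tame: "tame KX" "tame KZ"
 unfolding KX_def[abs_def] KZ_def[abs_def] by (intro tame_intros)+

lemma quotient_tame:
 assumes "k > 0" "tame K"
 shows "tame (\<lambda>a b. K a b / of_real (k + (\<bar>a\<bar> + \<bar>b\<bar>)))" "tame (\<lambda>a b. K a b / of_real (k + \<bar>b\<bar>))"
 using tame_divide[OF assms(2), of "\<lambda>a b. \<bar>a\<bar> + \<bar>b\<bar>" k] tame_divide[OF assms(2), of "\<lambda>a b. \<bar>b\<bar>" k] assms(1) rates by auto

lemma KL_tame: "k > 0 \<Longrightarrow> tame (KL k)"
 unfolding KL_def[abs_def] by (intro quotient_tame tame_intros)

text \<open>
  For fixed \<open>k > 0\<close> the kernel is replaced by one whose denominator stays away from zero.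
\<close>

lemma interaction_eq: "k > 0 \<Longrightarrow> interaction t k = conv (w t) (KL k) k"
 unfolding interaction_def KL_def by (rule conv_cong) (auto simp: Lambda_def add.assoc)

lemma plasma_kernels:
 assumes \<tau>: "\<tau> \<in> {0<..<T}" and k: "k > 0"
 defines "c \<equiv> \<lambda>K. conv (w \<tau>) K k"
 shows "c (\<lambda>a b. KI a b / of_real (k + (\<bar>a\<bar> + \<bar>b\<bar>))) + c (\<lambda>a b. KY a b / of_real (k + (\<bar>a\<bar> + \<bar>b\<bar>)))
   - c (\<lambda>a b. KG a b / of_real (k + \<bar>b\<bar>)) + \<i> * c (\<lambda>a b. KF a b / of_real (k + \<bar>b\<bar>)) - c KX = - interaction \<tau> k"
  (is "?A + ?B - ?C + \<i> * ?D - ?E = _")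
proof -
 note w = w_rapid[OF \<tau>]
 note t = quotient_tame[OF k] kernels_tame KX_tame tame_intros
 let ?N = "\<lambda>a b. (a * a * b - \<bar>a\<bar> * b * \<bar>b\<bar> + (a * b * \<bar>b\<bar> - \<bar>a\<bar> * b * b)) / (k + (\<bar>a\<bar> + \<bar>b\<bar>)) + (a * b * b - a * b * \<bar>b\<bar>) / (k + \<bar>b\<bar>) - a * \<bar>b\<bar>"
 let ?L = "\<lambda>a b. - (2 * k * \<bar>a\<bar> * \<bar>b\<bar> / (k + (\<bar>a\<bar> + \<bar>b\<bar>)))"
 let ?K = "\<lambda>a b. KI a b / of_real (k + (\<bar>a\<bar> + \<bar>b\<bar>)) + KY a b / of_real (k + (\<bar>a\<bar> + \<bar>b\<bar>)) - KG a b / of_real (k + \<bar>b\<bar>)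
   + \<i> * (KF a b / of_real (k + \<bar>b\<bar>)) - KX a b"
 have K: "?K a b = of_real (?N a b)" for a b
  unfolding KI_def KY_def KG_def KF_def KX_def of_real_add of_real_diff of_real_divide of_real_mult
  by (simp add: add_divide_distrib diff_divide_distrib mult.assoc[symmetric])
 have L: "- KL k a b = of_real (?L a b)" for a b unfolding KL_def by simp
 have "?A + ?B - ?C + \<i> * ?D - ?E = conv (w \<tau>) ?K k"
  unfolding c_def conv_cmult[symmetric]
  by (subst conv_diff[OF w] conv_add[OF w], (intro t)+)+ (rule refl)
 also have "\<dots> = conv (w \<tau>) (\<lambda>a b. - KL k a b) k"
 proof (rule conv_symmetrize[OF w])
  show "tame ?K" by (intro t)
  show "tame (\<lambda>a b. - KL k a b)" by (intro tame_uminus KL_tame k)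
  show "?K a b + ?K b a = - KL k a b + - KL k b a" if "a + b = k" for a b
   unfolding K L of_real_add[symmetric] of_real_eq_iff by (rule plasma_kernel_symmetrized[OF k that])
 qed
 finally show ?thesis unfolding conv_uminus interaction_eq[OF k] .
qed

lemma vacuum_kernels:
 assumes \<tau>: "\<tau> \<in> {0<..<T}" and k: "k > 0"
 defines "c \<equiv> \<lambda>K. conv (w \<tau>) K k"
 shows "c (\<lambda>a b. KG a b / of_real (k + \<bar>b\<bar>)) - c (\<lambda>a b. KQ a b / of_real (k + \<bar>b\<bar>)) + c KX + 1 / 2 * c KZ = interaction \<tau> k"
  (is "?A - ?B + ?C + 1 / 2 * ?D = _")
proof -
 note w = w_rapid[OF \<tau>]
 note t = quotient_tame[OF k] kernels_tame vacuum_kernels_tame KX_tame tame_intros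
 let ?N = "\<lambda>a b. (a * b * \<bar>b\<bar> - a * b * b) / (k + \<bar>b\<bar>) + a * \<bar>b\<bar> + (\<bar>a\<bar> * \<bar>b\<bar> - a * b) / 2"
 let ?L = "\<lambda>a b. 2 * k * \<bar>a\<bar> * \<bar>b\<bar> / (k + (\<bar>a\<bar> + \<bar>b\<bar>))"
 let ?K = "\<lambda>a b. KG a b / of_real (k + \<bar>b\<bar>) - KQ a b / of_real (k + \<bar>b\<bar>) + KX a b + 1 / 2 * KZ a b"
 have K: "?K a b = of_real (?N a b)" for a b
  unfolding KG_def KQ_def KX_def KZ_def of_real_add of_real_diff of_real_divide of_real_mult
  by (simp add: add_divide_distrib diff_divide_distrib)
 have L: "KL k a b = of_real (?L a b)" for a b unfolding KL_def by simp
 have "?A - ?B + ?C + 1 / 2 * ?D = conv (w \<tau>) ?K k"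
  unfolding c_def conv_cmult[symmetric]
  by (subst conv_diff[OF w] conv_add[OF w], (intro t)+)+ (rule refl)
 also have "\<dots> = conv (w \<tau>) (KL k) k"
 proof (rule conv_symmetrize[OF w _ KL_tame[OF k]])
  show "tame ?K" by (intro t)
  show "?K a b + ?K b a = KL k a b + KL k b a" if "a + b = k" for a b
   unfolding K L of_real_add[symmetric] of_real_eq_iff by (rule vacuum_kernel_symmetrized[OF k that])
 qed
 finally show ?thesis unfolding interaction_eq[OF k] .
qed

lemma conv_laplace_E:
 assumes t: "t \<in> {0<..<T}" and k: "k > 0" and K: "tame K"
 shows "laplace k (\<lambda>s. conv (w t) (\<lambda>a b. K a b * EE s a b) k) = conv (w t) (\<lambda>a b. K a b / of_real (k + (\<bar>a\<bar> + \<bar>b\<bar>))) k" (is ?thesis1)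
  and "laplace k (\<lambda>s. conv (w t) (\<lambda>a b. K a b * E2 s a b) k) = conv (w t) (\<lambda>a b. K a b / of_real (k + \<bar>b\<bar>)) k" (is ?thesis2)
  and "laplace (\<sigma> * k) (convV K t k) = 1 / Sc * conv (w t) (\<lambda>a b. K a b / of_real (k + \<bar>b\<bar>)) k" (is ?thesis3)
proof -
 show ?thesis1
  unfolding laplace_def EE_def
  by (rule conv_laplace[OF w_rapid[OF t] K, of "\<lambda>a b. \<bar>a\<bar> + \<bar>b\<bar>", OF rates(1,2) k])
 show ?thesis2
  unfolding laplace_def E2_def
  by (rule conv_laplace[OF w_rapid[OF t] K, of "\<lambda>a b. \<bar>b\<bar>", OF rates(3,4) k])
 have "laplace (\<sigma> * k) (convV K t k) = conv (w t) (\<lambda>a b. K a b / of_real (\<sigma> * k + \<sigma> * \<bar>b\<bar>)) k"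
  unfolding laplace_def convV_def EV_def
  by (rule conv_laplace[OF w_rapid[OF t] K, of "\<lambda>a b. \<sigma> * \<bar>b\<bar>", OF sigma_rate(1,2)]) (use k sigma_pos in simp)
 also have "\<dots> = conv (w t) (\<lambda>a b. 1 / Sc * (K a b / of_real (k + \<bar>b\<bar>))) k"
  by (simp only: distrib_left[symmetric] of_real_mult) (simp add: mult.commute)
 finally show ?thesis3
  unfolding conv_cmult .
qed

lemma forcing_laplace:
 assumes t: "t \<in> {0<..<T}" and k: "k > 0"
 defines "l \<equiv> \<lambda>j. laplace k (\<lambda>s. p_hat k s t $ j)" and "c \<equiv> \<lambda>K. conv (w t) K k"
 shows "l 1 = - Mc * wt t k / 2 - \<i> * Dc * c (\<lambda>a b. KI a b / of_real (k + (\<bar>a\<bar> + \<bar>b\<bar>)))" (is ?thesis1)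
  and "l 2 = - \<i> * Mc * wt t k / 2 + Dc * (c (\<lambda>a b. KY a b / of_real (k + (\<bar>a\<bar> + \<bar>b\<bar>))) - c (\<lambda>a b. KG a b / of_real (k + \<bar>b\<bar>)))" (is ?thesis2)
  and "l 3 = bc * wt t k / 2" (is ?thesis3) and "l 4 = \<i> * bc * wt t k / 2" (is ?thesis4)
  and "l 5 = Mc * c (\<lambda>a b. KF a b / of_real (k + \<bar>b\<bar>))" (is ?thesis5)
proof -
 have k0: "k \<noteq> 0" and ka: "\<bar>k\<bar> = k" and kc: "complex_of_real k \<noteq> 0" using k by auto
 have lE: "laplace k (\<lambda>s. z * E k s) = z / of_real (2 * k)" for z
 proof -
  have "laplace k (\<lambda>s. z * E k s) = z * laplace k (\<lambda>s. of_real (exp (- (k * s))))"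
   unfolding laplace_cmult E_def ka ..
  also have "\<dots> = z / of_real (2 * k)" unfolding laplace_exp[OF k k] by simp
  finally show ?thesis .
 qed
 have sE: "halfline_source (\<lambda>s. z * E k s)" for z by (intro halfline_source_intros E_source)
 note f = forcing_fourier[OF t _ k0, unfolded ka mu_def[symmetric]]
 note src = halfline_source_intros conv_exp_continuous(3,4)[OF t] kernels_tame sE
 note cl = conv_laplace_E[OF t k]
 have "l 1 = laplace k (\<lambda>s. (- Mc * of_real k * wt t k) * E k s + (- \<i> * Dc) * conv (w t) (\<lambda>a b. KI a b * EE s a b) k)"
  unfolding l_def by (rule laplace_cong) (simp add: f(1) algebra_simps del: field_hat_component)
 also have "\<dots> = (- Mc * of_real k * wt t k) / of_real (2 * k) + (- \<i> * Dc) * c (\<lambda>a b. KI a b / of_real (k + (\<bar>a\<bar> + \<bar>b\<bar>)))"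
  unfolding c_def cl(1)[OF kernels_tame(1), symmetric] lE[symmetric] laplace_cmult[of _ "- \<i> * Dc", symmetric]
  by (intro laplace_add k src)
 finally show ?thesis1
  using kc by (simp add: field_simps)
 have "l 2 = laplace k (\<lambda>s. (- \<i> * Mc * of_real k * wt t k) * E k s + Dc * (conv (w t) (\<lambda>a b. KY a b * EE s a b) k - conv (w t) (\<lambda>a b. KG a b * E2 s a b) k))"
  unfolding l_def by (rule laplace_cong) (simp add: f(2) algebra_simps del: field_hat_component)
 also have "\<dots> = laplace k (\<lambda>s. (- \<i> * Mc * of_real k * wt t k) * E k s) +
   laplace k (\<lambda>s. Dc * (conv (w t) (\<lambda>a b. KY a b * EE s a b) k - conv (w t) (\<lambda>a b. KG a b * E2 s a b) k))"
  by (intro laplace_add k src)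
 also have "laplace k (\<lambda>s. Dc * (conv (w t) (\<lambda>a b. KY a b * EE s a b) k - conv (w t) (\<lambda>a b. KG a b * E2 s a b) k)) =
   Dc * (c (\<lambda>a b. KY a b / of_real (k + (\<bar>a\<bar> + \<bar>b\<bar>))) - c (\<lambda>a b. KG a b / of_real (k + \<bar>b\<bar>)))"
  unfolding laplace_cmult c_def cl(1)[OF kernels_tame(2), symmetric] cl(2)[OF kernels_tame(3), symmetric]
  by (intro arg_cong[where f="\<lambda>x. Dc * x"] laplace_diff k src)
 finally show ?thesis2
  unfolding lE using kc by simp
 have "l 3 = laplace k (\<lambda>s. (bc * of_real k * wt t k) * E k s)"
  unfolding l_def by (rule laplace_cong) (simp add: f(3) algebra_simps del: field_hat_component)
 then show ?thesis3 unfolding lE using kc by simp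
 have "l 4 = laplace k (\<lambda>s. (\<i> * bc * of_real k * wt t k) * E k s)"
  unfolding l_def by (rule laplace_cong) (simp add: f(4) algebra_simps del: field_hat_component)
 then show ?thesis4 unfolding lE using kc by simp
 have "l 5 = laplace k (\<lambda>s. Mc * conv (w t) (\<lambda>a b. KF a b * E2 s a b) k)"
  unfolding l_def by (rule laplace_cong) (simp add: f(5) algebra_simps del: field_hat_component)
 then show ?thesis5
  unfolding laplace_cmult c_def cl(2)[OF kernels_tame(4)] .
qed

lemma forcing_bdot_laplace:
 assumes t: "t \<in> {0<..<T}" and k: "k > 0"
 defines "c \<equiv> \<lambda>K. conv (w t) K k"
 shows "laplace k (\<lambda>s. cnj_vec (L_vec v0 B0 lam) \<odot> p_hat k s t) =
  - (\<i> / (2 * Dc * Mc) * (- (Mc * Mc + bc * bc) * wt t k + Mc * Dc * (- \<i> * c (\<lambda>a b. KI a b / of_real (k + (\<bar>a\<bar> + \<bar>b\<bar>)))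
   - \<i> * (c (\<lambda>a b. KY a b / of_real (k + (\<bar>a\<bar> + \<bar>b\<bar>))) - c (\<lambda>a b. KG a b / of_real (k + \<bar>b\<bar>)))
   + c (\<lambda>a b. KF a b / of_real (k + \<bar>b\<bar>)))))"
proof -
 have k0: "k \<noteq> 0" using k by simp
 note s = forcing_source[OF t k0]
 have "laplace k (\<lambda>s. cnj_vec (L_vec v0 B0 lam) \<odot> p_hat k s t) =
  laplace k (\<lambda>s. - (\<i> / (2 * Dc * Mc)) * (Mc * p_hat k s t $ 1 - \<i> * Mc * p_hat k s t $ 2 - bc * p_hat k s t $ 3 + \<i> * bc * p_hat k s t $ 4 + Dc * p_hat k s t $ 5))"
  unfolding bdot_vectors by simp
 also have "\<dots> = - (\<i> / (2 * Dc * Mc)) * (Mc * laplace k (\<lambda>s. p_hat k s t $ 1) - \<i> * Mc * laplace k (\<lambda>s. p_hat k s t $ 2)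
   - bc * laplace k (\<lambda>s. p_hat k s t $ 3) + \<i> * bc * laplace k (\<lambda>s. p_hat k s t $ 4) + Dc * laplace k (\<lambda>s. p_hat k s t $ 5))"
  by (simp only: laplace_cmult laplace_add[OF k] laplace_diff[OF k] halfline_source_intros s)
 also have "\<dots> = - (\<i> / (2 * Dc * Mc) * (- (Mc * Mc + bc * bc) * wt t k + Mc * Dc * (- \<i> * c (\<lambda>a b. KI a b / of_real (k + (\<bar>a\<bar> + \<bar>b\<bar>)))
   - \<i> * (c (\<lambda>a b. KY a b / of_real (k + (\<bar>a\<bar> + \<bar>b\<bar>))) - c (\<lambda>a b. KG a b / of_real (k + \<bar>b\<bar>)))
   + c (\<lambda>a b. KF a b / of_real (k + \<bar>b\<bar>)))))"
  unfolding forcing_laplace[OF t k] c_def mult_minus_left[of "\<i> / (2 * Dc * Mc)"]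
  by (rule arg_cong[where f="\<lambda>x. - (\<i> / (2 * Dc * Mc) * x)"]) (simp add: algebra_simps)
 finally show ?thesis .
qed

text \<open>The trace of the total pressure, as it is determined by the plasma.\<close>

lemma plasma_trace:
 assumes so: "second_order_plasma v0 B0 lam T U1 \<phi>1 U2" and \<tau>: "\<tau> \<in> {0<..<T}" and k: "k > 0"
  and u2: "field_hat U2 k 0 \<tau> $ 2 = wt \<tau> k - \<i> * Mc * conv (w \<tau>) KX k - \<i> * Mc * g"
 shows "field_hat U2 k 0 \<tau> $ 5 = - 2 * \<i> * Mc * wt \<tau> k - Dc * g - Dc * interaction \<tau> k"
proof -
 have k0: "k \<noteq> 0" using k by simp
 let ?L = "L_vec v0 B0 lam"
 obtain a0 b0 where b0: "b0 k \<tau> = - (LBINT s:{0..}. (cnj_vec ?L \<odot> p_hat k s \<tau>) * of_real (exp (- k * s)))"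
  and f: "\<forall>y\<ge>0. field_hat U2 k y \<tau> = S_vec v0 B0 lam \<phi>1 k y \<tau>
     + (of_real (exp (- k * y)) * (a0 k \<tau> + (LBINT s:{0..y}. (?L \<odot> p_hat k s \<tau>) * of_real (exp (k * s))))) *s R_vec v0 B0 lam
     + (of_real (exp (k * y)) * (b0 k \<tau> + (LBINT s:{0..y}. (cnj_vec ?L \<odot> p_hat k s \<tau>) * of_real (exp (- k * s)))))
       *s cnj_vec (R_vec v0 B0 lam)"
  using so \<tau> k k0 unfolding second_order_plasma_def Let_def by blast
 have z: "(LBINT s:{0..0}. (cnj_vec ?L \<odot> p_hat k s \<tau>) * of_real (exp (- k * s))) = 0"
  using past_0[OF bdot_source[OF \<tau> k0], of "- k"] unfolding past_def by simp
 define A where "A = of_real (exp (- k * 0)) * (a0 k \<tau> + (LBINT s:{0..0}. (?L \<odot> p_hat k s \<tau>) * of_real (exp (k * s))))"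
 have "field_hat U2 k 0 \<tau> = S_vec v0 B0 lam \<phi>1 k 0 \<tau> + A *s R_vec v0 B0 lam +
   (of_real (exp (k * 0)) * (b0 k \<tau> + (LBINT s:{0..0}. (cnj_vec ?L \<odot> p_hat k s \<tau>) * of_real (exp (- k * s))))) *s cnj_vec (R_vec v0 B0 lam)"
  unfolding A_def by (rule f[rule_format]) simp
 then have A: "field_hat U2 k 0 \<tau> = S_vec v0 B0 lam \<phi>1 k 0 \<tau> + A *s R_vec v0 B0 lam + b0 k \<tau> *s cnj_vec (R_vec v0 B0 lam)"
  unfolding z by simp
 have "field_hat U2 k 0 \<tau> $ 2 = \<i> * Mc * (A - b0 k \<tau>)" "field_hat U2 k 0 \<tau> $ 5 = Dc * (A + b0 k \<tau>)"
  using A unfolding second_order_vector_iff[OF k0] by auto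
 then have u5: "field_hat U2 k 0 \<tau> $ 5 = Dc * (field_hat U2 k 0 \<tau> $ 2 / (\<i> * Mc) + 2 * b0 k \<tau>)"
  using Mc_nonzero by simp
 have b: "b0 k \<tau> = - laplace k (\<lambda>s. cnj_vec ?L \<odot> p_hat k s \<tau>)"
  unfolding b0 laplace_def by simp
 define I where "I = interaction \<tau> k"
 define cI cY cG cF cX where "cI = conv (w \<tau>) (\<lambda>a b. KI a b / of_real (k + (\<bar>a\<bar> + \<bar>b\<bar>))) k"
  and "cY = conv (w \<tau>) (\<lambda>a b. KY a b / of_real (k + (\<bar>a\<bar> + \<bar>b\<bar>))) k" and "cG = conv (w \<tau>) (\<lambda>a b. KG a b / of_real (k + \<bar>b\<bar>)) k"
  and "cF = conv (w \<tau>) (\<lambda>a b. KF a b / of_real (k + \<bar>b\<bar>)) k" and "cX = conv (w \<tau>) KX k"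
 have sum: "cI + cY - cG + \<i> * cF - cX = - I"
  using plasma_kernels[OF \<tau> k] unfolding cI_def cY_def cG_def cF_def cX_def I_def .
 have "field_hat U2 k 0 \<tau> $ 5 = Dc * ((wt \<tau> k - \<i> * Mc * cX - \<i> * Mc * g) / (\<i> * Mc)
   + 2 * (\<i> / (2 * Dc * Mc) * (- (Mc * Mc + bc * bc) * wt \<tau> k + Mc * Dc * (- \<i> * cI - \<i> * (cY - cG) + cF))))"
  unfolding u5 b u2 forcing_bdot_laplace[OF \<tau> k] cI_def cY_def cG_def cF_def cX_def by simp
 also have "\<dots> = (- \<i> * (Dc + (Mc * Mc + bc * bc)) / Mc) * wt \<tau> k - Dc * g + Dc * (cI + cY - cG + \<i> * cF - cX)"
  using Mc_nonzero Dc_nonzero by (simp add: field_simps)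
 also have "Dc + (Mc * Mc + bc * bc) = 2 * Mc * Mc" unfolding Dc_eq by simp
 also have "(- \<i> * (2 * Mc * Mc) / Mc) * wt \<tau> k - Dc * g + Dc * (cI + cY - cG + \<i> * cF - cX) =
   - 2 * \<i> * Mc * wt \<tau> k - Dc * g - Dc * interaction \<tau> k"
  unfolding sum I_def[symmetric] using Mc_nonzero by (simp add: field_simps)
 finally show ?thesis .
qed

text \<open>The trace of \<open>H\<^sub>1\<close>, as it is determined by the vacuum.\<close>

lemma vacuum_trace:
 assumes V2: "profile {..<0} T V2" and sys: "vacuum_hat_system \<nu> lam T V2 (vacuum_forcing \<nu> lam V1 \<phi>1)"
  and t: "t \<in> {0<..<T}" and k: "k > 0"
 shows "field_hat V2 k 0 t $ 1 = \<i> * Sc * field_hat V2 k 0 t $ 2 + \<i> * Nc * Nc * Lc * Hc / Sc * wt t k +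
  Sc * Sc * Hc * (conv (w t) (\<lambda>a b. KG a b / of_real (k + \<bar>b\<bar>)) k - conv (w t) (\<lambda>a b. KQ a b / of_real (k + \<bar>b\<bar>)) k)"
proof -
 have k0: "k \<noteq> 0" and ka: "\<bar>k\<bar> = k" using k by auto
 define h where "h = (\<lambda>j s. field_hat V2 k (- s) t $ j)"
 define y where "y = (\<lambda>j s. field_hat (pd2 V2) k (- s) t $ j)"
 define \<kappa> where "\<kappa> = \<sigma> * k"
 define K where "K = complex_of_real k"
 have \<kappa>: "\<kappa> > 0" unfolding \<kappa>_def using k sigma_pos by simp
 have nz: "K \<noteq> 0" "Sc \<noteq> 0" using k sigma_pos by (auto simp: K_def)
 have \<kappa>K: "complex_of_real \<kappa> = Sc * K" by (simp add: \<kappa>_def K_def)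
 have cont: "continuous_on {0..} (h j)" and D: "s > 0 \<Longrightarrow> (h j has_vector_derivative - y j s) (at s)" for j s
  using field_eta_reflected(1,3)[OF V2 t] unfolding h_def y_def by auto
 obtain M1 where M1: "\<And>s. s > 0 \<Longrightarrow> norm (h 1 s) \<le> M1"
  using field_eta_reflected(2)[OF V2 t, of k 1] unfolding h_def by blast
 obtain M2 where M2: "\<And>s. s > 0 \<Longrightarrow> norm (h 2 s) \<le> M2"
  using field_eta_reflected(2)[OF V2 t, of k 2] unfolding h_def by blast
 define c where "c = 2 * \<i> * Nc * Nc * Lc * Hc * K * wt t k"
 define r where "r = (\<lambda>s. c * EV k s + (Sc * Sc * Sc * Hc) * (convV KG t k s - convV KQ t k s))"
 have src: "halfline_source r"
  unfolding r_def by (intro halfline_source_intros EV_facts convV_source t kernels_tame vacuum_kernels_tame)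
 have r: "NL * P2 t k s - P3 t k s + \<i> * Sc * P4 t k s = r s" for s
  unfolding P2_def P3_def P4_def r_def c_def K_def by (simp add: algebra_simps)
 have e: "- (\<i> * K * (h 3 s + NL * h 2 s)) + P2 t k s = 0"
  "y 1 s - \<i> * K * (h 2 s + NL * h 3 s) + P3 t k s = 0" "\<i> * K * h 1 s + y 2 s + P4 t k s = 0" if "s > 0" for s
  using vacuum_hat_systemD[OF sys t k0, of "- s"] that
  unfolding vacuum_forcing_fourier[OF t that k0] h_def y_def K_def by (simp_all del: field_hat_component)
 have move: "u = v - z" if "u - v + z = 0" for u v z :: complex
 proof -
  have "u = (u - v + z) + (v - z)" by simp
  then show ?thesis unfolding that by simp
 qed
 define W where "W = (\<lambda>s. h 1 s - (\<i> * Sc) * h 2 s)"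
 have "W 0 = - (LBINT s:{0..}. (- 1 * r s) * of_real (exp (- (\<kappa> * s))))"
 proof (rule bounded_solution_initial_value[OF _ _ _ \<kappa>])
  show "continuous_on {0..} W" unfolding W_def by (intro continuous_intros cont)
  show "halfline_source (\<lambda>s. - 1 * r s)" by (intro halfline_source_intros src)
  show "norm (W s) \<le> M1 + norm (\<i> * Sc) * M2" if "s > 0" for s
   unfolding W_def by (intro norm_combination M1 M2 that)
  show "(W has_vector_derivative complex_of_real \<kappa> * W s + - 1 * r s) (at s)" if "s > 0" for s
  proof -
   have 1: "(W has_vector_derivative - y 1 s - (\<i> * Sc) * - y 2 s) (at s)"
    unfolding W_def by (intro has_vector_derivative_diff has_vector_derivative_mult_right D that)
   have y1: "y 1 s = \<i> * K * (h 2 s + NL * h 3 s) - P3 t k s" and y2: "y 2 s = - (\<i> * K * h 1 s) - P4 t k s"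
    and p2: "P2 t k s = \<i> * K * (h 3 s + NL * h 2 s)"
    using move[OF e(2)[OF that]] move[of "y 2 s" "- (\<i> * K * h 1 s)" "P4 t k s"] e(1,3)[OF that] by (simp_all add: add.commute)
   have "- y 1 s - (\<i> * Sc) * - y 2 s = Sc * K * h 1 s - \<i> * K * (1 - NL * NL) * h 2 s - r s"
    unfolding r[symmetric] y1 y2 p2 by (simp add: algebra_simps)
   also have "\<dots> = complex_of_real \<kappa> * W s + - 1 * r s"
    unfolding sigma_square_complex \<kappa>K W_def by (simp add: algebra_simps)
   finally have eq: "- y 1 s - (\<i> * Sc) * - y 2 s = complex_of_real \<kappa> * W s + - 1 * r s" .
   show ?thesis using 1 unfolding eq .
  qed
 qed
 then have "W 0 = laplace \<kappa> r" using laplace_cmult[of \<kappa> "- 1" r] unfolding laplace_def by simp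
 also have "\<dots> = c * laplace \<kappa> (EV k) + (Sc * Sc * Sc * Hc) * (laplace \<kappa> (convV KG t k) - laplace \<kappa> (convV KQ t k))"
  unfolding r_def
  by (subst laplace_add[OF \<kappa>], (intro halfline_source_intros EV_facts convV_source t kernels_tame vacuum_kernels_tame)+,
   simp only: laplace_cmult, subst laplace_diff[OF \<kappa>], (intro convV_source t kernels_tame vacuum_kernels_tame)+, rule refl)
 also have "laplace \<kappa> (EV k) = 1 / (2 * Sc * K)"
 proof -
  have "laplace \<kappa> (EV k) = laplace \<kappa> (\<lambda>s. of_real (exp (- (\<kappa> * s))))"
   by (rule laplace_cong) (simp add: EV_def ka \<kappa>_def)
  then show ?thesis unfolding laplace_exp[OF \<kappa> \<kappa>] of_real_add \<kappa>K by simp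
 qed
 also have "c * (1 / (2 * Sc * K)) = \<i> * Nc * Nc * Lc * Hc / Sc * wt t k"
  unfolding c_def using nz by (simp add: field_simps)
 finally have "W 0 = \<i> * Nc * Nc * Lc * Hc / Sc * wt t k + Sc * Sc * Sc * Hc *
   (1 / Sc * conv (w t) (\<lambda>a b. KG a b / of_real (k + \<bar>b\<bar>)) k - 1 / Sc * conv (w t) (\<lambda>a b. KQ a b / of_real (k + \<bar>b\<bar>)) k)"
  unfolding \<kappa>_def conv_laplace_E(3)[OF t k kernels_tame(3)] conv_laplace_E(3)[OF t k vacuum_kernels_tame(1)] .
 moreover have "field_hat V2 k 0 t $ 1 = \<i> * Sc * field_hat V2 k 0 t $ 2 + W 0"
  unfolding W_def h_def by (simp del: field_hat_component)
 ultimately show ?thesis using nz by (simp add: algebra_simps del: field_hat_component)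
qed

end

section \<open>The amplitude equation\<close>

lemma continuous_zero_of_integral:
 fixes h :: "real \<Rightarrow> real"
 assumes h: "continuous_on UNIV h" "\<And>x. h x \<ge> 0" "integrable lborel h" "(LINT x|lborel. h x) = 0"
 shows "h x = 0"
proof (rule ccontr)
 assume x: "h x \<noteq> 0"
 let ?S = "{x. h x \<noteq> 0}"
 have S: "open ?S"
  by (rule open_Collect_neq[OF h(1)]) (rule continuous_on_const)
 have "AE x in lborel. h x = 0"
  using integral_nonneg_eq_0_iff_AE[OF h(3)] h(2,4) by simp
 then have "?S \<in> null_sets lborel"
  using AE_iff_null[of lborel "\<lambda>x. h x = 0"] S by simp
 then have "negligible ?S" unfolding negligible_iff_null_sets by (rule null_sets_completionI)
 then show False using open_not_negligible[OF S] x by auto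
qed

context surface_wave
begin

text \<open>
 The factor by which time is rescaled; \<open>rate\<close> is the derivative of the dispersion function
 with respect to the phase velocity, which vanishes at a double root.
\<close>

definition "rate = 2 * m + H0\<^sup>2 * \<nu>\<^sup>2 * lam / \<sigma>"
definition "gain = d + \<sigma>\<^sup>2 * H0\<^sup>2"
definition "time_scale = (if rate = 0 then 1 else - rate / gain)"

lemma gain_pos: "gain > 0"
 unfolding gain_def using d_pos by (simp add: add_pos_nonneg)

lemma time_scale_nonzero: "time_scale \<noteq> 0"
 unfolding time_scale_def using gain_pos by auto

end

context first_order_solution
begin

lemma trace_nice:
 assumes t: "t \<in> {0<..<T}"
 shows "nice (\<lambda>x. U1 x 0 t $ j)" "nice (\<lambda>x. V1 x 0 t $ i)" "nice (\<lambda>x. sd1 \<phi>1 x t)" "nice (\<lambda>x. sd2 \<phi>1 x t)"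
 using field_nice(1)[OF U1 t, of 0 j] field_nice(1)[OF V1 t, of 0 i] surface_families(2,3)[OF \<phi>1_profile t] by auto

lemma trace_fourier:
 assumes t: "t \<in> {0<..<T}" and k: "k \<noteq> 0"
 shows "fourier (\<lambda>x. U1 x 0 t $ 1) k = (- (Mc * of_real \<bar>k\<bar>)) * w t k" (is ?thesis1)
  and "fourier (\<lambda>x. V1 x 0 t $ 1) k = (- (Hc * Sc * of_real \<bar>k\<bar>)) * w t k" (is ?thesis2)
  and "fourier (\<lambda>x. V1 x 0 t $ 2) k = (\<i> * Hc * of_real k) * w t k" (is ?thesis3)
  and "fourier (\<lambda>x. V1 x 0 t $ 3) k = (- (\<i> * Hc * Nc * Lc * of_real k)) * w t k" (is ?thesis4)
proof -
 have e: "exp (- (\<bar>k\<bar> * 0)) = 1" "exp (\<sigma> * \<bar>k\<bar> * 0) = 1" by simp_all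
 note f = first_order_multipliersD[OF fo t k, of 0, unfolded e field_hat_component of_real_1 mult_1_right]
 show ?thesis1
  using f(1)[OF order_refl] unfolding mu_def[symmetric] of_real_mult by simp
 show ?thesis2
  ?thesis3
  ?thesis4
  using f(6-8)[OF order_refl] unfolding of_real_mult by (simp_all add: mult.assoc)
qed

lemma jump_forcing_nice:
 assumes t: "t \<in> {0<..<T}"
 shows "nice (\<lambda>x. jump_forcing \<nu> H0 lam U1 V1 \<phi>1 x t $ i)"
 using exhaust_5[of i]
 by (auto simp: jump_forcing_def Let_def mult.assoc intro!: nice_intros trace_nice[OF t])

lemma jump_forcing_fourier:
 fixes k :: real
 assumes \<tau>: "\<tau> \<in> {0<..<T}"
 defines "j \<equiv> \<lambda>i. fourier (\<lambda>x. jump_forcing \<nu> H0 lam U1 V1 \<phi>1 x \<tau> $ i) k"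
 shows "j 1 = wt \<tau> k - \<i> * Mc * conv (w \<tau>) KX k" (is ?thesis1) and "j 3 = \<i> * Hc * Sc * conv (w \<tau>) KX k" (is ?thesis2)
  and "j 4 = Hc * Hc * Sc * Sc / 2 * conv (w \<tau>) KZ k" (is ?thesis3)
proof -
 note n = trace_nice[OF \<tau>] and w = w_rapid[OF \<tau>] and f = trace_fourier[OF \<tau>]
 have sx: "fourier (\<lambda>x. sd1 \<phi>1 x \<tau>) l = (\<i> * of_real l) * w \<tau> l" for l
  by (rule surface_fourier(1)[OF \<phi>1_profile \<tau>])
 have sx0: "l \<noteq> 0 \<Longrightarrow> fourier (\<lambda>x. sd1 \<phi>1 x \<tau>) l = (\<i> * of_real l) * w \<tau> l" for l by (rule sx)
 have t: "tame (\<lambda>a b. \<i> * of_real a)" "tame (\<lambda>a b. - (Mc * of_real \<bar>b\<bar>))" "tame (\<lambda>a b. - (Hc * Sc * of_real \<bar>b\<bar>))"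
  "tame (\<lambda>a b. - (Hc * Sc * of_real \<bar>a\<bar>))" "tame (\<lambda>a b. \<i> * Hc * of_real a)" "tame (\<lambda>a b. \<i> * Hc * of_real b)"
  "tame (\<lambda>a b. - (\<i> * Hc * Nc * Lc * of_real a))" "tame (\<lambda>a b. - (\<i> * Hc * Nc * Lc * of_real b))"
  by (intro tame_intros)+
 have 1: "fourier (\<lambda>x. sd1 \<phi>1 x \<tau> * U1 x 0 \<tau> $ 1) k = - (\<i> * Mc) * conv (w \<tau>) KX k"
  unfolding conv_cmult[symmetric]
  by (rule trans[OF fourier_product_conv[OF n(3,1) w t(1,2) sx0 f(1)] conv_cong]) (simp_all add: KX_def algebra_simps)
 have 2: "fourier (\<lambda>x. sd1 \<phi>1 x \<tau> * V1 x 0 \<tau> $ 1) k = - (\<i> * Hc * Sc) * conv (w \<tau>) KX k"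
  unfolding conv_cmult[symmetric]
  by (rule trans[OF fourier_product_conv[OF n(3,2) w t(1,3) sx0 f(2)] conv_cong]) (simp_all add: KX_def algebra_simps)
 define cA cP where "cA = conv (w \<tau>) (\<lambda>a b. of_real \<bar>a\<bar> * of_real \<bar>b\<bar>) k" and "cP = conv (w \<tau>) (\<lambda>a b. of_real a * of_real b) k"
 have 3: "fourier (\<lambda>x. V1 x 0 \<tau> $ 1 * V1 x 0 \<tau> $ 1) k = (Hc * Hc * Sc * Sc) * cA"
  unfolding conv_cmult[symmetric] cA_def
  by (rule trans[OF fourier_product_conv[OF n(2,2) w t(4,3) f(2,2)] conv_cong]) (simp_all add: algebra_simps)
 have 4: "fourier (\<lambda>x. V1 x 0 \<tau> $ 2 * V1 x 0 \<tau> $ 2) k = - (Hc * Hc) * cP"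
  unfolding conv_cmult[symmetric] cP_def
  by (rule trans[OF fourier_product_conv[OF n(2,2) w t(5,6) f(3,3)] conv_cong]) (simp_all add: algebra_simps)
 have 5: "fourier (\<lambda>x. V1 x 0 \<tau> $ 3 * V1 x 0 \<tau> $ 3) k = - (Hc * Hc * (NL * NL)) * cP"
  unfolding conv_cmult[symmetric] cP_def
  by (rule trans[OF fourier_product_conv[OF n(2,2) w t(7,8) f(4,4)] conv_cong]) (simp_all add: algebra_simps)
 have Z: "conv (w \<tau>) KZ k = cA - cP"
  unfolding cA_def cP_def KZ_def[abs_def] by (rule conv_diff[OF w]; intro tame_intros)
 have c: "jump_forcing \<nu> H0 lam U1 V1 \<phi>1 x \<tau> $ 1 = sd2 \<phi>1 x \<tau> + sd1 \<phi>1 x \<tau> * U1 x 0 \<tau> $ 1"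
  "jump_forcing \<nu> H0 lam U1 V1 \<phi>1 x \<tau> $ 3 = - (sd1 \<phi>1 x \<tau> * V1 x 0 \<tau> $ 1)"
  "jump_forcing \<nu> H0 lam U1 V1 \<phi>1 x \<tau> $ 4 = 1 / 2 * (V1 x 0 \<tau> $ 1 * V1 x 0 \<tau> $ 1 + V1 x 0 \<tau> $ 2 * V1 x 0 \<tau> $ 2 - V1 x 0 \<tau> $ 3 * V1 x 0 \<tau> $ 3)" for x
  by (simp_all add: jump_forcing_def Let_def power2_eq_square)
 have r: "fourier (\<lambda>x. sd2 \<phi>1 x \<tau>) k = wt \<tau> k" by (simp add: surface_hat_def)
 show ?thesis1
  unfolding j_def c fourier_add[OF n(4) nice_mult[OF n(3,1)]] 1 r by simp
 show ?thesis2
  unfolding j_def c fourier_uminus 2 by simp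
 have "j 4 = 1 / 2 * ((Hc * Hc * Sc * Sc) * cA + - (Hc * Hc) * cP - - (Hc * Hc * (NL * NL)) * cP)"
  unfolding j_def c fourier_cmult fourier_diff[OF nice_add[OF nice_mult[OF n(2,2)] nice_mult[OF n(2,2)]] nice_mult[OF n(2,2)]]
   fourier_add[OF nice_mult[OF n(2,2)] nice_mult[OF n(2,2)]] 3 4 5 by simp
 then show ?thesis3
  unfolding sigma_square_complex Z by (simp add: field_simps)
qed

lemma second_order_jump_iff:
 "second_order_jump \<nu> v0 B0 H0 lam T U1 V1 \<phi>1 U2 V2 \<phi>2 \<longleftrightarrow>
  jump_hat_system \<nu> v0 B0 H0 lam T U2 V2 \<phi>2 (jump_forcing \<nu> H0 lam U1 V1 \<phi>1)"
 unfolding second_order_jump_def jump_hat_system_def Let_def jump_forcing_def vector_5 of_real_diff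
 by (rule refl)

text \<open>The second order wave profile drops out of the compatibility of the two traces.\<close>

lemma amplitude_relation_pos:
 assumes V2: "profile {..<0} T V2" and so: "second_order_plasma v0 B0 lam T U1 \<phi>1 U2"
  and vac: "vacuum_hat_system \<nu> lam T V2 (vacuum_forcing \<nu> lam V1 \<phi>1)"
  and jump: "jump_hat_system \<nu> v0 B0 H0 lam T U2 V2 \<phi>2 (jump_forcing \<nu> H0 lam U1 V1 \<phi>1)"
  and t: "t \<in> {0<..<T}" and k: "k > 0"
 shows "- \<i> * of_real rate * wt t k = of_real gain * interaction t k"
proof -
 have k0: "k \<noteq> 0" and Sz: "Sc \<noteq> 0" using k sigma_pos by auto
 define g where "g = of_real k * surface_hat \<phi>2 k t"
 define X Z I where "X = conv (w t) KX k" and "Z = conv (w t) KZ k" and "I = interaction t k"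
 define cG cQ where "cG = conv (w t) (\<lambda>a b. KG a b / of_real (k + \<bar>b\<bar>)) k" and "cQ = conv (w t) (\<lambda>a b. KQ a b / of_real (k + \<bar>b\<bar>)) k"
 define u5 h1 where "u5 = field_hat U2 k 0 t $ 5" and "h1 = field_hat V2 k 0 t $ 1"
 note J = jump_hat_systemD[OF jump t k0, unfolded jump_forcing_fourier[OF t] mu_def[symmetric], folded X_def Z_def]
 have u2: "field_hat U2 k 0 t $ 2 = wt t k - \<i> * Mc * X - \<i> * Mc * g"
  using J(1) unfolding g_def by (simp add: algebra_simps eq_diff_eq del: field_hat_component)
 have h2: "field_hat V2 k 0 t $ 2 = \<i> * Hc * g - \<i> * Hc * Sc * X"
 proof -
  have "field_hat V2 k 0 t $ 2 = Hc * (\<i> * of_real k * surface_hat \<phi>2 k t) - (Hc * (\<i> * of_real k * surface_hat \<phi>2 k t) - field_hat V2 k 0 t $ 2)"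
   by simp
  then show ?thesis unfolding J(3) g_def by (simp add: ac_simps del: field_hat_component)
 qed
 have u5: "u5 = - 2 * \<i> * Mc * wt t k - Dc * g - Dc * I"
  unfolding u5_def I_def by (rule plasma_trace[OF so t k u2[unfolded X_def]])
 have h1: "h1 = \<i> * Sc * (\<i> * Hc * g - \<i> * Hc * Sc * X) + \<i> * Nc * Nc * Lc * Hc / Sc * wt t k + Sc * Sc * Hc * (cG - cQ)"
  unfolding h1_def vacuum_trace[OF V2 vac t k] h2 cG_def cQ_def ..
 have I: "cG - cQ + X + 1 / 2 * Z = I"
  using vacuum_kernels[OF t k] unfolding cG_def cQ_def X_def Z_def I_def .
 have Dd: "Dc = Hc * Hc * Sc" unfolding d_phase by (simp add: power2_eq_square)
 define z where "z = 1 / 2 * Z"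
 have "u5 - Hc * h1 = Hc * Hc * Sc * Sc * z" using J(4) unfolding u5_def h1_def z_def by simp
 then have "- 2 * \<i> * Mc * wt t k - Dc * I - \<i> * Nc * Nc * Lc * Hc * Hc / Sc * wt t k =
   Hc * Hc * Sc * Sc * (cG - cQ + X + z)"
  unfolding u5 h1 Dd by (simp add: algebra_simps)
 then have eq: "- \<i> * (2 * Mc + Hc * Hc * Nc * Nc * Lc / Sc) * wt t k = (Dc + Sc * Sc * Hc * Hc) * I"
  unfolding I[folded z_def] by (simp add: algebra_simps)
 have "complex_of_real rate = 2 * Mc + Hc * Hc * Nc * Nc * Lc / Sc" "complex_of_real gain = Dc + Sc * Sc * Hc * Hc"
  unfolding rate_def gain_def mu_def[symmetric] by (simp_all add: power2_eq_square mult.assoc)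
 then show ?thesis using eq unfolding I_def by simp
qed

lemma interaction_cnj: "interaction \<tau> (- k) = cnj (interaction \<tau> k)"
proof -
 have c: "w \<tau> (- l) = cnj (w \<tau> l)" for l unfolding surface_hat_def by (rule fourier_cnj)
 have "interaction \<tau> (- k) = (LINT l|lborel. of_real (Lambda (- k - (0 + - 1 * l)) (0 + - 1 * l)) * (w \<tau> (- k - (0 + - 1 * l)) * w \<tau> (0 + - 1 * l)))"
  unfolding interaction_def conv_def by (subst lborel_integral_real_affine[where c="- 1" and t=0]) simp_all
 also have "\<dots> = (LINT l|lborel. cnj (of_real (Lambda (k - l) l) * (w \<tau> (k - l) * w \<tau> l)))"
 proof (rule Bochner_Integration.integral_cong[OF refl])
  fix l
  have "- k - (0 + - 1 * l) = - (k - l)" "0 + - 1 * l = - l" by simp_all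
  moreover have "Lambda (- (k - l)) (- l) = Lambda (k - l) l"
   unfolding Lambda_def by (simp add: abs_minus_commute)
  ultimately show "of_real (Lambda (- k - (0 + - 1 * l)) (0 + - 1 * l)) * (w \<tau> (- k - (0 + - 1 * l)) * w \<tau> (0 + - 1 * l)) =
   cnj (of_real (Lambda (k - l) l) * (w \<tau> (k - l) * w \<tau> l))"
   by (simp only: c complex_cnj_mult complex_cnj_complex_of_real)
 qed
 also have "\<dots> = cnj (interaction \<tau> k)"
  unfolding interaction_def conv_def by (rule Bochner_Integration.integral_cnj)
 finally show ?thesis .
qed

text \<open>
 If the interaction integral vanishes for all wave numbers, its limit \<open>\<integral> \<bar>l\<bar> \<bar>w l\<bar>\<^sup>2 dl\<close> for long
 waves (after division by \<open>k\<close>) vanishes, and there is no wave.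
\<close>

lemma interaction_zero:
 assumes t: "t \<in> {0<..<T}" and zero: "\<And>k. k > 0 \<Longrightarrow> interaction t k = 0" and l: "l \<noteq> 0"
 shows "w t l = 0"
proof -
 have wr: "rapid (w t)" by (rule w_rapid[OF t])
 have wc: "continuous_on UNIV (w t)" using wr by (simp add: rapid_def)
 obtain C where C: "\<And>k. norm (w t k) \<le> C" using wr unfolding rapid_def by (metis power_0 mult_1)
 have wm: "w t \<in> borel_measurable borel" by (rule borel_measurable_continuous_onI[OF wc])
 have int: "integrable lborel (\<lambda>l. C * ((1 + \<bar>l\<bar>) ^ 1 * norm (w t l)))"
  by (intro integrable_mult_right rapid_integrable wr)
 define q where "q = (\<lambda>k l. of_real (\<bar>k - l\<bar> * \<bar>l\<bar> / (k + (\<bar>k - l\<bar> + \<bar>l\<bar>))) * (w t (k - l) * w t l))"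
 define h where "h = (\<lambda>l. \<bar>l\<bar> / 2 * (norm (w t l))\<^sup>2)"
 define e where "e = (\<lambda>n. inverse (real (Suc n)))"
 have e: "e n > 0" "e \<longlonglongrightarrow> 0" for n unfolding e_def by (simp, rule LIMSEQ_inverse_real_of_nat)
 have qz: "(LINT l|lborel. q k l) = 0" if k: "k > 0" for k
 proof -
  have "0 = (LINT l|lborel. of_real (2 * k) * q k l)"
   using zero[OF k] unfolding interaction_eq[OF k] conv_def KL_def q_def
   by (simp add: mult.assoc times_divide_eq_right)
  also have "\<dots> = of_real (2 * k) * (LINT l|lborel. q k l)" by (rule integral_mult_right_zero)
  finally show ?thesis using k by simp
 qed
 have w': "w t (- l) * w t l = of_real ((norm (w t l))\<^sup>2)" for l
  unfolding surface_hat_def fourier_cnj complex_norm_square by (rule mult.commute)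
 have bound: "norm (q k l) \<le> C * ((1 + \<bar>l\<bar>) ^ 1 * norm (w t l))" if k: "k > 0" for k l
 proof -
  have p: "k + (\<bar>k - l\<bar> + \<bar>l\<bar>) > 0" using k by linarith
  have "\<bar>k - l\<bar> * \<bar>l\<bar> / (k + (\<bar>k - l\<bar> + \<bar>l\<bar>)) \<le> (k + (\<bar>k - l\<bar> + \<bar>l\<bar>)) * \<bar>l\<bar> / (k + (\<bar>k - l\<bar> + \<bar>l\<bar>))"
   using p k by (intro divide_right_mono mult_right_mono) auto
  also have "\<dots> = \<bar>l\<bar>" using p by simp
  finally have a: "\<bar>k - l\<bar> * \<bar>l\<bar> / (k + (\<bar>k - l\<bar> + \<bar>l\<bar>)) \<le> 1 + \<bar>l\<bar>" by simp
  have "norm (q k l) = \<bar>k - l\<bar> * \<bar>l\<bar> / (k + (\<bar>k - l\<bar> + \<bar>l\<bar>)) * (norm (w t (k - l)) * norm (w t l))"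
   unfolding q_def norm_mult norm_of_real using p by simp
  also have "\<dots> \<le> (1 + \<bar>l\<bar>) * (C * norm (w t l))"
   using p by (intro mult_mono a mult_right_mono C) auto
  finally show ?thesis by (simp add: ac_simps)
 qed
 have "(\<lambda>n. LINT l|lborel. q (e n) l) \<longlonglongrightarrow> (LINT l|lborel. complex_of_real (h l))"
 proof (rule integral_dominated_convergence[OF _ _ int])
  show "(\<lambda>l. complex_of_real (h l)) \<in> borel_measurable lborel" unfolding h_def using wm by measurable
  show "q (e n) \<in> borel_measurable lborel" for n unfolding q_def using wm by measurable
  show "AE l in lborel. norm (q (e n) l) \<le> C * ((1 + \<bar>l\<bar>) ^ 1 * norm (w t l))" for n
   by (intro AE_I2 bound e)
  show "AE l in lborel. (\<lambda>n. q (e n) l) \<longlonglongrightarrow> complex_of_real (h l)"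
  proof (rule AE_nonzero)
   fix l :: real assume l: "l \<noteq> 0"
   have "isCont (w t) (0 - l)" using wc by (simp add: continuous_on_eq_continuous_at)
   moreover have el: "(\<lambda>n. e n - l) \<longlonglongrightarrow> 0 - l" by (intro tendsto_intros e)
   ultimately have "(\<lambda>n. w t (e n - l)) \<longlonglongrightarrow> w t (0 - l)" by (rule isCont_tendsto_compose)
   then have "(\<lambda>n. q (e n) l) \<longlonglongrightarrow> of_real (\<bar>0 - l\<bar> * \<bar>l\<bar> / (0 + (\<bar>0 - l\<bar> + \<bar>l\<bar>))) * (w t (0 - l) * w t l)"
    unfolding q_def using l by (intro tendsto_intros e) auto
   also have "of_real (\<bar>0 - l\<bar> * \<bar>l\<bar> / (0 + (\<bar>0 - l\<bar> + \<bar>l\<bar>))) * (w t (0 - l) * w t l) = complex_of_real (h l)"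
   proof -
    have eq: "\<bar>0 - l\<bar> * \<bar>l\<bar> / (0 + (\<bar>0 - l\<bar> + \<bar>l\<bar>)) = \<bar>l\<bar> / 2"
     using nonzero_mult_div_cancel_right[of "\<bar>l\<bar>" "\<bar>l\<bar>"] l by simp
    show ?thesis unfolding eq unfolding diff_0 w' of_real_mult[symmetric] h_def by (rule refl)
   qed
   finally show "(\<lambda>n. q (e n) l) \<longlonglongrightarrow> complex_of_real (h l)" .
  qed
 qed
 moreover have "(\<lambda>n. LINT l|lborel. q (e n) l) = (\<lambda>n. 0)" by (simp add: qz e)
 ultimately have h0: "(LINT l|lborel. h l) = 0"
  by (simp add: LIMSEQ_const_iff)
 have hc: "continuous_on UNIV h" unfolding h_def by (intro continuous_intros wc) auto
 have hi: "integrable lborel h"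
 proof (rule Bochner_Integration.integrable_bound[OF int])
  show "h \<in> borel_measurable lborel" unfolding h_def using wm by measurable
  have "norm (h l) \<le> norm (C * ((1 + \<bar>l\<bar>) ^ 1 * norm (w t l)))" for l
  proof -
   have "norm (h l) = (\<bar>l\<bar> / 2) * (norm (w t l) * norm (w t l))" by (simp add: h_def power2_eq_square)
   also have "\<dots> \<le> (1 + \<bar>l\<bar>) * (C * norm (w t l))" by (intro mult_mono mult_right_mono C) auto
   also have "\<dots> \<le> norm (C * ((1 + \<bar>l\<bar>) ^ 1 * norm (w t l)))" by (simp add: ac_simps)
   finally show ?thesis .
  qed
  then show "AE l in lborel. norm (h l) \<le> norm (C * ((1 + \<bar>l\<bar>) ^ 1 * norm (w t l)))" by (intro AE_I2)
 qed
 have "h l = 0" by (rule continuous_zero_of_integral[OF hc _ hi h0]) (simp add: h_def)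
 then show ?thesis using l by (simp add: h_def)
qed

text \<open>
  At a double root the relation says that the interaction vanishes, hence so does the wave and the amplitude
  equation holds trivially. Negative wave numbers are reached by conjugation.
\<close>

lemma amplitude_relation:
 assumes rel: "\<And>t k. t \<in> {0<..<T} \<Longrightarrow> k > 0 \<Longrightarrow> - \<i> * of_real rate * wt t k = of_real gain * interaction t k"
  and t: "t \<in> {0<..<T}" and k: "k \<noteq> 0"
 shows "of_real time_scale * wt t k + \<i> * sgn (complex_of_real k) * interaction t k = 0"
proof -
 have G: "complex_of_real gain \<noteq> 0" using gain_pos by simp
 have pos: "of_real time_scale * wt t k + \<i> * interaction t k = 0" if k: "k > 0" for k
 proof (cases "rate = 0")
  case False
  have "of_real gain * (of_real time_scale * wt t k + \<i> * interaction t k) = - of_real rate * wt t k + \<i> * (of_real gain * interaction t k)"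
   using False G by (simp add: time_scale_def algebra_simps)
  also have "\<dots> = 0" unfolding rel[OF t k, symmetric] by (simp add: algebra_simps)
  finally show ?thesis using G by simp
 next
  case True
  have I: "interaction t k = 0" if "t \<in> {0<..<T}" "k > 0" for t k using rel[OF that] True G by simp
  have w0: "w t k = 0" if "t \<in> {0<..<T}" for t
   by (rule interaction_zero[OF that I[OF that]]) (use k in auto)
  have "((\<lambda>t. w t k) has_vector_derivative 0) (at t)"
   by (rule has_vector_derivative_transform_within_open[of "\<lambda>t. 0" _ _ "{0<..<T}"]) (use t w0 in auto)
  then have "wt t k = 0" using surface_fourier(2)[OF \<phi>1_profile t, of k] vector_derivative_unique_at by blast
  then show ?thesis using I[OF t k] by simp
 qed
 show ?thesis
 proof (cases "k > 0")
  case True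
  then show ?thesis using pos[OF True] by (simp add: sgn_of_real)
 next
  case False
  then have k': "- k > 0" using k by simp
  have "wt t k = cnj (wt t (- k))" unfolding surface_hat_def fourier_cnj[of _ "k"] by simp
  moreover have "interaction t k = cnj (interaction t (- k))" using interaction_cnj[of t "k"] by simp
  moreover have "sgn (complex_of_real k) = - 1" using False k by (simp add: sgn_of_real)
  ultimately show ?thesis using arg_cong[OF pos[OF k'], of cnj] by simp
 qed
qed

lemma amplitude_equation_solved:
 assumes rel: "\<And>t k. t \<in> {0<..<T} \<Longrightarrow> k > 0 \<Longrightarrow> - \<i> * of_real rate * wt t k = of_real gain * interaction t k"
 shows "amplitude_equation (\<lambda>x s. \<phi>1 x (time_scale * s)) {s. time_scale * s \<in> {0<..<T}}"
 unfolding amplitude_equation_def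
proof (intro allI impI ballI)
 fix k s :: real assume k: "k \<noteq> 0" and "s \<in> {s. time_scale * s \<in> {0<..<T}}"
 then have t: "time_scale * s \<in> {0<..<T}" by simp
 have hat: "surface_hat (\<lambda>x s. \<phi>1 x (time_scale * s)) k r = w (time_scale * r) k" for k r
  unfolding surface_hat_def ..
 have "((\<lambda>r. time_scale * r) has_vector_derivative time_scale) (at s)"
  by (auto intro!: derivative_eq_intros)
 from vector_diff_chain_at[OF this surface_fourier(2)[OF \<phi>1_profile t, of k]]
 have "((\<lambda>r. w (time_scale * r) k) has_vector_derivative of_real time_scale * wt (time_scale * s) k) (at s)"
  by (simp add: o_def scaleR_conv_of_real)
 moreover have "of_real time_scale * wt (time_scale * s) k + \<i> * sgn (complex_of_real k) *
   (LINT l|lborel. of_real (Lambda (k - l) l) * w (time_scale * s) (k - l) * w (time_scale * s) l) = 0"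
  using amplitude_relation[OF rel t k] unfolding interaction_def conv_def by (simp add: mult.assoc)
 ultimately show "\<exists>D. ((\<lambda>r. surface_hat (\<lambda>x s. \<phi>1 x (time_scale * s)) k r) has_vector_derivative D) (at s) \<and>
   D + \<i> * sgn (complex_of_real k) * (LINT l|lborel. of_real (Lambda (k - l) l) *
    surface_hat (\<lambda>x s. \<phi>1 x (time_scale * s)) (k - l) s * surface_hat (\<lambda>x s. \<phi>1 x (time_scale * s)) l s) = 0"
  unfolding hat by blast
qed

end

section \<open>The interface and the conclusion\<close>

lemma interface_location:
 assumes "has_expansion v0 B0 H0 T U V \<phi> U1 V1 \<phi>1 U2 V2 \<phi>2" and \<phi>2: "surface_profile T \<phi>2" and ab: "0 < a" "b < T"
 shows "\<exists>C. \<forall>\<^sub>F \<epsilon> in at_right 0. \<forall>x t. \<epsilon> * t \<in> {a..b} \<longrightarrow>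
  \<bar>front lam \<phi> \<epsilon> x t - \<epsilon> * \<phi>1 (x - lam * t) (\<epsilon> * t)\<bar> \<le> C * \<epsilon>\<^sup>2"
proof -
 have agree: "agree_to_order 2 UNIV T (\<lambda>\<epsilon>. lift_surface (\<phi> \<epsilon>)) (\<lambda>\<epsilon> \<theta> y \<tau>. \<phi>1 \<theta> \<tau> + \<epsilon> * \<phi>2 \<theta> \<tau>)"
  using assms(1) by (simp add: has_expansion_def)
 have "\<exists>C. \<forall>\<^sub>F \<epsilon> in at_right 0. \<forall>\<theta>. \<forall>\<tau>\<in>{a..b}. \<bar>\<phi> \<epsilon> \<theta> \<tau> - (\<phi>1 \<theta> \<tau> + \<epsilon> * \<phi>2 \<theta> \<tau>)\<bar> \<le> C * \<epsilon>\<^sup>2"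
  by (rule ex_forward[OF agree[unfolded agree_to_order_def, rule_format, OF ab]], erule eventually_mono)
   (auto simp: lift_surface_def)
 then obtain C where C: "\<forall>\<^sub>F \<epsilon> in at_right 0. \<forall>\<theta>. \<forall>\<tau>\<in>{a..b}. \<bar>\<phi> \<epsilon> \<theta> \<tau> - (\<phi>1 \<theta> \<tau> + \<epsilon> * \<phi>2 \<theta> \<tau>)\<bar> \<le> C * \<epsilon>\<^sup>2" ..
 have p: "profile UNIV T (lift_surface \<phi>2)" using \<phi>2 by (simp add: surface_profile_def)
 obtain g where g: "integrable_majorant g" "\<And>\<theta> \<tau>. \<tau> \<in> {a..b} \<Longrightarrow> \<bar>\<phi>2 \<theta> \<tau>\<bar> \<le> g \<theta>"
  using profile_majorant[OF p ab] unfolding lift_surface_def by (metis UNIV_I closure_UNIV real_norm_def)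
 obtain G where G: "\<And>\<theta>. g \<theta> \<le> G"
  using g(1) unfolding integrable_majorant_def bounded_iff by (metis abs_ge_self order_trans rangeI real_norm_def)
 have "\<forall>\<^sub>F \<epsilon> in at_right (0::real). 0 < \<epsilon> \<and> \<epsilon> < 1"
  by (auto intro: eventually_at_rightI[of 0 1])
 with C have "\<forall>\<^sub>F \<epsilon> in at_right 0. \<forall>x t. \<epsilon> * t \<in> {a..b} \<longrightarrow>
  \<bar>front lam \<phi> \<epsilon> x t - \<epsilon> * \<phi>1 (x - lam * t) (\<epsilon> * t)\<bar> \<le> (\<bar>C\<bar> + G) * \<epsilon>\<^sup>2"
 proof eventually_elim
  case (elim \<epsilon>)
  show ?case
  proof (intro allI impI)
   fix x t assume t: "\<epsilon> * t \<in> {a..b}"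
   let ?f = "\<phi> \<epsilon> (x - lam * t) (\<epsilon> * t)" and ?f1 = "\<phi>1 (x - lam * t) (\<epsilon> * t)" and ?f2 = "\<phi>2 (x - lam * t) (\<epsilon> * t)"
   have e: "\<epsilon> > 0" "\<epsilon> < 1" using elim by auto
   have "\<bar>?f - (?f1 + \<epsilon> * ?f2)\<bar> \<le> C * \<epsilon>\<^sup>2" using elim t by blast
   also have "\<dots> \<le> \<bar>C\<bar> * \<epsilon>" using e by (intro mult_mono) (auto simp: power2_eq_square)
   finally have 1: "\<bar>?f - (?f1 + \<epsilon> * ?f2)\<bar> \<le> \<bar>C\<bar> * \<epsilon>" .
   have "\<bar>\<epsilon> * ?f2\<bar> \<le> G * \<epsilon>" using order_trans[OF g(2)[OF t] G] e by (simp add: abs_mult mult.commute)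
   with 1 have "\<bar>?f - ?f1\<bar> \<le> (\<bar>C\<bar> + G) * \<epsilon>" unfolding distrib_right by linarith
   then have "\<epsilon> * \<bar>?f - ?f1\<bar> \<le> \<epsilon> * ((\<bar>C\<bar> + G) * \<epsilon>)" using e by (intro mult_left_mono) auto
   moreover have "\<bar>front lam \<phi> \<epsilon> x t - \<epsilon> * ?f1\<bar> = \<epsilon> * \<bar>?f - ?f1\<bar>"
    unfolding front_def right_diff_distrib[symmetric] abs_mult using e by simp
   ultimately show "\<bar>front lam \<phi> \<epsilon> x t - \<epsilon> * ?f1\<bar> \<le> (\<bar>C\<bar> + G) * \<epsilon>\<^sup>2" by (simp add: power2_eq_square ac_simps)
  qed
 qed
 then show ?thesis by blast
qed

context surface_wave
begin

lemma first_order_systems_iff: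
 assumes U: "profile {0<..} T U" and V: "profile {..<0} T V" and \<phi>: "surface_profile T \<phi>"
 shows "plasma_system m B0 T U (\<lambda>_ _ _. 0) (\<lambda>_ _ _. 0) \<and> vacuum_system \<nu> lam T V (\<lambda>_ _ _. 0) \<and>
   jump_system \<nu> v0 B0 H0 lam T U V \<phi> (\<lambda>_ _. 0) \<longleftrightarrow>
  first_order_terms \<nu> v0 B0 H0 lam T U V \<phi>"
proof -
 have z: "nice (\<lambda>x. (0::real^5) $ j)" "nice (\<lambda>x. (0::real^4) $ i)" "nice (\<lambda>x. 0)" for i j by (simp_all add: nice_zero)
 show ?thesis
  unfolding plasma_system_iff_hat[OF U z(1,3)] vacuum_system_iff_hat[OF V z(2)] jump_system_iff_hat[OF U V \<phi> z(1)] first_order_terms_iff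
  using first_order_forward[OF U V] first_order_backward[OF U V] by blast
qed

end

context first_order_solution
begin

lemma second_order_systems_iff:
 assumes U2: "profile {0<..} T U2" and V2: "profile {..<0} T V2" and \<phi>2: "surface_profile T \<phi>2"
 shows "plasma_system m B0 T U2 (forcing v0 B0 lam U1 \<phi>1) (divergence_forcing U1 \<phi>1) \<longleftrightarrow>
   second_order_plasma v0 B0 lam T U1 \<phi>1 U2" (is ?thesis1)
  and "lam \<noteq> 0 \<Longrightarrow> vacuum_system \<nu> lam T V2 (vacuum_forcing \<nu> lam V1 \<phi>1) \<longleftrightarrow> second_order_vacuum \<nu> H0 lam T \<phi>1 V2"
  and "jump_system \<nu> v0 B0 H0 lam T U2 V2 \<phi>2 (jump_forcing \<nu> H0 lam U1 V1 \<phi>1) \<longleftrightarrow>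
   second_order_jump \<nu> v0 B0 H0 lam T U1 V1 \<phi>1 U2 V2 \<phi>2" (is ?thesis3)
proof -
 have vac: "vacuum_system \<nu> lam T V2 (vacuum_forcing \<nu> lam V1 \<phi>1) \<longleftrightarrow> vacuum_hat_system \<nu> lam T V2 (vacuum_forcing \<nu> lam V1 \<phi>1)"
  by (rule vacuum_system_iff_hat[OF V2 vacuum_forcing_nice])
 show ?thesis1
  by (rule trans[OF plasma_system_iff_hat[OF U2 forcing_nice(1,2)]])
   (blast intro: second_order_plasma_forward[OF U2] second_order_plasma_backward[OF U2])+
 show "vacuum_system \<nu> lam T V2 (vacuum_forcing \<nu> lam V1 \<phi>1) \<longleftrightarrow> second_order_vacuum \<nu> H0 lam T \<phi>1 V2" if "lam \<noteq> 0"
  by (rule trans[OF vac])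
   (blast intro: second_order_vacuum_forward[OF V2 _ that] second_order_vacuum_backward[OF V2 _ that])
 show ?thesis3
  unfolding second_order_jump_iff by (rule jump_system_iff_hat[OF U2 V2 \<phi>2 jump_forcing_nice])
qed

lemma amplitude_equation_of_solution:
 assumes U2: "profile {0<..} T U2" and V2: "profile {..<0} T V2" and \<phi>2: "surface_profile T \<phi>2"
  and so: "second_order_plasma v0 B0 lam T U1 \<phi>1 U2" and vac: "vacuum_system \<nu> lam T V2 (vacuum_forcing \<nu> lam V1 \<phi>1)"
  and jump: "second_order_jump \<nu> v0 B0 H0 lam T U1 V1 \<phi>1 U2 V2 \<phi>2"
 shows "amplitude_equation (\<lambda>x s. \<phi>1 x (time_scale * s)) {s. time_scale * s \<in> {0<..<T}}"
proof (rule amplitude_equation_solved)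
 have "vacuum_system \<nu> lam T V2 (vacuum_forcing \<nu> lam V1 \<phi>1) \<longleftrightarrow> vacuum_hat_system \<nu> lam T V2 (vacuum_forcing \<nu> lam V1 \<phi>1)"
  by (rule vacuum_system_iff_hat[OF V2 vacuum_forcing_nice])
 then have "vacuum_hat_system \<nu> lam T V2 (vacuum_forcing \<nu> lam V1 \<phi>1)" using vac by blast
 then show "- \<i> * of_real rate * wt t k = of_real gain * interaction t k" if "t \<in> {0<..<T}" "k > 0" for t k
  by (rule amplitude_relation_pos[OF V2 so _ jump[unfolded second_order_jump_iff] that])
qed

end

theorem theorem2:
  fixes \<nu> v0 B0 H0 lam :: real
  assumes nu: "\<nu> > 0"
    and stable:
      "(\<bar>v0\<bar> - 1 / \<nu> \<le> \<bar>B0\<bar> \<and> \<bar>B0\<bar> < \<bar>v0\<bar> + 1 / \<nu> \<and> \<bar>H0\<bar> > 0) \<or>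
       (\<bar>B0\<bar> < \<bar>v0\<bar> - 1 / \<nu> \<and> (\<exists>Hs. critical_field \<nu> v0 B0 Hs \<and> \<bar>H0\<bar> \<ge> Hs))"
    and root: "phase_equation \<nu> v0 B0 H0 lam" "\<bar>lam\<bar> < 1 / \<nu>"
  shows "\<exists>c::real. c \<noteq> 0 \<and>
    (\<forall>T U V \<phi> U1 V1 \<phi>1 U2 V2 \<phi>2.
      T > 0 \<longrightarrow>
      plasma_profile T U1 \<longrightarrow> vacuum_profile T V1 \<longrightarrow> smooth_surface_profile T \<phi>1 \<longrightarrow>
      plasma_profile T U2 \<longrightarrow> vacuum_profile T V2 \<longrightarrow> surface_profile T \<phi>2 \<longrightarrow>
      has_expansion v0 B0 H0 T U V \<phi> U1 V1 \<phi>1 U2 V2 \<phi>2 \<longrightarrow>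
        \<comment> \<open>the terms of the expansion of a solution\<close>
        (solves_to_second_order \<nu> lam T U V \<phi> \<longrightarrow>
          first_order_terms \<nu> v0 B0 H0 lam T U1 V1 \<phi>1 \<and>
          second_order_plasma v0 B0 lam T U1 \<phi>1 U2 \<and>
          (lam \<noteq> 0 \<longrightarrow> second_order_vacuum \<nu> H0 lam T \<phi>1 V2) \<and>
          second_order_jump \<nu> v0 B0 H0 lam T U1 V1 \<phi>1 U2 V2 \<phi>2 \<and>
          amplitude_equation (\<lambda>\<theta> s. \<phi>1 \<theta> (c * s)) {s. c * s \<in> {0<..<T}}) \<and>
        \<comment> \<open>conversely, these terms do provide a solution to the order considered\<close>
        (lam \<noteq> 0 \<and>
          first_order_terms \<nu> v0 B0 H0 lam T U1 V1 \<phi>1 \<and>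
          second_order_plasma v0 B0 lam T U1 \<phi>1 U2 \<and>
          second_order_vacuum \<nu> H0 lam T \<phi>1 V2 \<and>
          second_order_jump \<nu> v0 B0 H0 lam T U1 V1 \<phi>1 U2 V2 \<phi>2 \<and>
          amplitude_equation (\<lambda>\<theta> s. \<phi>1 \<theta> (c * s)) {s. c * s \<in> {0<..<T}} \<longrightarrow>
          solves_to_second_order \<nu> lam T U V \<phi>) \<and>
        \<comment> \<open>location of the interface for times of order \<open>1/\<epsilon>\<close>\<close>
        (\<forall>a b. 0 < a \<longrightarrow> b < T \<longrightarrow> (\<exists>C. \<forall>\<^sub>F \<epsilon> in at_right 0. \<forall>x t. \<epsilon> * t \<in> {a..b} \<longrightarrow>
          \<bar>front lam \<phi> \<epsilon> x t - \<epsilon> * \<phi>1 (x - lam * t) (\<epsilon> * t)\<bar> \<le> C * \<epsilon>\<^sup>2)))"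
proof -
  have "H0 \<noteq> 0" using stable unfolding critical_field_def by auto
  with nu root interpret surface_wave \<nu> v0 B0 H0 lam by unfold_locales auto
  show ?thesis
  proof (rule exI[of _ time_scale], intro conjI allI impI time_scale_nonzero)
    fix T and U :: "real \<Rightarrow> (real^5) field" and V :: "real \<Rightarrow> (real^3) field" and \<phi> U1 V1 \<phi>1 U2 V2 \<phi>2
    assume p: "plasma_profile T U1" "vacuum_profile T V1" "smooth_surface_profile T \<phi>1"
      "plasma_profile T U2" "vacuum_profile T V2" "surface_profile T \<phi>2"
      and exp: "has_expansion v0 B0 H0 T U V \<phi> U1 V1 \<phi>1 U2 V2 \<phi>2"
    have U1: "profile {0<..} T U1" and V1: "profile {..<0} T V1" and U2: "profile {0<..} T U2" and V2: "profile {..<0} T V2"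
      and \<phi>1: "surface_profile T \<phi>1"
      using p by (simp_all add: plasma_profile_def vacuum_profile_def smooth_surface_profile_def)
    have iff: "solves_to_second_order \<nu> lam T U V \<phi> \<longleftrightarrow> first_order_terms \<nu> v0 B0 H0 lam T U1 V1 \<phi>1 \<and>
        (plasma_system m B0 T U2 (forcing v0 B0 lam U1 \<phi>1) (divergence_forcing U1 \<phi>1) \<and>
         vacuum_system \<nu> lam T V2 (vacuum_forcing \<nu> lam V1 \<phi>1) \<and>
         jump_system \<nu> v0 B0 H0 lam T U2 V2 \<phi>2 (jump_forcing \<nu> H0 lam U1 V1 \<phi>1))"
      using solves_to_second_order_iff[OF exp p(1,4,2,5) \<phi>1 p(6)] first_order_systems_iff[OF U1 V1 \<phi>1] by blast
    have loc: "first_order_solution \<nu> v0 B0 H0 lam T U1 V1 \<phi>1" if "first_order_terms \<nu> v0 B0 H0 lam T U1 V1 \<phi>1"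
      using that[unfolded first_order_terms_iff] U1 V1 p(3) by unfold_locales
    note so = first_order_solution.second_order_systems_iff[OF loc U2 V2 p(6)]
    {
      assume "solves_to_second_order \<nu> lam T U V \<phi>"
      then have fo: "first_order_terms \<nu> v0 B0 H0 lam T U1 V1 \<phi>1"
        and sys: "plasma_system m B0 T U2 (forcing v0 B0 lam U1 \<phi>1) (divergence_forcing U1 \<phi>1)"
          "vacuum_system \<nu> lam T V2 (vacuum_forcing \<nu> lam V1 \<phi>1)"
          "jump_system \<nu> v0 B0 H0 lam T U2 V2 \<phi>2 (jump_forcing \<nu> H0 lam U1 V1 \<phi>1)"
        unfolding iff by blast+
      show "first_order_terms \<nu> v0 B0 H0 lam T U1 V1 \<phi>1" by (rule fo)
      show pl: "second_order_plasma v0 B0 lam T U1 \<phi>1 U2" using sys(1) so(1)[OF fo] by blast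
      show "second_order_vacuum \<nu> H0 lam T \<phi>1 V2" if "lam \<noteq> 0" using sys(2) so(2)[OF fo that] by blast
      show ju: "second_order_jump \<nu> v0 B0 H0 lam T U1 V1 \<phi>1 U2 V2 \<phi>2" using sys(3) so(3)[OF fo] by blast
      show "amplitude_equation (\<lambda>\<theta> s. \<phi>1 \<theta> (time_scale * s)) {s. time_scale * s \<in> {0<..<T}}"
        by (rule first_order_solution.amplitude_equation_of_solution[OF loc[OF fo] U2 V2 p(6) pl sys(2) ju])
    }
    show "solves_to_second_order \<nu> lam T U V \<phi>"
      if "lam \<noteq> 0 \<and> first_order_terms \<nu> v0 B0 H0 lam T U1 V1 \<phi>1 \<and> second_order_plasma v0 B0 lam T U1 \<phi>1 U2 \<and>
        second_order_vacuum \<nu> H0 lam T \<phi>1 V2 \<and> second_order_jump \<nu> v0 B0 H0 lam T U1 V1 \<phi>1 U2 V2 \<phi>2 \<and>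
        amplitude_equation (\<lambda>\<theta> s. \<phi>1 \<theta> (time_scale * s)) {s. time_scale * s \<in> {0<..<T}}"
      using that so unfolding iff by blast
    show "\<exists>C. \<forall>\<^sub>F \<epsilon> in at_right 0. \<forall>x t. \<epsilon> * t \<in> {a..b} \<longrightarrow>
      \<bar>front lam \<phi> \<epsilon> x t - \<epsilon> * \<phi>1 (x - lam * t) (\<epsilon> * t)\<bar> \<le> C * \<epsilon>\<^sup>2" if "0 < a" "b < T" for a b
      by (rule interface_location[OF exp p(6) that])
  qed
qed

end
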